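(* Let $\mathcal K$ be a 2-category with finite products and let $(T,\eta,\mu,t,\Gamma)$ be a symmetric, pseudo commutative, strong 2-monad on $\mathcal K$. Then the free algebra construction $T\colon \mathcal K\to T\text{-}\mathrm{Alg}$, with the assignments on objects and on multimorphism categories described in the context, is a (non-symmetric) $\mathbf{Cat}$-multifunctor; that is, it is given on each multimorphism category by a functor, and it preserves units and the multicategorical composition $\gamma$ (on 1-cells and 2-cells).
   Context: **Conventions.** $\mathcal K$ is a 2-category with finite products $\times$ and terminal object $1$; associativity isomorphisms are suppressed. $s_{A,B}\colon A\times B\to B\times A$ is the symmetry, $1$ also denotes identities. $\beta\cdot\alpha$ is vertical composition ($\alpha$ first); $\circ$ is composition of 1-cells and whiskering. **Strong 2-monads.** A strong 2-monad $(T,\eta,\mu,t)$ is a strict 2-monad $(T,\eta,\mu)$ on $\mathcal K$ with a 2-natural $t_{A,B}\colon A\times TB\to T(A\times B)$ such that, with $l_A\colon 1\times A\cong A$: $T(l_A)\circ t_{1,A}=l_{TA}$; $t_{A,B\times C}\circ(1\times t_{B,C})=t_{A\times B,C}$; $t\circ(1\times\eta)=\eta$; $t\circ(1\times\mu)=\mu\circ Tt\circ t$. For $1\le i\le n$, $t_i\colon A_1\times\cdots\times TA_i\times\cdots\times A_n\to T(A_1\times\cdots\times A_n)$ is obtained by moving $TA_i$ to the last position, applying $t$, and applying $T$ of the inverse permutation (so for $n=2$, $t_2=t$ and $t_1\colon TA\times B\to T(A\times B)$). Write $\omega_{A,B}=\mu\circ Tt_2\circ t_1$ and $\omega'_{A,B}=\mu\circ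 Tt_1\circ t_2$, 1-cells $TA\times TB\to T(A\times B)$. **Pseudo commutativity.** A pseudo commutativity $\Gamma$ is an invertible modification with components $\Gamma_{A,B}\colon\omega_{A,B}\Rightarrow\omega'_{A,B}$ (so $T(f\times g)\circ\Gamma_{A,B}=\Gamma_{A',B'}\circ(Tf\times Tg)$) such that: (1) $\Gamma_{A\times B,C}\circ(t_2\times1_{TC})=t_2\circ(1_A\times\Gamma_{B,C})$; (2) $\Gamma_{A,B\times C}\circ(1_{TA}\times t_2)=\Gamma_{A\times B,C}\circ(t_1\times1_{TC})$; (3) $\Gamma_{A,B\times C}\circ(1_{TA}\times t_1)=t_1\circ(\Gamma_{A,B}\times1_C)$; (4) $\Gamma_{A,B}\circ(\eta_A\times1)$ is an identity; (5) $\Gamma_{A,B}\circ(1\times\eta_B)$ is an identity; (6) $\Gamma_{A,B}\circ(\mu_A\times1)=(\mu\circ Tt_1\circ\Gamma_{TA,B})\cdot(\mu\circ T\Gamma_{A,B}\circ t_1)$; (7) $\Gamma_{A,B}\circ(1\times\mu_B)=(\mu\circ T\Gamma_{A,B}\circ t_2)\cdot(\mu\circ Tt_2\circ\Gamma_{A,TB})$. It is *symmetric* if $\bigl(T(s_{B,A})\circ\Gamma_{B,A}\circ s_{TA,TB}\bigr)\cdot\Gamma_{A,B}=1_{\omega_{A,B}}$ for all $A,B$. For $1\le i<j\le n$ let $\Gamma_{i,j}\colon \mu\circ Tt_j\circ t_i\Rightarrow\mu\circ Tt_i\circ t_j$ (1-cells from the product of the $A_k$ with $A_i,A_j$ replaced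 by $TA_i,TA_j$ to $T(A_1\times\cdots\times A_n)$) be the whiskering of $1\times\Gamma_{A_i\times\cdots\times A_{j-1},\,A_j\times\cdots\times A_n}$ (identity on $A_1\times\cdots\times A_{i-1}$) by $1\times t_1\times t_1$ before and $t_2$ after. **The $\mathbf{Cat}$-multicategory $T\text{-}\mathrm{Alg}$.** Objects: strict $T$-algebras. For $n=0$, $T\text{-}\mathrm{Alg}(\,;B)=\mathcal K(1,B)$. For $n\ge1$, an $n$-ary 1-cell $\langle (A_1,a_1),\dots,(A_n,a_n)\rangle\to(B,b)$ is a 1-cell $h\colon A_1\times\cdots\times A_n\to B$ with invertible 2-cells $h_i\colon b\circ Th\circ t_i\Rightarrow h\circ(1\times a_i\times1)$, $1\le i\le n$, such that: ($\eta$) $h_i\circ(1\times\eta\times1)=1_h$; ($\mu$) $h_i\circ(1\times\mu\times1)=(h_i\circ(1\times Ta_i\times1))\cdot(b\circ Th_i\circ t_i)$; (coherence) for $i<j$, $(h_i\circ(1\times a_j\times1))\cdot(b\circ Th_j\circ t_i)=(h_j\circ(1\times a_i\times1))\cdot(b\circ Th_i\circ t_j)\cdot(b\circ Th\circ\Gamma_{i,j})$. A 2-cell $(f,f_i)\to(g,g_i)$ is a 2-cell $\alpha\colon f\Rightarrow g$ in $\mathcal K$ with $(\alpha\circ(1\times a_i\times1))\cdot f_i=g_i\cdot(b\circ T\alpha\circ t_i)$ for all $i$. Composition: for $(f,f_j)\colon\langle B_1,\dots,B_n\rangle\to C$ and $(g_j,g_{j,d})\colon\langle A_{j,1},\dots,A_{j,k_j}\rangle\to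 B_j$, $\gamma(f;g_1,\dots,g_n)$ has underlying 1-cell $f\circ(g_1\times\cdots\times g_n)$ and, for $s=d+\sum_{r<j}k_r$ with $1\le d\le k_j$, structure 2-cell $\bigl(f\circ(g_1\times\cdots\times g_{j,d}\times\cdots\times g_n)\bigr)\cdot\bigl(f_j\circ(g_1\times\cdots\times(Tg_j\circ t_d)\times\cdots\times g_n)\bigr)$; on 2-cells $\gamma(\alpha;\beta_1,\dots,\beta_n)$ is the horizontal composite of $\alpha$ with $\beta_1\times\cdots\times\beta_n$. Units are identities. $\mathcal K$ is a $\mathbf{Cat}$-multicategory via $\mathcal K(A_1,\dots,A_n;B)=\mathcal K(A_1\times\cdots\times A_n,B)$. **The assignment $T$.** On objects $A\mapsto(TA,\mu_A)$. The 1-cell $\omega_{A_1,A_2}$ is made a 2-ary 1-cell $\langle TA_1,TA_2\rangle\to T(A_1\times A_2)$ in $T\text{-}\mathrm{Alg}$ with first structure 2-cell the identity and second structure 2-cell $\bigl(T(s_{A_2,A_1})\circ\Gamma_{A_2,A_1}\circ s_{TA_1,TA_2}\circ(1\times\mu)\bigr)\cdot\bigl(\mu\circ T\Gamma_{A_1,A_2}\circ t_2\bigr)$. Put $\omega_{()}=\eta_1\colon1\to T1$, $\omega_{A_1}=1_{TA_1}$, and $\omega_{A_1,\dots,A_n}=\gamma(\omega_{A_1\times\cdots\times A_{n-1},A_n};\omega_{A_1,\dots,A_{n-1}},1_{TA_n})$ for $n\ge3$. On multimorphism categories: for $n=0$, $f\colon1\to A$ goes to $Tf\circ\eta_1$;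 for $n=1$, $f$ goes to $Tf$ with identity structure 2-cell; for $n\ge2$, $f\colon A_1\times\cdots\times A_n\to B$ goes to $\gamma(Tf;\omega_{A_1,\dots,A_n})\colon\langle TA_1,\dots,TA_n\rangle\to TB$; likewise on 2-cells. A non-symmetric $\mathbf{Cat}$-multifunctor is an object function together with functors on multimorphism categories that preserve units and $\gamma$; no compatibility with symmetric group actions is required. *)

theory Defs
  imports Main
begin

section \<open>2-categories with finite products\<close>

record ('o, 'f, 't) two_cat =
  Ob :: "'o set"
  Ar :: "'f set"
  Ce :: "'t set"
  dom1 :: "'f \<Rightarrow> 'o"
  cod1 :: "'f \<Rightarrow> 'o"
  dom2 :: "'t \<Rightarrow> 'f"
  cod2 :: "'t \<Rightarrow> 'f"
  id1 :: "'o \<Rightarrow> 'f" ("id1\<index>")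
  id2 :: "'f \<Rightarrow> 't" ("id2\<index>")
  comp1 :: "'f \<Rightarrow> 'f \<Rightarrow> 'f" (infixr "\<odot>\<index>" 72)
  vcomp :: "'t \<Rightarrow> 't \<Rightarrow> 't" (infixr "\<cdot>\<index>" 62)
  hcomp :: "'t \<Rightarrow> 't \<Rightarrow> 't" (infixr "\<star>\<index>" 66)

definition hom1 :: "('o, 'f, 't, 'x) two_cat_scheme \<Rightarrow> 'o \<Rightarrow> 'o \<Rightarrow> 'f set" where
  "hom1 K A B = {f \<in> Ar K. dom1 K f = A \<and> cod1 K f = B}"

definition hom2 :: "('o, 'f, 't, 'x) two_cat_scheme \<Rightarrow> 'f \<Rightarrow> 'f \<Rightarrow> 't set" where
  "hom2 K f g = {\<alpha> \<in> Ce K. dom2 K \<alpha> = f \<and> cod2 K \<alpha> = g}"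

locale two_category =
  fixes K :: "('o, 'f, 't, 'x) two_cat_scheme" (structure)
  assumes dom1_in: "f \<in> Ar K \<Longrightarrow> dom1 K f \<in> Ob K"
    and cod1_in: "f \<in> Ar K \<Longrightarrow> cod1 K f \<in> Ob K"
    and dom2_in: "\<alpha> \<in> Ce K \<Longrightarrow> dom2 K \<alpha> \<in> Ar K"
    and cod2_in: "\<alpha> \<in> Ce K \<Longrightarrow> cod2 K \<alpha> \<in> Ar K"
    and dom1_dom2: "\<alpha> \<in> Ce K \<Longrightarrow> dom1 K (dom2 K \<alpha>) = dom1 K (cod2 K \<alpha>)"
    and cod1_dom2: "\<alpha> \<in> Ce K \<Longrightarrow> cod1 K (dom2 K \<alpha>) = cod1 K (cod2 K \<alpha>)"
    and id1_in: "A \<in> Ob K \<Longrightarrow> id1 A \<in> hom1 K A A"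
    and comp1_in: "\<lbrakk>f \<in> hom1 K A B; g \<in> hom1 K B C\<rbrakk> \<Longrightarrow> g \<odot> f \<in> hom1 K A C"
    and comp1_assoc: "\<lbrakk>f \<in> hom1 K A B; g \<in> hom1 K B C; h \<in> hom1 K C D\<rbrakk>
        \<Longrightarrow> (h \<odot> g) \<odot> f = h \<odot> (g \<odot> f)"
    and comp1_id_left: "f \<in> hom1 K A B \<Longrightarrow> id1 B \<odot> f = f"
    and comp1_id_right: "f \<in> hom1 K A B \<Longrightarrow> f \<odot> id1 A = f"
    and id2_in: "f \<in> Ar K \<Longrightarrow> id2 f \<in> hom2 K f f"
    and vcomp_in: "\<lbrakk>\<alpha> \<in> hom2 K f g; \<beta> \<in> hom2 K g h\<rbrakk> \<Longrightarrow> \<beta> \<cdot> \<alpha> \<in> hom2 K f h"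
    and vcomp_assoc: "\<lbrakk>\<alpha> \<in> hom2 K f g; \<beta> \<in> hom2 K g h; \<gamma> \<in> hom2 K h k\<rbrakk>
        \<Longrightarrow> (\<gamma> \<cdot> \<beta>) \<cdot> \<alpha> = \<gamma> \<cdot> (\<beta> \<cdot> \<alpha>)"
    and vcomp_id_left: "\<alpha> \<in> hom2 K f g \<Longrightarrow> id2 g \<cdot> \<alpha> = \<alpha>"
    and vcomp_id_right: "\<alpha> \<in> hom2 K f g \<Longrightarrow> \<alpha> \<cdot> id2 f = \<alpha>"
    and hcomp_in: "\<lbrakk>f \<in> hom1 K A B; g \<in> hom1 K B C; \<alpha> \<in> hom2 K f f'; \<beta> \<in> hom2 K g g'\<rbrakk>
        \<Longrightarrow> \<beta> \<star> \<alpha> \<in> hom2 K (g \<odot> f) (g' \<odot> f')"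
    and hcomp_assoc: "\<lbrakk>f \<in> hom1 K A B; g \<in> hom1 K B C; h \<in> hom1 K C D;
          \<alpha> \<in> hom2 K f f'; \<beta> \<in> hom2 K g g'; \<gamma> \<in> hom2 K h h'\<rbrakk>
        \<Longrightarrow> (\<gamma> \<star> \<beta>) \<star> \<alpha> = \<gamma> \<star> (\<beta> \<star> \<alpha>)"
    and hcomp_id_left: "\<lbrakk>f \<in> hom1 K A B; \<alpha> \<in> hom2 K f f'\<rbrakk> \<Longrightarrow> id2 (id1 B) \<star> \<alpha> = \<alpha>"
    and hcomp_id_right: "\<lbrakk>f \<in> hom1 K A B; \<alpha> \<in> hom2 K f f'\<rbrakk> \<Longrightarrow> \<alpha> \<star> id2 (id1 A) = \<alpha>"
    and hcomp_id2: "\<lbrakk>f \<in> hom1 K A B; g \<in> hom1 K B C\<rbrakk> \<Longrightarrow> id2 g \<star> id2 f = id2 (g \<odot> f)"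
    and interchange: "\<lbrakk>f \<in> hom1 K A B; g \<in> hom1 K B C;
          \<alpha> \<in> hom2 K f f'; \<alpha>' \<in> hom2 K f' f''; \<beta> \<in> hom2 K g g'; \<beta>' \<in> hom2 K g' g''\<rbrakk>
        \<Longrightarrow> (\<beta>' \<cdot> \<beta>) \<star> (\<alpha>' \<cdot> \<alpha>) = (\<beta>' \<star> \<alpha>') \<cdot> (\<beta> \<star> \<alpha>)"
begin

abbreviation whisker_left :: "'f \<Rightarrow> 't \<Rightarrow> 't" (infixr "\<lhd>" 68) where
  "f \<lhd> \<alpha> \<equiv> id2 f \<star> \<alpha>"

abbreviation whisker_right :: "'t \<Rightarrow> 'f \<Rightarrow> 't" (infixl "\<rhd>" 70) where
  "\<alpha> \<rhd> f \<equiv> \<alpha> \<star> id2 f"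

definition invertible2 :: "'t \<Rightarrow> bool" where
  "invertible2 \<alpha> \<longleftrightarrow> \<alpha> \<in> Ce K \<and>
     (\<exists>\<beta> \<in> hom2 K (cod2 K \<alpha>) (dom2 K \<alpha>). \<beta> \<cdot> \<alpha> = id2 (dom2 K \<alpha>) \<and> \<alpha> \<cdot> \<beta> = id2 (cod2 K \<alpha>))"

end

record ('o, 'f, 't) fp_two_cat = "('o, 'f, 't) two_cat" +
  one :: "'o" ("\<one>\<index>")
  bang :: "'o \<Rightarrow> 'f" ("bang\<index>")
  prod_ob :: "'o \<Rightarrow> 'o \<Rightarrow> 'o" (infixl "\<otimes>\<index>" 74)
  pr1 :: "'o \<Rightarrow> 'o \<Rightarrow> 'f" ("pr1\<index>")
  pr2 :: "'o \<Rightarrow> 'o \<Rightarrow> 'f" ("pr2\<index>")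
  pair1 :: "'f \<Rightarrow> 'f \<Rightarrow> 'f" ("pair1\<index>")
  pair2 :: "'t \<Rightarrow> 't \<Rightarrow> 't" ("pair2\<index>")

text \<open>
  The products are 2-categorical: the universal properties hold for 1-cells and for 2-cells,
  that is, \<open>K(X,1)\<close> is the terminal category and \<open>K(X,A\<times>B) \<cong> K(X,A) \<times> K(X,B)\<close>.
  They are not assumed to be strictly associative or strictly unital, so the associativity and
  unit isomorphisms, suppressed in the usual notation, appear explicitly below.
\<close>

locale fp_two_category = two_category K
  for K :: "('o, 'f, 't, 'x) fp_two_cat_scheme" (structure) +
  assumes one_in: "\<one> \<in> Ob K"
    and bang_in: "A \<in> Ob K \<Longrightarrow> bang A \<in> hom1 K A \<one>"
    and bang_unique: "f \<in> hom1 K A \<one> \<Longrightarrow> f = bang A"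
    and bang_unique2: "\<alpha> \<in> hom2 K (bang A) (bang A) \<Longrightarrow> A \<in> Ob K \<Longrightarrow> \<alpha> = id2 (bang A)"
    and prod_in: "\<lbrakk>A \<in> Ob K; B \<in> Ob K\<rbrakk> \<Longrightarrow> A \<otimes> B \<in> Ob K"
    and pr1_in: "\<lbrakk>A \<in> Ob K; B \<in> Ob K\<rbrakk> \<Longrightarrow> pr1 A B \<in> hom1 K (A \<otimes> B) A"
    and pr2_in: "\<lbrakk>A \<in> Ob K; B \<in> Ob K\<rbrakk> \<Longrightarrow> pr2 A B \<in> hom1 K (A \<otimes> B) B"
    and pair1_in: "\<lbrakk>f \<in> hom1 K X A; g \<in> hom1 K X B\<rbrakk> \<Longrightarrow> pair1 f g \<in> hom1 K X (A \<otimes> B)"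
    and pr1_pair1: "\<lbrakk>f \<in> hom1 K X A; g \<in> hom1 K X B\<rbrakk> \<Longrightarrow> pr1 A B \<odot> pair1 f g = f"
    and pr2_pair1: "\<lbrakk>f \<in> hom1 K X A; g \<in> hom1 K X B\<rbrakk> \<Longrightarrow> pr2 A B \<odot> pair1 f g = g"
    and pair1_unique: "\<lbrakk>A \<in> Ob K; B \<in> Ob K; h \<in> hom1 K X (A \<otimes> B)\<rbrakk>
        \<Longrightarrow> pair1 (pr1 A B \<odot> h) (pr2 A B \<odot> h) = h"
    and pair2_in: "\<lbrakk>f \<in> hom1 K X A; g \<in> hom1 K X B; \<alpha> \<in> hom2 K f f'; \<beta> \<in> hom2 K g g'\<rbrakk>
        \<Longrightarrow> pair2 \<alpha> \<beta> \<in> hom2 K (pair1 f g) (pair1 f' g')"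
    and pr1_pair2: "\<lbrakk>f \<in> hom1 K X A; g \<in> hom1 K X B; \<alpha> \<in> hom2 K f f'; \<beta> \<in> hom2 K g g'\<rbrakk>
        \<Longrightarrow> pr1 A B \<lhd> pair2 \<alpha> \<beta> = \<alpha>"
    and pr2_pair2: "\<lbrakk>f \<in> hom1 K X A; g \<in> hom1 K X B; \<alpha> \<in> hom2 K f f'; \<beta> \<in> hom2 K g g'\<rbrakk>
        \<Longrightarrow> pr2 A B \<lhd> pair2 \<alpha> \<beta> = \<beta>"
    and pair2_unique: "\<lbrakk>A \<in> Ob K; B \<in> Ob K; h \<in> hom1 K X (A \<otimes> B); \<theta> \<in> hom2 K h h'\<rbrakk>
        \<Longrightarrow> pair2 (pr1 A B \<lhd> \<theta>) (pr2 A B \<lhd> \<theta>) = \<theta>"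
begin

subsection \<open>Binary products of 1-cells and 2-cells, canonical isomorphisms\<close>

definition prod1 :: "'f \<Rightarrow> 'f \<Rightarrow> 'f" (infixl "\<otimes>\<^sub>1" 74) where
  "f \<otimes>\<^sub>1 g = pair1 (f \<odot> pr1 (dom1 K f) (dom1 K g)) (g \<odot> pr2 (dom1 K f) (dom1 K g))"

definition prod2 :: "'t \<Rightarrow> 't \<Rightarrow> 't" (infixl "\<otimes>\<^sub>2" 74) where
  "\<alpha> \<otimes>\<^sub>2 \<beta> =
     (let A = dom1 K (dom2 K \<alpha>); B = dom1 K (dom2 K \<beta>) in pair2 (\<alpha> \<rhd> pr1 A B) (\<beta> \<rhd> pr2 A B))"

definition sym :: "'o \<Rightarrow> 'o \<Rightarrow> 'f" where
  "sym A B = pair1 (pr2 A B) (pr1 A B)"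

definition assoc :: "'o \<Rightarrow> 'o \<Rightarrow> 'o \<Rightarrow> 'f" where
  \<comment> \<open>\<open>(A \<times> B) \<times> C \<rightarrow> A \<times> (B \<times> C)\<close>\<close>
  "assoc A B C = pair1 (pr1 A B \<odot> pr1 (A \<otimes> B) C)
                       (pair1 (pr2 A B \<odot> pr1 (A \<otimes> B) C) (pr2 (A \<otimes> B) C))"

definition assoc_inv :: "'o \<Rightarrow> 'o \<Rightarrow> 'o \<Rightarrow> 'f" where
  \<comment> \<open>\<open>A \<times> (B \<times> C) \<rightarrow> (A \<times> B) \<times> C\<close>\<close>
  "assoc_inv A B C = pair1 (pair1 (pr1 A (B \<otimes> C)) (pr1 B C \<odot> pr2 A (B \<otimes> C)))
                           (pr2 B C \<odot> pr2 A (B \<otimes> C))"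

subsection \<open>Products of lists\<close>

text \<open>
  The product of \<open>[A\<^sub>1, \<dots>, A\<^sub>n]\<close> is \<open>((A\<^sub>1 \<times> A\<^sub>2) \<times> \<dots>) \<times> A\<^sub>n\<close>; it is \<open>1\<close> for \<open>n = 0\<close>
  and \<open>A\<^sub>1\<close> itself for \<open>n = 1\<close>. All positions in lists count from \<open>0\<close>.
\<close>

fun nprod :: "'o list \<Rightarrow> 'o" where
  "nprod [] = \<one>"
| "nprod (A # As) = foldl (\<otimes>) A As"

fun nproj :: "'o list \<Rightarrow> nat \<Rightarrow> 'f" where
  "nproj As i =
     (if length As \<le> 1 then id1 (As ! i)
      else if Suc i = length As then pr2 (nprod (butlast As)) (last As)
      else nproj (butlast As) i \<odot> pr1 (nprod (butlast As)) (last As))"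

declare nproj.simps [simp del]

fun ntuple1 :: "'o \<Rightarrow> 'f list \<Rightarrow> 'f" where
  \<comment> \<open>the first argument is the common domain, needed only for the empty tuple\<close>
  "ntuple1 X [] = bang X"
| "ntuple1 X (f # fs) = foldl pair1 f fs"

fun ntuple2 :: "'o \<Rightarrow> 't list \<Rightarrow> 't" where
  "ntuple2 X [] = id2 (bang X)"
| "ntuple2 X (\<alpha> # \<alpha>s) = foldl pair2 \<alpha> \<alpha>s"

definition nmap1 :: "'f list \<Rightarrow> 'f" where
  \<comment> \<open>\<open>f\<^sub>1 \<times> \<dots> \<times> f\<^sub>n\<close>\<close>
  "nmap1 fs = (let As = map (dom1 K) fs in
     ntuple1 (nprod As) (map (\<lambda>i. (fs ! i) \<odot> nproj As i) [0..<length fs]))"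

definition nmap2 :: "'t list \<Rightarrow> 't" where
  "nmap2 \<alpha>s = (let As = map (\<lambda>\<alpha>. dom1 K (dom2 K \<alpha>)) \<alpha>s in
     ntuple2 (nprod As) (map (\<lambda>i. (\<alpha>s ! i) \<rhd> nproj As i) [0..<length \<alpha>s]))"

definition slot :: "'o list \<Rightarrow> nat \<Rightarrow> 'f \<Rightarrow> 'f" where
  \<comment> \<open>\<open>1 \<times> f \<times> 1\<close> with \<open>f\<close> in position \<open>i\<close>; the entry \<open>As ! i\<close> is irrelevant\<close>
  "slot As i f = nmap1 ((map id1 As)[i := f])"

definition regroup :: "'o list list \<Rightarrow> 'f" where
  \<comment> \<open>canonical isomorphism from the product of the concatenation to the product of the products\<close>
  "regroup Ass =
     (let Cs = concat Ass; X = nprod Cs in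
      ntuple1 X (map (\<lambda>j. ntuple1 X (map (\<lambda>d. nproj Cs (length (concat (take j Ass)) + d))
                                         [0..<length (Ass ! j)]))
                     [0..<length Ass]))"

definition ungroup :: "'o list list \<Rightarrow> 'f" where
  \<comment> \<open>inverse of \<open>regroup\<close>\<close>
  "ungroup Ass =
     (let Ps = map nprod Ass in
      ntuple1 (nprod Ps) (concat (map (\<lambda>j. map (\<lambda>d. nproj (Ass ! j) d \<odot> nproj Ps j)
                                               [0..<length (Ass ! j)])
                                      [0..<length Ass])))"

end

section \<open>Strong 2-monads\<close>

locale strong_two_monad = fp_two_category K
  for K :: "('o, 'f, 't, 'x) fp_two_cat_scheme" (structure) +
  fixes T0 :: "'o \<Rightarrow> 'o" and T1 :: "'f \<Rightarrow> 'f" and T2 :: "'t \<Rightarrow> 't"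
    and \<eta> :: "'o \<Rightarrow> 'f" and \<mu> :: "'o \<Rightarrow> 'f" and t :: "'o \<Rightarrow> 'o \<Rightarrow> 'f"
  assumes T0_in: "A \<in> Ob K \<Longrightarrow> T0 A \<in> Ob K"
    and T1_in: "f \<in> hom1 K A B \<Longrightarrow> T1 f \<in> hom1 K (T0 A) (T0 B)"
    and T2_in: "\<alpha> \<in> hom2 K f g \<Longrightarrow> T2 \<alpha> \<in> hom2 K (T1 f) (T1 g)"
    and T1_id: "A \<in> Ob K \<Longrightarrow> T1 (id1 A) = id1 (T0 A)"
    and T1_comp: "\<lbrakk>f \<in> hom1 K A B; g \<in> hom1 K B C\<rbrakk> \<Longrightarrow> T1 (g \<odot> f) = T1 g \<odot> T1 f"
    and T2_id: "f \<in> Ar K \<Longrightarrow> T2 (id2 f) = id2 (T1 f)"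
    and T2_vcomp: "\<lbrakk>\<alpha> \<in> hom2 K f g; \<beta> \<in> hom2 K g h\<rbrakk> \<Longrightarrow> T2 (\<beta> \<cdot> \<alpha>) = T2 \<beta> \<cdot> T2 \<alpha>"
    and T2_hcomp: "\<lbrakk>f \<in> hom1 K A B; g \<in> hom1 K B C; \<alpha> \<in> hom2 K f f'; \<beta> \<in> hom2 K g g'\<rbrakk>
        \<Longrightarrow> T2 (\<beta> \<star> \<alpha>) = T2 \<beta> \<star> T2 \<alpha>"
    and \<eta>_in: "A \<in> Ob K \<Longrightarrow> \<eta> A \<in> hom1 K A (T0 A)"
    and \<eta>_natural: "f \<in> hom1 K A B \<Longrightarrow> T1 f \<odot> \<eta> A = \<eta> B \<odot> f"
    and \<eta>_natural2: "\<lbrakk>f \<in> hom1 K A B; \<alpha> \<in> hom2 K f g\<rbrakk> \<Longrightarrow> T2 \<alpha> \<rhd> \<eta> A = \<eta> B \<lhd> \<alpha>"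
    and \<mu>_in: "A \<in> Ob K \<Longrightarrow> \<mu> A \<in> hom1 K (T0 (T0 A)) (T0 A)"
    and \<mu>_natural: "f \<in> hom1 K A B \<Longrightarrow> T1 f \<odot> \<mu> A = \<mu> B \<odot> T1 (T1 f)"
    and \<mu>_natural2: "\<lbrakk>f \<in> hom1 K A B; \<alpha> \<in> hom2 K f g\<rbrakk> \<Longrightarrow> T2 \<alpha> \<rhd> \<mu> A = \<mu> B \<lhd> T2 (T2 \<alpha>)"
    and monad_unit_left: "A \<in> Ob K \<Longrightarrow> \<mu> A \<odot> \<eta> (T0 A) = id1 (T0 A)"
    and monad_unit_right: "A \<in> Ob K \<Longrightarrow> \<mu> A \<odot> T1 (\<eta> A) = id1 (T0 A)"
    and monad_assoc: "A \<in> Ob K \<Longrightarrow> \<mu> A \<odot> T1 (\<mu> A) = \<mu> A \<odot> \<mu> (T0 A)"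
    and t_in: "\<lbrakk>A \<in> Ob K; B \<in> Ob K\<rbrakk> \<Longrightarrow> t A B \<in> hom1 K (A \<otimes> T0 B) (T0 (A \<otimes> B))"
    and t_natural: "\<lbrakk>f \<in> hom1 K A A'; g \<in> hom1 K B B'\<rbrakk>
        \<Longrightarrow> T1 (f \<otimes>\<^sub>1 g) \<odot> t A B = t A' B' \<odot> (f \<otimes>\<^sub>1 T1 g)"
    and t_natural2: "\<lbrakk>f \<in> hom1 K A A'; g \<in> hom1 K B B'; \<alpha> \<in> hom2 K f f'; \<beta> \<in> hom2 K g g'\<rbrakk>
        \<Longrightarrow> T2 (\<alpha> \<otimes>\<^sub>2 \<beta>) \<rhd> t A B = t A' B' \<lhd> (\<alpha> \<otimes>\<^sub>2 T2 \<beta>)"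
    and t_unit: "A \<in> Ob K \<Longrightarrow> T1 (pr2 \<one> A) \<odot> t \<one> A = pr2 \<one> (T0 A)"
    and t_assoc: "\<lbrakk>A \<in> Ob K; B \<in> Ob K; C \<in> Ob K\<rbrakk>
        \<Longrightarrow> t A (B \<otimes> C) \<odot> (id1 A \<otimes>\<^sub>1 t B C) \<odot> assoc A B (T0 C)
            = T1 (assoc A B C) \<odot> t (A \<otimes> B) C"
    and t_\<eta>: "\<lbrakk>A \<in> Ob K; B \<in> Ob K\<rbrakk> \<Longrightarrow> t A B \<odot> (id1 A \<otimes>\<^sub>1 \<eta> B) = \<eta> (A \<otimes> B)"
    and t_\<mu>: "\<lbrakk>A \<in> Ob K; B \<in> Ob K\<rbrakk>
        \<Longrightarrow> t A B \<odot> (id1 A \<otimes>\<^sub>1 \<mu> B) = \<mu> (A \<otimes> B) \<odot> T1 (t A B) \<odot> t A (T0 B)"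
begin

definition t' :: "'o \<Rightarrow> 'o \<Rightarrow> 'f" where
  \<comment> \<open>the binary \<open>t\<^sub>1 : TA \<times> B \<rightarrow> T(A \<times> B)\<close>; the binary \<open>t\<^sub>2\<close> is \<open>t\<close>\<close>
  "t' A B = T1 (sym B A) \<odot> t B A \<odot> sym (T0 A) B"

definition tn :: "'o list \<Rightarrow> nat \<Rightarrow> 'f" where
  \<comment> \<open>the \<open>n\<close>-ary \<open>t\<^sub>i\<close>, from the product of \<open>As[i := T0 (As ! i)]\<close> to \<open>T\<close> of the product of \<open>As\<close>:
     \<open>to_last\<close> moves position \<open>i\<close> to the end, \<open>from_last\<close> is the inverse permutation\<close>
  "tn As i =
     (let n = length As;
          As' = As[i := T0 (As ! i)];
          Bs = take i As @ drop (Suc i) As;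
          P = nprod Bs;
          to_last = pair1
            (ntuple1 (nprod As') (map (nproj As') ([0..<i] @ [Suc i..<n])))
            (nproj As' i);
          from_last = ntuple1 (P \<otimes> (As ! i))
            (map (\<lambda>k. nproj Bs k \<odot> pr1 P (As ! i)) [0..<i] @
             [pr2 P (As ! i)] @
             map (\<lambda>k. nproj Bs (k - 1) \<odot> pr1 P (As ! i)) [Suc i..<n])
      in T1 from_last \<odot> t P (As ! i) \<odot> to_last)"

definition \<omega> :: "'o \<Rightarrow> 'o \<Rightarrow> 'f" where
  "\<omega> A B = \<mu> (A \<otimes> B) \<odot> T1 (t A B) \<odot> t' A (T0 B)"

definition \<omega>' :: "'o \<Rightarrow> 'o \<Rightarrow> 'f" where
  "\<omega>' A B = \<mu> (A \<otimes> B) \<odot> T1 (t' A B) \<odot> t (T0 A) B"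

definition algebra :: "'o \<times> 'f \<Rightarrow> bool" where
  "algebra = (\<lambda>(A, a). A \<in> Ob K \<and> a \<in> hom1 K (T0 A) A \<and>
     a \<odot> \<eta> A = id1 A \<and> a \<odot> T1 a = a \<odot> \<mu> A)"

definition Free :: "'o \<Rightarrow> 'o \<times> 'f" where
  "Free A = (T0 A, \<mu> A)"

end

section \<open>Symmetric pseudo commutativities\<close>

locale pseudo_commutative_strong_two_monad = strong_two_monad K T0 T1 T2 \<eta> \<mu> t
  for K :: "('o, 'f, 't, 'x) fp_two_cat_scheme" (structure)
    and T0 T1 T2 \<eta> \<mu> t +
  fixes \<Gamma> :: "'o \<Rightarrow> 'o \<Rightarrow> 't"
  assumes \<Gamma>_in: "\<lbrakk>A \<in> Ob K; B \<in> Ob K\<rbrakk> \<Longrightarrow> \<Gamma> A B \<in> hom2 K (\<omega> A B) (\<omega>' A B)"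
    and \<Gamma>_invertible: "\<lbrakk>A \<in> Ob K; B \<in> Ob K\<rbrakk> \<Longrightarrow> invertible2 (\<Gamma> A B)"
    and \<Gamma>_modification: "\<lbrakk>f \<in> hom1 K A A'; g \<in> hom1 K B B'\<rbrakk>
        \<Longrightarrow> T1 (f \<otimes>\<^sub>1 g) \<lhd> \<Gamma> A B = \<Gamma> A' B' \<rhd> (T1 f \<otimes>\<^sub>1 T1 g)"
    and \<Gamma>_t_left: "\<lbrakk>A \<in> Ob K; B \<in> Ob K; C \<in> Ob K\<rbrakk>
        \<Longrightarrow> T1 (assoc A B C) \<lhd> \<Gamma> (A \<otimes> B) C \<rhd> (t A B \<otimes>\<^sub>1 id1 (T0 C))
            = t A (B \<otimes> C) \<lhd> (id2 (id1 A) \<otimes>\<^sub>2 \<Gamma> B C) \<rhd> assoc A (T0 B) (T0 C)"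
    and \<Gamma>_t_middle: "\<lbrakk>A \<in> Ob K; B \<in> Ob K; C \<in> Ob K\<rbrakk>
        \<Longrightarrow> \<Gamma> A (B \<otimes> C) \<rhd> ((id1 (T0 A) \<otimes>\<^sub>1 t B C) \<odot> assoc (T0 A) B (T0 C))
            = T1 (assoc A B C) \<lhd> \<Gamma> (A \<otimes> B) C \<rhd> (t' A B \<otimes>\<^sub>1 id1 (T0 C))"
    and \<Gamma>_t_right: "\<lbrakk>A \<in> Ob K; B \<in> Ob K; C \<in> Ob K\<rbrakk>
        \<Longrightarrow> \<Gamma> A (B \<otimes> C) \<rhd> ((id1 (T0 A) \<otimes>\<^sub>1 t' B C) \<odot> assoc (T0 A) (T0 B) C)
            = (T1 (assoc A B C) \<odot> t' (A \<otimes> B) C) \<lhd> (\<Gamma> A B \<otimes>\<^sub>2 id2 (id1 C))"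
    and \<Gamma>_\<eta>_left: "\<lbrakk>A \<in> Ob K; B \<in> Ob K\<rbrakk>
        \<Longrightarrow> \<Gamma> A B \<rhd> (\<eta> A \<otimes>\<^sub>1 id1 (T0 B)) = id2 (\<omega> A B \<odot> (\<eta> A \<otimes>\<^sub>1 id1 (T0 B)))"
    and \<Gamma>_\<eta>_right: "\<lbrakk>A \<in> Ob K; B \<in> Ob K\<rbrakk>
        \<Longrightarrow> \<Gamma> A B \<rhd> (id1 (T0 A) \<otimes>\<^sub>1 \<eta> B) = id2 (\<omega> A B \<odot> (id1 (T0 A) \<otimes>\<^sub>1 \<eta> B))"
    and \<Gamma>_\<mu>_left: "\<lbrakk>A \<in> Ob K; B \<in> Ob K\<rbrakk>
        \<Longrightarrow> \<Gamma> A B \<rhd> (\<mu> A \<otimes>\<^sub>1 id1 (T0 B))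
            = ((\<mu> (A \<otimes> B) \<odot> T1 (t' A B)) \<lhd> \<Gamma> (T0 A) B)
              \<cdot> (\<mu> (A \<otimes> B) \<lhd> T2 (\<Gamma> A B) \<rhd> t' (T0 A) (T0 B))"
    and \<Gamma>_\<mu>_right: "\<lbrakk>A \<in> Ob K; B \<in> Ob K\<rbrakk>
        \<Longrightarrow> \<Gamma> A B \<rhd> (id1 (T0 A) \<otimes>\<^sub>1 \<mu> B)
            = (\<mu> (A \<otimes> B) \<lhd> T2 (\<Gamma> A B) \<rhd> t (T0 A) (T0 B))
              \<cdot> ((\<mu> (A \<otimes> B) \<odot> T1 (t A B)) \<lhd> \<Gamma> A (T0 B))"

locale symmetric_pseudo_commutative_strong_two_monad =
  pseudo_commutative_strong_two_monad K T0 T1 T2 \<eta> \<mu> t \<Gamma>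
  for K :: "('o, 'f, 't, 'x) fp_two_cat_scheme" (structure)
    and T0 T1 T2 \<eta> \<mu> t \<Gamma> +
  assumes \<Gamma>_symmetric: "\<lbrakk>A \<in> Ob K; B \<in> Ob K\<rbrakk>
        \<Longrightarrow> (T1 (sym B A) \<lhd> \<Gamma> B A \<rhd> sym (T0 A) (T0 B)) \<cdot> \<Gamma> A B = id2 (\<omega> A B)"

section \<open>Cat-multicategories and non-symmetric Cat-multifunctors\<close>

record ('a, 'm) cat =
  CO :: "'a set"
  CA :: "'m set"
  cdom :: "'m \<Rightarrow> 'a"
  ccod :: "'m \<Rightarrow> 'a"
  cid :: "'a \<Rightarrow> 'm"
  ccomp :: "'m \<Rightarrow> 'm \<Rightarrow> 'm"

definition category :: "('a, 'm) cat \<Rightarrow> bool" where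
  "category C \<longleftrightarrow>
     (\<forall>m \<in> CA C. cdom C m \<in> CO C \<and> ccod C m \<in> CO C) \<and>
     (\<forall>a \<in> CO C. cid C a \<in> CA C \<and> cdom C (cid C a) = a \<and> ccod C (cid C a) = a) \<and>
     (\<forall>m \<in> CA C. \<forall>m' \<in> CA C. ccod C m = cdom C m' \<longrightarrow>
        ccomp C m' m \<in> CA C \<and> cdom C (ccomp C m' m) = cdom C m \<and> ccod C (ccomp C m' m) = ccod C m') \<and>
     (\<forall>m \<in> CA C. ccomp C (cid C (ccod C m)) m = m \<and> ccomp C m (cid C (cdom C m)) = m) \<and>
     (\<forall>m \<in> CA C. \<forall>m' \<in> CA C. \<forall>m'' \<in> CA C. ccod C m = cdom C m' \<and> ccod C m' = cdom C m'' \<longrightarrow>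
        ccomp C (ccomp C m'' m') m = ccomp C m'' (ccomp C m' m))"

definition is_functor :: "('a, 'm) cat \<Rightarrow> ('b, 'n) cat \<Rightarrow> ('a \<Rightarrow> 'b) \<Rightarrow> ('m \<Rightarrow> 'n) \<Rightarrow> bool" where
  "is_functor C D F0 F1 \<longleftrightarrow> category C \<and> category D \<and>
     (\<forall>a \<in> CO C. F0 a \<in> CO D) \<and>
     (\<forall>m \<in> CA C. F1 m \<in> CA D \<and> cdom D (F1 m) = F0 (cdom C m) \<and> ccod D (F1 m) = F0 (ccod C m)) \<and>
     (\<forall>a \<in> CO C. F1 (cid C a) = cid D (F0 a)) \<and>
     (\<forall>m \<in> CA C. \<forall>m' \<in> CA C. ccod C m = cdom C m' \<longrightarrow> F1 (ccomp C m' m) = ccomp D (F1 m') (F1 m))"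

text \<open>
  The data of a Cat-multicategory. The composition \<open>\<gamma>(f; g\<^sub>1, \<dots>, g\<^sub>n)\<close> takes the input lists
  \<open>Ass\<close> of the \<open>g\<^sub>j\<close>, the inputs \<open>Bs\<close> of \<open>f\<close> and the output \<open>C\<close> of \<open>f\<close> as explicit arguments,
  because a 1-cell of the examples below does not determine its list of inputs.
  The notion of a multifunctor (preservation of units and of \<open>\<gamma>\<close>) refers to the data only;
  no compatibility with symmetric group actions is involved.
\<close>

record ('a, 'm, 'c) cat_multi =
  MOb :: "'a set"
  MHom :: "'a list \<Rightarrow> 'a \<Rightarrow> ('m, 'c) cat"
  MUnit :: "'a \<Rightarrow> 'm"
  MComp1 :: "'a list list \<Rightarrow> 'a list \<Rightarrow> 'a \<Rightarrow> 'm \<Rightarrow> 'm list \<Rightarrow> 'm"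
  MComp2 :: "'a list list \<Rightarrow> 'a list \<Rightarrow> 'a \<Rightarrow> 'c \<Rightarrow> 'c list \<Rightarrow> 'c"

definition cat_multifunctor ::
  "('a, 'm, 'c) cat_multi \<Rightarrow> ('b, 'n, 'd) cat_multi \<Rightarrow> ('a \<Rightarrow> 'b) \<Rightarrow>
   ('a list \<Rightarrow> 'a \<Rightarrow> 'm \<Rightarrow> 'n) \<Rightarrow> ('a list \<Rightarrow> 'a \<Rightarrow> 'c \<Rightarrow> 'd) \<Rightarrow> bool" where
  "cat_multifunctor M N F0 F1 F2 \<longleftrightarrow>
     (\<forall>A \<in> MOb M. F0 A \<in> MOb N) \<and>
     (\<forall>As B. set As \<subseteq> MOb M \<and> B \<in> MOb M \<longrightarrow>
        is_functor (MHom M As B) (MHom N (map F0 As) (F0 B)) (F1 As B) (F2 As B)) \<and>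
     (\<forall>A \<in> MOb M. F1 [A] A (MUnit M A) = MUnit N (F0 A)) \<and>
     (\<forall>Ass Bs C f gs.
        (\<forall>As \<in> set Ass. set As \<subseteq> MOb M) \<and> set Bs \<subseteq> MOb M \<and> C \<in> MOb M \<and>
        length Ass = length Bs \<and> length gs = length Bs \<and>
        f \<in> CO (MHom M Bs C) \<and> (\<forall>j < length Bs. gs ! j \<in> CO (MHom M (Ass ! j) (Bs ! j))) \<longrightarrow>
        F1 (concat Ass) C (MComp1 M Ass Bs C f gs)
          = MComp1 N (map (map F0) Ass) (map F0 Bs) (F0 C) (F1 Bs C f)
              (map (\<lambda>j. F1 (Ass ! j) (Bs ! j) (gs ! j)) [0..<length Bs])) \<and>
     (\<forall>Ass Bs C \<alpha> \<beta>s.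
        (\<forall>As \<in> set Ass. set As \<subseteq> MOb M) \<and> set Bs \<subseteq> MOb M \<and> C \<in> MOb M \<and>
        length Ass = length Bs \<and> length \<beta>s = length Bs \<and>
        \<alpha> \<in> CA (MHom M Bs C) \<and> (\<forall>j < length Bs. \<beta>s ! j \<in> CA (MHom M (Ass ! j) (Bs ! j))) \<longrightarrow>
        F2 (concat Ass) C (MComp2 M Ass Bs C \<alpha> \<beta>s)
          = MComp2 N (map (map F0) Ass) (map F0 Bs) (F0 C) (F2 Bs C \<alpha>)
              (map (\<lambda>j. F2 (Ass ! j) (Bs ! j) (\<beta>s ! j)) [0..<length Bs]))"

section \<open>The Cat-multicategory of a 2-category with finite products\<close>

context fp_two_category
begin

definition K_multi :: "('o, 'f, 't) cat_multi" where
  "K_multi = \<lparr>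
     MOb = Ob K,
     MHom = (\<lambda>As B. \<lparr>
       CO = hom1 K (nprod As) B,
       CA = {\<alpha> \<in> Ce K. dom2 K \<alpha> \<in> hom1 K (nprod As) B \<and> cod2 K \<alpha> \<in> hom1 K (nprod As) B},
       cdom = dom2 K, ccod = cod2 K, cid = id2, ccomp = (\<cdot>) \<rparr>),
     MUnit = id1,
     MComp1 = (\<lambda>Ass Bs C f gs. f \<odot> nmap1 gs \<odot> regroup Ass),
     MComp2 = (\<lambda>Ass Bs C \<alpha> \<beta>s. (\<alpha> \<star> nmap2 \<beta>s) \<rhd> regroup Ass) \<rparr>"

end

section \<open>The Cat-multicategory of strict algebras and the free algebra construction\<close>

context pseudo_commutative_strong_two_monad
begin

text \<open>
  \<open>\<Gamma>\<^bsub>i,j\<^esub>\<close> for \<open>i < j < n\<close>, between 1-cells from the product of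
  \<open>As[i := T0 (As ! i), j := T0 (As ! j)]\<close> to \<open>T\<close> of the product of \<open>As\<close>. The list is cut before
  the positions \<open>i\<close> and \<open>j\<close> into three blocks, the first of which is empty if \<open>i = 0\<close>; its product
  is then \<open>\<one>\<close>.
\<close>

definition \<Gamma>n :: "'o list \<Rightarrow> nat \<Rightarrow> nat \<Rightarrow> 't" where
  "\<Gamma>n As i j =
     (let blocks = (\<lambda>Xs. [take i Xs, drop i (take j Xs), drop j Xs]);
          As' = As[i := T0 (As ! i), j := T0 (As ! j)];
          Ps = blocks As;
          P = nprod (Ps ! 0); Q = nprod (Ps ! 1); R = nprod (Ps ! 2)
      in (T1 (ungroup Ps \<odot> assoc_inv P Q R) \<odot> t P (Q \<otimes> R))
           \<lhd> (id2 (id1 P) \<otimes>\<^sub>2 \<Gamma> Q R)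
           \<rhd> ((id1 P \<otimes>\<^sub>1 (tn (Ps ! 1) 0 \<otimes>\<^sub>1 tn (Ps ! 2) 0))
               \<odot> assoc P (nprod (blocks As' ! 1)) (nprod (blocks As' ! 2))
               \<odot> regroup (blocks As')))"

text \<open>
  An \<open>n\<close>-ary 1-cell is a pair \<open>(h, [h\<^sub>1, \<dots>, h\<^sub>n])\<close>. For \<open>n = 0\<close> the conditions on the structure
  2-cells are void, so that the \<open>0\<close>-ary 1-cells and 2-cells are those of \<open>K(1,B)\<close>.
\<close>

definition alg_cells1 :: "('o \<times> 'f) list \<Rightarrow> 'o \<times> 'f \<Rightarrow> ('f \<times> 't list) set" where
  "alg_cells1 As Bb =
     {(h, hs). let n = length As; X = map fst As; a = (\<lambda>i. snd (As ! i)); B = fst Bb; b = snd Bb;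
                   TX = (\<lambda>i. X[i := T0 (X ! i)]) in
        h \<in> hom1 K (nprod X) B \<and> length hs = n \<and>
        (\<forall>i<n. hs ! i \<in> hom2 K (b \<odot> T1 h \<odot> tn X i) (h \<odot> slot X i (a i)) \<and> invertible2 (hs ! i)) \<and>
        (\<forall>i<n. hs ! i \<rhd> slot X i (\<eta> (X ! i)) = id2 h) \<and>
        (\<forall>i<n. hs ! i \<rhd> slot X i (\<mu> (X ! i))
               = (hs ! i \<rhd> slot X i (T1 (a i))) \<cdot> (b \<lhd> T2 (hs ! i) \<rhd> tn (TX i) i)) \<and>
        (\<forall>j<n. \<forall>i<j.
           (hs ! i \<rhd> slot (TX i) j (a j)) \<cdot> (b \<lhd> T2 (hs ! j) \<rhd> tn (TX j) i)
           = (hs ! j \<rhd> slot (TX j) i (a i)) \<cdot> (b \<lhd> T2 (hs ! i) \<rhd> tn (TX i) j)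
               \<cdot> ((b \<odot> T1 h) \<lhd> \<Gamma>n X i j))}"

text \<open>
  A 2-cell \<open>F \<Rightarrow> G\<close> of \<open>T\<close>-algebras is a triple \<open>(F, \<alpha>, G)\<close>, since the underlying 2-cell \<open>\<alpha>\<close>
  does not determine the structure 2-cells of its source and target.
\<close>

type_synonym ('ff, 'tt) cell2 = "('ff \<times> 'tt list) \<times> 'tt \<times> ('ff \<times> 'tt list)"

definition alg_cells2 :: "('o \<times> 'f) list \<Rightarrow> 'o \<times> 'f \<Rightarrow> ('f, 't) cell2 set" where
  "alg_cells2 As Bb =
     {(F, \<alpha>, G). let n = length As; X = map fst As; a = (\<lambda>i. snd (As ! i)); b = snd Bb in
        F \<in> alg_cells1 As Bb \<and> G \<in> alg_cells1 As Bb \<and> \<alpha> \<in> hom2 K (fst F) (fst G) \<and>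
        (\<forall>i<n. (\<alpha> \<rhd> slot X i (a i)) \<cdot> (snd F ! i) = (snd G ! i) \<cdot> (b \<lhd> T2 \<alpha> \<rhd> tn X i))}"

definition alg_hom :: "('o \<times> 'f) list \<Rightarrow> 'o \<times> 'f \<Rightarrow> ('f \<times> 't list, ('f, 't) cell2) cat" where
  "alg_hom As B = \<lparr>
     CO = alg_cells1 As B,
     CA = alg_cells2 As B,
     cdom = (\<lambda>(F, \<alpha>, G). F),
     ccod = (\<lambda>(F, \<alpha>, G). G),
     cid = (\<lambda>F. (F, id2 (fst F), F)),
     ccomp = (\<lambda>(G', \<beta>, H) (F, \<alpha>, G). (F, \<beta> \<cdot> \<alpha>, H)) \<rparr>"

definition alg_unit :: "'o \<times> 'f \<Rightarrow> 'f \<times> 't list" where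
  "alg_unit Aa = (id1 (fst Aa), [id2 (snd Aa)])"

definition alg_comp1 ::
  "('o \<times> 'f) list list \<Rightarrow> 'f \<times> 't list \<Rightarrow> ('f \<times> 't list) list \<Rightarrow> 'f \<times> 't list" where
  \<comment> \<open>in the structure 2-cell for input \<open>d\<close> of the \<open>j\<close>-th argument, \<open>Yss\<close> is the family of
     underlying objects \<open>Xss\<close> with \<open>T\<close> applied in that place\<close>
  "alg_comp1 Ass F Gs =
     (let Xss = map (map fst) Ass; f = fst F; gs = map fst Gs in
      (f \<odot> nmap1 gs \<odot> regroup Xss,
       concat (map (\<lambda>j. map (\<lambda>d.
         let Yss = Xss[j := (Xss ! j)[d := T0 (Xss ! j ! d)]] in
           (f \<lhd> nmap2 ((map id2 gs)[j := snd (Gs ! j) ! d]) \<rhd> regroup Yss)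
           \<cdot> (snd F ! j \<rhd> (nmap1 (gs[j := T1 (gs ! j) \<odot> tn (Xss ! j) d]) \<odot> regroup Yss)))
         [0..<length (Ass ! j)]) [0..<length Ass])))"

definition alg_comp2 ::
  "('o \<times> 'f) list list \<Rightarrow> ('f, 't) cell2 \<Rightarrow> ('f, 't) cell2 list \<Rightarrow> ('f, 't) cell2" where
  "alg_comp2 Ass = (\<lambda>(F, \<alpha>, F') \<beta>s.
     (alg_comp1 Ass F (map fst \<beta>s),
      (\<alpha> \<star> nmap2 (map (fst \<circ> snd) \<beta>s)) \<rhd> regroup (map (map fst) Ass),
      alg_comp1 Ass F' (map (snd \<circ> snd) \<beta>s)))"

definition T_Alg :: "('o \<times> 'f, 'f \<times> 't list, ('f, 't) cell2) cat_multi" where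
  "T_Alg = \<lparr>
     MOb = Collect algebra,
     MHom = alg_hom,
     MUnit = alg_unit,
     MComp1 = (\<lambda>Ass Bs C. alg_comp1 Ass),
     MComp2 = (\<lambda>Ass Bs C. alg_comp2 Ass) \<rparr>"

definition \<omega>_cell :: "'o \<Rightarrow> 'o \<Rightarrow> 'f \<times> 't list" where
  "\<omega>_cell A B =
     (\<omega> A B,
      [id2 (\<omega> A B \<odot> (\<mu> A \<otimes>\<^sub>1 id1 (T0 B))),
       (T1 (sym B A) \<lhd> \<Gamma> B A \<rhd> (sym (T0 A) (T0 B) \<odot> (id1 (T0 A) \<otimes>\<^sub>1 \<mu> B)))
       \<cdot> (\<mu> (A \<otimes> B) \<lhd> T2 (\<Gamma> A B) \<rhd> t (T0 A) (T0 B))])"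

fun \<omega>n_cell :: "'o list \<Rightarrow> 'f \<times> 't list" where
  "\<omega>n_cell As =
     (if length As = 0 then (\<eta> \<one>, [])
      else if length As = 1 then alg_unit (Free (As ! 0))
      else if length As = 2 then \<omega>_cell (As ! 0) (As ! 1)
      else alg_comp1 [map Free (butlast As), [Free (last As)]]
             (\<omega>_cell (nprod (butlast As)) (last As))
             [\<omega>n_cell (butlast As), alg_unit (Free (last As))])"

declare \<omega>n_cell.simps [simp del]

definition free1_unary :: "'f \<Rightarrow> 'f \<times> 't list" where
  "free1_unary f = (T1 f, [id2 (T1 f \<odot> \<mu> (dom1 K f))])"

definition free1 :: "'o list \<Rightarrow> 'o \<Rightarrow> 'f \<Rightarrow> 'f \<times> 't list" where
  "free1 As B f =
     (if length As = 0 then (T1 f \<odot> \<eta> \<one>, [])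
      else if length As = 1 then free1_unary f
      else alg_comp1 [map Free As] (free1_unary f) [\<omega>n_cell As])"

definition free2 :: "'o list \<Rightarrow> 'o \<Rightarrow> 't \<Rightarrow> ('f, 't) cell2" where
  "free2 As B \<alpha> =
     (let f = dom2 K \<alpha>; g = cod2 K \<alpha>;
          unary = (free1_unary f, T2 \<alpha>, free1_unary g);
          \<omega>s = \<omega>n_cell As in
      if length As = 0 then (free1 As B f, T2 \<alpha> \<rhd> \<eta> \<one>, free1 As B g)
      else if length As = 1 then unary
      else alg_comp2 [map Free As] unary [(\<omega>s, id2 (fst \<omega>s), \<omega>s)])"

end

end

theory Submission
  imports Defs
begin

text \<open>
  Under horizontal composition the 2-cells form a category with finite products, containing the
  1-cells as the identity 2-cells, and \<open>T2\<close> is a strong monad on it. So every 2-cell equation can be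
  checked on generalized elements, i.e. on tuples of 2-cells with a common source \<open>Z\<close>, where the
  strength becomes Kleisli extension with a parameter and \<open>\<Gamma>\<close> a natural arrow.

  By symmetry and axiom (7) the second structure 2-cell of \<open>\<omega>\<^bsub>A,B\<^esub>\<close> is the inverse of
  \<open>(\<mu> \<circ> Tt\<^sub>2) \<circ> \<Gamma>\<^bsub>A,TB\<^esub>\<close>. Its laws (unit, multiplication, coherence, compatibility with the
  associativity of \<open>\<omega>\<close>) follow by inverting equations between composites of \<open>\<Gamma>\<close>. Adding one factor
  at a time, these laws show that \<open>\<omega>\<^bsub>A\<^sub>1,\<dots>,A\<^sub>n\<^esub>\<close> is a multimorphism and that it is natural and
  associative, including its structure 2-cells; preservation of \<open>\<gamma>\<close> is naturality combined with
  associativity.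
\<close>

section \<open>2-cells as the arrows of a category under horizontal composition\<close>

text \<open>Vertical composites make evaluation on elements delicate. The naturality axiom of
  \<open>\<Gamma>\<close> speaks of 1-cells only, and precomposition distributes over a vertical
  composite only along an identity 2-cell. So equations about \<open>\<omega>\<close> alone are
  proved for tuples of arbitrary 2-cells, which the action on 2-cells needs, whereas equations
  between vertical composites are proved for tuples of identities (\<open>idc\<close>). These
  suffice: the tuple of all projections consists of identities and is itself an identity, so
  evaluating at it recovers the 2-cell. Each vertical composite also needs a proof that its middle
  1-cells agree.

  The reason for inverting: the structure 2-cell of \<open>\<omega>\<close> is a composite of two
  \<open>\<Gamma>\<close>'s, one conjugated by symmetries, while its inverse \<open>D\<close> is a
  single whiskered \<open>\<Gamma>\<close>, whose laws can be read off the axioms. Symmetry enters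
  only to see that the two are inverse. The \<open>\<Gamma>\<close> in the coherence condition of
  algebra 1-cells comes from the law of \<open>D\<close> for \<open>\<mu>\<close> in the first
  argument: once that law is inverted, one \<open>\<Gamma>\<close> has to be moved to the other
  side.\<close>

context two_category
begin

abbreviation hc (infixr "**" 66) where "\<beta> ** \<alpha> \<equiv> \<beta> \<star> \<alpha>"

definition src :: "'t \<Rightarrow> 'o" where "src \<alpha> = dom1 K (dom2 K \<alpha>)"
definition tgt :: "'t \<Rightarrow> 'o" where "tgt \<alpha> = cod1 K (dom2 K \<alpha>)"
text \<open>1-cells are represented by their identity 2-cells. Composability for
  \<open>\<cdot>\<close> then becomes the equation \<open>cm \<alpha> = dm \<beta>\<close> between
  2-cells, which rewriting can compute through horizontal composites and pairs.\<close>

definition dm :: "'t \<Rightarrow> 't" where "dm \<alpha> = id2 (dom2 K \<alpha>)"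
definition cm :: "'t \<Rightarrow> 't" where "cm \<alpha> = id2 (cod2 K \<alpha>)"
definition idc :: "'t \<Rightarrow> bool" where "idc \<alpha> \<longleftrightarrow> \<alpha> \<in> Ce K \<and> dm \<alpha> = \<alpha>"

lemma hom2I: "\<alpha> \<in> Ce K \<Longrightarrow> \<alpha> \<in> hom2 K (dom2 K \<alpha>) (cod2 K \<alpha>)"
  by (simp add: hom2_def)

lemma hom1_dom_cod: "f \<in> Ar K \<Longrightarrow> f \<in> hom1 K (dom1 K f) (cod1 K f)"
  by (simp add: hom1_def)

lemma dom_cod_in_Ob [simp]: "f \<in> Ar K \<Longrightarrow> dom1 K f \<in> Ob K" "f \<in> Ar K \<Longrightarrow> cod1 K f \<in> Ob K"
  by (auto simp: dom1_in cod1_in)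

lemma comp1_typing [simp]:
  assumes "f \<in> Ar K" "g \<in> Ar K" "cod1 K f = dom1 K g"
  shows "g \<odot> f \<in> Ar K" "dom1 K (g \<odot> f) = dom1 K f" "cod1 K (g \<odot> f) = cod1 K g"
  using comp1_in[of f "dom1 K f" "cod1 K f" g "cod1 K g"] assms by (auto simp: hom1_def)

lemma id1_typing [simp]:
  assumes "A \<in> Ob K"
  shows "id1 A \<in> Ar K" "dom1 K (id1 A) = A" "cod1 K (id1 A) = A"
  using id1_in[OF assms] by (auto simp: hom1_def)

lemma id2_dom_cod [simp]: "f \<in> Ar K \<Longrightarrow> dom2 K (id2 f) = f" "f \<in> Ar K \<Longrightarrow> cod2 K (id2 f) = f"
  using id2_in by (auto simp: hom2_def)

lemma id2_typing [simp]:
  assumes "f \<in> Ar K"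
  shows "id2 f \<in> Ce K" "src (id2 f) = dom1 K f" "tgt (id2 f) = cod1 K f" "idc (id2 f)"
  using id2_in[OF assms] by (auto simp: hom2_def src_def tgt_def idc_def dm_def)

lemma dom2_Ar [simp]: "\<alpha> \<in> Ce K \<Longrightarrow> dom2 K \<alpha> \<in> Ar K" "\<alpha> \<in> Ce K \<Longrightarrow> cod2 K \<alpha> \<in> Ar K"
  by (auto simp: dom2_in cod2_in)

lemma dom1_dom2_src: "\<alpha> \<in> Ce K \<Longrightarrow> dom1 K (dom2 K \<alpha>) = src \<alpha>"
    "\<alpha> \<in> Ce K \<Longrightarrow> dom1 K (cod2 K \<alpha>) = src \<alpha>"
    "\<alpha> \<in> Ce K \<Longrightarrow> cod1 K (dom2 K \<alpha>) = tgt \<alpha>"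
    "\<alpha> \<in> Ce K \<Longrightarrow> cod1 K (cod2 K \<alpha>) = tgt \<alpha>"
  by (simp_all add: src_def tgt_def dom1_dom2 cod1_dom2)

lemma src_tgt_Ob [simp]: "\<alpha> \<in> Ce K \<Longrightarrow> src \<alpha> \<in> Ob K" "\<alpha> \<in> Ce K \<Longrightarrow> tgt \<alpha> \<in> Ob K"
  by (simp_all add: src_def tgt_def)

text \<open>The way back from identity 2-cells to equations of 1-cells; nothing is lost by computing
  with 2-cells only.\<close>

lemma id2_inject: "f \<in> Ar K \<Longrightarrow> g \<in> Ar K \<Longrightarrow> id2 f = id2 g \<longleftrightarrow> f = g"
  by (metis id2_dom_cod(1))

lemma dm_typing [simp]:
  assumes "\<alpha> \<in> Ce K"
  shows "dm \<alpha> \<in> Ce K" "src (dm \<alpha>) = src \<alpha>" "tgt (dm \<alpha>) = tgt \<alpha>" "idc (dm \<alpha>)"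
    "cm \<alpha> \<in> Ce K" "src (cm \<alpha>) = src \<alpha>" "tgt (cm \<alpha>) = tgt \<alpha>" "idc (cm \<alpha>)"
  using assms by (simp_all add: dm_def cm_def dom1_dom2_src)

lemma idcD: "idc \<alpha> \<Longrightarrow> \<alpha> \<in> Ce K" "idc \<alpha> \<Longrightarrow> dm \<alpha> = \<alpha>" "idc \<alpha> \<Longrightarrow> cm \<alpha> = \<alpha>"
proof -
  show "idc \<alpha> \<Longrightarrow> \<alpha> \<in> Ce K" "idc \<alpha> \<Longrightarrow> dm \<alpha> = \<alpha>" by (simp_all add: idc_def)
  assume a: "idc \<alpha>"
  then have "\<alpha> = id2 (dom2 K \<alpha>)" "\<alpha> \<in> Ce K" by (simp_all add: idc_def dm_def)
  then show "cm \<alpha> = \<alpha>" by (metis cm_def id2_dom_cod(2) dom2_Ar(1))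
qed

lemma idc_id2_dom2: "idc \<alpha> \<Longrightarrow> id2 (dom2 K \<alpha>) = \<alpha>"
  by (simp add: idc_def dm_def)

lemma dm_idc [simp]: "idc \<alpha> \<Longrightarrow> dm \<alpha> = \<alpha>" "idc \<alpha> \<Longrightarrow> cm \<alpha> = \<alpha>"
  by (simp_all add: idcD)

lemma dm_eq_iff:
  assumes "\<alpha> \<in> Ce K" "\<beta> \<in> Ce K"
  shows "dm \<alpha> = dm \<beta> \<longleftrightarrow> dom2 K \<alpha> = dom2 K \<beta>" "cm \<alpha> = dm \<beta> \<longleftrightarrow> cod2 K \<alpha> = dom2 K \<beta>"
    "cm \<alpha> = cm \<beta> \<longleftrightarrow> cod2 K \<alpha> = cod2 K \<beta>"
  using assms by (simp_all add: dm_def cm_def id2_inject)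

lemma hcomp_hom2:
  assumes "\<alpha> \<in> Ce K" "\<beta> \<in> Ce K" "tgt \<alpha> = src \<beta>"
  shows "\<beta> ** \<alpha> \<in> hom2 K (dom2 K \<beta> \<odot> dom2 K \<alpha>) (cod2 K \<beta> \<odot> cod2 K \<alpha>)"
  by (rule hcomp_in[of _ "src \<alpha>" "tgt \<alpha>" _ "tgt \<beta>"])
     (use assms in \<open>auto simp: hom2_def hom1_def dom1_dom2_src\<close>)

lemma hcomp_typing [simp]:
  assumes "\<alpha> \<in> Ce K" "\<beta> \<in> Ce K" "tgt \<alpha> = src \<beta>"
  shows "\<beta> ** \<alpha> \<in> Ce K" "src (\<beta> ** \<alpha>) = src \<alpha>" "tgt (\<beta> ** \<alpha>) = tgt \<beta>"
    "dom2 K (\<beta> ** \<alpha>) = dom2 K \<beta> \<odot> dom2 K \<alpha>" "cod2 K (\<beta> ** \<alpha>) = cod2 K \<beta> \<odot> cod2 K \<alpha>"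
  using hcomp_hom2[OF assms] assms by (auto simp: hom2_def src_def tgt_def)

lemma hcomp_assoc' [simp]:
  assumes "\<alpha> \<in> Ce K" "\<beta> \<in> Ce K" "\<gamma> \<in> Ce K" "tgt \<alpha> = src \<beta>" "tgt \<beta> = src \<gamma>"
  shows "(\<gamma> ** \<beta>) ** \<alpha> = \<gamma> ** (\<beta> ** \<alpha>)"
  by (rule hcomp_assoc[of "dom2 K \<alpha>" "src \<alpha>" "tgt \<alpha>" "dom2 K \<beta>" "tgt \<beta>" "dom2 K \<gamma>" "tgt \<gamma>"
        _ "cod2 K \<alpha>" _ "cod2 K \<beta>" _ "cod2 K \<gamma>"])
     (use assms in \<open>auto simp: hom2_def hom1_def dom1_dom2_src\<close>)

text \<open>Oriented so that \<open>id2\<close> moves inwards. Applying \<open>id2\<close> to an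
  axiom about composite 1-cells thus yields an equation of horizontal composites.\<close>

lemma id2_comp1 [simp]:
  assumes "f \<in> Ar K" "g \<in> Ar K" "cod1 K f = dom1 K g"
  shows "id2 (g \<odot> f) = id2 g ** id2 f"
  by (rule hcomp_id2[of _ "dom1 K f" "cod1 K f" _ "cod1 K g", symmetric])
     (use assms in \<open>auto simp: hom1_def\<close>)

lemma hcomp_id [simp]:
  assumes "\<alpha> \<in> Ce K"
  shows "tgt \<alpha> = A \<Longrightarrow> id2 (id1 A) ** \<alpha> = \<alpha>" "src \<alpha> = A \<Longrightarrow> \<alpha> ** id2 (id1 A) = \<alpha>"
  using hcomp_id_left[of "dom2 K \<alpha>" "src \<alpha>" "tgt \<alpha>" \<alpha> "cod2 K \<alpha>"]
    hcomp_id_right[of "dom2 K \<alpha>" "src \<alpha>" "tgt \<alpha>" \<alpha> "cod2 K \<alpha>"] assms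
  by (auto simp: hom2_def hom1_def dom1_dom2_src)

lemma dm_hcomp [simp]:
  assumes "\<alpha> \<in> Ce K" "\<beta> \<in> Ce K" "tgt \<alpha> = src \<beta>"
  shows "dm (\<beta> ** \<alpha>) = dm \<beta> ** dm \<alpha>" "cm (\<beta> ** \<alpha>) = cm \<beta> ** cm \<alpha>"
  using assms by (simp_all add: dm_def cm_def dom1_dom2_src)

lemma idc_hcomp [simp]: "idc \<alpha> \<Longrightarrow> idc \<beta> \<Longrightarrow> tgt \<alpha> = src \<beta> \<Longrightarrow> idc (\<beta> ** \<alpha>)"
  by (simp add: idc_def)

lemma vcomp_hom2:
  assumes "\<alpha> \<in> Ce K" "\<beta> \<in> Ce K" "cm \<alpha> = dm \<beta>"
  shows "\<beta> \<cdot> \<alpha> \<in> hom2 K (dom2 K \<alpha>) (cod2 K \<beta>)"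
  by (rule vcomp_in[of _ _ "cod2 K \<alpha>"]) (use assms in \<open>auto simp: hom2_def dm_eq_iff\<close>)

lemma vcomp_typing [simp]:
  assumes "\<alpha> \<in> Ce K" "\<beta> \<in> Ce K" "cm \<alpha> = dm \<beta>"
  shows "\<beta> \<cdot> \<alpha> \<in> Ce K" "src (\<beta> \<cdot> \<alpha>) = src \<alpha>" "tgt (\<beta> \<cdot> \<alpha>) = tgt \<alpha>"
    "dm (\<beta> \<cdot> \<alpha>) = dm \<alpha>" "cm (\<beta> \<cdot> \<alpha>) = cm \<beta>"
  using vcomp_hom2[OF assms] assms by (auto simp: hom2_def src_def tgt_def dm_def cm_def)

lemma cm_dm_src_tgt: "\<alpha> \<in> Ce K \<Longrightarrow> \<beta> \<in> Ce K \<Longrightarrow> cm \<alpha> = dm \<beta> \<Longrightarrow> src \<beta> = src \<alpha> \<and> tgt \<beta> = tgt \<alpha>"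
  by (metis dm_typing)

lemma vcomp_assoc' [simp]:
  assumes "\<alpha> \<in> Ce K" "\<beta> \<in> Ce K" "\<gamma> \<in> Ce K" "cm \<alpha> = dm \<beta>" "cm \<beta> = dm \<gamma>"
  shows "(\<gamma> \<cdot> \<beta>) \<cdot> \<alpha> = \<gamma> \<cdot> (\<beta> \<cdot> \<alpha>)"
  by (rule vcomp_assoc[of _ "dom2 K \<alpha>" "cod2 K \<alpha>" _ "cod2 K \<beta>" _ "cod2 K \<gamma>"])
     (use assms in \<open>auto simp: hom2_def dm_eq_iff\<close>)

lemma vcomp_idc [simp]:
  assumes "\<alpha> \<in> Ce K" "idc \<beta>"
  shows "cm \<alpha> = \<beta> \<Longrightarrow> \<beta> \<cdot> \<alpha> = \<alpha>" "dm \<alpha> = \<beta> \<Longrightarrow> \<alpha> \<cdot> \<beta> = \<alpha>"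
  using vcomp_id_left[OF hom2I[OF assms(1)]] vcomp_id_right[OF hom2I[OF assms(1)]]
  by (auto simp: dm_def cm_def)

lemma interchange':
  assumes "\<alpha> \<in> Ce K" "\<alpha>' \<in> Ce K" "\<beta> \<in> Ce K" "\<beta>' \<in> Ce K" "cm \<alpha> = dm \<alpha>'" "cm \<beta> = dm \<beta>'"
    "tgt \<alpha> = src \<beta>"
  shows "(\<beta>' \<cdot> \<beta>) ** (\<alpha>' \<cdot> \<alpha>) = (\<beta>' ** \<alpha>') \<cdot> (\<beta> ** \<alpha>)"
  by (rule interchange[of "dom2 K \<alpha>" "src \<alpha>" "tgt \<alpha>" "dom2 K \<beta>" "tgt \<beta>" _ "cod2 K \<alpha>" _ "cod2 K \<alpha>'"
        _ "cod2 K \<beta>" _ "cod2 K \<beta>'"])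
     (use assms in \<open>auto simp: hom2_def hom1_def dm_eq_iff dom1_dom2_src\<close>)

text \<open>The case of interchange in which \<open>\<beta>\<close> is split as
  \<open>\<beta> \<cdot> \<beta>\<close>, which is possible because it is an identity. This is the
  source of the \<open>idc\<close> hypotheses in later laws.\<close>

lemma whisker_vcomp_left [simp]:
  assumes "\<alpha> \<in> Ce K" "\<alpha>' \<in> Ce K" "idc \<beta>" "cm \<alpha> = dm \<alpha>'" "tgt \<alpha> = src \<beta>"
  shows "\<beta> ** (\<alpha>' \<cdot> \<alpha>) = (\<beta> ** \<alpha>') \<cdot> (\<beta> ** \<alpha>)"
  using interchange'[of \<alpha> \<alpha>' \<beta> \<beta>] assms by (simp add: idcD)

lemma whisker_vcomp_right [simp]:
  assumes "idc \<alpha>" "\<beta> \<in> Ce K" "\<beta>' \<in> Ce K" "cm \<beta> = dm \<beta>'" "tgt \<alpha> = src \<beta>"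
  shows "(\<beta>' \<cdot> \<beta>) ** \<alpha> = (\<beta>' ** \<alpha>) \<cdot> (\<beta> ** \<alpha>)"
  using interchange'[of \<alpha> \<alpha> \<beta> \<beta>'] assms by (simp add: idcD)

text \<open>Together with \<open>hcomp_vcomp2\<close> this gives the two factorizations of a
  horizontal composite. Equating them is the interchange step in the coherence proof and in the
  proof that images of 2-cells are algebra 2-cells.\<close>

lemma hcomp_vcomp1:
  assumes "\<alpha> \<in> Ce K" "\<beta> \<in> Ce K" "tgt \<alpha> = src \<beta>"
  shows "\<beta> ** \<alpha> = (cm \<beta> ** \<alpha>) \<cdot> (\<beta> ** dm \<alpha>)"
  using interchange'[of "dm \<alpha>" \<alpha> \<beta> "cm \<beta>"] assms by simp

lemma hcomp_vcomp2:
  assumes "\<alpha> \<in> Ce K" "\<beta> \<in> Ce K" "tgt \<alpha> = src \<beta>"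
  shows "\<beta> ** \<alpha> = (\<beta> ** cm \<alpha>) \<cdot> (dm \<beta> ** \<alpha>)"
  using interchange'[of \<alpha> "cm \<alpha>" "dm \<beta>" \<beta>] assms by simp

text \<open>A relation and not an operation: inverses are only known to exist, and
  \<open>vinv_unique\<close> converts an equation between 2-cells into one between their
  inverses.\<close>

definition vinv :: "'t \<Rightarrow> 't \<Rightarrow> bool" where
  "vinv \<alpha> \<beta> \<longleftrightarrow> \<alpha> \<in> Ce K \<and> \<beta> \<in> Ce K \<and> cm \<alpha> = dm \<beta> \<and> cm \<beta> = dm \<alpha> \<and> \<beta> \<cdot> \<alpha> = dm \<alpha> \<and> \<alpha> \<cdot> \<beta> = dm \<beta>"

lemma vinv_sym: "vinv \<alpha> \<beta> \<Longrightarrow> vinv \<beta> \<alpha>"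
  by (simp add: vinv_def)

lemma vinv_idc: "idc \<alpha> \<Longrightarrow> vinv \<alpha> \<alpha>"
  by (simp add: vinv_def idcD)

lemma vinv_unique:
  assumes "vinv \<alpha> \<beta>" "vinv \<alpha> \<beta>'"
  shows "\<beta> = \<beta>'"
proof -
  have "\<beta> = (\<beta>' \<cdot> \<alpha>) \<cdot> \<beta>" using assms by (simp add: vinv_def del: vcomp_assoc')
  also have "\<dots> = \<beta>' \<cdot> (\<alpha> \<cdot> \<beta>)" using assms by (intro vcomp_assoc') (auto simp: vinv_def)
  also have "\<dots> = \<beta>'" using assms by (simp add: vinv_def)
  finally show ?thesis .
qed

text \<open>Insert \<open>\<alpha> \<cdot> \<beta>\<close> to the right of \<open>\<gamma>\<close>.
  Serves the structure 2-cell of \<open>\<omega>\<close>, for which only one of the two composites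
  with its inverse is computed directly.\<close>

lemma vinv_left_inverse:
  assumes "vinv \<alpha> \<beta>" "\<gamma> \<in> Ce K" "cm \<alpha> = dm \<gamma>" "\<gamma> \<cdot> \<alpha> = dm \<alpha>"
  shows "vinv \<alpha> \<gamma>"
proof -
  have "\<gamma> = \<gamma> \<cdot> (\<alpha> \<cdot> \<beta>)" using assms by (simp add: vinv_def)
  also have "\<dots> = (\<gamma> \<cdot> \<alpha>) \<cdot> \<beta>" using assms by (intro vcomp_assoc'[symmetric]) (auto simp: vinv_def)
  also have "\<dots> = \<beta>" using assms by (simp add: vinv_def del: vcomp_assoc')
  finally show ?thesis using assms(1) by simp
qed

lemma vinv_hcomp:
  assumes "vinv \<alpha> \<beta>" "vinv \<alpha>' \<beta>'" "tgt \<alpha> = src \<alpha>'"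
  shows "vinv (\<alpha>' ** \<alpha>) (\<beta>' ** \<beta>)"
proof -
  have [simp]: "tgt \<beta> = src \<beta>'" using assms by (auto simp: vinv_def) (metis dm_typing)
  show ?thesis
    using assms interchange'[of \<alpha> \<beta> \<alpha>' \<beta>'] interchange'[of \<beta> \<alpha> \<beta>' \<alpha>']
    by (auto simp: vinv_def)
qed

lemma vinv_vcomp:
  assumes "vinv \<alpha> \<beta>" "vinv \<alpha>' \<beta>'" "cm \<alpha> = dm \<alpha>'"
  shows "vinv (\<alpha>' \<cdot> \<alpha>) (\<beta> \<cdot> \<beta>')"
proof -
  have ce: "\<alpha> \<in> Ce K" "\<beta> \<in> Ce K" "\<alpha>' \<in> Ce K" "\<beta>' \<in> Ce K"
    and e: "cm \<alpha> = dm \<beta>" "cm \<beta> = dm \<alpha>" "cm \<alpha>' = dm \<beta>'" "cm \<beta>' = dm \<alpha>'"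
    and i: "\<beta> \<cdot> \<alpha> = dm \<alpha>" "\<alpha> \<cdot> \<beta> = dm \<beta>" "\<beta>' \<cdot> \<alpha>' = dm \<alpha>'" "\<alpha>' \<cdot> \<beta>' = dm \<beta>'"
    using assms by (auto simp: vinv_def)
  have [simp]: "dm \<alpha>' = dm \<beta>" using e assms(3) by simp
  have "\<beta> \<cdot> \<beta>' \<cdot> \<alpha>' \<cdot> \<alpha> = \<beta> \<cdot> (\<beta>' \<cdot> \<alpha>') \<cdot> \<alpha>" using ce e assms(3) by simp
  also have "\<dots> = dm \<alpha>" using ce e i assms(3) by simp
  finally have 1: "\<beta> \<cdot> \<beta>' \<cdot> \<alpha>' \<cdot> \<alpha> = dm \<alpha>" .
  have "\<alpha>' \<cdot> \<alpha> \<cdot> \<beta> \<cdot> \<beta>' = \<alpha>' \<cdot> (\<alpha> \<cdot> \<beta>) \<cdot> \<beta>'" using ce e assms(3) by simp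
  also have "\<dots> = dm \<beta>'" using ce e i assms(3) by simp
  finally show ?thesis using 1 ce e assms(3) by (simp add: vinv_def)
qed

lemma vinv_dm: "vinv \<alpha> \<beta> \<Longrightarrow> \<beta> \<in> Ce K" "vinv \<alpha> \<beta> \<Longrightarrow> dm \<beta> = cm \<alpha>" "vinv \<alpha> \<beta> \<Longrightarrow> cm \<beta> = dm \<alpha>"
   "vinv \<alpha> \<beta> \<Longrightarrow> src \<beta> = src \<alpha>" "vinv \<alpha> \<beta> \<Longrightarrow> tgt \<beta> = tgt \<alpha>"
  by (auto simp: vinv_def) (metis dm_typing)+

lemma invertible2_iff_vinv: "invertible2 \<alpha> \<longleftrightarrow> (\<exists>\<beta>. vinv \<alpha> \<beta>)"
proof
  assume "invertible2 \<alpha>"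
  then show "\<exists>\<beta>. vinv \<alpha> \<beta>"
    unfolding invertible2_def vinv_def by (auto simp: hom2_def dm_def cm_def)
next
  assume "\<exists>\<beta>. vinv \<alpha> \<beta>"
  then show "invertible2 \<alpha>"
    unfolding invertible2_def vinv_def
    by (metis dm_def cm_def dm_eq_iff(2) hom2I)
qed

end

section \<open>Products of 2-cells under horizontal composition\<close>

context fp_two_category
begin

abbreviation "p1 A B \<equiv> id2 (pr1 A B)"
abbreviation "p2 A B \<equiv> id2 (pr2 A B)"
abbreviation "tup \<equiv> ntuple2"

lemma ob_typing [simp]: "\<one> \<in> Ob K" "A \<in> Ob K \<Longrightarrow> B \<in> Ob K \<Longrightarrow> A \<otimes> B \<in> Ob K"
  by (simp_all add: one_in prod_in)

lemma pr_typing [simp]: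
  assumes "A \<in> Ob K" "B \<in> Ob K"
  shows "pr1 A B \<in> Ar K" "dom1 K (pr1 A B) = A \<otimes> B" "cod1 K (pr1 A B) = A"
    "pr2 A B \<in> Ar K" "dom1 K (pr2 A B) = A \<otimes> B" "cod1 K (pr2 A B) = B"
  using pr1_in[OF assms] pr2_in[OF assms] by (auto simp: hom1_def)

lemma bang_typing [simp]:
  assumes "A \<in> Ob K"
  shows "bang A \<in> Ar K" "dom1 K (bang A) = A" "cod1 K (bang A) = \<one>"
  using bang_in[OF assms] by (auto simp: hom1_def)

lemma pair1_typing [simp]:
  assumes "f \<in> Ar K" "g \<in> Ar K" "dom1 K f = dom1 K g"
  shows "pair1 f g \<in> Ar K" "dom1 K (pair1 f g) = dom1 K f" "cod1 K (pair1 f g) = cod1 K f \<otimes> cod1 K g"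
  using pair1_in[of f "dom1 K f" "cod1 K f" g "cod1 K g"] assms by (auto simp: hom1_def)

lemma pair2_hom2:
  assumes "\<alpha> \<in> Ce K" "\<beta> \<in> Ce K" "src \<alpha> = src \<beta>"
  shows "pair2 \<alpha> \<beta> \<in> hom2 K (pair1 (dom2 K \<alpha>) (dom2 K \<beta>)) (pair1 (cod2 K \<alpha>) (cod2 K \<beta>))"
  by (rule pair2_in[of _ "src \<alpha>" "tgt \<alpha>" _ "tgt \<beta>"])
     (use assms in \<open>auto simp: hom2_def hom1_def dom1_dom2_src\<close>)

lemma pair2_typing [simp]:
  assumes "\<alpha> \<in> Ce K" "\<beta> \<in> Ce K" "src \<alpha> = src \<beta>"
  shows "pair2 \<alpha> \<beta> \<in> Ce K" "src (pair2 \<alpha> \<beta>) = src \<alpha>" "tgt (pair2 \<alpha> \<beta>) = tgt \<alpha> \<otimes> tgt \<beta>"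
    "dom2 K (pair2 \<alpha> \<beta>) = pair1 (dom2 K \<alpha>) (dom2 K \<beta>)"
    "cod2 K (pair2 \<alpha> \<beta>) = pair1 (cod2 K \<alpha>) (cod2 K \<beta>)"
  using pair2_hom2[OF assms] assms by (auto simp: hom2_def src_def tgt_def)

lemma pr_pair2 [simp]:
  assumes "\<alpha> \<in> Ce K" "\<beta> \<in> Ce K" "src \<alpha> = src \<beta>" "tgt \<alpha> = A" "tgt \<beta> = B"
  shows "p1 A B ** pair2 \<alpha> \<beta> = \<alpha>" "p2 A B ** pair2 \<alpha> \<beta> = \<beta>"
  by (rule pr1_pair2[of _ "src \<alpha>" _ _ _ _ "cod2 K \<alpha>" _ "cod2 K \<beta>"]
        pr2_pair2[of _ "src \<alpha>" _ _ _ _ "cod2 K \<alpha>" _ "cod2 K \<beta>"];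
     use assms in \<open>auto simp: hom2_def hom1_def dom1_dom2_src\<close>)+

lemma pair2_eta [simp]:
  assumes "\<theta> \<in> Ce K" "tgt \<theta> = A \<otimes> B" "A \<in> Ob K" "B \<in> Ob K"
  shows "pair2 (p1 A B ** \<theta>) (p2 A B ** \<theta>) = \<theta>"
  by (rule pair2_unique[of _ _ "dom2 K \<theta>" "src \<theta>" _ "cod2 K \<theta>"])
    (use assms in \<open>auto simp: hom2_def hom1_def dom1_dom2_src\<close>)

lemma pair2_pr [simp]:
  assumes "A \<in> Ob K" "B \<in> Ob K"
  shows "pair2 (p1 A B) (p2 A B) = id2 (id1 (A \<otimes> B))"
  using pair2_eta[of "id2 (id1 (A \<otimes> B))" A B] assms by simp

lemma prod_ext:
  assumes "\<theta> \<in> Ce K" "\<theta>' \<in> Ce K" "tgt \<theta> = A \<otimes> B" "tgt \<theta>' = A \<otimes> B" "A \<in> Ob K" "B \<in> Ob K"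
    "p1 A B ** \<theta> = p1 A B ** \<theta>'" "p2 A B ** \<theta> = p2 A B ** \<theta>'"
  shows "\<theta> = \<theta>'"
  using pair2_eta assms by metis

text \<open>The projection laws for 1-cells, transported by \<open>id2\<close>, together with
  uniqueness of \<open>pair2\<close>.\<close>

lemma id2_pair1 [simp]:
  assumes "f \<in> Ar K" "g \<in> Ar K" "dom1 K f = dom1 K g"
  shows "id2 (pair1 f g) = pair2 (id2 f) (id2 g)"
proof -
  have h: "f \<in> hom1 K (dom1 K f) (cod1 K f)" "g \<in> hom1 K (dom1 K f) (cod1 K g)"
    using assms by (auto simp: hom1_def)
  have e: "pr1 (cod1 K f) (cod1 K g) \<odot> pair1 f g = f" "pr2 (cod1 K f) (cod1 K g) \<odot> pair1 f g = g"
    using pr1_pair1[OF h] pr2_pair1[OF h] by auto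
  have "p1 (cod1 K f) (cod1 K g) ** id2 (pair1 f g) = id2 f"
    "p2 (cod1 K f) (cod1 K g) ** id2 (pair1 f g) = id2 g"
    using assms arg_cong[OF e(1), of id2] arg_cong[OF e(2), of id2] by simp_all
  then show ?thesis using pair2_eta[of "id2 (pair1 f g)" "cod1 K f" "cod1 K g"] assms by simp
qed

lemma pair2_hcomp [simp]:
  assumes "\<alpha> \<in> Ce K" "\<beta> \<in> Ce K" "src \<alpha> = src \<beta>" "\<gamma> \<in> Ce K" "tgt \<gamma> = src \<beta>"
  shows "pair2 \<alpha> \<beta> ** \<gamma> = pair2 (\<alpha> ** \<gamma>) (\<beta> ** \<gamma>)"
  by (rule prod_ext[of _ _ "tgt \<alpha>" "tgt \<beta>"]) (use assms in \<open>simp_all flip: hcomp_assoc'\<close>)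

lemma dm_pair2 [simp]:
  assumes "\<alpha> \<in> Ce K" "\<beta> \<in> Ce K" "src \<alpha> = src \<beta>"
  shows "dm (pair2 \<alpha> \<beta>) = pair2 (dm \<alpha>) (dm \<beta>)" "cm (pair2 \<alpha> \<beta>) = pair2 (cm \<alpha>) (cm \<beta>)"
  using assms by (simp_all add: dm_def cm_def dom1_dom2_src)

lemma idc_pair2 [simp]: "idc \<alpha> \<Longrightarrow> idc \<beta> \<Longrightarrow> src \<alpha> = src \<beta> \<Longrightarrow> idc (pair2 \<alpha> \<beta>)"
  by (simp add: idc_def)

lemma pair2_vcomp:
  assumes "\<alpha> \<in> Ce K" "\<alpha>' \<in> Ce K" "\<beta> \<in> Ce K" "\<beta>' \<in> Ce K" "cm \<alpha> = dm \<alpha>'" "cm \<beta> = dm \<beta>'"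
    "src \<alpha> = src \<beta>"
  shows "pair2 (\<alpha>' \<cdot> \<alpha>) (\<beta>' \<cdot> \<beta>) = pair2 \<alpha>' \<beta>' \<cdot> pair2 \<alpha> \<beta>"
proof -
  have [simp]: "src \<alpha>' = src \<beta>" "src \<beta>' = src \<beta>" "tgt \<alpha>' = tgt \<alpha>" "tgt \<beta>' = tgt \<beta>"
    using assms cm_dm_src_tgt by auto
  show ?thesis
    by (rule prod_ext[of _ _ "tgt \<alpha>" "tgt \<beta>"]) (use assms in simp_all)
qed

lemma pair2_vcomp_left [simp]:
  assumes "\<alpha> \<in> Ce K" "\<alpha>' \<in> Ce K" "idc \<beta>" "cm \<alpha> = dm \<alpha>'" "src \<alpha> = src \<beta>"
  shows "pair2 (\<alpha>' \<cdot> \<alpha>) \<beta> = pair2 \<alpha>' \<beta> \<cdot> pair2 \<alpha> \<beta>"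
  using pair2_vcomp[of \<alpha> \<alpha>' \<beta> \<beta>] assms by (simp add: idcD)

lemma pair2_vcomp_right [simp]:
  assumes "\<alpha> \<in> Ce K" "\<alpha>' \<in> Ce K" "idc \<beta>" "cm \<alpha> = dm \<alpha>'" "src \<alpha> = src \<beta>"
  shows "pair2 \<beta> (\<alpha>' \<cdot> \<alpha>) = pair2 \<beta> \<alpha>' \<cdot> pair2 \<beta> \<alpha>"
  using pair2_vcomp[of \<beta> \<beta> \<alpha> \<alpha>'] assms by (simp add: idcD)

lemma vinv_pair2:
  assumes "vinv \<alpha> \<beta>" "vinv \<alpha>' \<beta>'" "src \<alpha> = src \<alpha>'"
  shows "vinv (pair2 \<alpha> \<alpha>') (pair2 \<beta> \<beta>')"
proof -
  have [simp]: "src \<beta> = src \<beta>'" using assms by (auto simp: vinv_def) (metis dm_typing)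
  show ?thesis
    using assms pair2_vcomp[of \<alpha> \<beta> \<alpha>' \<beta>'] pair2_vcomp[of \<beta> \<alpha> \<beta>' \<alpha>'] by (auto simp: vinv_def)
qed

text \<open>Source and target 1-cell are both \<open>bang\<close>, so the 2-dimensional part of
  terminality applies.\<close>

lemma terminal_unique:
  assumes "\<alpha> \<in> Ce K" "tgt \<alpha> = \<one>"
  shows "\<alpha> = id2 (bang (src \<alpha>))"
proof -
  have "dom2 K \<alpha> = bang (src \<alpha>)" "cod2 K \<alpha> = bang (src \<alpha>)"
    by (rule bang_unique; use assms in \<open>simp add: hom1_def dom1_dom2_src\<close>)+
  then show ?thesis
    using bang_unique2[of \<alpha> "src \<alpha>"] assms by (simp add: hom2_def)
qed

lemma bang_hcomp [simp]: "\<gamma> \<in> Ce K \<Longrightarrow> tgt \<gamma> = A \<Longrightarrow> id2 (bang A) ** \<gamma> = id2 (bang (src \<gamma>))"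
  using terminal_unique[of "id2 (bang A) ** \<gamma>"] by auto

lemma prod1_typing [simp]:
  assumes "f \<in> Ar K" "g \<in> Ar K"
  shows "f \<otimes>\<^sub>1 g \<in> Ar K" "dom1 K (f \<otimes>\<^sub>1 g) = dom1 K f \<otimes> dom1 K g"
    "cod1 K (f \<otimes>\<^sub>1 g) = cod1 K f \<otimes> cod1 K g"
    "id2 (f \<otimes>\<^sub>1 g) = pair2 (id2 f ** p1 (dom1 K f) (dom1 K g)) (id2 g ** p2 (dom1 K f) (dom1 K g))"
  using assms by (simp_all add: prod1_def)

lemma prod2_eq:
  assumes "\<alpha> \<in> Ce K" "\<beta> \<in> Ce K"
  shows "\<alpha> \<otimes>\<^sub>2 \<beta> = pair2 (\<alpha> ** p1 (src \<alpha>) (src \<beta>)) (\<beta> ** p2 (src \<alpha>) (src \<beta>))"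
  using assms by (simp add: prod2_def Let_def src_def)

lemma sym_typing [simp]:
  assumes "A \<in> Ob K" "B \<in> Ob K"
  shows "sym A B \<in> Ar K" "dom1 K (sym A B) = A \<otimes> B" "cod1 K (sym A B) = B \<otimes> A"
    "id2 (sym A B) = pair2 (p2 A B) (p1 A B)"
  using assms by (simp_all add: sym_def)

lemma assoc_typing [simp]:
  assumes "A \<in> Ob K" "B \<in> Ob K" "C \<in> Ob K"
  shows "assoc A B C \<in> Ar K" "dom1 K (assoc A B C) = A \<otimes> B \<otimes> C"
    "cod1 K (assoc A B C) = A \<otimes> (B \<otimes> C)"
    "id2 (assoc A B C) = pair2 (p1 A B ** p1 (A \<otimes> B) C)
       (pair2 (p2 A B ** p1 (A \<otimes> B) C) (p2 (A \<otimes> B) C))"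
  using assms by (simp_all add: assoc_def)

lemma assoc_inv_typing [simp]:
  assumes "A \<in> Ob K" "B \<in> Ob K" "C \<in> Ob K"
  shows "assoc_inv A B C \<in> Ar K" "cod1 K (assoc_inv A B C) = A \<otimes> B \<otimes> C"
    "dom1 K (assoc_inv A B C) = A \<otimes> (B \<otimes> C)"
    "id2 (assoc_inv A B C) = pair2 (pair2 (p1 A (B \<otimes> C)) (p1 B C ** p2 A (B \<otimes> C)))
       (p2 B C ** p2 A (B \<otimes> C))"
  using assms by (simp_all add: assoc_inv_def)

subsection \<open>Tuples of generalized elements\<close>

text \<open>A list of generalized elements at stage \<open>Z\<close> of the objects in the list \<open>X\<close>.\<close>

definition els :: "'o \<Rightarrow> 'o list \<Rightarrow> 't list \<Rightarrow> bool" where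
  "els Z X xs \<longleftrightarrow> Z \<in> Ob K \<and> (\<forall>x \<in> set xs. x \<in> Ce K \<and> src x = Z) \<and> map tgt xs = X"

lemma nprod_snoc [simp]: "X \<noteq> [] \<Longrightarrow> nprod (X @ [A]) = nprod X \<otimes> A"
  by (cases X) auto

lemma ntuple1_snoc [simp]: "fs \<noteq> [] \<Longrightarrow> ntuple1 Z (fs @ [f]) = pair1 (ntuple1 Z fs) f"
  by (cases fs) auto

lemma ntuple2_snoc [simp]: "xs \<noteq> [] \<Longrightarrow> tup Z (xs @ [x]) = pair2 (tup Z xs) x"
  by (cases xs) auto

lemma nprod_Ob [simp]: "set X \<subseteq> Ob K \<Longrightarrow> nprod X \<in> Ob K"
proof (induction X rule: rev_induct)
  case (snoc x xs) then show ?case by (cases "xs = []") auto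
qed simp

lemma nth_Ob [simp]: "set X \<subseteq> Ob K \<Longrightarrow> i < length X \<Longrightarrow> X ! i \<in> Ob K"
  by auto

lemma els_Nil [simp]: "els Z X [] \<longleftrightarrow> Z \<in> Ob K \<and> X = []" "els Z [] xs \<longleftrightarrow> Z \<in> Ob K \<and> xs = []"
  by (auto simp: els_def)

lemma els_snoc [simp]:
  "els Z (X @ [A]) (xs @ [x]) \<longleftrightarrow> els Z X xs \<and> x \<in> Ce K \<and> src x = Z \<and> tgt x = A"
  by (auto simp: els_def)

lemma els_Cons [simp]:
  "els Z (A # X) (x # xs) \<longleftrightarrow> els Z X xs \<and> x \<in> Ce K \<and> src x = Z \<and> tgt x = A"
  by (auto simp: els_def)

lemma els_snocE:
  assumes "els Z (X @ [A]) ys"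
  obtains xs x where "ys = xs @ [x]" "els Z X xs" "x \<in> Ce K" "src x = Z" "tgt x = A"
proof -
  have "ys \<noteq> []" using assms by (auto simp: els_def)
  then obtain xs x where ys: "ys = xs @ [x]" by (metis rev_exhaust)
  then show ?thesis using that assms by (auto simp del: els_def)
qed

lemma els_append: "length X = length xs \<Longrightarrow> els Z (X @ Y) (xs @ ys) \<longleftrightarrow> els Z X xs \<and> els Z Y ys"
  by (auto simp: els_def append_eq_append_conv)

lemma elsD:
  assumes "els Z X xs"
  shows "length xs = length X" "Z \<in> Ob K" "set X \<subseteq> Ob K"
    "i < length X \<Longrightarrow> xs ! i \<in> Ce K" "i < length X \<Longrightarrow> src (xs ! i) = Z" "i < length X \<Longrightarrow> tgt (xs ! i) = X ! i"
proof -
  show l: "length xs = length X" using assms by (auto simp: els_def)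
  show "Z \<in> Ob K" "set X \<subseteq> Ob K" using assms by (auto simp: els_def)
  assume "i < length X"
  then have "xs ! i \<in> set xs" "map tgt xs ! i = X ! i" "i < length xs"
    using l assms by (auto simp: els_def)
  then show "xs ! i \<in> Ce K" "src (xs ! i) = Z" "tgt (xs ! i) = X ! i"
    using assms unfolding els_def by auto
qed

lemma elsI:
  assumes "Z \<in> Ob K" "length xs = length X"
    "\<And>i. i < length X \<Longrightarrow> xs ! i \<in> Ce K \<and> src (xs ! i) = Z \<and> tgt (xs ! i) = X ! i"
  shows "els Z X xs"
  using assms by (auto simp: els_def in_set_conv_nth intro!: nth_equalityI)

lemma els_update:
  assumes "els Z X xs" "x \<in> Ce K" "src x = Z" "tgt x = A"
  shows "els Z (X[i := A]) (xs[i := x])"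
proof (rule elsI)
  fix j assume "j < length (X[i := A])"
  then show "xs[i := x] ! j \<in> Ce K \<and> src (xs[i := x] ! j) = Z \<and> tgt (xs[i := x] ! j) = X[i := A] ! j"
    using assms(2-4) elsD[OF assms(1)] by (cases "i = j") simp_all
qed (use elsD[OF assms(1)] in simp_all)

lemma els_update_same:
  assumes "els Z X' xs" "X' = X[i := A']" "x \<in> Ce K" "src x = Z" "tgt x = A"
  shows "els Z (X[i := A]) (xs[i := x])"
  using els_update[OF assms(1,3-5), of i] assms(2) by simp

lemma ntuple2_typing:
  assumes "els Z X xs"
  shows "tup Z xs \<in> Ce K \<and> src (tup Z xs) = Z \<and> tgt (tup Z xs) = nprod X"
  using assms
proof (induction X arbitrary: xs rule: rev_induct)
  case Nil then show ?case by simp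
next
  case (snoc A X)
  from snoc(2) obtain ys y where ys: "xs = ys @ [y]" "els Z X ys" "y \<in> Ce K" "src y = Z" "tgt y = A"
    by (rule els_snocE)
  then show ?case using snoc.IH[OF ys(2)] elsD(1)[OF ys(2)] by (cases "ys = []"; cases "X = []") auto
qed

lemma ntuple2_typing' [simp]:
  "els Z X xs \<Longrightarrow> tup Z xs \<in> Ce K" "els Z X xs \<Longrightarrow> src (tup Z xs) = Z"
  "els Z X xs \<Longrightarrow> tgt (tup Z xs) = nprod X"
  using ntuple2_typing by auto

lemma els_map_hcomp:
  "els Z X xs \<Longrightarrow> \<gamma> \<in> Ce K \<Longrightarrow> tgt \<gamma> = Z \<Longrightarrow> els (src \<gamma>) X (map (\<lambda>x. x ** \<gamma>) xs)"
  by (auto simp: els_def)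

lemma ntuple2_hcomp:
  "els Z X xs \<Longrightarrow> \<gamma> \<in> Ce K \<Longrightarrow> tgt \<gamma> = Z \<Longrightarrow> tup Z xs ** \<gamma> = tup (src \<gamma>) (map (\<lambda>x. x ** \<gamma>) xs)"
proof (induction X arbitrary: xs rule: rev_induct)
  case Nil then show ?case by simp
next
  case (snoc A X)
  from snoc(2) obtain ys y where ys: "xs = ys @ [y]" "els Z X ys" "y \<in> Ce K" "src y = Z" "tgt y = A"
    by (rule els_snocE)
  then show ?case using snoc.IH[of ys] snoc.prems elsD(1)[OF ys(2)] by (cases "ys = []") auto
qed

lemma dm_ntuple2:
  "els Z X xs \<Longrightarrow> dm (tup Z xs) = tup Z (map dm xs) \<and> cm (tup Z xs) = tup Z (map cm xs)"
proof (induction X arbitrary: xs rule: rev_induct)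
  case Nil then show ?case by simp
next
  case (snoc A X)
  from snoc(2) obtain ys y where ys: "xs = ys @ [y]" "els Z X ys" "y \<in> Ce K" "src y = Z" "tgt y = A"
    by (rule els_snocE)
  then show ?case using snoc.IH[of ys] snoc.prems elsD(1)[OF ys(2)] by (cases "ys = []") auto
qed

lemma idc_ntuple2 [simp]:
  assumes "els Z X xs" "\<forall>x \<in> set xs. idc x"
  shows "idc (tup Z xs)"
proof -
  have "map dm xs = xs" using assms by (auto intro!: map_idI)
  then show ?thesis using assms dm_ntuple2[OF assms(1)] by (simp add: idc_def)
qed

text \<open>The recursion of \<open>nproj\<close> in the form that inductions appending one factor
  at the end can use.\<close>

lemma nproj_Suc:
  "X \<noteq> [] \<Longrightarrow> nproj (X @ [A]) i = (if i = length X then pr2 (nprod X) A else nproj X i \<odot> pr1 (nprod X) A)"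
  by (subst nproj.simps) (cases X, auto)

lemma nproj_single [simp]: "nproj [A] 0 = id1 A"
  by (subst nproj.simps) simp

lemma nproj_typing [simp]:
  "set X \<subseteq> Ob K \<Longrightarrow> i < length X \<Longrightarrow> nproj X i \<in> Ar K \<and> dom1 K (nproj X i) = nprod X \<and> cod1 K (nproj X i) = X ! i"
proof (induction X arbitrary: i rule: rev_induct)
  case (snoc A X)
  then show ?case
  proof (cases "X = []")
    case False
    then show ?thesis using snoc by (auto simp: nproj_Suc nth_append)
  qed auto
qed simp

lemma nproj_ntuple2 [simp]:
  "els Z X xs \<Longrightarrow> i < length X \<Longrightarrow> id2 (nproj X i) ** tup Z xs = xs ! i"
proof (induction X arbitrary: i xs rule: rev_induct)
  case (snoc A X)
  from snoc(2) obtain ys y where ys: "xs = ys @ [y]" "els Z X ys" "y \<in> Ce K" "src y = Z" "tgt y = A"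
    by (rule els_snocE)
  note l = elsD[OF ys(2)]
  show ?case
  proof (cases "X = []")
    case True then show ?thesis using snoc.prems ys by simp
  next
    case False
    then have "ys \<noteq> []" using l by auto
    then show ?thesis
      using snoc.IH[OF ys(2), of i] snoc.prems ys l False by (auto simp: nproj_Suc nth_append)
  qed
qed simp

text \<open>The generic element of the product: every other tuple arises from it by
  precomposition.\<close>

definition projs :: "'o list \<Rightarrow> 't list" where
  "projs X = map (\<lambda>i. id2 (nproj X i)) [0..<length X]"

lemma els_projs [simp]: "set X \<subseteq> Ob K \<Longrightarrow> els (nprod X) X (projs X)"
  by (rule elsI) (auto simp: projs_def)

lemma idc_projs [simp]: "set X \<subseteq> Ob K \<Longrightarrow> x \<in> set (projs X) \<Longrightarrow> idc x"
  by (auto simp: projs_def)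

text \<open>Makes evaluation on elements faithful: a 2-cell is its own value at the generic tuple.
  Since the entries are identities, even an equation known only for tuples of identities may be
  evaluated here.\<close>

lemma ntuple2_projs [simp]: "set X \<subseteq> Ob K \<Longrightarrow> tup (nprod X) (projs X) = id2 (id1 (nprod X))"
proof (induction X rule: rev_induct)
  case Nil then show ?case using terminal_unique[of "id2 (id1 \<one>)"] by (simp add: projs_def)
next
  case (snoc A X)
  show ?case
  proof (cases "X = []")
    case True then show ?thesis using snoc by (simp add: projs_def)
  next
    case False
    have e: "projs (X @ [A]) = map (\<lambda>x. x ** p1 (nprod X) A) (projs X) @ [p2 (nprod X) A]"
      using False snoc.prems by (auto simp: projs_def nproj_Suc)
    have ne: "projs X \<noteq> []" using False by (simp add: projs_def)
    have A: "A \<in> Ob K" and X: "set X \<subseteq> Ob K" using snoc.prems by auto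
    have "tup (nprod X \<otimes> A) (map (\<lambda>x. x ** p1 (nprod X) A) (projs X))
       = tup (nprod X) (projs X) ** p1 (nprod X) A"
      using ntuple2_hcomp[of "nprod X" X "projs X" "p1 (nprod X) A"] X A by simp
    then show ?thesis using snoc.IH e ne False X A by simp
  qed
qed

lemma ntuple2_eta:
  assumes "set X \<subseteq> Ob K" "\<alpha> \<in> Ce K" "tgt \<alpha> = nprod X"
  shows "\<alpha> = tup (src \<alpha>) (map (\<lambda>i. id2 (nproj X i) ** \<alpha>) [0..<length X])"
proof -
  have "\<alpha> = tup (nprod X) (projs X) ** \<alpha>" using assms by simp
  also have "\<dots> = tup (src \<alpha>) (map (\<lambda>i. id2 (nproj X i) ** \<alpha>) [0..<length X])"
    unfolding ntuple2_hcomp[OF els_projs[OF assms(1)] assms(2,3)] by (simp add: projs_def o_def)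
  finally show ?thesis .
qed

text \<open>Typing and image under \<open>id2\<close> are proved in one induction because the step
  for each uses the others. The object \<open>Z\<close> fixes the domain of the empty tuple.\<close>

lemma id2_ntuple1:
  assumes "Z \<in> Ob K" "\<forall>f \<in> set fs. f \<in> Ar K \<and> dom1 K f = Z"
  shows "ntuple1 Z fs \<in> Ar K \<and> dom1 K (ntuple1 Z fs) = Z \<and> cod1 K (ntuple1 Z fs) = nprod (map (cod1 K) fs)
    \<and> id2 (ntuple1 Z fs) = tup Z (map id2 fs)"
  using assms(2)
proof (induction fs rule: rev_induct)
  case Nil then show ?case using assms(1) by simp
next
  case (snoc f fs) then show ?case by (cases "fs = []") auto
qed

lemma id2_nmap1:
  assumes "\<forall>f \<in> set fs. f \<in> Ar K"
  shows "nmap1 fs \<in> Ar K" "dom1 K (nmap1 fs) = nprod (map (dom1 K) fs)"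
    "cod1 K (nmap1 fs) = nprod (map (cod1 K) fs)" "id2 (nmap1 fs) = nmap2 (map id2 fs)"
proof -
  let ?X = "map (dom1 K) fs"
  let ?gs = "map (\<lambda>i. (fs ! i) \<odot> nproj ?X i) [0..<length fs]"
  have X: "set ?X \<subseteq> Ob K" using assms by auto
  have g: "\<forall>g \<in> set ?gs. g \<in> Ar K \<and> dom1 K g = nprod ?X" using assms X by auto
  have c: "map (cod1 K) ?gs = map (cod1 K) fs" using assms X by (auto intro!: nth_equalityI)
  note i = id2_ntuple1[OF nprod_Ob[OF X] g]
  show "nmap1 fs \<in> Ar K" "dom1 K (nmap1 fs) = nprod (map (dom1 K) fs)"
    "cod1 K (nmap1 fs) = nprod (map (cod1 K) fs)"
    using i c unfolding nmap1_def Let_def by auto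
  have "map (\<lambda>\<alpha>. dom1 K (dom2 K \<alpha>)) (map id2 fs) = ?X" using assms by auto
  moreover have "map id2 ?gs = map (\<lambda>i. ((map id2 fs) ! i) \<rhd> nproj ?X i) [0..<length (map id2 fs)]"
    using assms X by auto
  ultimately show "id2 (nmap1 fs) = nmap2 (map id2 fs)"
    using i unfolding nmap1_def nmap2_def Let_def by metis
qed

lemma els_nmap2:
  assumes "\<forall>\<alpha> \<in> set \<alpha>s. \<alpha> \<in> Ce K"
  shows "els (nprod (map src \<alpha>s)) (map tgt \<alpha>s) (map (\<lambda>i. (\<alpha>s ! i) \<rhd> nproj (map src \<alpha>s) i) [0..<length \<alpha>s])"
proof -
  have "set (map src \<alpha>s) \<subseteq> Ob K" using assms by auto
  then show ?thesis using assms by (intro elsI) auto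
qed

lemma nmap2_eq: "nmap2 \<alpha>s = tup (nprod (map src \<alpha>s)) (map (\<lambda>i. (\<alpha>s ! i) \<rhd> nproj (map src \<alpha>s) i) [0..<length \<alpha>s])"
  unfolding nmap2_def src_def[abs_def] Let_def ..

lemma nmap2_typing:
  assumes "\<forall>\<alpha> \<in> set \<alpha>s. \<alpha> \<in> Ce K"
  shows "nmap2 \<alpha>s \<in> Ce K" "src (nmap2 \<alpha>s) = nprod (map src \<alpha>s)" "tgt (nmap2 \<alpha>s) = nprod (map tgt \<alpha>s)"
  using ntuple2_typing[OF els_nmap2[OF assms]] by (simp_all add: nmap2_eq)

lemma nmap2_ntuple2:
  assumes "\<forall>\<alpha> \<in> set \<alpha>s. \<alpha> \<in> Ce K" "els Z (map src \<alpha>s) xs"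
  shows "nmap2 \<alpha>s ** tup Z xs = tup Z (map2 (\<star>) \<alpha>s xs)"
proof -
  have X: "set (map src \<alpha>s) \<subseteq> Ob K" using assms by auto
  have "nmap2 \<alpha>s ** tup Z xs
     = tup Z (map (\<lambda>x. x ** tup Z xs) (map (\<lambda>i. (\<alpha>s ! i) \<rhd> nproj (map src \<alpha>s) i) [0..<length \<alpha>s]))"
    using ntuple2_hcomp[OF els_nmap2[OF assms(1)], of "tup Z xs"] assms(2)
    by (simp add: nmap2_eq)
  also have "map (\<lambda>x. x ** tup Z xs) (map (\<lambda>i. (\<alpha>s ! i) \<rhd> nproj (map src \<alpha>s) i) [0..<length \<alpha>s])
    = map2 (\<star>) \<alpha>s xs"
    using assms elsD[OF assms(2)] X nproj_ntuple2[OF assms(2)] by (auto intro!: nth_equalityI)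
  finally show ?thesis .
qed

lemma els_map2:
  assumes "\<forall>\<alpha> \<in> set \<alpha>s. \<alpha> \<in> Ce K" "els Z (map src \<alpha>s) xs"
  shows "els Z (map tgt \<alpha>s) (map2 (\<star>) \<alpha>s xs)"
  using assms elsD[OF assms(2)] by (intro elsI) auto

text \<open>Stated with \<open>dom2\<close> and \<open>cod2\<close> because the source and target of
  a composite in the multicategory have to be recognized as composites of 1-cells.\<close>

lemma dm_nmap2:
  assumes "\<forall>\<alpha> \<in> set \<alpha>s. \<alpha> \<in> Ce K"
  shows "dom2 K (nmap2 \<alpha>s) = nmap1 (map (dom2 K) \<alpha>s)" "cod2 K (nmap2 \<alpha>s) = nmap1 (map (cod2 K) \<alpha>s)"
proof -
  have X: "set (map src \<alpha>s) \<subseteq> Ob K" using assms by auto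
  have e: "map src (map id2 (map (dom2 K) \<alpha>s)) = map src \<alpha>s" "map src (map id2 (map (cod2 K) \<alpha>s)) = map src \<alpha>s"
    using assms by (auto simp: dom1_dom2_src)
  have "dm (nmap2 \<alpha>s) = nmap2 (map id2 (map (dom2 K) \<alpha>s))" "cm (nmap2 \<alpha>s) = nmap2 (map id2 (map (cod2 K) \<alpha>s))"
    unfolding nmap2_eq dm_ntuple2[OF els_nmap2[OF assms], THEN conjunct1]
      dm_ntuple2[OF els_nmap2[OF assms], THEN conjunct2] e
    using assms X by (auto intro!: arg_cong[where f="tup _"] simp: dm_def cm_def dom1_dom2_src)
  moreover have f: "\<forall>f \<in> set (map (dom2 K) \<alpha>s). f \<in> Ar K" "\<forall>f \<in> set (map (cod2 K) \<alpha>s). f \<in> Ar K" using assms by auto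
  ultimately have "id2 (dom2 K (nmap2 \<alpha>s)) = id2 (nmap1 (map (dom2 K) \<alpha>s))"
     "id2 (cod2 K (nmap2 \<alpha>s)) = id2 (nmap1 (map (cod2 K) \<alpha>s))"
    by (simp_all add: id2_nmap1 dm_def cm_def)
  then show "dom2 K (nmap2 \<alpha>s) = nmap1 (map (dom2 K) \<alpha>s)" "cod2 K (nmap2 \<alpha>s) = nmap1 (map (cod2 K) \<alpha>s)"
    using f id2_nmap1(1) nmap2_typing(1)[OF assms] by (simp_all add: id2_inject)
qed

lemma slot_typing:
  assumes "set X \<subseteq> Ob K" "f \<in> Ar K" "i < length X"
  shows "slot X i f \<in> Ar K" "dom1 K (slot X i f) = nprod (X[i := dom1 K f])"
    "cod1 K (slot X i f) = nprod (X[i := cod1 K f])"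
proof -
  have f: "\<forall>g \<in> set ((map id1 X)[i := f]). g \<in> Ar K" using assms by (auto dest!: set_update_subset_insert[THEN subsetD] simp: subset_iff)
  have "map (dom1 K) (map id1 X) = X" "map (cod1 K) (map id1 X) = X" using assms(1) by (auto intro!: nth_equalityI)
  then show "slot X i f \<in> Ar K" "dom1 K (slot X i f) = nprod (X[i := dom1 K f])"
    "cod1 K (slot X i f) = nprod (X[i := cod1 K f])"
    using id2_nmap1[OF f] assms by (simp_all add: slot_def map_update)
qed

lemma slot_ntuple2:
  assumes "set X \<subseteq> Ob K" "f \<in> Ar K" "i < length X" "els Z (X[i := dom1 K f]) xs"
  shows "id2 (slot X i f) ** tup Z xs = tup Z (xs[i := id2 f ** xs ! i])"
proof -
  let ?fs = "(map id1 X)[i := f]"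
  have f: "\<forall>g \<in> set ?fs. g \<in> Ar K" using assms by (auto dest!: set_update_subset_insert[THEN subsetD] simp: subset_iff)
  then have f2: "\<forall>\<alpha> \<in> set (map id2 ?fs). \<alpha> \<in> Ce K" by auto
  have s: "map src (map id2 ?fs) = X[i := dom1 K f]"
    using assms(1-3) by (auto intro!: nth_equalityI simp: nth_list_update)
  note l = elsD[OF assms(4)]
  have m: "map2 (\<star>) (map id2 ?fs) xs = xs[i := id2 f ** xs ! i]"
    using l assms(1-3) by (auto intro!: nth_equalityI simp: nth_list_update)
  show ?thesis
    unfolding slot_def id2_nmap1(4)[OF f] nmap2_ntuple2[OF f2 assms(4)[folded s]] m ..
qed


section \<open>Lists of lists: flat positions, regrouping and ungrouping\<close>

lemma nth_concat_offset:
  assumes "j < length xss" "d < length (xss ! j)"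
  shows "length (concat (take j xss)) + d < length (concat xss)"
    "concat xss ! (length (concat (take j xss)) + d) = xss ! j ! d"
proof -
  have e: "concat xss = concat (take j xss) @ xss ! j @ concat (drop (Suc j) xss)"
    by (metis assms(1) concat.simps(2) concat_append id_take_nth_drop)
  have l: "length (concat xss) = length (concat (take j xss)) + (length (xss ! j) + length (concat (drop (Suc j) xss)))"
    by (subst e) (simp only: length_append)
  show "length (concat (take j xss)) + d < length (concat xss)"
    using assms(2) l by linarith
  show "concat xss ! (length (concat (take j xss)) + d) = xss ! j ! d"
    by (subst e) (simp add: nth_append assms(2))
qed

lemma concat_update_offset:
  assumes "j < length xss" "d < length (xss ! j)"
  shows "concat (xss[j := (xss ! j)[d := x]]) = (concat xss)[length (concat (take j xss)) + d := x]"
proof -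
  have e: "concat xss = concat (take j xss) @ xss ! j @ concat (drop (Suc j) xss)"
    by (metis assms(1) concat.simps(2) concat_append id_take_nth_drop)
  have "concat (xss[j := (xss ! j)[d := x]]) = concat (take j xss) @ (xss ! j)[d := x] @ concat (drop (Suc j) xss)"
    using assms(1) by (simp add: upd_conv_take_nth_drop)
  also have "\<dots> = (concat (take j xss) @ xss ! j @ concat (drop (Suc j) xss))[length (concat (take j xss)) + d := x]"
    using assms(2) by (simp add: list_update_append)
  finally show ?thesis using e by simp
qed

text \<open>Keeps the block structure that \<open>concat\<close> forgets. The condition on
  \<open>Z\<close> is listed separately since an empty family of blocks would leave it
  unconstrained.\<close>

definition elss :: "'o \<Rightarrow> 'o list list \<Rightarrow> 't list list \<Rightarrow> bool" where
  "elss Z Xss xss \<longleftrightarrow> Z \<in> Ob K \<and> length xss = length Xss \<and> (\<forall>j < length Xss. els Z (Xss ! j) (xss ! j))"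

lemma elss_snoc [simp]: "elss Z (Xss @ [X]) (xss @ [xs]) \<longleftrightarrow> elss Z Xss xss \<and> els Z X xs"
  by (auto simp: elss_def nth_append less_Suc_eq)

lemma elss_Nil [simp]: "elss Z [] xss \<longleftrightarrow> Z \<in> Ob K \<and> xss = []"
  by (auto simp: elss_def)

lemma elss_snocE:
  assumes "elss Z (Xss @ [X]) yss"
  obtains xss xs where "yss = xss @ [xs]" "elss Z Xss xss" "els Z X xs"
proof -
  have "yss \<noteq> []" using assms by (auto simp: elss_def)
  then obtain xss xs where ys: "yss = xss @ [xs]" by (metis rev_exhaust)
  then show ?thesis using that assms by auto
qed

lemma elssD:
  assumes "elss Z Xss xss"
  shows "length xss = length Xss" "Z \<in> Ob K" "j < length Xss \<Longrightarrow> els Z (Xss ! j) (xss ! j)"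
    "j < length Xss \<Longrightarrow> length (xss ! j) = length (Xss ! j)"
    "map length xss = map length Xss"
  using assms by (auto simp: elss_def elsD(1) intro!: nth_equalityI)

lemma elss_concat: "elss Z Xss xss \<Longrightarrow> els Z (concat Xss) (concat xss)"
proof (induction Xss arbitrary: xss rule: rev_induct)
  case (snoc X Xss)
  from snoc(2) show ?case
    by (rule elss_snocE) (auto simp: els_append elsD(1) dest!: snoc.IH)
qed simp

lemma length_concat_take: "map length xss = map length yss \<Longrightarrow> length (concat (take j xss)) = length (concat (take j yss))"
  by (metis length_concat take_map)

lemma elss_ob: "elss Z Xss xss \<Longrightarrow> j < length Xss \<Longrightarrow> set (Xss ! j) \<subseteq> Ob K"
  by (auto dest!: elssD(3) elsD(3))

text \<open>The blocks of \<open>Xss\<close> dictate where the flat list is cut. Needed because the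
  generic tuple of a concatenation arises as a flat list.\<close>

lemma elss_ex:
  assumes "els Z (concat Xss) ys"
  obtains xss where "elss Z Xss xss" "concat xss = ys"
proof -
  have "\<exists>xss. elss Z Xss xss \<and> concat xss = ys"
    using assms
  proof (induction Xss arbitrary: ys rule: rev_induct)
    case (snoc X Xss)
    let ?n = "length (concat Xss)"
    have e: "els Z (concat Xss @ X) (take ?n ys @ drop ?n ys)" using snoc.prems by simp
    have "length (take ?n ys) = ?n" using elsD(1)[OF snoc.prems] by simp
    then have "els Z (concat Xss) (take ?n ys)" "els Z X (drop ?n ys)"
      using e by (metis els_append)+
    with snoc.IH obtain xss where "elss Z Xss xss" "concat xss = take ?n ys" by blast
    then show ?case using \<open>els Z X (drop ?n ys)\<close>
      by (intro exI[of _ "xss @ [drop ?n ys]"]) simp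
  qed auto
  then show ?thesis using that by blast
qed

lemma elss_projs:
  assumes "\<forall>X \<in> set Xss. set X \<subseteq> Ob K"
  obtains xss where "elss (nprod (concat Xss)) Xss xss" "concat xss = projs (concat Xss)"
    "\<forall>xs \<in> set xss. \<forall>x \<in> set xs. idc x"
proof -
  have s: "set (concat Xss) \<subseteq> Ob K" using assms by auto
  obtain xss where x: "elss (nprod (concat Xss)) Xss xss" "concat xss = projs (concat Xss)"
    using elss_ex[OF els_projs[OF s]] .
  then have "\<forall>xs \<in> set xss. \<forall>x \<in> set xs. idc x"
    using idc_projs[OF s] by (metis (no_types, lifting) UN_I set_concat)
  with x show ?thesis using that by blast
qed

lemma regroup_typing:
  assumes "\<forall>X \<in> set Xss. set X \<subseteq> Ob K"
  shows "regroup Xss \<in> Ar K" "dom1 K (regroup Xss) = nprod (concat Xss)"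
    "cod1 K (regroup Xss) = nprod (map nprod Xss)"
    "id2 (regroup Xss) = tup (nprod (concat Xss))
       (map (\<lambda>j. tup (nprod (concat Xss))
          (map (\<lambda>d. id2 (nproj (concat Xss) (length (concat (take j Xss)) + d))) [0..<length (Xss ! j)]))
        [0..<length Xss])"
proof -
  let ?C = "concat Xss"
  let ?f = "\<lambda>j. map (\<lambda>d. nproj ?C (length (concat (take j Xss)) + d)) [0..<length (Xss ! j)]"
  have C: "set ?C \<subseteq> Ob K" using assms by auto
  have f: "\<forall>f \<in> set (?f j). f \<in> Ar K \<and> dom1 K f = nprod ?C" "map (cod1 K) (?f j) = Xss ! j"
    if "j < length Xss" for j
    using that C nth_concat_offset[OF that] by (auto intro!: nth_equalityI)
  note g = id2_ntuple1[OF nprod_Ob[OF C] f(1)]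
  let ?g = "map (\<lambda>j. ntuple1 (nprod ?C) (?f j)) [0..<length Xss]"
  have h: "\<forall>f \<in> set ?g. f \<in> Ar K \<and> dom1 K f = nprod ?C"
    using g by auto
  have c: "map (cod1 K) ?g = map nprod Xss"
    using g f(2) by (auto intro!: nth_equalityI)
  note k = id2_ntuple1[OF nprod_Ob[OF C] h]
  have r: "regroup Xss = ntuple1 (nprod ?C) ?g" by (simp add: regroup_def Let_def)
  show "regroup Xss \<in> Ar K" "dom1 K (regroup Xss) = nprod (concat Xss)"
    "cod1 K (regroup Xss) = nprod (map nprod Xss)"
    using k c unfolding r by auto
  have m: "map id2 ?g = map (\<lambda>j. tup (nprod ?C) (map (\<lambda>d. id2 (nproj ?C (length (concat (take j Xss)) + d))) [0..<length (Xss ! j)])) [0..<length Xss]"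
    using g by (auto simp: o_def)
  show "id2 (regroup Xss) = tup (nprod ?C)
       (map (\<lambda>j. tup (nprod ?C) (map (\<lambda>d. id2 (nproj ?C (length (concat (take j Xss)) + d))) [0..<length (Xss ! j)]))
        [0..<length Xss])"
    unfolding r m[symmetric] using k by blast
qed

lemma els_map_ntuple2: "elss Z Xss xss \<Longrightarrow> els Z (map nprod Xss) (map (tup Z) xss)"
  using elssD(1,2) ntuple2_typing[OF elssD(3)] by (intro elsI) auto

text \<open>On elements the canonical isomorphism only inserts brackets, which is why regrouping
  disappears from computations with elements.\<close>

lemma regroup_ntuple2:
  assumes "elss Z Xss xss"
  shows "id2 (regroup Xss) ** tup Z (concat xss) = tup Z (map (tup Z) xss)"
proof -
  let ?C = "concat Xss" and ?P = "nprod (concat Xss)"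
  have X: "\<forall>X \<in> set Xss. set X \<subseteq> Ob K" using elss_ob[OF assms] by (metis in_set_conv_nth)
  then have C: "set ?C \<subseteq> Ob K" by auto
  note e = elss_concat[OF assms]
  note l = elssD[OF assms]
  let ?f = "\<lambda>j. map (\<lambda>d. id2 (nproj ?C (length (concat (take j Xss)) + d))) [0..<length (Xss ! j)]"
  have f: "els ?P (Xss ! j) (?f j)" if "j < length Xss" for j
    using that C nth_concat_offset[OF that] by (intro elsI) auto
  have g: "els ?P (map nprod Xss) (map (\<lambda>j. tup ?P (?f j)) [0..<length Xss])"
    using ntuple2_typing[OF f] C by (intro elsI) auto
  have "map (\<lambda>x. x ** tup Z (concat xss)) (?f j) = xss ! j" if "j < length Xss" for j
  proof (rule nth_equalityI)
    fix d assume "d < length (map (\<lambda>x. x ** tup Z (concat xss)) (?f j))"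
    then have d: "d < length (Xss ! j)" by simp
    have "concat xss ! (length (concat (take j xss)) + d) = xss ! j ! d"
      using nth_concat_offset(2)[of j xss d] that d l by simp
    then show "map (\<lambda>x. x ** tup Z (concat xss)) (?f j) ! d = xss ! j ! d"
      using d nth_concat_offset(1)[OF that d] e length_concat_take[OF l(5)] by simp
  qed (use l that in simp)
  then have "tup ?P (?f j) ** tup Z (concat xss) = tup Z (xss ! j)" if "j < length Xss" for j
    using ntuple2_hcomp[OF f[OF that], of "tup Z (concat xss)"] that e by simp
  then have m: "map (\<lambda>x. x ** tup Z (concat xss)) (map (\<lambda>j. tup ?P (?f j)) [0..<length Xss]) = map (tup Z) xss"
    using l by (auto intro!: nth_equalityI)
  show ?thesis
    unfolding regroup_typing(4)[OF X] using ntuple2_hcomp[OF g, of "tup Z (concat xss)"] e m by simp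
qed

text \<open>Typing and evaluation rest on the same flattened list of 1-cells, hence one statement
  for both.\<close>

lemma ungroup_typing:
  assumes "\<forall>X \<in> set Xss. set X \<subseteq> Ob K"
  shows "ungroup Xss \<in> Ar K \<and> dom1 K (ungroup Xss) = nprod (map nprod Xss) \<and>
    cod1 K (ungroup Xss) = nprod (concat Xss) \<and>
    (elss Z Xss xss \<longrightarrow> id2 (ungroup Xss) ** tup Z (map (tup Z) xss) = tup Z (concat xss))"
proof -
  let ?P = "map nprod Xss"
  have P: "set ?P \<subseteq> Ob K" using assms by auto
  let ?f = "\<lambda>j. map (\<lambda>d. nproj (Xss ! j) d \<odot> nproj ?P j) [0..<length (Xss ! j)]"
  let ?fs = "concat (map ?f [0..<length Xss])"
  have X: "set (Xss ! j) \<subseteq> Ob K" if "j < length Xss" for j using assms that by auto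
  have f: "\<forall>f \<in> set ?fs. f \<in> Ar K \<and> dom1 K f = nprod ?P"
    using P X by auto
  have "map (map (cod1 K)) (map ?f [0..<length Xss]) = Xss"
    using P X by (auto intro!: nth_equalityI)
  then have c: "map (cod1 K) ?fs = concat Xss" by (simp only: map_concat)
  note k = id2_ntuple1[OF nprod_Ob[OF P] f]
  have r: "ungroup Xss = ntuple1 (nprod ?P) ?fs" by (simp add: ungroup_def Let_def)
  have e: "els (nprod ?P) (concat Xss) (map id2 ?fs)"
  proof -
    have "map tgt (map id2 ?fs) = map (cod1 K) ?fs" unfolding map_map
    proof (rule map_cong[OF refl])
      fix x assume "x \<in> set ?fs"
      then have "x \<in> Ar K" using f by blast
      then show "(tgt \<circ> id2) x = cod1 K x" by simp
    qed
    then have "map tgt (map id2 ?fs) = concat Xss" by (simp only: c)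
    moreover have "\<forall>x \<in> set (map id2 ?fs). x \<in> Ce K \<and> src x = nprod ?P" unfolding set_map using f by simp
    ultimately show ?thesis using nprod_Ob[OF P] unfolding els_def by blast
  qed
  have "id2 (ungroup Xss) ** tup Z (map (tup Z) xss) = tup Z (concat xss)" if x: "elss Z Xss xss"
  proof -
    note t = els_map_ntuple2[OF x] and l = elssD[OF x]
    let ?T = "tup Z (map (tup Z) xss)"
    have "map (map (\<lambda>f. id2 f ** ?T)) (map ?f [0..<length Xss]) = xss"
      using P X l t by (auto intro!: nth_equalityI)
    then have "map (\<lambda>x. x ** ?T) (map id2 ?fs) = concat xss"
      by (simp only: map_map map_concat o_def)
    then show ?thesis unfolding r using k ntuple2_hcomp[OF e, of ?T] t by simp
  qed
  then show ?thesis using k c unfolding r by auto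
qed

end

section \<open>Strong monads as extension systems with parameters\<close>

context strong_two_monad
begin

abbreviation "\<eta>2 A \<equiv> id2 (\<eta> A)"
abbreviation "\<mu>2 A \<equiv> id2 (\<mu> A)"
abbreviation "\<omega>2 A B \<equiv> id2 (\<omega> A B)"

lemma T0_Ob [simp]: "A \<in> Ob K \<Longrightarrow> T0 A \<in> Ob K"
  by (rule T0_in)

lemma T1_typing [simp]:
  assumes "f \<in> Ar K"
  shows "T1 f \<in> Ar K" "dom1 K (T1 f) = T0 (dom1 K f)" "cod1 K (T1 f) = T0 (cod1 K f)"
    "id2 (T1 f) = T2 (id2 f)"
  using T1_in[OF hom1_dom_cod[OF assms]] T2_id[OF assms] by (auto simp: hom1_def)

lemma T2_typing [simp]:
  assumes "\<alpha> \<in> Ce K"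
  shows "T2 \<alpha> \<in> Ce K" "src (T2 \<alpha>) = T0 (src \<alpha>)" "tgt (T2 \<alpha>) = T0 (tgt \<alpha>)"
    "dom2 K (T2 \<alpha>) = T1 (dom2 K \<alpha>)" "cod2 K (T2 \<alpha>) = T1 (cod2 K \<alpha>)"
    "dm (T2 \<alpha>) = T2 (dm \<alpha>)" "cm (T2 \<alpha>) = T2 (cm \<alpha>)"
  using T2_in[OF hom2I[OF assms]] assms by (auto simp: hom2_def src_def tgt_def dm_def cm_def)

lemma idc_T2 [simp]: "idc \<alpha> \<Longrightarrow> idc (T2 \<alpha>)"
  by (simp add: idc_def)

lemma T2_id1 [simp]: "A \<in> Ob K \<Longrightarrow> T2 (id2 (id1 A)) = id2 (id1 (T0 A))"
  by (simp add: T1_id flip: T1_typing(4))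

lemma T2_comp [simp]:
  assumes "\<alpha> \<in> Ce K" "\<beta> \<in> Ce K" "tgt \<alpha> = src \<beta>"
  shows "T2 \<beta> ** T2 \<alpha> = T2 (\<beta> ** \<alpha>)"
  by (rule T2_hcomp[of "dom2 K \<alpha>" "src \<alpha>" "tgt \<alpha>" "dom2 K \<beta>" "tgt \<beta>" _ "cod2 K \<alpha>" _ "cod2 K \<beta>", symmetric])
    (use assms in \<open>auto simp: hom2_def hom1_def dom1_dom2_src\<close>)

lemma T2_comp_assoc [simp]:
  assumes "\<alpha> \<in> Ce K" "\<beta> \<in> Ce K" "\<gamma> \<in> Ce K" "tgt \<alpha> = src \<beta>" "tgt \<gamma> = T0 (src \<alpha>)"
  shows "T2 \<beta> ** (T2 \<alpha> ** \<gamma>) = T2 (\<beta> ** \<alpha>) ** \<gamma>"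
  using assms by (simp flip: hcomp_assoc')

lemma T2_vc [simp]:
  assumes "\<alpha> \<in> Ce K" "\<beta> \<in> Ce K" "cm \<alpha> = dm \<beta>"
  shows "T2 (\<beta> \<cdot> \<alpha>) = T2 \<beta> \<cdot> T2 \<alpha>"
  by (rule T2_vcomp[of _ "dom2 K \<alpha>" "cod2 K \<alpha>" _ "cod2 K \<beta>"])
    (use assms in \<open>auto simp: hom2_def dm_eq_iff\<close>)

lemma vinv_T2: "vinv \<alpha> \<beta> \<Longrightarrow> vinv (T2 \<alpha>) (T2 \<beta>)"
  unfolding vinv_def by (metis T2_typing(1,6,7) T2_vc)

lemma \<eta>_typing [simp]:
  assumes "A \<in> Ob K"
  shows "\<eta> A \<in> Ar K" "dom1 K (\<eta> A) = A" "cod1 K (\<eta> A) = T0 A"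
  using \<eta>_in[OF assms] by (auto simp: hom1_def)

lemma \<mu>_typing [simp]:
  assumes "A \<in> Ob K"
  shows "\<mu> A \<in> Ar K" "dom1 K (\<mu> A) = T0 (T0 A)" "cod1 K (\<mu> A) = T0 A"
  using \<mu>_in[OF assms] by (auto simp: hom1_def)

lemma t_typing [simp]:
  assumes "A \<in> Ob K" "B \<in> Ob K"
  shows "t A B \<in> Ar K" "dom1 K (t A B) = A \<otimes> T0 B" "cod1 K (t A B) = T0 (A \<otimes> B)"
  using t_in[OF assms] by (auto simp: hom1_def)

lemma \<eta>_nat:
  assumes "\<alpha> \<in> Ce K"
  shows "T2 \<alpha> ** \<eta>2 (src \<alpha>) = \<eta>2 (tgt \<alpha>) ** \<alpha>"
  by (rule \<eta>_natural2[of "dom2 K \<alpha>" _ _ _ "cod2 K \<alpha>"])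
    (use assms in \<open>auto simp: hom2_def hom1_def dom1_dom2_src\<close>)

lemma \<mu>_nat:
  assumes "\<alpha> \<in> Ce K"
  shows "T2 \<alpha> ** \<mu>2 (src \<alpha>) = \<mu>2 (tgt \<alpha>) ** T2 (T2 \<alpha>)"
  by (rule \<mu>_natural2[of "dom2 K \<alpha>" _ _ _ "cod2 K \<alpha>"])
    (use assms in \<open>auto simp: hom2_def hom1_def dom1_dom2_src\<close>)

lemma \<eta>_nat_assoc:
  assumes "\<alpha> \<in> Ce K" "\<gamma> \<in> Ce K" "tgt \<gamma> = src \<alpha>" "src \<alpha> = A"
  shows "T2 \<alpha> ** (\<eta>2 A ** \<gamma>) = \<eta>2 (tgt \<alpha>) ** (\<alpha> ** \<gamma>)"
  using arg_cong[OF \<eta>_nat[OF assms(1)], of "\<lambda>x. x ** \<gamma>"] assms by auto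

lemma \<mu>_nat_assoc:
  assumes "\<alpha> \<in> Ce K" "\<gamma> \<in> Ce K" "tgt \<gamma> = T0 (T0 (src \<alpha>))"
  shows "T2 \<alpha> ** (\<mu>2 (src \<alpha>) ** \<gamma>) = \<mu>2 (tgt \<alpha>) ** (T2 (T2 \<alpha>) ** \<gamma>)"
  using arg_cong[OF \<mu>_nat[OF assms(1)], of "\<lambda>x. x ** \<gamma>"] assms by simp

lemma t_nat:
  assumes "\<alpha> \<in> Ce K" "\<beta> \<in> Ce K" "a \<in> Ce K" "b \<in> Ce K" "src a = src b" "tgt a = src \<alpha>" "tgt b = T0 (src \<beta>)"
  shows "id2 (t (tgt \<alpha>) (tgt \<beta>)) ** pair2 (\<alpha> ** a) (T2 \<beta> ** b)
    = T2 (pair2 (\<alpha> ** p1 (src \<alpha>) (src \<beta>)) (\<beta> ** p2 (src \<alpha>) (src \<beta>)))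
      ** (id2 (t (src \<alpha>) (src \<beta>)) ** pair2 a b)"
proof -
  have "T2 (\<alpha> \<otimes>\<^sub>2 \<beta>) \<rhd> t (src \<alpha>) (src \<beta>) = t (tgt \<alpha>) (tgt \<beta>) \<lhd> (\<alpha> \<otimes>\<^sub>2 T2 \<beta>)"
    by (rule t_natural2[of "dom2 K \<alpha>" _ _ "dom2 K \<beta>" _ _ _ "cod2 K \<alpha>" _ "cod2 K \<beta>"])
      (use assms in \<open>auto simp: hom2_def hom1_def dom1_dom2_src\<close>)
  from arg_cong[OF this, of "\<lambda>x. x ** pair2 a b"] show ?thesis
    using assms by (simp add: prod2_eq)
qed

text \<open>The strength with the whole context \<open>src u\<close> as its parameter: the result is
  \<open>T\<close> of context times value. Every other use of \<open>t\<close> reduces to this one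
  by naturality.\<close>

definition \<tau> :: "'o \<Rightarrow> 't \<Rightarrow> 't" where
  "\<tau> A u = id2 (t (src u) A) ** pair2 (id2 (id1 (src u))) u"

text \<open>\<open>bnd A B u k\<close> is the Kleisli extension of \<open>k : Z \<times> A \<rightarrow> TB\<close>, with parameter in \<open>Z\<close>,
  evaluated at \<open>u : Z \<rightarrow> TA\<close>; read ``let \<open>a\<close> be \<open>u\<close> in \<open>k(z, a)\<close>''.\<close>

definition bnd :: "'o \<Rightarrow> 'o \<Rightarrow> 't \<Rightarrow> 't \<Rightarrow> 't" where
  "bnd A B u k = \<mu>2 B ** (T2 k ** \<tau> A u)"

lemma \<tau>_typing [simp]:
  assumes "u \<in> Ce K" "tgt u = T0 A" "A \<in> Ob K"
  shows "\<tau> A u \<in> Ce K" "src (\<tau> A u) = src u" "tgt (\<tau> A u) = T0 (src u \<otimes> A)"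
    "dm (\<tau> A u) = \<tau> A (dm u)" "cm (\<tau> A u) = \<tau> A (cm u)"
  using assms by (simp_all add: \<tau>_def)

lemma bnd_typing [simp]:
  assumes "u \<in> Ce K" "tgt u = T0 A" "A \<in> Ob K" "k \<in> Ce K" "src k = src u \<otimes> A" "tgt k = T0 B" "B \<in> Ob K"
  shows "bnd A B u k \<in> Ce K" "src (bnd A B u k) = src u" "tgt (bnd A B u k) = T0 B"
    "dm (bnd A B u k) = bnd A B (dm u) (dm k)" "cm (bnd A B u k) = bnd A B (cm u) (cm k)"
  using assms by (simp_all add: bnd_def)

lemma idc_\<tau> [simp]: "idc u \<Longrightarrow> tgt u = T0 A \<Longrightarrow> A \<in> Ob K \<Longrightarrow> idc (\<tau> A u)"
  by (simp add: idc_def)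

lemma idc_bnd [simp]:
  "idc u \<Longrightarrow> tgt u = T0 A \<Longrightarrow> A \<in> Ob K \<Longrightarrow> idc k \<Longrightarrow> src k = src u \<otimes> A \<Longrightarrow> tgt k = T0 B \<Longrightarrow> B \<in> Ob K
   \<Longrightarrow> idc (bnd A B u k)"
  by (simp add: idc_def)

text \<open>Naturality of \<open>t\<close> along \<open>x\<close>: any parameter is a function of
  the context.\<close>

lemma t_pair_\<tau>:
  assumes "x \<in> Ce K" "u \<in> Ce K" "src x = src u" "tgt x = A" "tgt u = T0 B" "B \<in> Ob K"
  shows "id2 (t A B) ** pair2 x u = T2 (pair2 (x ** p1 (src u) B) (p2 (src u) B)) ** \<tau> B u"
  using t_nat[of x "id2 (id1 B)" "id2 (id1 (src u))" u] assms by (simp add: \<tau>_def)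

text \<open>Substitution into the context: the new context is attached to the value, and
  \<open>z\<close> is applied to it afterwards, inside \<open>T2\<close>.\<close>

lemma \<tau>_hcomp:
  assumes "u \<in> Ce K" "tgt u = T0 A" "A \<in> Ob K" "z \<in> Ce K" "tgt z = src u"
  shows "\<tau> A u ** z = T2 (pair2 (z ** p1 (src z) A) (p2 (src z) A)) ** \<tau> A (u ** z)"
  using t_pair_\<tau>[of z "u ** z" "src u" A] assms by (simp add: \<tau>_def)

lemma \<tau>_T2:
  assumes "u \<in> Ce K" "k \<in> Ce K" "tgt u = T0 (src k)" "tgt k = B"
  shows "\<tau> B (T2 k ** u) = T2 (pair2 (p1 (src u) (src k)) (k ** p2 (src u) (src k))) ** \<tau> (src k) u"
  using t_nat[of "id2 (id1 (src u))" k "id2 (id1 (src u))" u] assms by (simp add: \<tau>_def)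

lemma \<tau>_\<eta>:
  assumes "x \<in> Ce K" "tgt x = A"
  shows "\<tau> A (\<eta>2 A ** x) = \<eta>2 (src x \<otimes> A) ** pair2 (id2 (id1 (src x))) x"
  using arg_cong[OF t_\<eta>[of "src x" A], of "\<lambda>f. id2 f ** pair2 (id2 (id1 (src x))) x"] assms
  by (auto simp: \<tau>_def)

lemma \<tau>_\<mu>:
  assumes "u \<in> Ce K" "tgt u = T0 (T0 A)" "A \<in> Ob K"
  shows "\<tau> A (\<mu>2 A ** u) = \<mu>2 (src u \<otimes> A) ** (T2 (id2 (t (src u) A)) ** \<tau> (T0 A) u)"
  using arg_cong[OF t_\<mu>[of "src u" A], of "\<lambda>f. id2 f ** pair2 (id2 (id1 (src u))) u"] assms
  by (simp add: \<tau>_def)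

lemma t_assoc_pair:
  assumes "x \<in> Ce K" "y \<in> Ce K" "u \<in> Ce K" "src x = src u" "src y = src u" "tgt x = A" "tgt y = B" "tgt u = T0 C" "C \<in> Ob K"
  shows "id2 (t A (B \<otimes> C)) ** pair2 x (id2 (t B C) ** pair2 y u)
    = T2 (id2 (assoc A B C)) ** (id2 (t (A \<otimes> B) C) ** pair2 (pair2 x y) u)"
  using arg_cong[OF t_assoc[of A B C], of "\<lambda>f. id2 f ** pair2 (pair2 x y) u"] assms by auto

text \<open>The associativity axiom of the strength with the context in both parameter places:
  attaching the context a second time merely duplicates it.\<close>

lemma \<tau>_\<tau>:
  assumes "u \<in> Ce K" "tgt u = T0 A" "A \<in> Ob K" 
  shows "\<tau> (src u \<otimes> A) (\<tau> A u) = T2 (pair2 (p1 (src u) A) (id2 (id1 (src u \<otimes> A)))) ** \<tau> A u"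
proof -
  let ?Z = "src u"
  have "\<tau> (?Z \<otimes> A) (\<tau> A u) = T2 (id2 (assoc ?Z ?Z A)) ** (id2 (t (?Z \<otimes> ?Z) A) ** pair2 (pair2 (id2 (id1 ?Z)) (id2 (id1 ?Z))) u)"
    using t_assoc_pair[of "id2 (id1 ?Z)" "id2 (id1 ?Z)" u ?Z ?Z A] assms
    by (simp add: \<tau>_def)
  also have "\<dots> = T2 (pair2 (p1 ?Z A) (id2 (id1 (?Z \<otimes> A)))) ** \<tau> A u"
    by (subst t_pair_\<tau>) (use assms in simp_all)
  finally show ?thesis .
qed

text \<open>The unit axiom of the strength, after the context has been collapsed to
  \<open>\<one>\<close>: attaching a context and dropping it again changes nothing.\<close>

lemma T2_pr2_\<tau>:
  assumes "u \<in> Ce K" "tgt u = T0 A" "A \<in> Ob K"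
  shows "T2 (p2 (src u) A) ** \<tau> A u = u"
proof -
  let ?Z = "src u" and ?b = "id2 (bang (src u))"
  have "p2 \<one> (T0 A) ** pair2 ?b u = T2 (p2 \<one> A) ** (id2 (t \<one> A) ** pair2 ?b u)"
    using arg_cong[OF t_unit[of A], of "\<lambda>f. id2 f ** pair2 ?b u"] assms by simp
  also have "\<dots> = T2 (p2 ?Z A) ** \<tau> A u"
    by (subst t_pair_\<tau>) (use assms in simp_all)
  finally show ?thesis using assms by simp
qed

lemma \<mu>_unit:
  assumes "u \<in> Ce K" "tgt u = T0 A" "A \<in> Ob K"
  shows "\<mu>2 A ** (\<eta>2 (T0 A) ** u) = u" "\<mu>2 A ** (T2 (\<eta>2 A) ** u) = u"
  using arg_cong[OF monad_unit_left[of A], of "\<lambda>f. id2 f ** u"]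
    arg_cong[OF monad_unit_right[of A], of "\<lambda>f. id2 f ** u"] assms by simp_all

lemma \<mu>_assoc:
  assumes "u \<in> Ce K" "tgt u = T0 (T0 (T0 A))" "A \<in> Ob K"
  shows "\<mu>2 A ** (\<mu>2 (T0 A) ** u) = \<mu>2 A ** (T2 (\<mu>2 A) ** u)"
  using arg_cong[OF monad_assoc[of A], of "\<lambda>f. id2 f ** u"] assms by simp

text \<open>Substitution passes under the binder: \<open>z\<close> acts on the context and leaves
  the bound variable alone.\<close>

lemma bnd_hcomp [simp]:
  assumes "u \<in> Ce K" "tgt u = T0 A" "A \<in> Ob K" "k \<in> Ce K" "src k = src u \<otimes> A" "tgt k = T0 B" "B \<in> Ob K"
    "z \<in> Ce K" "tgt z = src u"
  shows "bnd A B u k ** z = bnd A B (u ** z) (k ** pair2 (z ** p1 (src z) A) (p2 (src z) A))"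
  using assms by (simp add: bnd_def \<tau>_hcomp)

text \<open>The multiplication axiom of the strength moves the outer \<open>\<tau>\<close> below
  \<open>\<mu>\<close>, and \<open>\<tau>_\<tau>\<close> merges the two copies of the
  context.\<close>

lemma \<tau>_bnd_aux:
  assumes "u \<in> Ce K" "tgt u = T0 A" "A \<in> Ob K" "k \<in> Ce K" "src k = src u \<otimes> A" "tgt k = T0 B" "B \<in> Ob K"
  shows "\<tau> B (bnd A B u k) = \<mu>2 (src u \<otimes> B) ** (T2 (id2 (t (src u) B) ** pair2 (p1 (src u) A) k) ** \<tau> A u)"
  using assms by (simp add: bnd_def \<tau>_\<mu> \<tau>_T2 \<tau>_\<tau>)

text \<open>Associativity of sequencing. On the nested side \<open>l\<close> is weakened, as it must
  ignore the variable bound by the first step.\<close>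

lemma bnd_assoc:
  assumes "u \<in> Ce K" "tgt u = T0 A" "A \<in> Ob K" "k \<in> Ce K" "src k = src u \<otimes> A" "tgt k = T0 B" "B \<in> Ob K"
    "l \<in> Ce K" "src l = src u \<otimes> B" "tgt l = T0 C" "C \<in> Ob K"
  shows "bnd B C (bnd A B u k) l =
    bnd A C u (bnd B C k (l ** pair2 (p1 (src u) A ** p1 (src u \<otimes> A) B) (p2 (src u \<otimes> A) B)))"
proof -
  let ?Z = "src u"
  let ?t = "id2 (t ?Z B) ** pair2 (p1 ?Z A) k"
  have t: "?t \<in> Ce K" "src ?t = ?Z \<otimes> A" "tgt ?t = T0 (?Z \<otimes> B)" using assms by simp_all
  have "bnd B C (bnd A B u k) l = \<mu>2 C ** (T2 l ** (\<mu>2 (?Z \<otimes> B) ** (T2 ?t ** \<tau> A u)))"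
    using assms by (simp add: bnd_def[of B] \<tau>_bnd_aux del: T2_comp_assoc)
  also have "\<dots> = \<mu>2 C ** (\<mu>2 (T0 C) ** (T2 (T2 l) ** (T2 ?t ** \<tau> A u)))"
    using \<mu>_nat_assoc[of l "T2 ?t ** \<tau> A u"] assms by (simp del: T2_comp_assoc)
  also have "\<dots> = \<mu>2 C ** (T2 (\<mu>2 C ** (T2 l ** ?t)) ** \<tau> A u)"
    using t assms by (simp add: \<mu>_assoc)
  also have "\<mu>2 C ** (T2 l ** ?t) = bnd B C k (l ** pair2 (p1 ?Z A ** p1 (?Z \<otimes> A) B) (p2 (?Z \<otimes> A) B))"
    using assms by (simp add: t_pair_\<tau> bnd_def)
  finally show ?thesis by (simp add: bnd_def[of A])
qed

text \<open>The left unit law: binding a pure value substitutes it for the bound variable.\<close>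

lemma bnd_\<eta>:
  assumes "x \<in> Ce K" "tgt x = A" "k \<in> Ce K" "src k = src x \<otimes> A" "tgt k = T0 B" "B \<in> Ob K"
  shows "bnd A B (\<eta>2 A ** x) k = k ** pair2 (id2 (id1 (src x))) x"
proof -
  have "bnd A B (\<eta>2 A ** x) k = \<mu>2 B ** (T2 k ** (\<eta>2 (src x \<otimes> A) ** pair2 (id2 (id1 (src x))) x))"
    using assms by (simp add: bnd_def \<tau>_\<eta>)
  also have "\<dots> = \<mu>2 B ** (\<eta>2 (T0 B) ** (k ** pair2 (id2 (id1 (src x))) x))"
    using \<eta>_nat_assoc[of k "pair2 (id2 (id1 (src x))) x"] assms by simp
  finally show ?thesis using assms by (simp add: \<mu>_unit)
qed

lemma bnd_\<eta>':
  assumes "k \<in> Ce K" "src k = A \<otimes> A" "tgt k = T0 B" "B \<in> Ob K" "A \<in> Ob K"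
  shows "bnd A B (\<eta>2 A) k = k ** pair2 (id2 (id1 A)) (id2 (id1 A))"
  using bnd_\<eta>[of "id2 (id1 A)" A k B] assms by simp

text \<open>The right unit law, with a pure final step \<open>k\<close>; it is the bridge between
  \<open>bnd\<close> and the form \<open>T2 k ** \<tau> A u\<close> in which naturality laws are
  stated.\<close>

lemma bnd_ret:
  assumes "k \<in> Ce K" "src k = src u \<otimes> A" "tgt k = B" "u \<in> Ce K" "tgt u = T0 A" "A \<in> Ob K" "B \<in> Ob K"
  shows "bnd A B u (\<eta>2 B ** k) = T2 k ** \<tau> A u"
  using assms by (simp add: bnd_def \<mu>_unit(2) flip: T2_comp_assoc)

lemma bnd_ret_pr2:
  assumes "u \<in> Ce K" "tgt u = T0 A" "A \<in> Ob K" "Z = src u"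
  shows "bnd A A u (\<eta>2 A ** p2 Z A) = u"
  using assms by (simp add: bnd_ret T2_pr2_\<tau>)

lemma T2_bnd:
  assumes "u \<in> Ce K" "f \<in> Ce K" "tgt u = T0 (src f)"
  shows "T2 f ** u = bnd (src f) (tgt f) u (\<eta>2 (tgt f) ** (f ** p2 (src u) (src f)))"
  using assms arg_cong[OF T2_pr2_\<tau>[of u "src f"], of "\<lambda>x. T2 f ** x"] by (simp add: bnd_ret)

lemma \<mu>_bnd:
  assumes "u \<in> Ce K" "tgt u = T0 (T0 A)" "A \<in> Ob K"
  shows "\<mu>2 A ** u = bnd (T0 A) A u (p2 (src u) (T0 A))"
  using assms by (simp add: bnd_def T2_pr2_\<tau>)

lemma t_bnd:
  assumes "x \<in> Ce K" "u \<in> Ce K" "src x = src u" "tgt x = A" "tgt u = T0 B" "B \<in> Ob K"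
  shows "id2 (t A B) ** pair2 x u = bnd B (A \<otimes> B) u (\<eta>2 (A \<otimes> B) ** pair2 (x ** p1 (src u) B) (p2 (src u) B))"
  using assms by (auto simp add: bnd_ret t_pair_\<tau>)

lemma \<tau>_bnd:
  assumes "u \<in> Ce K" "tgt u = T0 A" "A \<in> Ob K"
  shows "\<tau> A u = bnd A (src u \<otimes> A) u (\<eta>2 (src u \<otimes> A))"
  using assms bnd_ret[of "id2 (id1 (src u \<otimes> A))" u A "src u \<otimes> A"] by simp

lemma bnd_T2:
  assumes "u \<in> Ce K" "f \<in> Ce K" "tgt u = T0 (src f)" "tgt f = A" "k \<in> Ce K" "src k = src u \<otimes> A" "tgt k = T0 B" "B \<in> Ob K"
  shows "bnd A B (T2 f ** u) k = bnd (src f) B u (k ** pair2 (p1 (src u) (src f)) (f ** p2 (src u) (src f)))"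
  using assms by (auto simp: bnd_def \<tau>_T2)

lemma T2_bnd_push:
  assumes "u \<in> Ce K" "tgt u = T0 A" "A \<in> Ob K" "k \<in> Ce K" "src k = src u \<otimes> A" "tgt k = T0 B" "f \<in> Ce K" "src f = B"
  shows "T2 f ** bnd A B u k = bnd A (tgt f) u (T2 f ** k)"
  using assms \<mu>_nat_assoc[of f "T2 k ** \<tau> A u"] by (auto simp: bnd_def)

text \<open>Rules towards a normal form: nested \<open>bnd\<close>s that end in a pure value, on
  which the equality of two terms built from monad and strength can be read off.\<close>

lemmas bind_simps = bnd_assoc bnd_\<eta> bnd_\<eta>' bnd_ret_pr2 T2_bnd \<mu>_bnd t_bnd \<tau>_bnd

lemma t'_typing [simp]:
  assumes "A \<in> Ob K" "B \<in> Ob K"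
  shows "t' A B \<in> Ar K" "dom1 K (t' A B) = T0 A \<otimes> B" "cod1 K (t' A B) = T0 (A \<otimes> B)"
  using assms by (simp_all add: t'_def)

lemma t'_bnd:
  assumes "x \<in> Ce K" "u \<in> Ce K" "src x = src u" "tgt x = B" "tgt u = T0 A" "A \<in> Ob K"
  shows "id2 (t' A B) ** pair2 u x = bnd A (A \<otimes> B) u (\<eta>2 (A \<otimes> B) ** pair2 (p2 (src u) A) (x ** p1 (src u) A))"
  using assms by (auto simp add: t'_def bind_simps)

lemma \<omega>_typing [simp]:
  assumes "A \<in> Ob K" "B \<in> Ob K"
  shows "\<omega> A B \<in> Ar K" "dom1 K (\<omega> A B) = T0 A \<otimes> T0 B" "cod1 K (\<omega> A B) = T0 (A \<otimes> B)"
    "\<omega>' A B \<in> Ar K" "dom1 K (\<omega>' A B) = T0 A \<otimes> T0 B" "cod1 K (\<omega>' A B) = T0 (A \<otimes> B)"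
  using assms by (simp_all add: \<omega>_def \<omega>'_def)

text \<open>The two composites differ only in the order of evaluation: \<open>\<omega>\<close> runs
  its first argument first, \<open>\<omega>'\<close> its second. So \<open>\<Gamma>\<close> is a
  commutation of two effects.\<close>

lemma \<omega>_bnd:
  assumes "u \<in> Ce K" "v \<in> Ce K" "src u = Z" "src v = Z" "tgt u = T0 A" "tgt v = T0 B" "A \<in> Ob K" "B \<in> Ob K"
  shows "\<omega>2 A B ** pair2 u v = bnd A (A \<otimes> B) u (bnd B (A \<otimes> B) (v ** p1 Z A)
     (\<eta>2 (A \<otimes> B) ** pair2 (p2 Z A ** p1 (Z \<otimes> A) B) (p2 (Z \<otimes> A) B)))"
    "id2 (\<omega>' A B) ** pair2 u v = bnd B (A \<otimes> B) v (bnd A (A \<otimes> B) (u ** p1 Z B)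
     (\<eta>2 (A \<otimes> B) ** pair2 (p2 (Z \<otimes> B) A) (p2 Z B ** p1 (Z \<otimes> B) A)))"
proof -
  have Z: "Z \<in> Ob K" using assms by auto
  have "\<omega>2 A B ** pair2 u v = \<mu>2 (A \<otimes> B) ** ((T2 (id2 (t A B)) ** (id2 (t' A (T0 B)) ** pair2 u v)))"
    using assms by (simp add: \<omega>_def)
  also have "\<dots> = \<mu>2 (A \<otimes> B) ** ((T2 (id2 (t A B) ** pair2 (p2 Z A) (v ** p1 Z A)) ** \<tau> A u))"
    using assms Z by (simp add: t'_bnd bnd_ret)
  also have "\<dots> = bnd A (A \<otimes> B) u (id2 (t A B) ** pair2 (p2 Z A) (v ** p1 Z A))"
    by (simp add: bnd_def)
  also have "\<dots> = bnd A (A \<otimes> B) u (bnd B (A \<otimes> B) (v ** p1 Z A)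
     (\<eta>2 (A \<otimes> B) ** pair2 (p2 Z A ** p1 (Z \<otimes> A) B) (p2 (Z \<otimes> A) B)))"
    using assms Z by (simp add: t_bnd)
  finally show "\<omega>2 A B ** pair2 u v = \<dots>" .
  have "id2 (\<omega>' A B) ** pair2 u v = \<mu>2 (A \<otimes> B) ** ((T2 (id2 (t' A B)) ** (id2 (t (T0 A) B) ** pair2 u v)))"
    using assms by (simp add: \<omega>'_def)
  also have "\<dots> = \<mu>2 (A \<otimes> B) ** ((T2 (id2 (t' A B) ** pair2 (u ** p1 Z B) (p2 Z B)) ** \<tau> B v))"
    using assms Z by (simp add: t_bnd bnd_ret)
  also have "\<dots> = bnd B (A \<otimes> B) v (id2 (t' A B) ** pair2 (u ** p1 Z B) (p2 Z B))"
    by (simp add: bnd_def)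
  also have "\<dots> = bnd B (A \<otimes> B) v (bnd A (A \<otimes> B) (u ** p1 Z B)
     (\<eta>2 (A \<otimes> B) ** pair2 (p2 (Z \<otimes> B) A) (p2 Z B ** p1 (Z \<otimes> B) A)))"
    using assms Z by (simp add: t'_bnd)
  finally show "id2 (\<omega>' A B) ** pair2 u v = \<dots>" .
qed

lemma \<omega>_nat:
  assumes "u \<in> Ce K" "v \<in> Ce K" "src u = src v" "tgt u = T0 (src f)" "tgt v = T0 (src g)" "f \<in> Ce K" "g \<in> Ce K"
  shows "\<omega>2 (tgt f) (tgt g) ** pair2 (T2 f ** u) (T2 g ** v)
     = T2 (pair2 (f ** p1 (src f) (src g)) (g ** p2 (src f) (src g))) ** (\<omega>2 (src f) (src g) ** pair2 u v)"
  using assms by (simp add: \<omega>_bnd[where Z = "src v"] bnd_T2 T2_bnd_push \<eta>_nat_assoc)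

text \<open>Both sides normalize to running \<open>u\<close>, \<open>v\<close>, \<open>w\<close> in
  this order.\<close>

lemma \<omega>_assoc:
  assumes "u \<in> Ce K" "v \<in> Ce K" "w \<in> Ce K" "src u = Z" "src v = Z" "src w = Z"
    "tgt u = T0 A" "tgt v = T0 B" "tgt w = T0 C" "A \<in> Ob K" "B \<in> Ob K" "C \<in> Ob K"
  shows "\<omega>2 A (B \<otimes> C) ** pair2 u (\<omega>2 B C ** pair2 v w)
     = T2 (id2 (assoc A B C)) ** (\<omega>2 (A \<otimes> B) C ** pair2 (\<omega>2 A B ** pair2 u v) w)"
proof -
  have "Z \<in> Ob K" using assms by auto
  then show ?thesis
  using assms by (simp add: \<omega>_bnd[where Z = Z] bnd_assoc bnd_\<eta> T2_bnd_push \<eta>_nat_assoc)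
qed

text \<open>A pure argument has no effect to be ordered, so only the strength for the other argument
  remains.\<close>

lemma \<omega>_\<eta>:
  assumes "u \<in> Ce K" "x \<in> Ce K" "src u = Z" "src x = Z" "tgt u = T0 A" "tgt x = B" "A \<in> Ob K"
  shows "\<omega>2 A B ** pair2 u (\<eta>2 B ** x) = T2 (pair2 (p2 Z A) (x ** p1 Z A)) ** \<tau> A u"
    "\<omega>2 B A ** pair2 (\<eta>2 B ** x) u = T2 (pair2 (x ** p1 Z A) (p2 Z A)) ** \<tau> A u"
proof -
  have [simp]: "Z \<in> Ob K" "B \<in> Ob K" using assms by auto
  show "\<omega>2 A B ** pair2 u (\<eta>2 B ** x) = T2 (pair2 (p2 Z A) (x ** p1 Z A)) ** \<tau> A u"
    "\<omega>2 B A ** pair2 (\<eta>2 B ** x) u = T2 (pair2 (x ** p1 Z A) (p2 Z A)) ** \<tau> A u"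
    using assms by (simp_all add: \<omega>_bnd[where Z = Z] bnd_\<eta> bnd_ret \<tau>_\<eta> \<eta>_nat_assoc \<tau>_hcomp)
qed

text \<open>The first argument is run first, so a sequence inside it can be taken out of
  \<open>\<omega>\<close>. This is why, when a factor is appended, the old structure 2-cells need
  only be whiskered by \<open>\<omega>\<close>.\<close>

lemma \<omega>_bnd_left:
  assumes "u \<in> Ce K" "k \<in> Ce K" "v \<in> Ce K" "src u = Z" "src v = Z" "src k = Z \<otimes> C"
    "tgt u = T0 C" "tgt k = T0 A" "tgt v = T0 B" "A \<in> Ob K" "B \<in> Ob K" "C \<in> Ob K"
  shows "\<omega>2 A B ** pair2 (bnd C A u k) v = bnd C (A \<otimes> B) u (\<omega>2 A B ** pair2 k (v ** p1 Z C))"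
proof -
  have [simp]: "Z \<in> Ob K" using assms by auto
  show ?thesis
    using assms by (simp add: \<omega>_bnd[where Z = Z] \<omega>_bnd[where Z = "Z \<otimes> C"] bnd_assoc)
qed

end

section \<open>The pseudo commutativity on generalized elements\<close>

context strong_two_monad
begin

text \<open>A pure parameter \<open>x\<close> passes through \<open>\<mu>\<close> and
  \<open>T t\<close>: first by the multiplication axiom of the strength, then by its associativity.
  The result has the shape that \<open>D\<close> at a product object produces.\<close>

lemma t_\<mu>T:
  assumes "x \<in> Ce K" "y \<in> Ce K" "src x = Z" "src y = Z" "tgt x = A" "tgt y = T0 (B \<otimes> T0 C)"
    "B \<in> Ob K" "C \<in> Ob K" "A \<in> Ob K"
  shows "id2 (t A (B \<otimes> C)) ** pair2 x (\<mu>2 (B \<otimes> C) ** (T2 (id2 (t B C)) ** y))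
    = T2 (id2 (assoc A B C)) ** (\<mu>2 (A \<otimes> B \<otimes> C) ** (T2 (id2 (t (A \<otimes> B) C)) ** (T2 (id2 (assoc_inv A B (T0 C))) **
       (id2 (t A (B \<otimes> T0 C)) ** pair2 x y))))"
proof -
  have [simp]: "Z \<in> Ob K" using assms by auto
  have e: "T2 (id2 (t B C)) ** y = bnd (B \<otimes> T0 C) (T0 (B \<otimes> C)) y (\<eta>2 (T0 (B \<otimes> C)) ** (id2 (t B C) ** p2 Z (B \<otimes> T0 C)))"
    using assms by (simp add: T2_bnd)
  have l: "id2 (t A (B \<otimes> C)) ** pair2 x (\<mu>2 (B \<otimes> C) ** (T2 (id2 (t B C)) ** y))
    = \<mu>2 (A \<otimes> (B \<otimes> C)) ** (T2 (id2 (t A (B \<otimes> C))) ** (id2 (t A (T0 (B \<otimes> C))) ** pair2 x (T2 (id2 (t B C)) ** y)))"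
    using arg_cong[OF t_\<mu>[of A "B \<otimes> C"], of "\<lambda>f. id2 f ** pair2 x (T2 (id2 (t B C)) ** y)"] assms
    by (simp del: T2_comp_assoc)
  have m: "id2 (t A (T0 (B \<otimes> C))) ** pair2 x (T2 (id2 (t B C)) ** y)
    = T2 (pair2 (p1 A (B \<otimes> T0 C)) (id2 (t B C) ** p2 A (B \<otimes> T0 C))) ** (id2 (t A (B \<otimes> T0 C)) ** pair2 x y)"
    using t_nat[of "id2 (id1 A)" "id2 (t B C)" x y] assms by simp
  let ?q = "id2 (t A (B \<otimes> C)) ** pair2 (p1 A (B \<otimes> T0 C)) (id2 (t B C) ** p2 A (B \<otimes> T0 C))"
  have k: "?q = T2 (id2 (assoc A B C)) ** (id2 (t (A \<otimes> B) C) ** id2 (assoc_inv A B (T0 C)))"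
    using t_assoc_pair[of "p1 A (B \<otimes> T0 C)" "p1 B (T0 C) ** p2 A (B \<otimes> T0 C)"
        "p2 B (T0 C) ** p2 A (B \<otimes> T0 C)" A B C] assms
    by (simp flip: pair2_hcomp)
  have "id2 (t A (B \<otimes> C)) ** pair2 x (\<mu>2 (B \<otimes> C) ** (T2 (id2 (t B C)) ** y))
    = \<mu>2 (A \<otimes> (B \<otimes> C)) ** (T2 ?q ** (id2 (t A (B \<otimes> T0 C)) ** pair2 x y))"
    using assms unfolding l m by simp
  also have "\<dots> = \<mu>2 (A \<otimes> (B \<otimes> C)) ** (T2 (T2 (id2 (assoc A B C))) ** (T2 (id2 (t (A \<otimes> B) C)) ** (T2 (id2 (assoc_inv A B (T0 C))) **
       (id2 (t A (B \<otimes> T0 C)) ** pair2 x y))))"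
    unfolding k using assms by simp
  also have "\<dots> = T2 (id2 (assoc A B C)) ** (\<mu>2 (A \<otimes> B \<otimes> C) ** (T2 (id2 (t (A \<otimes> B) C)) ** (T2 (id2 (assoc_inv A B (T0 C))) **
       (id2 (t A (B \<otimes> T0 C)) ** pair2 x y))))"
    using \<mu>_nat_assoc[of "id2 (assoc A B C)" "T2 (id2 (t (A \<otimes> B) C)) ** (T2 (id2 (assoc_inv A B (T0 C))) **
       (id2 (t A (B \<otimes> T0 C)) ** pair2 x y))"] assms
    by (simp del: T2_comp_assoc assoc_typing(4) assoc_inv_typing(4))
  finally show ?thesis .
qed

text \<open>A pure parameter in the first argument may be attached before or after the two effects
  are run.\<close>

lemma \<omega>_t:
  assumes "x \<in> Ce K" "v \<in> Ce K" "c \<in> Ce K" "src x = Z" "src v = Z" "src c = Z"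
    "tgt x = A" "tgt v = T0 B" "tgt c = T0 C" "A \<in> Ob K" "B \<in> Ob K" "C \<in> Ob K"
  shows "T2 (id2 (assoc A B C)) ** (\<omega>2 (A \<otimes> B) C ** pair2 (id2 (t A B) ** pair2 x v) c)
    = id2 (t A (B \<otimes> C)) ** pair2 x (\<omega>2 B C ** pair2 v c)"
proof -
  have [simp]: "Z \<in> Ob K" using assms by auto
  show ?thesis
    using assms by (simp add: \<omega>_bnd[where Z = Z] t_bnd bnd_assoc bnd_\<eta> T2_bnd_push \<eta>_nat_assoc)
qed

lemma T2_assoc_inv:
  assumes "A \<in> Ob K" "B \<in> Ob K" "C \<in> Ob K" "x \<in> Ce K"
  shows "tgt x = T0 (A \<otimes> B \<otimes> C) \<Longrightarrow> T2 (id2 (assoc_inv A B C)) ** (T2 (id2 (assoc A B C)) ** x) = x"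
    "tgt x = T0 (A \<otimes> (B \<otimes> C)) \<Longrightarrow> T2 (id2 (assoc A B C)) ** (T2 (id2 (assoc_inv A B C)) ** x) = x"
  using assms by simp_all

lemma t'_pair_\<tau>:
  assumes "x \<in> Ce K" "u \<in> Ce K" "src x = Z" "src u = Z" "tgt x = B" "tgt u = T0 A" "A \<in> Ob K"
  shows "id2 (t' A B) ** pair2 u x = T2 (pair2 (p2 Z A) (x ** p1 Z A)) ** \<tau> A u"
  using assms by (auto simp add: t'_bnd bnd_ret)

text \<open>The middle 1-cells of the axiom \<open>\<Gamma>_\<mu>_left\<close> agree: both run the
  outer layer of \<open>u\<close>, then \<open>v\<close>, then the inner layer of
  \<open>u\<close>.\<close>

lemma \<mu>_\<omega>'_t':
  assumes "u \<in> Ce K" "v \<in> Ce K" "src u = Z" "src v = Z" "tgt u = T0 (T0 A)" "tgt v = T0 B" "A \<in> Ob K" "B \<in> Ob K"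
  shows "\<mu>2 (A \<otimes> B) ** (T2 (id2 (\<omega>' A B)) ** (id2 (t' (T0 A) (T0 B)) ** pair2 u v))
      = \<mu>2 (A \<otimes> B) ** (T2 (id2 (t' A B)) ** (\<omega>2 (T0 A) B ** pair2 u v))"
proof -
  have [simp]: "Z \<in> Ob K" using assms by auto
  have "\<mu>2 (A \<otimes> B) ** (T2 (id2 (\<omega>' A B)) ** (id2 (t' (T0 A) (T0 B)) ** pair2 u v))
    = bnd (T0 A) (A \<otimes> B) u (id2 (\<omega>' A B) ** pair2 (p2 Z (T0 A)) (v ** p1 Z (T0 A)))"
    using assms by (simp add: t'_pair_\<tau>[of _ _ Z] bnd_def)
  also have "\<dots> = bnd (T0 A) (A \<otimes> B) u (bnd B (A \<otimes> B) (v ** p1 Z (T0 A)) 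
     (id2 (t' A B) ** pair2 (p2 Z (T0 A) ** p1 (Z \<otimes> T0 A) B) (p2 (Z \<otimes> T0 A) B)))"
    using assms by (simp add: \<omega>_bnd[of _ _ "Z \<otimes> T0 A"] t'_bnd)
  also have "\<dots> = \<mu>2 (A \<otimes> B) ** (T2 (id2 (t' A B)) ** (\<omega>2 (T0 A) B ** pair2 u v))"
    using assms by (simp add: \<omega>_bnd[of _ _ Z] T2_bnd_push \<eta>_nat_assoc \<mu>_bnd bnd_assoc bnd_\<eta>)
  finally show ?thesis .
qed

text \<open>The middle 1-cells of the axiom \<open>\<Gamma>_\<mu>_right\<close> agree: both run the
  outer layer of \<open>v\<close>, then \<open>u\<close>, then the inner layer of
  \<open>v\<close>.\<close>

lemma \<mu>_\<omega>_t:
  assumes "u \<in> Ce K" "v \<in> Ce K" "src u = Z" "src v = Z" "tgt u = T0 A" "tgt v = T0 (T0 B)" "A \<in> Ob K" "B \<in> Ob K"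
  shows "\<mu>2 (A \<otimes> B) ** (T2 (\<omega>2 A B) ** (id2 (t (T0 A) (T0 B)) ** pair2 u v))
      = \<mu>2 (A \<otimes> B) ** (T2 (id2 (t A B)) ** (id2 (\<omega>' A (T0 B)) ** pair2 u v))"
proof -
  have [simp]: "Z \<in> Ob K" using assms by auto
  have "\<mu>2 (A \<otimes> B) ** (T2 (\<omega>2 A B) ** (id2 (t (T0 A) (T0 B)) ** pair2 u v))
    = bnd (T0 B) (A \<otimes> B) v (\<omega>2 A B ** pair2 (u ** p1 Z (T0 B)) (p2 Z (T0 B)))"
    using assms by (simp add: t_pair_\<tau> bnd_def)
  also have "\<dots> = bnd (T0 B) (A \<otimes> B) v (bnd A (A \<otimes> B) (u ** p1 Z (T0 B)) 
     (id2 (t A B) ** pair2 (p2 (Z \<otimes> T0 B) A) (p2 Z (T0 B) ** p1 (Z \<otimes> T0 B) A)))"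
    using assms by (simp add: \<omega>_bnd[of _ _ "Z \<otimes> T0 B"] t_bnd)
  also have "\<dots> = \<mu>2 (A \<otimes> B) ** (T2 (id2 (t A B)) ** (id2 (\<omega>' A (T0 B)) ** pair2 u v))"
    using assms by (simp add: \<omega>_bnd[of _ _ Z] T2_bnd_push \<eta>_nat_assoc \<mu>_bnd bnd_assoc bnd_\<eta>)
  finally show ?thesis .
qed

end

section \<open>The axioms of \<open>\<Gamma>\<close> on elements, and the laws of the inverse
  structure 2-cell\<close>

context pseudo_commutative_strong_two_monad
begin

lemma \<Gamma>_typing [simp]:
  assumes "A \<in> Ob K" "B \<in> Ob K"
  shows "\<Gamma> A B \<in> Ce K" "src (\<Gamma> A B) = T0 A \<otimes> T0 B" "tgt (\<Gamma> A B) = T0 (A \<otimes> B)"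
    "dm (\<Gamma> A B) = \<omega>2 A B" "cm (\<Gamma> A B) = id2 (\<omega>' A B)"
  using \<Gamma>_in[OF assms] assms by (auto simp: hom2_def src_def tgt_def dm_def cm_def)

text \<open>The modification axiom concerns 1-cells, so \<open>f\<close> and \<open>g\<close> are
  identity 2-cells; the elements \<open>u\<close> and \<open>v\<close> at which it is evaluated may
  be arbitrary.\<close>

lemma \<Gamma>_nat:
  assumes "idc f" "idc g" "u \<in> Ce K" "v \<in> Ce K" "src u = src v" "tgt u = T0 (src f)" "tgt v = T0 (src g)"
    "tgt f = A" "tgt g = B"
  shows "\<Gamma> A B ** pair2 (T2 f ** u) (T2 g ** v)
    = T2 (pair2 (f ** p1 (src f) (src g)) (g ** p2 (src f) (src g))) ** (\<Gamma> (src f) (src g) ** pair2 u v)"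
proof -
  have ce: "f \<in> Ce K" "g \<in> Ce K" using assms by (auto simp: idcD)
  note i = idc_id2_dom2[OF assms(1)] idc_id2_dom2[OF assms(2)]
  have "T1 (dom2 K f \<otimes>\<^sub>1 dom2 K g) \<lhd> \<Gamma> (src f) (src g) = \<Gamma> (tgt f) (tgt g) \<rhd> (T1 (dom2 K f) \<otimes>\<^sub>1 T1 (dom2 K g))"
    by (rule \<Gamma>_modification) (use ce in \<open>auto simp: hom1_def dom1_dom2_src\<close>)
  from arg_cong[OF this, of "\<lambda>x. x ** pair2 u v"] show ?thesis
    using assms ce i by (auto simp: dom1_dom2_src)
qed

text \<open>The axiom \<open>\<Gamma>_t_left\<close> solved for its left-hand
  \<open>\<Gamma>\<close> by inverting the associativity isomorphism.\<close>

lemma \<Gamma>_t1: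
  assumes "x \<in> Ce K" "u \<in> Ce K" "v \<in> Ce K" "src x = Z" "src u = Z" "src v = Z"
    "tgt x = A" "tgt u = T0 B" "tgt v = T0 C" "A \<in> Ob K" "B \<in> Ob K" "C \<in> Ob K"
  shows "\<Gamma> (A \<otimes> B) C ** pair2 (id2 (t A B) ** pair2 x u) v
    = T2 (id2 (assoc_inv A B C)) ** (id2 (t A (B \<otimes> C)) ** pair2 x (\<Gamma> B C ** pair2 u v))"
proof -
  have "T2 (id2 (assoc A B C)) ** (\<Gamma> (A \<otimes> B) C ** pair2 (id2 (t A B) ** pair2 x u) v)
    = id2 (t A (B \<otimes> C)) ** pair2 x (\<Gamma> B C ** pair2 u v)"
    using arg_cong[OF \<Gamma>_t_left[of A B C], of "\<lambda>\<alpha>. \<alpha> ** pair2 (pair2 x u) v"] assms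
    by (simp add: prod2_eq del: assoc_typing(4)) (simp)
  from arg_cong[OF this, of "\<lambda>x. T2 (id2 (assoc_inv A B C)) ** x"]
  show ?thesis
    using T2_assoc_inv(1)[of A B C "\<Gamma> (A \<otimes> B) C ** pair2 (id2 (t A B) ** pair2 x u) v"] assms
    by (simp del: assoc_typing(4) assoc_inv_typing(4) T2_comp_assoc)
qed

lemma \<Gamma>_t2:
  assumes "y \<in> Ce K" "u \<in> Ce K" "v \<in> Ce K" "src y = Z" "src u = Z" "src v = Z"
    "tgt u = T0 A" "tgt y = B" "tgt v = T0 C" "A \<in> Ob K" "B \<in> Ob K" "C \<in> Ob K"
  shows "\<Gamma> A (B \<otimes> C) ** pair2 u (id2 (t B C) ** pair2 y v)
    = T2 (id2 (assoc A B C)) ** (\<Gamma> (A \<otimes> B) C ** pair2 (id2 (t' A B) ** pair2 u y) v)"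
  using arg_cong[OF \<Gamma>_t_middle[of A B C], of "\<lambda>\<alpha>. \<alpha> ** pair2 (pair2 u y) v"] assms
  by simp

text \<open>Naturality takes \<open>f\<close> out of the first argument and
  \<open>\<Gamma>_t1\<close> takes out the context. What remains is \<open>\<Gamma>\<close> on the
  bare effects, followed by a pure function of the context and both results.\<close>

lemma \<Gamma>_\<tau>_left:
  assumes "u \<in> Ce K" "v \<in> Ce K" "src u = Z" "src v = Z" "tgt u = T0 A" "tgt v = T0 B"
    "A \<in> Ob K" "B \<in> Ob K" "idc f" "src f = Z \<otimes> A" "tgt f = C"
  shows "\<Gamma> C B ** pair2 (T2 f ** \<tau> A u) v
    = T2 (pair2 (f ** pair2 (p1 Z (A \<otimes> B)) (p1 A B ** p2 Z (A \<otimes> B))) (p2 A B ** p2 Z (A \<otimes> B)))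
        ** \<tau> (A \<otimes> B) (\<Gamma> A B ** pair2 u v)"
proof -
  have [simp]: "Z \<in> Ob K" "C \<in> Ob K" "f \<in> Ce K" using assms by (auto simp: idcD)
  have "\<Gamma> C B ** pair2 (T2 f ** \<tau> A u) v = \<Gamma> C B ** pair2 (T2 f ** \<tau> A u) (T2 (id2 (id1 B)) ** v)"
    using assms by simp
  also have "\<dots> = T2 (pair2 (f ** p1 (Z \<otimes> A) B) (p2 (Z \<otimes> A) B)) ** (\<Gamma> (Z \<otimes> A) B ** pair2 (\<tau> A u) v)"
    by (subst \<Gamma>_nat) (use assms in simp_all)
  also have "\<Gamma> (Z \<otimes> A) B ** pair2 (\<tau> A u) v = T2 (id2 (assoc_inv Z A B)) ** \<tau> (A \<otimes> B) (\<Gamma> A B ** pair2 u v)"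
    using \<Gamma>_t1[of "id2 (id1 Z)" u v Z Z A B] assms by (simp add: \<tau>_def)
  finally show ?thesis using assms by simp
qed

text \<open>The axiom \<open>\<Gamma>_t_middle\<close> turns a strength in the second argument into
  \<open>t'\<close> in the first, which is again expressed by \<open>\<tau>\<close>, so
  \<open>\<Gamma>_\<tau>_left\<close> applies.\<close>

lemma \<Gamma>_\<tau>_right:
  assumes "u \<in> Ce K" "v \<in> Ce K" "src u = Z" "src v = Z" "tgt u = T0 A" "tgt v = T0 B"
    "A \<in> Ob K" "B \<in> Ob K" "idc g" "src g = Z \<otimes> B" "tgt g = C"
  shows "\<Gamma> A C ** pair2 u (T2 g ** \<tau> B v)
    = T2 (pair2 (p1 A B ** p2 Z (A \<otimes> B)) (g ** pair2 (p1 Z (A \<otimes> B)) (p2 A B ** p2 Z (A \<otimes> B))))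
        ** \<tau> (A \<otimes> B) (\<Gamma> A B ** pair2 u v)"
proof -
  have [simp]: "Z \<in> Ob K" "C \<in> Ob K" "g \<in> Ce K" using assms by (auto simp: idcD)
  have "\<Gamma> A C ** pair2 u (T2 g ** \<tau> B v) = \<Gamma> A C ** pair2 (T2 (id2 (id1 A)) ** u) (T2 g ** \<tau> B v)"
    using assms by simp
  also have "\<dots> = T2 (pair2 (p1 A (Z \<otimes> B)) (g ** p2 A (Z \<otimes> B))) ** (\<Gamma> A (Z \<otimes> B) ** pair2 u (\<tau> B v))"
    by (subst \<Gamma>_nat) (use assms in simp_all)
  also have "\<Gamma> A (Z \<otimes> B) ** pair2 u (\<tau> B v)
     = T2 (id2 (assoc A Z B)) ** (\<Gamma> (A \<otimes> Z) B ** pair2 (T2 (pair2 (p2 Z A) (p1 Z A)) ** \<tau> A u) v)"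
    using \<Gamma>_t2[of "id2 (id1 Z)" u v Z A Z B] assms by (simp add: \<tau>_def[of B] t'_pair_\<tau>[of _ _ Z])
  finally show ?thesis using assms by (simp add: \<Gamma>_\<tau>_left[where Z = Z])
qed

text \<open>Extracting on the left and then on the right attaches the context twice;
  \<open>\<tau>_\<tau>\<close> merges the copies.\<close>

lemma \<Gamma>_\<tau>:
  assumes "u \<in> Ce K" "v \<in> Ce K" "src u = Z" "src v = Z" "tgt u = T0 A" "tgt v = T0 B"
    "A \<in> Ob K" "B \<in> Ob K" "idc f" "src f = Z \<otimes> A" "tgt f = C" "idc g" "src g = Z \<otimes> B" "tgt g = D"
  shows "\<Gamma> C D ** pair2 (T2 f ** \<tau> A u) (T2 g ** \<tau> B v)
    = T2 (pair2 (f ** pair2 (p1 Z (A \<otimes> B)) (p1 A B ** p2 Z (A \<otimes> B)))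
                (g ** pair2 (p1 Z (A \<otimes> B)) (p2 A B ** p2 Z (A \<otimes> B))))
        ** \<tau> (A \<otimes> B) (\<Gamma> A B ** pair2 u v)"
proof -
  have [simp]: "Z \<in> Ob K" "C \<in> Ob K" "D \<in> Ob K" "f \<in> Ce K" "g \<in> Ce K" using assms by (auto simp: idcD)
  let ?G = "\<Gamma> A B ** pair2 u v"
  have G: "?G \<in> Ce K" "src ?G = Z" "tgt ?G = T0 (A \<otimes> B)" using assms by simp_all
  let ?r = "pair2 (p1 A B ** p2 Z (A \<otimes> B)) (g ** pair2 (p1 Z (A \<otimes> B)) (p2 A B ** p2 Z (A \<otimes> B)))"
  have r: "?r \<in> Ce K" "src ?r = Z \<otimes> (A \<otimes> B)" "tgt ?r = A \<otimes> D" using assms by simp_all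
  have "\<tau> (A \<otimes> D) (T2 ?r ** \<tau> (A \<otimes> B) ?G) = T2 (pair2 (p1 Z (A \<otimes> B)) ?r) ** \<tau> (A \<otimes> B) ?G"
    using \<tau>_T2[of "\<tau> (A \<otimes> B) ?G" ?r "A \<otimes> D"] \<tau>_\<tau>[of ?G "A \<otimes> B"] G r assms
    by simp
  then show ?thesis
    using \<Gamma>_\<tau>_left[of u "T2 g ** \<tau> B v" Z A D f C] \<Gamma>_\<tau>_right[of u v Z A B g D] assms G r
    by simp
qed

text \<open>The axiom \<open>\<Gamma>_\<mu>_left\<close> on elements. Precomposition has to pass
  through a vertical composite, which requires identities \<open>u\<close> and \<open>v\<close> and
  the agreement of the middle 1-cells.\<close>

lemma \<Gamma>_\<mu>1:
  assumes "idc u" "idc v" "src u = Z" "src v = Z" "tgt u = T0 (T0 A)" "tgt v = T0 B" "A \<in> Ob K" "B \<in> Ob K"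
  shows "\<Gamma> A B ** pair2 (\<mu>2 A ** u) v
    = (\<mu>2 (A \<otimes> B) ** (T2 (id2 (t' A B)) ** (\<Gamma> (T0 A) B ** pair2 u v)))
      \<cdot> (\<mu>2 (A \<otimes> B) ** (T2 (\<Gamma> A B) ** (id2 (t' (T0 A) (T0 B)) ** pair2 u v)))"
proof -
  have c: "u \<in> Ce K" "v \<in> Ce K" using assms by (auto simp: idcD)
  let ?P = "\<mu>2 (A \<otimes> B) ** (T2 (id2 (t' A B)) ** \<Gamma> (T0 A) B)"
  let ?Q = "\<mu>2 (A \<otimes> B) ** (T2 (\<Gamma> A B) ** id2 (t' (T0 A) (T0 B)))"
  have e: "\<Gamma> A B ** id2 (\<mu> A \<otimes>\<^sub>1 id1 (T0 B)) = ?P \<cdot> ?Q"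
    using \<Gamma>_\<mu>_left[of A B] assms by simp
  have "cm ?Q = \<mu>2 (A \<otimes> B) ** (T2 (id2 (\<omega>' A B)) ** id2 (t' (T0 A) (T0 B)))"
    using assms by simp
  also have "\<dots> = dm ?P"
    using \<mu>_\<omega>'_t'[of "p1 (T0 (T0 A)) (T0 B)" "p2 (T0 (T0 A)) (T0 B)" "T0 (T0 A) \<otimes> T0 B" A B] assms
    by simp
  finally have d: "cm ?Q = dm ?P" .
  have "(?P \<cdot> ?Q) ** pair2 u v = (?P ** pair2 u v) \<cdot> (?Q ** pair2 u v)"
    by (rule whisker_vcomp_right) (use assms c d in simp_all)
  then show ?thesis
    using arg_cong[OF e, of "\<lambda>\<alpha>. \<alpha> ** pair2 u v"] assms c by simp
qed

text \<open>Runs from \<open>\<omega>\<close> after \<open>\<mu>\<close> in the second argument to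
  the extension of \<open>\<omega>\<close> along the strength, against the direction of an algebra
  structure 2-cell. Its laws are computed first and inverted later.\<close>

definition D :: "'o \<Rightarrow> 'o \<Rightarrow> 't" where
  "D A B = \<mu>2 (A \<otimes> B) ** (T2 (id2 (t A B)) ** \<Gamma> A (T0 B))"

lemma D_typing [simp]:
  assumes "A \<in> Ob K" "B \<in> Ob K"
  shows "D A B \<in> Ce K" "src (D A B) = T0 A \<otimes> T0 (T0 B)" "tgt (D A B) = T0 (A \<otimes> B)"
    "cm (D A B) = \<mu>2 (A \<otimes> B) ** (T2 (\<omega>2 A B) ** id2 (t (T0 A) (T0 B)))"
    "dm (D A B) = \<omega>2 A B ** pair2 (p1 (T0 A) (T0 (T0 B))) (\<mu>2 B ** p2 (T0 A) (T0 (T0 B)))"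
proof -
  let ?p = "p1 (T0 A) (T0 (T0 B))" and ?q = "p2 (T0 A) (T0 (T0 B))"
  let ?Z = "T0 A \<otimes> T0 (T0 B)"
  show "D A B \<in> Ce K" "src (D A B) = T0 A \<otimes> T0 (T0 B)" "tgt (D A B) = T0 (A \<otimes> B)"
    using assms by (simp_all add: D_def)
  show "cm (D A B) = \<mu>2 (A \<otimes> B) ** (T2 (\<omega>2 A B) ** id2 (t (T0 A) (T0 B)))"
    using \<mu>_\<omega>_t[of ?p ?q ?Z A B] assms by (simp add: D_def)
  \<comment> \<open>The source of \<open>D\<close>: both sides run \<open>u\<close>, then the outer
    and the inner layer of \<open>v\<close>.\<close>
  have w: "\<mu>2 (A \<otimes> B) ** (T2 (id2 (t A B)) ** (\<omega>2 A (T0 B) ** pair2 u v))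
     = \<omega>2 A B ** pair2 u (\<mu>2 B ** v)"
    if "u \<in> Ce K" "v \<in> Ce K" "src u = Z" "src v = Z" "tgt u = T0 A" "tgt v = T0 (T0 B)" for u v Z
  proof -
    have [simp]: "Z \<in> Ob K" using that by auto
    have "\<mu>2 (A \<otimes> B) ** (T2 (id2 (t A B)) ** (\<omega>2 A (T0 B) ** pair2 u v))
      = bnd A (A \<otimes> B) u (bnd (T0 B) (A \<otimes> B) (v ** p1 Z A) 
      (id2 (t A B) ** pair2 (p2 Z A ** p1 (Z \<otimes> A) (T0 B)) (p2 (Z \<otimes> A) (T0 B))))"
      using assms that by (simp add: \<omega>_bnd[of _ _ Z] T2_bnd_push \<eta>_nat_assoc \<mu>_bnd bnd_assoc bnd_\<eta>)
    also have "\<dots> = \<omega>2 A B ** pair2 u (\<mu>2 B ** v)"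
      using assms that by (simp add: \<omega>_bnd[of _ _ Z] \<mu>_bnd bnd_assoc t_bnd)
    finally show ?thesis .
  qed
  show "dm (D A B) = \<omega>2 A B ** pair2 ?p (\<mu>2 B ** ?q)"
    using w[of ?p ?q ?Z] assms by (simp add: D_def)
qed

text \<open>The axiom \<open>\<Gamma>_\<mu>_right\<close>, whose factor that comes first in time is
  exactly \<open>D\<close>.\<close>

lemma \<Gamma>_\<mu>2:
  assumes "A \<in> Ob K" "B \<in> Ob K"
  shows "\<Gamma> A B ** pair2 (p1 (T0 A) (T0 (T0 B))) (\<mu>2 B ** p2 (T0 A) (T0 (T0 B)))
      = (\<mu>2 (A \<otimes> B) ** (T2 (\<Gamma> A B) ** id2 (t (T0 A) (T0 B)))) \<cdot> D A B"
  using \<Gamma>_\<mu>_right[of A B] assms by (simp add: D_def)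

text \<open>\<open>D\<close> reorders the effects by \<open>\<Gamma>\<close> and then runs the inner
  layer of \<open>v\<close> through the strength.\<close>

lemma D_pair:
  assumes "u \<in> Ce K" "v \<in> Ce K" "src u = Z" "src v = Z" "tgt u = T0 A" "tgt v = T0 (T0 B)" "A \<in> Ob K" "B \<in> Ob K"
  shows "D A B ** pair2 u v = bnd (A \<otimes> T0 B) (A \<otimes> B) (\<Gamma> A (T0 B) ** pair2 u v) (id2 (t A B) ** p2 Z (A \<otimes> T0 B))"
proof -
  have "Z \<in> Ob K" using assms by auto
  then show ?thesis
    using assms T2_pr2_\<tau>[of "\<Gamma> A (T0 B) ** pair2 u v" "A \<otimes> T0 B"] T2_comp_assoc[symmetric, of "p2 Z (A \<otimes> T0 B)" "id2 (t A B)"]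
    by (simp add: D_def bnd_def del: T2_comp_assoc)
qed

lemma D_\<tau>:
  assumes "u \<in> Ce K" "v \<in> Ce K" "src u = Z" "src v = Z" "tgt u = T0 A" "tgt v = T0 B"
    "A \<in> Ob K" "B \<in> Ob K" "idc g" "src g = Z \<otimes> B" "tgt g = T0 C" "C \<in> Ob K"
  shows "D A C ** pair2 u (T2 g ** \<tau> B v)
    = bnd (A \<otimes> B) (A \<otimes> C) (\<Gamma> A B ** pair2 u v)
       (id2 (t A C) ** pair2 (p1 A B ** p2 Z (A \<otimes> B)) (g ** pair2 (p1 Z (A \<otimes> B)) (p2 A B ** p2 Z (A \<otimes> B))))"
proof -
  have [simp]: "Z \<in> Ob K" "g \<in> Ce K" using assms by (auto simp: idcD)
  show ?thesis
    using assms by (simp add: D_def \<Gamma>_\<tau>_right[where Z = Z] bnd_def)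
qed

text \<open>The axiom \<open>\<Gamma>_\<mu>_left\<close> at \<open>A\<close> and
  \<open>T0 B\<close>, whiskered by \<open>\<mu>\<close> and \<open>T t\<close>. Naturality and
  associativity of \<open>\<mu>\<close> move the strength inwards, where it completes
  \<open>t'\<close> to \<open>\<omega>\<close> in one factor and \<open>\<Gamma>\<close> to
  \<open>D\<close> in the other. The versions with \<open>\<tau>\<close> and with \<open>t'\<close>
  and the composability of the factors serve different later arguments.\<close>

lemma D_\<mu>1:
  assumes "idc u" "idc v" "src u = Z" "src v = Z" "tgt u = T0 (T0 A)" "tgt v = T0 (T0 B)" "A \<in> Ob K" "B \<in> Ob K"
  shows "D A B ** pair2 (\<mu>2 A ** u) v
    = (\<mu>2 (A \<otimes> B) ** (T2 (\<omega>2 A B) ** (\<Gamma> (T0 A) (T0 B) ** pair2 u v)))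
      \<cdot> (\<mu>2 (A \<otimes> B) ** (T2 (D A B ** pair2 (p2 Z (T0 A)) (v ** p1 Z (T0 A))) ** \<tau> (T0 A) u))"
    "D A B ** pair2 (\<mu>2 A ** u) v
    = (\<mu>2 (A \<otimes> B) ** (T2 (\<omega>2 A B) ** (\<Gamma> (T0 A) (T0 B) ** pair2 u v)))
      \<cdot> (\<mu>2 (A \<otimes> B) ** (T2 (D A B) ** (id2 (t' (T0 A) (T0 (T0 B))) ** pair2 u v)))"
    "cm (\<mu>2 (A \<otimes> B) ** (T2 (D A B ** pair2 (p2 Z (T0 A)) (v ** p1 Z (T0 A))) ** \<tau> (T0 A) u))
     = dm (\<mu>2 (A \<otimes> B) ** (T2 (\<omega>2 A B) ** (\<Gamma> (T0 A) (T0 B) ** pair2 u v)))"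
proof -
  have c [simp]: "u \<in> Ce K" "v \<in> Ce K" "Z \<in> Ob K" using assms by (auto simp: idcD)
  let ?m = "\<mu>2 (A \<otimes> B)" and ?t = "id2 (t A B)" and ?AB = "A \<otimes> T0 B"
  let ?G = "\<Gamma> (T0 A) (T0 B) ** pair2 u v"
  let ?P = "\<mu>2 ?AB ** (T2 (id2 (t' A (T0 B))) ** ?G)"
  let ?s = "id2 (t' (T0 A) (T0 (T0 B))) ** pair2 u v"
  let ?Q = "\<mu>2 ?AB ** (T2 (\<Gamma> A (T0 B)) ** ?s)"
  have e: "\<Gamma> A (T0 B) ** pair2 (\<mu>2 A ** u) v = ?P \<cdot> ?Q"
    by (rule \<Gamma>_\<mu>1) (use assms in simp_all)
  have s: "?s = T2 (pair2 (p2 Z (T0 A)) (v ** p1 Z (T0 A))) ** \<tau> (T0 A) u"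
    by (rule t'_pair_\<tau>) (use assms in simp_all)
  have d: "cm ?Q = dm ?P"
    using \<mu>_\<omega>'_t'[of u v Z A "T0 B"] assms by simp
  have D: "D A B ** pair2 (\<mu>2 A ** u) v = ?m ** (T2 ?t ** (\<Gamma> A (T0 B) ** pair2 (\<mu>2 A ** u) v))"
    using assms by (simp add: D_def)
  have "\<dots> = (?m ** (T2 ?t ** ?P)) \<cdot> (?m ** (T2 ?t ** ?Q))"
  proof -
    have "T2 ?t ** (?P \<cdot> ?Q) = (T2 ?t ** ?P) \<cdot> (T2 ?t ** ?Q)"
      by (rule whisker_vcomp_left) (use assms d in simp_all)
    moreover have "?m ** ((T2 ?t ** ?P) \<cdot> (T2 ?t ** ?Q)) = (?m ** (T2 ?t ** ?P)) \<cdot> (?m ** (T2 ?t ** ?Q))"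
    proof (rule whisker_vcomp_left)
      show "cm (T2 ?t ** ?Q) = dm (T2 ?t ** ?P)"
        using d assms by (subst dm_hcomp; (subst dm_hcomp)?) (simp_all del: dm_hcomp)
    qed (use assms in simp_all)
    ultimately show ?thesis unfolding e by simp
  qed
  \<comment> \<open>Below the outer \<open>\<mu>\<close>, the terms \<open>\<mu>\<close>,
    \<open>T t\<close> and \<open>t'\<close> fold back to the definition of
    \<open>\<omega>\<close>.\<close>
  moreover have p: "?m ** (T2 ?t ** ?P) = ?m ** (T2 (\<omega>2 A B) ** ?G)"
  proof -
    have "?m ** (T2 ?t ** ?P) = ?m ** (\<mu>2 (T0 (A \<otimes> B)) ** (T2 (T2 ?t) ** (T2 (id2 (t' A (T0 B))) ** ?G)))"
      using \<mu>_nat_assoc[of ?t "T2 (id2 (t' A (T0 B))) ** ?G"] assms by (simp del: T2_comp_assoc)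
    also have "\<dots> = ?m ** (T2 (\<omega>2 A B) ** ?G)"
      using assms by (simp add: \<mu>_assoc \<omega>_def)
    finally show ?thesis .
  qed
  moreover have f: "?m ** (T2 ?t ** ?Q) = ?m ** (T2 (D A B) ** ?s)"
  proof -
    have "?m ** (T2 ?t ** ?Q) = ?m ** (\<mu>2 (T0 (A \<otimes> B)) ** (T2 (T2 ?t) ** (T2 (\<Gamma> A (T0 B)) ** ?s)))"
      using \<mu>_nat_assoc[of ?t "T2 (\<Gamma> A (T0 B)) ** ?s"] assms by (simp del: T2_comp_assoc)
    also have "\<dots> = ?m ** (T2 (D A B) ** ?s)"
      using assms by (simp add: \<mu>_assoc D_def)
    finally show ?thesis .
  qed
  ultimately show r: "D A B ** pair2 (\<mu>2 A ** u) v
    = (?m ** (T2 (\<omega>2 A B) ** (\<Gamma> (T0 A) (T0 B) ** pair2 u v))) \<cdot> (?m ** (T2 (D A B) ** ?s))"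
    using D by simp
  have g: "?m ** (T2 (D A B) ** ?s) = ?m ** (T2 (D A B ** pair2 (p2 Z (T0 A)) (v ** p1 Z (T0 A))) ** \<tau> (T0 A) u)"
    unfolding s using assms by simp
  show "D A B ** pair2 (\<mu>2 A ** u) v = (?m ** (T2 (\<omega>2 A B) ** (\<Gamma> (T0 A) (T0 B) ** pair2 u v)))
      \<cdot> (?m ** (T2 (D A B ** pair2 (p2 Z (T0 A)) (v ** p1 Z (T0 A))) ** \<tau> (T0 A) u))"
    using r unfolding g .
  show "cm (?m ** (T2 (D A B ** pair2 (p2 Z (T0 A)) (v ** p1 Z (T0 A))) ** \<tau> (T0 A) u))
     = dm (?m ** (T2 (\<omega>2 A B) ** (\<Gamma> (T0 A) (T0 B) ** pair2 u v)))"
  proof -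
    have "cm (?m ** (T2 ?t ** ?Q)) = ?m ** (T2 ?t ** cm ?Q)" using assms by simp
    also have "\<dots> = dm (?m ** (T2 ?t ** ?P))" unfolding d using assms by simp
    finally show ?thesis using f g p by simp
  qed
qed

text \<open>The axiom \<open>\<Gamma>_\<mu>_right\<close> at \<open>A\<close> and
  \<open>T0 B\<close>. Its factor \<open>D A (T0 B)\<close> becomes, after whiskering,
  \<open>D A B\<close> at an argument with \<open>\<mu>\<close> applied to the inner layers, by the
  multiplication axiom of the strength and naturality of \<open>\<Gamma>\<close>.\<close>

lemma D_\<mu>2:
  assumes "idc u" "idc v" "src u = Z" "src v = Z" "tgt u = T0 A" "tgt v = T0 (T0 (T0 B))" "A \<in> Ob K" "B \<in> Ob K"
  shows "D A B ** pair2 u (\<mu>2 (T0 B) ** v)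
    = (\<mu>2 (A \<otimes> B) ** (T2 (D A B ** pair2 (u ** p1 Z (T0 (T0 B))) (p2 Z (T0 (T0 B)))) ** \<tau> (T0 (T0 B)) v))
      \<cdot> (D A B ** pair2 u (T2 (\<mu>2 B) ** v))"
    "cm (D A B ** pair2 u (T2 (\<mu>2 B) ** v))
     = dm (\<mu>2 (A \<otimes> B) ** (T2 (D A B ** pair2 (u ** p1 Z (T0 (T0 B))) (p2 Z (T0 (T0 B)))) ** \<tau> (T0 (T0 B)) v))"
proof -
  have c [simp]: "u \<in> Ce K" "v \<in> Ce K" "Z \<in> Ob K" using assms by (auto simp: idcD)
  let ?m = "\<mu>2 (A \<otimes> B)" and ?t = "id2 (t A B)" and ?AB = "A \<otimes> T0 B"
  let ?G = "\<Gamma> A (T0 (T0 B)) ** pair2 u v"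
  let ?s = "id2 (t (T0 A) (T0 (T0 B))) ** pair2 u v"
  let ?P = "\<mu>2 ?AB ** (T2 (\<Gamma> A (T0 B)) ** ?s)"
  let ?Q = "D A (T0 B) ** pair2 u v"
  have s: "?s = T2 (pair2 (u ** p1 Z (T0 (T0 B))) (p2 Z (T0 (T0 B)))) ** \<tau> (T0 (T0 B)) v"
    using t_pair_\<tau>[of u v "T0 A" "T0 (T0 B)"] assms by simp
  have d: "cm ?Q = dm ?P"
    using assms by simp
  have "\<Gamma> A (T0 B) ** pair2 u (\<mu>2 (T0 B) ** v) = ((\<mu>2 ?AB ** (T2 (\<Gamma> A (T0 B)) ** id2 (t (T0 A) (T0 (T0 B))))) \<cdot> D A (T0 B)) ** pair2 u v"
    using arg_cong[OF \<Gamma>_\<mu>2[of A "T0 B"], of "\<lambda>\<alpha>. \<alpha> ** pair2 u v"] assms by simp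
  also have "\<dots> = ((\<mu>2 ?AB ** (T2 (\<Gamma> A (T0 B)) ** id2 (t (T0 A) (T0 (T0 B))))) ** pair2 u v) \<cdot> ?Q"
    by (rule whisker_vcomp_right) (use assms in simp_all)
  finally have e: "\<Gamma> A (T0 B) ** pair2 u (\<mu>2 (T0 B) ** v) = ?P \<cdot> ?Q"
    using assms by simp
  have D: "D A B ** pair2 u (\<mu>2 (T0 B) ** v) = ?m ** (T2 ?t ** (\<Gamma> A (T0 B) ** pair2 u (\<mu>2 (T0 B) ** v)))"
    using assms by (simp add: D_def)
  have "\<dots> = (?m ** (T2 ?t ** ?P)) \<cdot> (?m ** (T2 ?t ** ?Q))"
  proof -
    have "T2 ?t ** (?P \<cdot> ?Q) = (T2 ?t ** ?P) \<cdot> (T2 ?t ** ?Q)"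
      by (rule whisker_vcomp_left) (use assms d in simp_all)
    moreover have "?m ** ((T2 ?t ** ?P) \<cdot> (T2 ?t ** ?Q)) = (?m ** (T2 ?t ** ?P)) \<cdot> (?m ** (T2 ?t ** ?Q))"
    proof (rule whisker_vcomp_left)
      show "cm (T2 ?t ** ?Q) = dm (T2 ?t ** ?P)"
        using d assms by (subst dm_hcomp; (subst dm_hcomp)?) (simp_all del: dm_hcomp)
    qed (use assms in simp_all)
    ultimately show ?thesis unfolding e by simp
  qed
  moreover have p: "?m ** (T2 ?t ** ?P) = ?m ** (T2 (D A B ** pair2 (u ** p1 Z (T0 (T0 B))) (p2 Z (T0 (T0 B)))) ** \<tau> (T0 (T0 B)) v)"
  proof -
    have "?m ** (T2 ?t ** ?P) = ?m ** (\<mu>2 (T0 (A \<otimes> B)) ** (T2 (T2 ?t) ** (T2 (\<Gamma> A (T0 B)) ** ?s)))"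
      using \<mu>_nat_assoc[of ?t "T2 (\<Gamma> A (T0 B)) ** ?s"] assms by (simp del: T2_comp_assoc)
    also have "\<dots> = ?m ** (T2 (D A B) ** ?s)"
      using assms by (simp add: \<mu>_assoc D_def)
    finally show ?thesis unfolding s using assms by simp
  qed
  moreover have q: "?m ** (T2 ?t ** ?Q) = D A B ** pair2 u (T2 (\<mu>2 B) ** v)"
  proof -
    have "?m ** (T2 ?t ** ?Q) = ?m ** (T2 ?t ** (\<mu>2 ?AB ** (T2 (id2 (t A (T0 B))) ** ?G)))"
      using assms by (simp add: D_def)
    also have "\<dots> = ?m ** (\<mu>2 (T0 (A \<otimes> B)) ** (T2 (T2 ?t) ** (T2 (id2 (t A (T0 B))) ** ?G)))"
      using \<mu>_nat_assoc[of ?t "T2 (id2 (t A (T0 B))) ** ?G"] assms by (simp del: T2_comp_assoc)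
    also have "\<dots> = ?m ** (T2 (?m ** (T2 ?t ** id2 (t A (T0 B)))) ** ?G)"
      using assms by (simp add: \<mu>_assoc)
    also have "?m ** (T2 ?t ** id2 (t A (T0 B))) = ?t ** pair2 (p1 A (T0 (T0 B))) (\<mu>2 B ** p2 A (T0 (T0 B)))"
      using arg_cong[OF t_\<mu>[of A B], of id2] assms by simp
    also have "?m ** (T2 (?t ** pair2 (p1 A (T0 (T0 B))) (\<mu>2 B ** p2 A (T0 (T0 B)))) ** ?G) = D A B ** pair2 u (T2 (\<mu>2 B) ** v)"
      using \<Gamma>_nat[of "id2 (id1 A)" "\<mu>2 B" u v A "T0 B"] assms by (simp add: D_def)
    finally show ?thesis .
  qed
  ultimately show "D A B ** pair2 u (\<mu>2 (T0 B) ** v)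
    = (\<mu>2 (A \<otimes> B) ** (T2 (D A B ** pair2 (u ** p1 Z (T0 (T0 B))) (p2 Z (T0 (T0 B)))) ** \<tau> (T0 (T0 B)) v))
      \<cdot> (D A B ** pair2 u (T2 (\<mu>2 B) ** v))"
    using D by simp
  have "cm (?m ** (T2 ?t ** ?Q)) = ?m ** (T2 ?t ** cm ?Q)" using assms by simp
  also have "\<dots> = dm (?m ** (T2 ?t ** ?P))" unfolding d using assms by simp
  finally show "cm (D A B ** pair2 u (T2 (\<mu>2 B) ** v))
     = dm (\<mu>2 (A \<otimes> B) ** (T2 (D A B ** pair2 (u ** p1 Z (T0 (T0 B))) (p2 Z (T0 (T0 B)))) ** \<tau> (T0 (T0 B)) v))"
    unfolding p q .
qed

lemma D_nat:
  assumes "idc f" "idc g" "u \<in> Ce K" "v \<in> Ce K" "src u = src v" "tgt u = T0 (src f)" "tgt v = T0 (T0 (src g))" "tgt f = A" "tgt g = B"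
  shows "D A B ** pair2 (T2 f ** u) (T2 (T2 g) ** v)
    = T2 (pair2 (f ** p1 (src f) (src g)) (g ** p2 (src f) (src g))) ** (D (src f) (src g) ** pair2 u v)"
proof -
  have [simp]: "f \<in> Ce K" "g \<in> Ce K" using assms by (auto simp: idcD)
  have [simp]: "A \<in> Ob K" "B \<in> Ob K" using assms by auto
  let ?G = "\<Gamma> (src f) (T0 (src g)) ** pair2 u v" and ?fg = "pair2 (f ** p1 (src f) (src g)) (g ** p2 (src f) (src g))"
  have "id2 (t A B) ** pair2 (f ** p1 (src f) (T0 (src g))) (T2 g ** p2 (src f) (T0 (src g))) = T2 ?fg ** id2 (t (src f) (src g))"
    using t_nat[of f g "p1 (src f) (T0 (src g))" "p2 (src f) (T0 (src g))"] assms by simp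
  then have "D A B ** pair2 (T2 f ** u) (T2 (T2 g) ** v) = \<mu>2 (A \<otimes> B) ** (T2 (T2 ?fg) ** (T2 (id2 (t (src f) (src g))) ** ?G))"
    using assms \<Gamma>_nat[of f "T2 g" u v A "T0 B"] by (simp add: D_def)
  also have "\<dots> = T2 ?fg ** (D (src f) (src g) ** pair2 u v)"
    using \<mu>_nat_assoc[of ?fg "T2 (id2 (t (src f) (src g))) ** ?G"] assms by (simp add: D_def del: T2_comp_assoc)
  finally show ?thesis .
qed

text \<open>The axioms \<open>\<Gamma>_\<eta>_right\<close> and \<open>\<Gamma>_\<eta>_left\<close>:
  there is nothing to commute when one argument is a pure value.\<close>

lemma D_\<eta>:
  assumes "idc u" "idc v" "src u = Z" "src v = Z" "A \<in> Ob K" "B \<in> Ob K"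
  shows "tgt u = T0 A \<Longrightarrow> tgt v = T0 B \<Longrightarrow> idc (D A B ** pair2 u (\<eta>2 (T0 B) ** v))"
    "tgt u = A \<Longrightarrow> tgt v = T0 (T0 B) \<Longrightarrow> idc (D A B ** pair2 (\<eta>2 A ** u) v)"
proof -
  have c [simp]: "u \<in> Ce K" "v \<in> Ce K" "Z \<in> Ob K" using assms by (auto simp: idcD)
  {
    assume a: "tgt u = T0 A" "tgt v = T0 B"
    have "\<Gamma> A (T0 B) ** pair2 u (\<eta>2 (T0 B) ** v) = \<omega>2 A (T0 B) ** pair2 u (\<eta>2 (T0 B) ** v)"
      using arg_cong[OF \<Gamma>_\<eta>_right[of A "T0 B"], of "\<lambda>\<alpha>. \<alpha> ** pair2 u v"] assms a by simp
    then show "idc (D A B ** pair2 u (\<eta>2 (T0 B) ** v))" using assms a by (simp add: D_def)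
  }
  {
    assume a: "tgt u = A" "tgt v = T0 (T0 B)"
    have "\<Gamma> A (T0 B) ** pair2 (\<eta>2 A ** u) v = \<omega>2 A (T0 B) ** pair2 (\<eta>2 A ** u) v"
      using arg_cong[OF \<Gamma>_\<eta>_left[of A "T0 B"], of "\<lambda>\<alpha>. \<alpha> ** pair2 u v"] assms a by simp
    then show "idc (D A B ** pair2 (\<eta>2 A ** u) v)" using assms a by (simp add: D_def)
  }
qed

text \<open>The outer \<open>\<omega>\<close> runs its first argument first, so it moves below the
  binder for the result of \<open>\<Gamma>\<close>. There \<open>\<omega>_t\<close> takes
  \<open>w\<close> below the strength, and \<open>D_\<tau>\<close> recognizes the outcome as
  \<open>D\<close> at \<open>B \<otimes> C\<close>.\<close>

lemma D_\<omega>_middle: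
  assumes "u \<in> Ce K" "v \<in> Ce K" "w \<in> Ce K" "src u = Z" "src v = Z" "src w = Z"
    "tgt u = T0 A" "tgt v = T0 (T0 B)" "tgt w = T0 C" "A \<in> Ob K" "B \<in> Ob K" "C \<in> Ob K" "idc w"
  shows "\<omega>2 (A \<otimes> B) C ** pair2 (D A B ** pair2 u v) w
    = T2 (id2 (assoc_inv A B C)) ** (D A (B \<otimes> C) ** pair2 u
        (T2 (\<omega>2 B C ** pair2 (p2 Z (T0 B)) (w ** p1 Z (T0 B))) ** \<tau> (T0 B) v))"
proof -
  have [simp]: "Z \<in> Ob K" using assms by auto
  let ?G = "\<Gamma> A (T0 B) ** pair2 u v" and ?p = "p1 Z (A \<otimes> T0 B)" and ?q = "p2 Z (A \<otimes> T0 B)"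
  let ?a = "p1 A (T0 B) ** ?q" and ?b = "p2 A (T0 B) ** ?q"
  have qq: "pair2 ?a ?b = ?q" using assms by (simp flip: pair2_hcomp)
  have k: "\<omega>2 (A \<otimes> B) C ** pair2 (id2 (t A B) ** ?q) (w ** ?p)
    = T2 (id2 (assoc_inv A B C)) ** (id2 (t A (B \<otimes> C)) ** pair2 ?a (\<omega>2 B C ** pair2 ?b (w ** ?p)))"
    using \<omega>_t[of ?a ?b "w ** ?p" "Z \<otimes> (A \<otimes> T0 B)" A B C, symmetric] T2_assoc_inv(1)[of A B C "\<omega>2 (A \<otimes> B) C ** pair2 (id2 (t A B) ** ?q) (w ** ?p)"] assms
    unfolding qq by (simp del: T2_comp_assoc assoc_typing(4) assoc_inv_typing(4))
  have "\<omega>2 (A \<otimes> B) C ** pair2 (D A B ** pair2 u v) w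
    = bnd (A \<otimes> T0 B) (A \<otimes> B \<otimes> C) ?G (\<omega>2 (A \<otimes> B) C ** pair2 (id2 (t A B) ** ?q) (w ** ?p))"
    using assms by (simp add: D_pair[of _ _ Z] \<omega>_bnd_left[of _ _ _ Z])
  also have "\<dots> = T2 (id2 (assoc_inv A B C)) ** bnd (A \<otimes> T0 B) (A \<otimes> (B \<otimes> C)) ?G (id2 (t A (B \<otimes> C)) ** pair2 ?a (\<omega>2 B C ** pair2 ?b (w ** ?p)))"
    unfolding k using assms by (simp add: T2_bnd_push del: assoc_inv_typing(4))
  finally show ?thesis
    using assms by (simp add: D_\<tau>[of _ _ Z] del: assoc_inv_typing(4))
qed

text \<open>The computation \<open>\<omega>\<close> of \<open>u\<close> and \<open>v\<close> is
  written as \<open>\<mu>\<close> of one that runs \<open>u\<close> and returns a computation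
  involving \<open>v\<close>. Then the law of \<open>D\<close> for \<open>\<mu>\<close> in its first
  argument applies, and its two factors are identified separately.\<close>

lemma D_\<omega>_right:
  assumes "idc u" "idc v" "idc w" "src u = Z" "src v = Z" "src w = Z"
    "tgt u = T0 A" "tgt v = T0 B" "tgt w = T0 (T0 C)" "A \<in> Ob K" "B \<in> Ob K" "C \<in> Ob K"
  shows "T2 (id2 (assoc A B C)) ** (D (A \<otimes> B) C ** pair2 (\<omega>2 A B ** pair2 u v) w)
    = (D A (B \<otimes> C) ** pair2 u (T2 (\<omega>2 B C ** pair2 (v ** p1 Z (T0 C)) (p2 Z (T0 C))) ** \<tau> (T0 C) w))
     \<cdot> (\<omega>2 A (B \<otimes> C) ** pair2 u (D B C ** pair2 v w))"
proof -
  have [simp]: "Z \<in> Ob K" "u \<in> Ce K" "v \<in> Ce K" "w \<in> Ce K" using assms by (auto simp: idcD)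
  let ?h = "id2 (t A B) ** pair2 (p2 Z A) (v ** p1 Z A)"
  let ?U = "T2 ?h ** \<tau> A u"
  let ?as = "T2 (id2 (assoc A B C))"
  let ?G = "\<Gamma> A (T0 C) ** pair2 u w"
  let ?p = "p1 Z (A \<otimes> T0 C)" and ?q = "p2 Z (A \<otimes> T0 C)"
  let ?a = "p1 A (T0 C) ** ?q" and ?b = "p2 A (T0 C) ** ?q"
  have om: "\<omega>2 A B ** pair2 u v = \<mu>2 (A \<otimes> B) ** ?U"
    using assms by (simp add: \<omega>_bnd[of _ _ Z] t_bnd bnd_def[of A "A \<otimes> B"])
  let ?P = "\<mu>2 (A \<otimes> B \<otimes> C) ** (T2 (\<omega>2 (A \<otimes> B) C) ** (\<Gamma> (T0 (A \<otimes> B)) (T0 C) ** pair2 ?U w))"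
  let ?Q = "\<mu>2 (A \<otimes> B \<otimes> C) ** (T2 (D (A \<otimes> B) C) ** (id2 (t' (T0 (A \<otimes> B)) (T0 (T0 C))) ** pair2 ?U w))"
  have Q': "?Q = \<mu>2 (A \<otimes> B \<otimes> C) ** (T2 (D (A \<otimes> B) C ** pair2 (p2 Z (T0 (A \<otimes> B))) (w ** p1 Z (T0 (A \<otimes> B)))) ** \<tau> (T0 (A \<otimes> B)) ?U)"
    using assms t'_pair_\<tau>[of w ?U Z "T0 (T0 C)" "T0 (A \<otimes> B)"] by simp
  have e: "D (A \<otimes> B) C ** pair2 (\<mu>2 (A \<otimes> B) ** ?U) w = ?P \<cdot> ?Q" 
    by (rule D_\<mu>1(2)[of _ _ Z]) (use assms in simp_all)
  have d: "cm ?Q = dm ?P"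
    unfolding Q' by (rule D_\<mu>1(3)) (use assms in simp_all)
  have "?as ** (D (A \<otimes> B) C ** pair2 (\<omega>2 A B ** pair2 u v) w) = (?as ** ?P) \<cdot> (?as ** ?Q)"
    unfolding om e by (rule whisker_vcomp_left) (use assms d in simp_all)
  \<comment> \<open>In this factor context extraction leaves \<open>\<Gamma>\<close> on
    \<open>u\<close> and \<open>w\<close> alone; \<open>v\<close> and the inner layer of
    \<open>w\<close> are combined afterwards by \<open>\<omega>\<close>.\<close>
  also have "?as ** ?P = D A (B \<otimes> C) ** pair2 u (T2 (\<omega>2 B C ** pair2 (v ** p1 Z (T0 C)) (p2 Z (T0 C))) ** \<tau> (T0 C) w)"
  proof -
    let ?th = "id2 (t A B) ** pair2 ?a (v ** ?p)"
    have "\<Gamma> (T0 (A \<otimes> B)) (T0 C) ** pair2 ?U w = T2 (pair2 ?th ?b) ** \<tau> (A \<otimes> T0 C) ?G"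
      by (subst \<Gamma>_\<tau>_left[of _ _ Z]) (use assms in simp_all)
    then have "?P = bnd (A \<otimes> T0 C) (A \<otimes> B \<otimes> C) ?G (\<omega>2 (A \<otimes> B) C ** pair2 ?th ?b)"
      using assms by (simp add: bnd_def)
    then have "?as ** ?P = bnd (A \<otimes> T0 C) (A \<otimes> (B \<otimes> C)) ?G (?as ** (\<omega>2 (A \<otimes> B) C ** pair2 ?th ?b))"
      using assms by (simp add: T2_bnd_push del: assoc_typing(4))
    also have "?as ** (\<omega>2 (A \<otimes> B) C ** pair2 ?th ?b) = id2 (t A (B \<otimes> C)) ** pair2 ?a (\<omega>2 B C ** pair2 (v ** ?p) ?b)"
      by (rule \<omega>_t[where Z = "Z \<otimes> (A \<otimes> T0 C)"]) (use assms in simp_all)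
    finally show ?thesis using assms by (simp add: D_\<tau>[of _ _ Z])
  qed
  \<comment> \<open>This factor runs \<open>u\<close> first; then \<open>D\<close> acts on
    \<open>v\<close> and \<open>w\<close> next to the pure value of \<open>u\<close>, which
    \<open>\<Gamma>_t1\<close> and \<open>t_\<mu>T\<close> move outside.\<close>
  also have "?as ** ?Q = \<omega>2 A (B \<otimes> C) ** pair2 u (D B C ** pair2 v w)"
  proof -
    let ?x = "p2 Z A" and ?y = "\<Gamma> B (T0 C) ** pair2 (v ** p1 Z A) (w ** p1 Z A)"
    have "id2 (t' (T0 (A \<otimes> B)) (T0 (T0 C))) ** pair2 ?U w = T2 (pair2 ?h (w ** p1 Z A)) ** \<tau> A u"
      using assms t'_pair_\<tau>[of w ?U Z "T0 (T0 C)" "T0 (A \<otimes> B)"] \<tau>_\<tau>[of u A] by (simp add: \<tau>_T2)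
    then have "?Q = \<mu>2 (A \<otimes> B \<otimes> C) ** (T2 (D (A \<otimes> B) C ** pair2 ?h (w ** p1 Z A)) ** \<tau> A u)"
      using assms by simp
    also have "D (A \<otimes> B) C ** pair2 ?h (w ** p1 Z A) = \<mu>2 (A \<otimes> B \<otimes> C) ** (T2 (id2 (t (A \<otimes> B) C)) ** (T2 (id2 (assoc_inv A B (T0 C))) **
       (id2 (t A (B \<otimes> T0 C)) ** pair2 ?x ?y)))"
      using \<Gamma>_t1[of ?x "v ** p1 Z A" "w ** p1 Z A" "Z \<otimes> A" A B "T0 C"] assms
      by (simp add: D_def del: assoc_inv_typing(4))
    finally have "?Q = bnd A (A \<otimes> B \<otimes> C) u \<dots>" by (simp add: bnd_def)
    then have "?as ** ?Q = bnd A (A \<otimes> (B \<otimes> C)) u (?as ** (\<mu>2 (A \<otimes> B \<otimes> C) ** (T2 (id2 (t (A \<otimes> B) C)) ** (T2 (id2 (assoc_inv A B (T0 C))) **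
       (id2 (t A (B \<otimes> T0 C)) ** pair2 ?x ?y)))))"
      using assms by (simp add: T2_bnd_push del: assoc_typing(4) assoc_inv_typing(4) T2_comp_assoc)
    also have "?as ** (\<mu>2 (A \<otimes> B \<otimes> C) ** (T2 (id2 (t (A \<otimes> B) C)) ** (T2 (id2 (assoc_inv A B (T0 C))) **
       (id2 (t A (B \<otimes> T0 C)) ** pair2 ?x ?y)))) = id2 (t A (B \<otimes> C)) ** pair2 ?x (\<mu>2 (B \<otimes> C) ** (T2 (id2 (t B C)) ** ?y))"
      by (rule t_\<mu>T[of _ _ "Z \<otimes> A", symmetric]) (use assms in simp_all)
    also have "\<mu>2 (B \<otimes> C) ** (T2 (id2 (t B C)) ** ?y) = (D B C ** pair2 v w) ** p1 Z A"
      using assms by (simp add: D_def)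
    also have "bnd A (A \<otimes> (B \<otimes> C)) u (id2 (t A (B \<otimes> C)) ** pair2 ?x ((D B C ** pair2 v w) ** p1 Z A))
       = \<omega>2 A (B \<otimes> C) ** pair2 u (D B C ** pair2 v w)"
      using assms by (simp add: \<omega>_bnd[of _ _ Z] t_bnd)
    finally show ?thesis .
  qed
  finally show ?thesis .
qed

end

section \<open>The second structure 2-cell of the binary multiplication\<close>

context two_category
begin

lemma vinv_whisker:
  assumes "vinv \<alpha> \<beta>" "idc x"
  shows "tgt \<alpha> = src x \<Longrightarrow> vinv (x ** \<alpha>) (x ** \<beta>)" "tgt x = src \<alpha> \<Longrightarrow> vinv (\<alpha> ** x) (\<beta> ** x)"
  using vinv_hcomp vinv_idc assms by blast+

lemma vinv_idc_eq: "vinv \<alpha> \<beta> \<Longrightarrow> idc \<alpha> \<Longrightarrow> \<beta> = \<alpha>"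
  using vinv_unique vinv_idc by blast

lemma vinv_Ce: "vinv \<alpha> \<beta> \<Longrightarrow> \<alpha> \<in> Ce K"
  by (simp add: vinv_def)

end

context pseudo_commutative_strong_two_monad
begin

text \<open>Lists count from 0, so this is the structure 2-cell for the second argument; the one at
  position 0 is an identity.\<close>

definition c1 :: "'o \<Rightarrow> 'o \<Rightarrow> 't" where "c1 A B = snd (\<omega>_cell A B) ! 1"

end

context symmetric_pseudo_commutative_strong_two_monad
begin

text \<open>Symmetry makes \<open>T(s) \<circ> \<Gamma>\<^bsub>B,A\<^esub> \<circ> s\<close> the inverse of \<open>\<Gamma>\<^bsub>A,B\<^esub>\<close>, so axiom (7) identifies the
  second structure 2-cell of \<open>\<omega>\<close> with the inverse of \<open>\<mu> \<circ> Tt\<^sub>2 \<circ> \<Gamma>\<^bsub>A,TB\<^esub>\<close>.\<close>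

lemma vinv_D_c1:
  assumes [simp]: "A \<in> Ob K" "B \<in> Ob K"
  shows "vinv (D A B) (c1 A B)"
proof -
  let ?S = "T2 (id2 (sym B A)) ** (\<Gamma> B A ** id2 (sym (T0 A) (T0 B)))"
  let ?p = "pair2 (p1 (T0 A) (T0 (T0 B))) (\<mu>2 B ** p2 (T0 A) (T0 (T0 B)))"
  let ?Y = "\<mu>2 (A \<otimes> B) ** (T2 (\<Gamma> A B) ** id2 (t (T0 A) (T0 B)))"
  let ?u = "p1 (T0 A) (T0 B)" and ?v = "p2 (T0 A) (T0 B)"
  \<comment> \<open>Conjugating by the symmetries swaps the order of evaluation and gives
    \<open>\<omega>'\<close>. Hence the conjugate of \<open>\<Gamma> B A\<close> starts where
    \<open>\<Gamma> A B\<close> ends.\<close>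
  have "T2 (id2 (sym B A)) ** (\<omega>2 B A ** pair2 v u) = id2 (\<omega>' A B) ** pair2 u v"
    if "u \<in> Ce K" "v \<in> Ce K" "src u = Z" "src v = Z" "tgt u = T0 A" "tgt v = T0 B" for u v Z
  proof -
    have [simp]: "Z \<in> Ob K" using that by auto
    show ?thesis using that by (simp add: \<omega>_bnd[of _ _ Z] T2_bnd_push \<eta>_nat_assoc)
  qed
  from this[of ?u ?v "T0 A \<otimes> T0 B"] have dS: "dm ?S = id2 (\<omega>' A B)" by simp
  have S: "?S \<in> Ce K" "src ?S = T0 A \<otimes> T0 B" "tgt ?S = T0 (A \<otimes> B)" by simp_all
  have e: "?S \<cdot> \<Gamma> A B = \<omega>2 A B"
    using \<Gamma>_symmetric[of A B] by simp
  have c1: "c1 A B = (?S ** ?p) \<cdot> ?Y"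
    by (simp add: c1_def \<omega>_cell_def)
  have d1: "cm ?Y = id2 (\<omega>' A B) ** ?p"
    using arg_cong[OF \<Gamma>_\<mu>2[of A B], of cm] by simp
  have d2: "cm (D A B) = dm ?Y" by simp
  have "dm (?S ** ?p) = dm ?S ** dm ?p" by (rule dm_hcomp(1)) simp_all
  then have d3: "cm ?Y = dm (?S ** ?p)" unfolding d1 dS by simp
  have Sp: "?S ** ?p \<in> Ce K" by (simp del: sym_typing(4))
  \<comment> \<open>By \<open>\<Gamma>_\<mu>2\<close> the factor \<open>?Y\<close> after
    \<open>D\<close> is \<open>\<Gamma>\<close> precomposed with \<open>\<mu>\<close> in the second
    argument, and the conjugate \<open>?S\<close> cancels it by symmetry.\<close>
  have "c1 A B \<cdot> D A B = (?S ** ?p) \<cdot> (?Y \<cdot> D A B)"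
    unfolding c1 by (rule vcomp_assoc'[OF _ _ Sp d2 d3]) simp_all
  also have "\<dots> = (?S ** ?p) \<cdot> (\<Gamma> A B ** ?p)"
    using \<Gamma>_\<mu>2[of A B] by simp
  also have "\<dots> = (?S \<cdot> \<Gamma> A B) ** ?p"
    by (rule whisker_vcomp_right[symmetric]) (use dS in \<open>simp_all del: sym_typing(4)\<close>)
  also have "\<dots> = dm (D A B)"
    unfolding e by simp
  finally have *: "c1 A B \<cdot> D A B = dm (D A B)" .
  \<comment> \<open>So far \<open>c1\<close> is a left inverse. Invertibility of
    \<open>\<Gamma>\<close> makes \<open>D\<close> invertible, and then the left inverse is the
    inverse.\<close>
  obtain G where G: "vinv (\<Gamma> A (T0 B)) G"
    using \<Gamma>_invertible[of A "T0 B"] invertible2_iff_vinv by auto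
  have D: "vinv (D A B) (\<mu>2 (A \<otimes> B) ** (T2 (id2 (t A B)) ** G))"
    unfolding D_def by (intro vinv_whisker(1) G) simp_all
  have "c1 A B \<in> Ce K" "dm (c1 A B) = dm ?Y"
    unfolding c1 using vcomp_typing(1,4)[OF _ Sp d3] by simp_all
  then show ?thesis
    using vinv_left_inverse[OF D, of "c1 A B"] * d2 by simp
qed

lemma c1_typing [simp]:
  assumes "A \<in> Ob K" "B \<in> Ob K"
  shows "c1 A B \<in> Ce K" "src (c1 A B) = T0 A \<otimes> T0 (T0 B)" "tgt (c1 A B) = T0 (A \<otimes> B)"
    "dm (c1 A B) = \<mu>2 (A \<otimes> B) ** (T2 (\<omega>2 A B) ** id2 (t (T0 A) (T0 B)))"
    "cm (c1 A B) = \<omega>2 A B ** pair2 (p1 (T0 A) (T0 (T0 B))) (\<mu>2 B ** p2 (T0 A) (T0 (T0 B)))"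
  using vinv_dm[OF vinv_D_c1[OF assms]] assms by simp_all

lemma vinv_c1_pair:
  assumes "idc u" "idc v" "src u = src v" "tgt u = T0 A" "tgt v = T0 (T0 B)" "A \<in> Ob K" "B \<in> Ob K"
  shows "vinv (D A B ** pair2 u v) (c1 A B ** pair2 u v)"
  by (rule vinv_whisker(2)) (use assms in \<open>simp_all add: vinv_D_c1 idcD\<close>)

text \<open>Both sides are inverse to the same 2-cell. This pattern transfers the laws of
  \<open>D\<close> to \<open>c1\<close>.\<close>

lemma c1_nat:
  assumes "idc f" "idc g" "idc u" "idc v" "src u = src v" "tgt u = T0 (src f)" "tgt v = T0 (T0 (src g))" "tgt f = A" "tgt g = B"
  shows "c1 A B ** pair2 (T2 f ** u) (T2 (T2 g) ** v)
    = T2 (pair2 (f ** p1 (src f) (src g)) (g ** p2 (src f) (src g))) ** (c1 (src f) (src g) ** pair2 u v)"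
proof (rule vinv_unique)
  have [simp]: "f \<in> Ce K" "g \<in> Ce K" "u \<in> Ce K" "v \<in> Ce K" using assms by (auto simp: idcD)
  have [simp]: "A \<in> Ob K" "B \<in> Ob K" using assms by auto
  show "vinv (D A B ** pair2 (T2 f ** u) (T2 (T2 g) ** v)) (c1 A B ** pair2 (T2 f ** u) (T2 (T2 g) ** v))"
    by (rule vinv_c1_pair) (use assms in simp_all)
  have e: "D A B ** pair2 (T2 f ** u) (T2 (T2 g) ** v)
    = T2 (pair2 (f ** p1 (src f) (src g)) (g ** p2 (src f) (src g))) ** (D (src f) (src g) ** pair2 u v)"
    by (rule D_nat) (use assms in simp_all)
  show "vinv (D A B ** pair2 (T2 f ** u) (T2 (T2 g) ** v))
    (T2 (pair2 (f ** p1 (src f) (src g)) (g ** p2 (src f) (src g))) ** (c1 (src f) (src g) ** pair2 u v))"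
    unfolding e by (intro vinv_whisker(1) vinv_c1_pair) (use assms in simp_all)
qed

text \<open>\<open>D\<close> is an identity at a pure argument, hence so is its inverse; which
  identity it is can be read off the target 1-cell.\<close>

lemma c1_\<eta>:
  assumes "idc u" "idc v" "src u = Z" "src v = Z" "A \<in> Ob K" "B \<in> Ob K"
  shows "tgt u = T0 A \<Longrightarrow> tgt v = T0 B \<Longrightarrow> c1 A B ** pair2 u (\<eta>2 (T0 B) ** v) = \<omega>2 A B ** pair2 u v"
    "tgt u = A \<Longrightarrow> tgt v = T0 (T0 B) \<Longrightarrow> c1 A B ** pair2 (\<eta>2 A ** u) v = \<omega>2 A B ** pair2 (\<eta>2 A ** u) (\<mu>2 B ** v)"
proof -
  have c [simp]: "u \<in> Ce K" "v \<in> Ce K" "Z \<in> Ob K" using assms by (auto simp: idcD)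
  {
    assume a: "tgt u = T0 A" "tgt v = T0 B"
    have "vinv (D A B ** pair2 u (\<eta>2 (T0 B) ** v)) (c1 A B ** pair2 u (\<eta>2 (T0 B) ** v))"
      by (rule vinv_c1_pair) (use assms a in simp_all)
    from vinv_idc_eq[OF this] D_\<eta>(1)[OF assms a]
    have "idc (c1 A B ** pair2 u (\<eta>2 (T0 B) ** v))" by simp
    from dm_idc(2)[OF this] show "c1 A B ** pair2 u (\<eta>2 (T0 B) ** v) = \<omega>2 A B ** pair2 u v"
      using assms a by (simp add: \<mu>_unit)
  }
  {
    assume a: "tgt u = A" "tgt v = T0 (T0 B)"
    have "vinv (D A B ** pair2 (\<eta>2 A ** u) v) (c1 A B ** pair2 (\<eta>2 A ** u) v)"
      by (rule vinv_c1_pair) (use assms a in simp_all)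
    from vinv_idc_eq[OF this] D_\<eta>(2)[OF assms a]
    have "idc (c1 A B ** pair2 (\<eta>2 A ** u) v)" by simp
    from dm_idc(2)[OF this] show "c1 A B ** pair2 (\<eta>2 A ** u) v = \<omega>2 A B ** pair2 (\<eta>2 A ** u) (\<mu>2 B ** v)"
      using assms a by simp
  }
qed

text \<open>Inverting \<open>D_\<mu>2\<close> swaps its factors, and the result is the
  multiplication condition of an algebra 1-cell in the last place.\<close>

lemma c1_\<mu>2:
  assumes "idc u" "idc v" "src u = Z" "src v = Z" "tgt u = T0 A" "tgt v = T0 (T0 (T0 B))" "A \<in> Ob K" "B \<in> Ob K"
  shows "c1 A B ** pair2 u (\<mu>2 (T0 B) ** v)
    = (c1 A B ** pair2 u (T2 (\<mu>2 B) ** v))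
     \<cdot> (\<mu>2 (A \<otimes> B) ** (T2 (c1 A B ** pair2 (u ** p1 Z (T0 (T0 B))) (p2 Z (T0 (T0 B)))) ** \<tau> (T0 (T0 B)) v))"
proof (rule vinv_unique)
  have [simp]: "u \<in> Ce K" "v \<in> Ce K" "Z \<in> Ob K" using assms by (auto simp: idcD)
  show "vinv (D A B ** pair2 u (\<mu>2 (T0 B) ** v)) (c1 A B ** pair2 u (\<mu>2 (T0 B) ** v))"
    by (rule vinv_c1_pair) (use assms in simp_all)
  show "vinv (D A B ** pair2 u (\<mu>2 (T0 B) ** v)) ((c1 A B ** pair2 u (T2 (\<mu>2 B) ** v))
     \<cdot> (\<mu>2 (A \<otimes> B) ** (T2 (c1 A B ** pair2 (u ** p1 Z (T0 (T0 B))) (p2 Z (T0 (T0 B)))) ** \<tau> (T0 (T0 B)) v)))"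
    unfolding D_\<mu>2(1)[OF assms]
    by (intro vinv_vcomp D_\<mu>2(2)[OF assms] vinv_whisker vinv_T2 vinv_D_c1) (use assms in simp_all)
qed

text \<open>Inverting \<open>D_\<mu>1\<close> expresses \<open>c1\<close> with an inverse of
  \<open>\<Gamma>\<close>; composing with that \<open>\<Gamma>\<close> on the right cancels it. This
  supplies the \<open>\<Gamma>\<close> of the coherence condition when the second of the two places
  is the last one.\<close>

lemma c1_\<mu>1:
  assumes "idc u" "idc v" "src u = Z" "src v = Z" "tgt u = T0 (T0 A)" "tgt v = T0 (T0 B)" "A \<in> Ob K" "B \<in> Ob K"
  shows "\<mu>2 (A \<otimes> B) ** (T2 (c1 A B ** pair2 (p2 Z (T0 A)) (v ** p1 Z (T0 A))) ** \<tau> (T0 A) u)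
     = (c1 A B ** pair2 (\<mu>2 A ** u) v)
     \<cdot> (\<mu>2 (A \<otimes> B) ** (T2 (\<omega>2 A B) ** (\<Gamma> (T0 A) (T0 B) ** pair2 u v)))"
proof -
  have [simp]: "u \<in> Ce K" "v \<in> Ce K" "Z \<in> Ob K" using assms by (auto simp: idcD)
  let ?X = "\<mu>2 (A \<otimes> B) ** (T2 (c1 A B ** pair2 (p2 Z (T0 A)) (v ** p1 Z (T0 A))) ** \<tau> (T0 A) u)"
  let ?Y = "\<mu>2 (A \<otimes> B) ** (T2 (D A B ** pair2 (p2 Z (T0 A)) (v ** p1 Z (T0 A))) ** \<tau> (T0 A) u)"
  let ?W = "\<mu>2 (A \<otimes> B) ** (T2 (\<omega>2 A B) ** (\<Gamma> (T0 A) (T0 B) ** pair2 u v))"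
  obtain G where G: "vinv (\<Gamma> (T0 A) (T0 B)) G"
    using \<Gamma>_invertible[of "T0 A" "T0 B"] invertible2_iff_vinv assms by auto
  let ?W' = "\<mu>2 (A \<otimes> B) ** (T2 (\<omega>2 A B) ** (G ** pair2 u v))"
  have W: "vinv ?W ?W'"
    by (intro vinv_whisker G) (use assms in simp_all)
  have Y: "vinv ?Y ?X"
    by (intro vinv_whisker vinv_T2 vinv_D_c1) (use assms in simp_all)
  have "vinv (D A B ** pair2 (\<mu>2 A ** u) v) (?X \<cdot> ?W')"
    unfolding D_\<mu>1(1)[OF assms] by (rule vinv_vcomp[OF Y W D_\<mu>1(3)[OF assms]])
  moreover have "vinv (D A B ** pair2 (\<mu>2 A ** u) v) (c1 A B ** pair2 (\<mu>2 A ** u) v)"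
    by (rule vinv_c1_pair) (use assms in simp_all)
  ultimately have "c1 A B ** pair2 (\<mu>2 A ** u) v = ?X \<cdot> ?W'" using vinv_unique by blast
  then have "(c1 A B ** pair2 (\<mu>2 A ** u) v) \<cdot> ?W = (?X \<cdot> ?W') \<cdot> ?W" by simp
  also have d: "cm ?W' = dm ?X"
    using D_\<mu>1(3)[OF assms] vinv_dm[OF W] vinv_dm[OF Y] by simp
  have "(?X \<cdot> ?W') \<cdot> ?W = ?X \<cdot> (?W' \<cdot> ?W)"
    by (rule vcomp_assoc'[OF _ _ _ _ d]) (use vinv_dm[OF W] vinv_dm[OF Y] vinv_Ce[OF W] in simp_all)
  also have "?W' \<cdot> ?W = dm ?W" using W unfolding vinv_def by blast
  also have "?X \<cdot> dm ?W = ?X"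
    by (rule vcomp_idc(2)) (use vinv_dm[OF W] vinv_dm[OF Y] vinv_Ce[OF W] d in \<open>simp_all only: dm_typing\<close>)
  finally show ?thesis by simp
qed

lemma c1_\<mu>1_composable:
  assumes "idc u" "idc v" "src u = Z" "src v = Z" "tgt u = T0 (T0 A)" "tgt v = T0 (T0 B)" "A \<in> Ob K" "B \<in> Ob K"
  shows "cm (\<mu>2 (A \<otimes> B) ** (T2 (\<omega>2 A B) ** (\<Gamma> (T0 A) (T0 B) ** pair2 u v))) = dm (c1 A B ** pair2 (\<mu>2 A ** u) v)"
proof -
  have [simp]: "u \<in> Ce K" "v \<in> Ce K" "Z \<in> Ob K" using assms by (auto simp: idcD)
  let ?Y = "\<mu>2 (A \<otimes> B) ** (T2 (D A B ** pair2 (p2 Z (T0 A)) (v ** p1 Z (T0 A))) ** \<tau> (T0 A) u)"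
  let ?W = "\<mu>2 (A \<otimes> B) ** (T2 (\<omega>2 A B) ** (\<Gamma> (T0 A) (T0 B) ** pair2 u v))"
  have W: "?W \<in> Ce K" and Y: "?Y \<in> Ce K" using assms by simp_all
  have "vinv (D A B ** pair2 (\<mu>2 A ** u) v) (c1 A B ** pair2 (\<mu>2 A ** u) v)"
    by (rule vinv_c1_pair) (use assms in simp_all)
  from vinv_dm(2)[OF this] have "dm (c1 A B ** pair2 (\<mu>2 A ** u) v) = cm (?W \<cdot> ?Y)"
    unfolding D_\<mu>1(1)[OF assms] .
  then show ?thesis using vcomp_typing(5)[OF Y W D_\<mu>1(3)[OF assms]] by simp
qed

text \<open>The inverse of \<open>D_\<omega>_middle\<close>: associativity of
  \<open>\<omega>\<close> for the structure 2-cell belonging to the middle one of three factors,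
  with the brackets on the left.\<close>

lemma c1_\<omega>_middle:
  assumes "idc u" "idc v" "idc w" "src u = Z" "src v = Z" "src w = Z"
    "tgt u = T0 A" "tgt v = T0 (T0 B)" "tgt w = T0 C" "A \<in> Ob K" "B \<in> Ob K" "C \<in> Ob K"
  shows "\<omega>2 (A \<otimes> B) C ** pair2 (c1 A B ** pair2 u v) w
    = T2 (id2 (assoc_inv A B C)) ** (c1 A (B \<otimes> C) ** pair2 u
        (T2 (\<omega>2 B C ** pair2 (p2 Z (T0 B)) (w ** p1 Z (T0 B))) ** \<tau> (T0 B) v))"
proof (rule vinv_unique)
  have [simp]: "u \<in> Ce K" "v \<in> Ce K" "w \<in> Ce K" "Z \<in> Ob K" using assms by (auto simp: idcD)
  show "vinv (\<omega>2 (A \<otimes> B) C ** pair2 (D A B ** pair2 u v) w) (\<omega>2 (A \<otimes> B) C ** pair2 (c1 A B ** pair2 u v) w)"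
    by (intro vinv_whisker vinv_pair2 vinv_idc vinv_D_c1) (use assms in simp_all)
  have e: "\<omega>2 (A \<otimes> B) C ** pair2 (D A B ** pair2 u v) w
    = T2 (id2 (assoc_inv A B C)) ** (D A (B \<otimes> C) ** pair2 u
        (T2 (\<omega>2 B C ** pair2 (p2 Z (T0 B)) (w ** p1 Z (T0 B))) ** \<tau> (T0 B) v))"
    by (rule D_\<omega>_middle) (use assms in simp_all)
  show "vinv (\<omega>2 (A \<otimes> B) C ** pair2 (D A B ** pair2 u v) w)
    (T2 (id2 (assoc_inv A B C)) ** (c1 A (B \<otimes> C) ** pair2 u
        (T2 (\<omega>2 B C ** pair2 (p2 Z (T0 B)) (w ** p1 Z (T0 B))) ** \<tau> (T0 B) v)))"
    unfolding e by (intro vinv_whisker vinv_D_c1) (use assms in simp_all)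
qed

text \<open>The inverse of \<open>D_\<omega>_right\<close>. The right-hand side is the composition
  formula for structure 2-cells, so this is associativity of \<open>\<omega>\<close> in the last of
  three places.\<close>

lemma c1_\<omega>_right:
  assumes "idc u" "idc v" "idc w" "src u = Z" "src v = Z" "src w = Z"
    "tgt u = T0 A" "tgt v = T0 B" "tgt w = T0 (T0 C)" "A \<in> Ob K" "B \<in> Ob K" "C \<in> Ob K"
  shows "T2 (id2 (assoc A B C)) ** (c1 (A \<otimes> B) C ** pair2 (\<omega>2 A B ** pair2 u v) w)
    = (\<omega>2 A (B \<otimes> C) ** pair2 u (c1 B C ** pair2 v w))
      \<cdot> (c1 A (B \<otimes> C) ** pair2 u (T2 (\<omega>2 B C ** pair2 (v ** p1 Z (T0 C)) (p2 Z (T0 C))) ** \<tau> (T0 C) w))"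
proof (rule vinv_unique)
  have [simp]: "u \<in> Ce K" "v \<in> Ce K" "w \<in> Ce K" "Z \<in> Ob K" using assms by (auto simp: idcD)
  let ?V = "T2 (\<omega>2 B C ** pair2 (v ** p1 Z (T0 C)) (p2 Z (T0 C))) ** \<tau> (T0 C) w"
  show "vinv (T2 (id2 (assoc A B C)) ** (D (A \<otimes> B) C ** pair2 (\<omega>2 A B ** pair2 u v) w))
     (T2 (id2 (assoc A B C)) ** (c1 (A \<otimes> B) C ** pair2 (\<omega>2 A B ** pair2 u v) w))"
    by (intro vinv_whisker vinv_D_c1) (use assms in simp_all)
  have d: "cm (\<omega>2 A (B \<otimes> C) ** pair2 u (D B C ** pair2 v w)) = dm (D A (B \<otimes> C) ** pair2 u ?V)"
    using assms t_pair_\<tau>[of v w "T0 B" "T0 C"] by simp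
  show "vinv (T2 (id2 (assoc A B C)) ** (D (A \<otimes> B) C ** pair2 (\<omega>2 A B ** pair2 u v) w))
   ((\<omega>2 A (B \<otimes> C) ** pair2 u (c1 B C ** pair2 v w)) \<cdot> (c1 A (B \<otimes> C) ** pair2 u ?V))"
    unfolding D_\<omega>_right[OF assms]
    by (intro vinv_vcomp d vinv_whisker vinv_pair2 vinv_idc vinv_D_c1) (use assms in simp_all)
qed

end

section \<open>Multimorphisms of free algebras on generalized elements\<close>

context fp_two_category
begin

lemma els_id2:
  assumes "Z \<in> Ob K" "\<forall>f \<in> set fs. f \<in> Ar K \<and> dom1 K f = Z"
  shows "els Z (map (cod1 K) fs) (map id2 fs)"
  using assms by (auto simp: els_def)

text \<open>With \<open>prod2_pair\<close> and \<open>assoc_inv_pair\<close> this evaluates the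
  pieces of \<open>\<Gamma>n\<close> at large objects without unfolding them into
  projections.\<close>

lemma assoc_prod_pair:
  assumes "a \<in> Ce K" "b \<in> Ce K" "c \<in> Ce K" "src a = Z" "src b = Z" "src c = Z" "tgt a = P" "tgt b = B" "tgt c = C"
    "f \<in> Ar K" "g \<in> Ar K" "dom1 K f = B" "dom1 K g = C"
  shows "id2 (id1 P \<otimes>\<^sub>1 (f \<otimes>\<^sub>1 g)) ** (id2 (assoc P B C) ** pair2 (pair2 a b) c) = pair2 a (pair2 (id2 f ** b) (id2 g ** c))"
proof -
  have "P \<in> Ob K" "B \<in> Ob K" "C \<in> Ob K" using assms by auto
  then show ?thesis using assms by simp
qed

lemma prod2_pair:
  assumes "a \<in> Ce K" "x \<in> Ce K" "src a = src x" "tgt a = P" "G \<in> Ce K" "src G = tgt x"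
  shows "(id2 (id1 P) \<otimes>\<^sub>2 G) ** pair2 a x = pair2 a (G ** x)"
proof -
  have "P \<in> Ob K" using assms by auto
  then show ?thesis using assms by (simp add: prod2_eq)
qed

lemma assoc_inv_pair:
  assumes "a \<in> Ce K" "b \<in> Ce K" "c \<in> Ce K" "src a = Z" "src b = Z" "src c = Z" "tgt a = P" "tgt b = B" "tgt c = C"
  shows "id2 (assoc_inv P B C) ** pair2 a (pair2 b c) = pair2 (pair2 a b) c"
proof -
  have "P \<in> Ob K" "B \<in> Ob K" "C \<in> Ob K" using assms by auto
  then show ?thesis using assms by simp
qed

text \<open>Weakening: the elements are read in a context enlarged by one variable of type
  \<open>A\<close>.\<close>

definition wk :: "'o \<Rightarrow> 'o \<Rightarrow> 't list \<Rightarrow> 't list" where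
  "wk Z A xs = map (\<lambda>x. x ** p1 Z A) xs"

lemma wk_simps [simp]: "length (wk Z A xs) = length xs" "i < length xs \<Longrightarrow> wk Z A xs ! i = xs ! i ** p1 Z A"
    "wk Z A (xs @ ys) = wk Z A xs @ wk Z A ys" "wk Z A (x # xs) = (x ** p1 Z A) # wk Z A xs" "wk Z A [] = []"
    "wk Z A (xs[i := x]) = (wk Z A xs)[i := x ** p1 Z A]"
  by (simp_all add: wk_def map_update)

lemma els_wk: "els Z X xs \<Longrightarrow> A \<in> Ob K \<Longrightarrow> els (Z \<otimes> A) X (wk Z A xs)"
  using els_map_hcomp[of Z X xs "p1 Z A"] elsD(2)[of Z X xs] by (simp add: wk_def)

definition idcs :: "'t list \<Rightarrow> bool" where "idcs xs \<longleftrightarrow> (\<forall>x \<in> set xs. idc x)"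

lemma idcs_simps [simp]: "idcs []" "idcs (x # xs) \<longleftrightarrow> idc x \<and> idcs xs" "idcs (xs @ ys) \<longleftrightarrow> idcs xs \<and> idcs ys"
  by (auto simp: idcs_def)

lemma idcs_nth: "idcs xs \<Longrightarrow> i < length xs \<Longrightarrow> idc (xs ! i)"
  by (simp add: idcs_def)

lemma idcsI: "(\<And>i. i < length xs \<Longrightarrow> idc (xs ! i)) \<Longrightarrow> idcs xs"
  by (auto simp: idcs_def in_set_conv_nth)

lemma idcs_update: "idcs xs \<Longrightarrow> idc x \<Longrightarrow> idcs (xs[i := x])"
  using set_update_subset_insert[of xs i x] by (auto simp: idcs_def)

lemma idcs_wk: "els Z X xs \<Longrightarrow> idcs xs \<Longrightarrow> A \<in> Ob K \<Longrightarrow> idcs (wk Z A xs)"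
  by (auto simp: idcs_def wk_def els_def)

lemma idc_ntuple2' [simp]: "els Z X xs \<Longrightarrow> idcs xs \<Longrightarrow> idc (tup Z xs)"
  by (rule idc_ntuple2) (simp_all add: idcs_def)

text \<open>\<open>osl Z A i ys\<close> replaces the entry \<open>i\<close> of \<open>ys\<close> by a fresh variable of type \<open>A\<close>.\<close>

definition osl :: "'o \<Rightarrow> 'o \<Rightarrow> nat \<Rightarrow> 't list \<Rightarrow> 't list" where
  "osl Z A i ys = (wk Z A ys)[i := p2 Z A]"

lemma els_osl: "els Z X ys \<Longrightarrow> A \<in> Ob K \<Longrightarrow> els (Z \<otimes> A) (X[i := A]) (osl Z A i ys)"
  unfolding osl_def by (rule els_update[OF els_wk]) (auto dest: elsD(2))

lemma els_osl': "els Z (X[i := B]) ys \<Longrightarrow> A \<in> Ob K \<Longrightarrow> els (Z \<otimes> A) (X[i := A]) (osl Z A i ys)"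
  using els_osl[of Z "X[i := B]" ys A i] by simp

lemma idcs_osl: "els Z X ys \<Longrightarrow> idcs ys \<Longrightarrow> A \<in> Ob K \<Longrightarrow> idcs (osl Z A i ys)"
  unfolding osl_def by (intro idcs_update idcs_wk) (auto dest: elsD(2))

lemma osl_snoc: "i < length ys \<Longrightarrow> osl Z A i (ys @ [y]) = osl Z A i ys @ [y ** p1 Z A]"
  "osl Z A (length ys) (ys @ [y]) = wk Z A ys @ [p2 Z A]"
  by (simp_all add: osl_def list_update_append)

lemma ntuple2_wk: "els Z X xs \<Longrightarrow> A \<in> Ob K \<Longrightarrow> tup Z xs ** p1 Z A = tup (Z \<otimes> A) (wk Z A xs)"
  using ntuple2_hcomp[of Z X xs "p1 Z A"] elsD(2)[of Z X xs] by (simp add: wk_def)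

end

section \<open>The n-ary strength and the n-ary \<open>\<Gamma>\<close> on elements\<close>

context strong_two_monad
begin

text \<open>A pure parameter \<open>a\<close> next to a computation joins the pure part of the
  latter; \<open>\<tau>_\<tau>\<close> merges the contexts.\<close>

lemma t_pair_T2_\<tau>:
  assumes "a \<in> Ce K" "src a = Z" "tgt a = P" "r \<in> Ce K" "src r = Z \<otimes> A" "tgt r = Q" "g \<in> Ce K" "src g = Z" "tgt g = T0 A" "A \<in> Ob K"
  shows "id2 (t P Q) ** pair2 a (T2 r ** \<tau> A g) = T2 (pair2 (a ** p1 Z A) r) ** \<tau> A g"
proof -
  have "P \<in> Ob K" "Q \<in> Ob K" "Z \<in> Ob K" using assms by auto
  then show ?thesis
    using assms t_pair_\<tau>[of a "T2 r ** \<tau> A g" P Q] \<tau>_T2[of "\<tau> A g" r Q] \<tau>_\<tau>[of g A] by simp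
qed

text \<open>Moving factor \<open>i\<close> to the end, applying \<open>t\<close> and moving it back
  amounts to the strength with all other entries as parameters: entry \<open>i\<close> is replaced
  by the variable that \<open>\<tau>\<close> binds. Typing belongs to the same statement because it
  needs the same description of the two permutations.\<close>

lemma tn_facts:
  assumes X: "set X \<subseteq> Ob K" and i: "i < length X"
  shows "tn X i \<in> Ar K \<and> dom1 K (tn X i) = nprod (X[i := T0 (X ! i)]) \<and> cod1 K (tn X i) = T0 (nprod X) \<and>
    (els Z (X[i := T0 (X ! i)]) ys \<longrightarrow>
      id2 (tn X i) ** tup Z ys = T2 (tup (Z \<otimes> X ! i) (osl Z (X ! i) i ys)) ** \<tau> (X ! i) (ys ! i))"
proof -
  let ?n = "length X" and ?X = "X[i := T0 (X ! i)]" and ?A = "X ! i"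
  let ?ks = "[0..<i] @ [Suc i..<?n]"
  let ?B = "take i X @ drop (Suc i) X"
  let ?P = "nprod ?B"
  have A: "?A \<in> Ob K" using X i by auto
  have X': "set ?X \<subseteq> Ob K"
  proof
    fix x assume "x \<in> set ?X"
    then have "x \<in> insert (T0 ?A) (set X)" using set_update_subset_insert[of X i] by blast
    then show "x \<in> Ob K" using X A by auto
  qed
  have B: "set ?B \<subseteq> Ob K" using X by (auto dest: in_set_takeD in_set_dropD)
  have P: "?P \<in> Ob K" using B by (rule nprod_Ob)
  have lB: "length ?B = ?n - 1" using i by simp
  have Bk: "?B ! k = X ! k" if "k < i" for k using that i by (simp add: nth_append)
  have Bk': "?B ! (k - 1) = X ! k" if "i < k" "k < ?n" for k using that i by (cases k) (simp_all add: nth_append)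
  have BX: "map ((!) X) ?ks = ?B"
    by (rule nth_equalityI) (use i in \<open>auto simp: nth_append\<close>)
  let ?to1 = "ntuple1 (nprod ?X) (map (nproj ?X) ?ks)"
  have f1: "\<forall>f \<in> set (map (nproj ?X) ?ks). f \<in> Ar K \<and> dom1 K f = nprod ?X"
    using X' i by auto
  have c1: "map (cod1 K) (map (nproj ?X) ?ks) = ?B"
    unfolding BX[symmetric] using X' i by auto
  note t1 = id2_ntuple1[OF nprod_Ob[OF X'] f1, unfolded c1]
  let ?to = "pair1 ?to1 (nproj ?X i)"
  have to: "?to \<in> Ar K" "dom1 K ?to = nprod ?X" "cod1 K ?to = ?P \<otimes> T0 ?A" "id2 ?to = pair2 (id2 ?to1) (id2 (nproj ?X i))"
    using t1 X' i by simp_all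
  \<comment> \<open>Entry \<open>i\<close> is absent from \<open>?B\<close>, so a position
    \<open>k\<close> beyond \<open>i\<close> becomes \<open>k - 1\<close> there.\<close>
  let ?fs = "map (\<lambda>k. nproj ?B k \<odot> pr1 ?P ?A) [0..<i] @ [pr2 ?P ?A] @ map (\<lambda>k. nproj ?B (k - 1) \<odot> pr1 ?P ?A) [Suc i..<?n]"
  have fsk: "?fs ! k = (if k < i then nproj ?B k \<odot> pr1 ?P ?A else if k = i then pr2 ?P ?A else nproj ?B (k - 1) \<odot> pr1 ?P ?A)"
    if "k < ?n" for k
    using that i by (auto simp: nth_append nth_Cons' split: nat.split)
  have lfs: "length ?fs = ?n" using i by simp
  have fs: "?fs ! k \<in> Ar K \<and> dom1 K (?fs ! k) = ?P \<otimes> ?A \<and> cod1 K (?fs ! k) = X ! k" if k: "k < ?n" for k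
  proof -
    consider "k < i" | "k = i" | "i < k" by linarith
    then show ?thesis
    proof cases
      case 1
      then have "k < length ?B" using i lB by linarith
      with nproj_typing[OF B this] 1 Bk[OF 1] P A k show ?thesis unfolding fsk[OF k] by simp
    next
      case 2 then show ?thesis unfolding fsk[OF k] using P A by simp
    next
      case 3
      then have "k - 1 < length ?B" using k lB by linarith
      with nproj_typing[OF B this] 3 Bk'[OF 3 k] P A k show ?thesis unfolding fsk[OF k] by simp
    qed
  qed
  have f2: "\<forall>f \<in> set ?fs. f \<in> Ar K \<and> dom1 K f = ?P \<otimes> ?A"
    using fs lfs by (metis in_set_conv_nth)
  have c2: "map (cod1 K) ?fs = X"
    by (rule nth_equalityI) (use fs lfs in \<open>simp_all only: length_map nth_map\<close>)
  let ?from = "ntuple1 (?P \<otimes> ?A) ?fs"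
  have PA: "?P \<otimes> ?A \<in> Ob K" using P A by simp
  note t2 = id2_ntuple1[OF PA f2, unfolded c2]
  define fr to where "fr = ?from" and "to = ?to"
  have tn: "tn X i = T1 fr \<odot> t ?P ?A \<odot> to"
    by (simp add: tn_def Let_def fr_def to_def)
  have fr: "fr \<in> Ar K" "dom1 K fr = ?P \<otimes> ?A" "cod1 K fr = nprod X"
    unfolding fr_def using t2 by blast+
  have to': "to \<in> Ar K" "dom1 K to = nprod ?X" "cod1 K to = ?P \<otimes> T0 ?A"
    unfolding to_def using to by blast+
  have "id2 (tn X i) ** tup Z ys = T2 (tup (Z \<otimes> ?A) (osl Z ?A i ys)) ** \<tau> ?A (ys ! i)" if e: "els Z ?X ys"
  proof -
    note l = elsD[OF e]
    have Z: "Z \<in> Ob K" by (rule l(2))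
    let ?r = "map ((!) ys) ?ks"
    have yi: "ys ! i \<in> Ce K" "src (ys ! i) = Z" "tgt (ys ! i) = T0 ?A" using l i by simp_all
    have r: "els Z ?B ?r"
    proof (rule elsI)
      show "length ?r = length ?B" using i by simp
      fix k assume "k < length ?B"
      then show "?r ! k \<in> Ce K \<and> src (?r ! k) = Z \<and> tgt (?r ! k) = ?B ! k"
        using l i lB by (auto simp: nth_append nth_list_update)
    qed (rule Z)
    have e1: "els (nprod ?X) ?B (map id2 (map (nproj ?X) ?ks))"
      using els_id2[OF nprod_Ob[OF X'] f1] unfolding c1 .
    have "id2 ?to1 ** tup Z ys = tup Z ?r"
    proof -
      have "id2 ?to1 ** tup Z ys = tup Z (map (\<lambda>x. x ** tup Z ys) (map id2 (map (nproj ?X) ?ks)))"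
        using ntuple2_hcomp[OF e1, of "tup Z ys"] e t1 by simp
      also have "map (\<lambda>x. x ** tup Z ys) (map id2 (map (nproj ?X) ?ks)) = ?r"
        using e i by auto
      finally show ?thesis .
    qed
    moreover have "id2 ?to ** tup Z ys = pair2 (id2 ?to1 ** tup Z ys) (id2 (nproj ?X i) ** tup Z ys)"
      unfolding to(4) by (rule pair2_hcomp) (use e i t1[THEN conjunct1] t1[THEN conjunct2, THEN conjunct1] X' in simp_all)
    ultimately have "id2 to ** tup Z ys = pair2 (tup Z ?r) (ys ! i)"
      unfolding to_def using nproj_ntuple2[OF e, of i] i by simp
    then have "id2 (tn X i) ** tup Z ys = T2 (id2 fr) ** (id2 (t ?P ?A) ** pair2 (tup Z ?r) (ys ! i))"
      unfolding tn using to' fr P A e by simp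
    also have "\<dots> = T2 (id2 fr ** pair2 (tup (Z \<otimes> ?A) (wk Z ?A ?r)) (p2 Z ?A)) ** \<tau> ?A (ys ! i)"
      using t_pair_\<tau>[of "tup Z ?r" "ys ! i" ?P ?A] r yi A P fr Z ntuple2_wk[OF r A] els_wk[OF r A] by simp
    also have "id2 fr ** pair2 (tup (Z \<otimes> ?A) (wk Z ?A ?r)) (p2 Z ?A) = tup (Z \<otimes> ?A) (osl Z ?A i ys)"
    proof -
      let ?W = "Z \<otimes> ?A" and ?q = "pair2 (tup (Z \<otimes> ?A) (wk Z ?A ?r)) (p2 Z ?A)"
      have wr: "els ?W ?B (wk Z ?A ?r)" by (rule els_wk[OF r A])
      have q: "?q \<in> Ce K" "src ?q = ?W" "tgt ?q = ?P \<otimes> ?A" using wr Z A by simp_all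
      have e2: "els (?P \<otimes> ?A) X (map id2 ?fs)"
        using els_id2[OF PA f2] unfolding c2 .
      have "id2 fr ** ?q = tup (?P \<otimes> ?A) (map id2 ?fs) ** ?q"
        using t2 unfolding fr_def by metis
      also have "\<dots> = tup ?W (map (\<lambda>x. x ** ?q) (map id2 ?fs))"
        using ntuple2_hcomp[OF e2 q(1) q(3)] unfolding q(2) .
      also have "map (\<lambda>x. x ** ?q) (map id2 ?fs) = osl Z ?A i ys"
      proof (rule nth_equalityI)
        fix k assume "k < length (map (\<lambda>x. x ** ?q) (map id2 ?fs))"
        then have k: "k < ?n" using lfs by simp
        have a: "map (\<lambda>x. x ** ?q) (map id2 ?fs) ! k = id2 (?fs ! k) ** ?q"
          using k lfs by (simp only: nth_map length_map)
        consider "k < i" | "k = i" | "i < k" by linarith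
        then have "id2 (?fs ! k) ** ?q = osl Z ?A i ys ! k"
        proof cases
          case 1
          then have kB: "k < length ?B" using i lB by linarith
          have "id2 (?fs ! k) ** ?q = id2 (nproj ?B k) ** tup ?W (wk Z ?A ?r)"
            unfolding fsk[OF k] using 1 nproj_typing[OF B kB] P A q wr Z by simp
          also have "\<dots> = wk Z ?A ?r ! k" by (rule nproj_ntuple2[OF wr kB])
          also have "\<dots> = osl Z ?A i ys ! k" using 1 k i l(1) by (simp add: osl_def nth_append)
          finally show ?thesis .
        next
          case 2 then show ?thesis unfolding fsk[OF k] using P A q wr Z l(1) i by (simp add: osl_def)
        next
          case 3
          then have kB: "k - 1 < length ?B" using k lB by linarith
          have "id2 (?fs ! k) ** ?q = id2 (nproj ?B (k - 1)) ** tup ?W (wk Z ?A ?r)"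
            unfolding fsk[OF k] using 3 nproj_typing[OF B kB] P A q wr Z by simp
          also have "\<dots> = wk Z ?A ?r ! (k - 1)" by (rule nproj_ntuple2[OF wr kB])
          also have "\<dots> = osl Z ?A i ys ! k" using 3 k i l(1) by (cases k) (simp_all add: osl_def nth_append)
          finally show ?thesis .
        qed
        then show "map (\<lambda>x. x ** ?q) (map id2 ?fs) ! k = osl Z ?A i ys ! k" unfolding a .
      qed (use lfs l(1) i in \<open>simp add: osl_def\<close>)
      finally show ?thesis .
    qed
    finally show ?thesis .
  qed
  then show ?thesis unfolding tn using to' fr P A by simp
qed

lemmas tn_typing = tn_facts[THEN conjunct1] tn_facts[THEN conjunct2, THEN conjunct1]
  tn_facts[THEN conjunct2, THEN conjunct2, THEN conjunct1]
lemmas tn_ntuple2 = tn_facts[THEN conjunct2, THEN conjunct2, THEN conjunct2, THEN mp]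

end

context pseudo_commutative_strong_two_monad
begin

text \<open>\<open>\<Gamma>\<close> returns its two values as one element of
  \<open>T0 (A \<otimes> B)\<close>. Hence a single variable of product type is bound, and its
  components fill the places \<open>i\<close> and \<open>j\<close>.\<close>

definition osl2 :: "'o \<Rightarrow> 'o \<Rightarrow> 'o \<Rightarrow> nat \<Rightarrow> nat \<Rightarrow> 't list \<Rightarrow> 't list" where
  "osl2 Z A B i j ys = (wk Z (A \<otimes> B) ys)[i := p1 A B ** p2 Z (A \<otimes> B), j := p2 A B ** p2 Z (A \<otimes> B)]"

text \<open>By definition \<open>\<Gamma>\<close> acts on whole blocks, but the two blocks involved
  each contain just one entry to be run and are otherwise pure. \<open>\<Gamma>_\<tau>\<close>
  extracts the pure entries and leaves \<open>\<Gamma>\<close> on the entries \<open>i\<close> and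
  \<open>j\<close>.\<close>

lemma \<Gamma>n_facts:
  assumes X: "set X \<subseteq> Ob K" and ij: "i < j" "j < length X"
  shows "\<Gamma>n X i j \<in> Ce K \<and> src (\<Gamma>n X i j) = nprod (X[i := T0 (X ! i), j := T0 (X ! j)]) \<and> tgt (\<Gamma>n X i j) = T0 (nprod X) \<and>
    (els Z (X[i := T0 (X ! i), j := T0 (X ! j)]) ys \<and> idcs ys \<longrightarrow>
      \<Gamma>n X i j ** tup Z ys = T2 (tup (Z \<otimes> (X ! i \<otimes> X ! j)) (osl2 Z (X ! i) (X ! j) i j ys)) **
         \<tau> (X ! i \<otimes> X ! j) (\<Gamma> (X ! i) (X ! j) ** pair2 (ys ! i) (ys ! j)))"
proof -
  let ?X = "X[i := T0 (X ! i), j := T0 (X ! j)]" and ?A = "X ! i" and ?B = "X ! j"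
  let ?U = "take i X" and ?V = "drop i (take j X)" and ?W = "drop j X"
  let ?V' = "?V[0 := T0 ?A]" and ?W' = "?W[0 := T0 ?B]"
  let ?P = "nprod ?U" and ?Q = "nprod ?V" and ?R = "nprod ?W"
  have V0: "?V ! 0 = ?A" "0 < length ?V" and W0: "?W ! 0 = ?B" "0 < length ?W" using ij by simp_all
  have tU: "take i ?X = ?U" and tV: "drop i (take j ?X) = ?V'" and tW: "drop j ?X = ?W'"
    using ij by (simp_all add: take_update_swap drop_update_swap drop_take list_update_beyond)
  have A: "?A \<in> Ob K" "?B \<in> Ob K" using X ij by auto
  have U: "set ?U \<subseteq> Ob K" and V: "set ?V \<subseteq> Ob K" and W: "set ?W \<subseteq> Ob K"
    using X by (auto dest: in_set_takeD in_set_dropD)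
  have upd: "set (Y[0 := T0 C]) \<subseteq> Ob K" if "set Y \<subseteq> Ob K" "C \<in> Ob K" for Y C
    using that set_update_subset_insert[of Y 0 "T0 C"] by auto
  have V': "set ?V' \<subseteq> Ob K" and W': "set ?W' \<subseteq> Ob K" using upd[OF V A(1)] upd[OF W A(2)] .
  have O: "?P \<in> Ob K" "?Q \<in> Ob K" "?R \<in> Ob K" "nprod ?V' \<in> Ob K" "nprod ?W' \<in> Ob K"
    using U V W V' W' by simp_all
  have cX: "concat [?U, ?V, ?W] = X" using ij by (simp add: drop_take) (metis append_assoc append_take_drop_id drop_take le_add_diff_inverse less_imp_le take_add)
  have cX': "concat [?U, ?V', ?W'] = ?X"
    by (simp only: tU[symmetric] tV[symmetric] tW[symmetric] concat.simps append_Nil2)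
       (metis append_assoc append_take_drop_id less_imp_le ij(1) min_def take_take)
  have ug: "\<forall>Y \<in> set [?U, ?V, ?W]. set Y \<subseteq> Ob K" using U V W by simp
  have rg: "\<forall>Y \<in> set [?U, ?V', ?W']. set Y \<subseteq> Ob K" using U V' W' by simp
  note ugt = ungroup_typing[OF ug, unfolded cX]
  note rgt = regroup_typing[OF rg, unfolded cX']
  have np: "nprod (map nprod [x, y, z]) = nprod x \<otimes> nprod y \<otimes> nprod z" for x y z by simp
  note tV0 = tn_typing[OF V V0(2), unfolded V0(1)] and tW0 = tn_typing[OF W W0(2), unfolded W0(1)]
  have G: "\<Gamma>n X i j = id2 (T1 (ungroup [?U, ?V, ?W] \<odot> assoc_inv ?P ?Q ?R) \<odot> t ?P (?Q \<otimes> ?R)) **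
     ((id2 (id1 ?P) \<otimes>\<^sub>2 \<Gamma> ?Q ?R) ** id2 ((id1 ?P \<otimes>\<^sub>1 (tn ?V 0 \<otimes>\<^sub>1 tn ?W 0)) \<odot> assoc ?P (nprod ?V') (nprod ?W') \<odot> regroup [?U, ?V', ?W']))"
    unfolding \<Gamma>n_def Let_def by (simp only: tU tV tW nth_Cons_0 nth_Cons_Suc numeral_2_eq_2 One_nat_def)
  let ?d = "id2 ((id1 ?P \<otimes>\<^sub>1 (tn ?V 0 \<otimes>\<^sub>1 tn ?W 0)) \<odot> assoc ?P (nprod ?V') (nprod ?W') \<odot> regroup [?U, ?V', ?W'])"
  let ?e = "id2 (T1 (ungroup [?U, ?V, ?W] \<odot> assoc_inv ?P ?Q ?R) \<odot> t ?P (?Q \<otimes> ?R))"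
  have e: "?e = T2 (id2 (ungroup [?U, ?V, ?W]) ** id2 (assoc_inv ?P ?Q ?R)) ** id2 (t ?P (?Q \<otimes> ?R))"
    using O ugt by (simp del: assoc_inv_typing(4))
  have eT: "?e \<in> Ce K" "src ?e = ?P \<otimes> T0 (?Q \<otimes> ?R)" "tgt ?e = T0 (nprod X)"
    unfolding e using O ugt np by (simp_all del: assoc_inv_typing(4))
  have d: "?d = id2 (id1 ?P \<otimes>\<^sub>1 (tn ?V 0 \<otimes>\<^sub>1 tn ?W 0)) ** (id2 (assoc ?P (nprod ?V') (nprod ?W')) ** id2 (regroup [?U, ?V', ?W']))"
    using O rgt(1-3) tV0 tW0 by (simp del: assoc_typing(4) prod1_typing(4))
  have dT: "?d \<in> Ce K" "src ?d = nprod ?X" "tgt ?d = ?P \<otimes> (T0 ?Q \<otimes> T0 ?R)"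
    unfolding d using O rgt(1-3) tV0 tW0 by (simp_all del: assoc_typing(4) prod1_typing(4))
  have m: "id2 (id1 ?P) \<otimes>\<^sub>2 \<Gamma> ?Q ?R \<in> Ce K" "src (id2 (id1 ?P) \<otimes>\<^sub>2 \<Gamma> ?Q ?R) = ?P \<otimes> (T0 ?Q \<otimes> T0 ?R)"
      "tgt (id2 (id1 ?P) \<otimes>\<^sub>2 \<Gamma> ?Q ?R) = ?P \<otimes> T0 (?Q \<otimes> ?R)"
    using O by (simp_all add: prod2_eq)
  have "\<Gamma>n X i j ** tup Z ys = T2 (tup (Z \<otimes> (?A \<otimes> ?B)) (osl2 Z ?A ?B i j ys)) ** \<tau> (?A \<otimes> ?B) (\<Gamma> ?A ?B ** pair2 (ys ! i) (ys ! j))"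
    if ys: "els Z ?X ys" "idcs ys"
  proof -
    note l = elsD[OF ys(1)]
    have Z: "Z \<in> Ob K" by (rule l(2))
    \<comment> \<open>The elements are cut before the places \<open>i\<close> and \<open>j\<close>,
      like the objects, so each of these places is at the head of its block.\<close>
    let ?y1 = "take i ys" and ?y2 = "drop i (take j ys)" and ?y3 = "drop j ys"
    have y: "concat [?y1, ?y2, ?y3] = ys"
      by (simp only: concat.simps append_Nil2) (metis append_assoc append_take_drop_id less_imp_le ij(1) min_def take_take)
    have "els Z (?U @ ?V' @ ?W') (?y1 @ ?y2 @ ?y3)"
      using ys(1) cX' y by (simp only: concat.simps append_Nil2)
    moreover have "length ?U = length ?y1" "length ?V' = length ?y2" using l(1) by simp_all
    ultimately have e1: "els Z ?U ?y1" and e2: "els Z ?V' ?y2" and e3: "els Z ?W' ?y3"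
      using els_append by blast+
    have ess: "elss Z [?U, ?V', ?W'] [?y1, ?y2, ?y3]"
      unfolding elss_def using e1 e2 e3 Z by (auto simp: less_Suc_eq)
    have ic: "idcs ?y1" "idcs ?y2" "idcs ?y3" using ys(2) y by (auto simp: idcs_def dest: in_set_takeD in_set_dropD)
    have y0: "?y2 ! 0 = ys ! i" "?y3 ! 0 = ys ! j" using ij l(1) by simp_all
    let ?u = "ys ! i" and ?v = "ys ! j"
    have uv: "?u \<in> Ce K" "src ?u = Z" "tgt ?u = T0 ?A" "?v \<in> Ce K" "src ?v = Z" "tgt ?v = T0 ?B"
      using l(4-6)[of i] l(4-6)[of j] ij by simp_all
    let ?f = "tup (Z \<otimes> ?A) (osl Z ?A 0 ?y2)" and ?g = "tup (Z \<otimes> ?B) (osl Z ?B 0 ?y3)"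
    have t2: "id2 (tn ?V 0) ** tup Z ?y2 = T2 ?f ** \<tau> ?A ?u"
      using tn_ntuple2[OF V V0(2), of Z ?y2] e2 unfolding V0(1) y0 by simp
    have t3: "id2 (tn ?W 0) ** tup Z ?y3 = T2 ?g ** \<tau> ?B ?v"
      using tn_ntuple2[OF W W0(2), of Z ?y3] e3 unfolding W0(1) y0 by simp
    have Vs: "?V[0 := ?A] = ?V" "?W[0 := ?B] = ?W" using V0 W0 by (metis list_update_id)+
    have ef: "els (Z \<otimes> ?A) ?V (osl Z ?A 0 ?y2)" using els_osl'[OF e2 A(1)] Vs by simp
    have eg: "els (Z \<otimes> ?B) ?W (osl Z ?B 0 ?y3)" using els_osl'[OF e3 A(2)] Vs by simp
    have f: "idc ?f" "src ?f = Z \<otimes> ?A" "tgt ?f = ?Q" using ef idcs_osl[OF e2 ic(2) A(1)] by simp_all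
    have g: "idc ?g" "src ?g = Z \<otimes> ?B" "tgt ?g = ?R" using eg idcs_osl[OF e3 ic(3) A(2)] by simp_all
    have fg: "?f \<in> Ce K" "?g \<in> Ce K" using f g by (simp_all add: idcD)
    let ?a = "tup Z ?y1"
    have a: "?a \<in> Ce K" "src ?a = Z" "tgt ?a = ?P" using e1 by simp_all
    let ?Y = "Z \<otimes> (?A \<otimes> ?B)" and ?\<gamma> = "\<Gamma> ?A ?B ** pair2 ?u ?v"
    let ?p = "p1 Z (?A \<otimes> ?B)" and ?q = "p2 Z (?A \<otimes> ?B)"
    let ?f' = "?f ** pair2 ?p (p1 ?A ?B ** ?q)" and ?g' = "?g ** pair2 ?p (p2 ?A ?B ** ?q)"
    have fg': "?f' \<in> Ce K" "src ?f' = ?Y" "tgt ?f' = ?Q" "?g' \<in> Ce K" "src ?g' = ?Y" "tgt ?g' = ?R"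
      using f g fg A Z by simp_all
    have \<gamma>: "?\<gamma> \<in> Ce K" "src ?\<gamma> = Z" "tgt ?\<gamma> = T0 (?A \<otimes> ?B)" using uv A by simp_all
    have "id2 (regroup [?U, ?V', ?W']) ** tup Z ys = tup Z [tup Z ?y1, tup Z ?y2, tup Z ?y3]"
      using regroup_ntuple2[OF ess] unfolding y by simp
    then have rr: "id2 (regroup [?U, ?V', ?W']) ** tup Z ys = pair2 (pair2 ?a (tup Z ?y2)) (tup Z ?y3)"
      by simp
    have "?d ** tup Z ys = id2 (id1 ?P \<otimes>\<^sub>1 (tn ?V 0 \<otimes>\<^sub>1 tn ?W 0)) ** (id2 (assoc ?P (nprod ?V') (nprod ?W')) ** (id2 (regroup [?U, ?V', ?W']) ** tup Z ys))"
    proof -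
      define r v w where "r = regroup [?U, ?V', ?W']" and "v = tn ?V 0" and "w = tn ?W 0"
      have "r \<in> Ar K" "dom1 K r = nprod ?X" "cod1 K r = ?P \<otimes> nprod ?V' \<otimes> nprod ?W'"
        unfolding r_def using rgt(1-3) np by simp_all
      moreover have "v \<in> Ar K" "dom1 K v = nprod ?V'" "w \<in> Ar K" "dom1 K w = nprod ?W'"
        unfolding v_def w_def using tV0 tW0 by blast+
      moreover have "tup Z ys \<in> Ce K" "tgt (tup Z ys) = nprod ?X" using ys(1) by simp_all
      ultimately show ?thesis
        unfolding d r_def[symmetric] v_def[symmetric] w_def[symmetric] using O
        by (simp del: assoc_typing(4) prod1_typing(4))
    qed
    also have "\<dots> = pair2 ?a (pair2 (id2 (tn ?V 0) ** tup Z ?y2) (id2 (tn ?W 0) ** tup Z ?y3))"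
      unfolding rr by (rule assoc_prod_pair[where Z = Z]) (use e1 e2 e3 tV0 tW0 in \<open>simp_all only: ntuple2_typing'\<close>)
    finally have "?d ** tup Z ys = pair2 ?a (pair2 (id2 (tn ?V 0) ** tup Z ?y2) (id2 (tn ?W 0) ** tup Z ?y3))" .
    then have "?d ** tup Z ys = pair2 ?a (pair2 (T2 ?f ** \<tau> ?A ?u) (T2 ?g ** \<tau> ?B ?v))"
      unfolding t2 t3 .
    then have "((id2 (id1 ?P) \<otimes>\<^sub>2 \<Gamma> ?Q ?R) ** ?d) ** tup Z ys = pair2 ?a (\<Gamma> ?Q ?R ** pair2 (T2 ?f ** \<tau> ?A ?u) (T2 ?g ** \<tau> ?B ?v))"
    proof -
      assume that: "?d ** tup Z ys = pair2 ?a (pair2 (T2 ?f ** \<tau> ?A ?u) (T2 ?g ** \<tau> ?B ?v))"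
      have "((id2 (id1 ?P) \<otimes>\<^sub>2 \<Gamma> ?Q ?R) ** ?d) ** tup Z ys = (id2 (id1 ?P) \<otimes>\<^sub>2 \<Gamma> ?Q ?R) ** (?d ** tup Z ys)"
        by (rule hcomp_assoc') (use ys(1) m dT in \<open>simp_all only: ntuple2_typing'\<close>)
      moreover have "T2 ?f ** \<tau> ?A ?u \<in> Ce K" "src (T2 ?f ** \<tau> ?A ?u) = Z" "tgt (T2 ?f ** \<tau> ?A ?u) = T0 ?Q"
        "T2 ?g ** \<tau> ?B ?v \<in> Ce K" "src (T2 ?g ** \<tau> ?B ?v) = Z" "tgt (T2 ?g ** \<tau> ?B ?v) = T0 ?R"
        using fg f g uv A by simp_all
      ultimately show ?thesis
        using that a O by (simp only: prod2_pair \<Gamma>_typing pair2_typing)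
    qed
    \<comment> \<open>The reduction of \<open>\<Gamma>\<close> from blocks to single
      entries.\<close>
    also have "\<Gamma> ?Q ?R ** pair2 (T2 ?f ** \<tau> ?A ?u) (T2 ?g ** \<tau> ?B ?v) = T2 (pair2 ?f' ?g') ** \<tau> (?A \<otimes> ?B) ?\<gamma>"
      by (rule \<Gamma>_\<tau>[of _ _ Z]) (use uv A f g in simp_all)
    finally have 1: "((id2 (id1 ?P) \<otimes>\<^sub>2 \<Gamma> ?Q ?R) ** ?d) ** tup Z ys = pair2 ?a (T2 (pair2 ?f' ?g') ** \<tau> (?A \<otimes> ?B) ?\<gamma>)" .
    have 2: "id2 (t ?P (?Q \<otimes> ?R)) ** pair2 ?a (T2 (pair2 ?f' ?g') ** \<tau> (?A \<otimes> ?B) ?\<gamma>)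
      = T2 (pair2 (?a ** ?p) (pair2 ?f' ?g')) ** \<tau> (?A \<otimes> ?B) ?\<gamma>"
      using a fg' \<gamma> A by (intro t_pair_T2_\<tau>[where Z = Z]) (simp_all only: pair2_typing ob_typing)
    have w1: "?a ** ?p = tup ?Y (wk Z (?A \<otimes> ?B) ?y1)" by (rule ntuple2_wk[OF e1]) (use A in simp)
    \<comment> \<open>The variable bound by the unary strength of a block is replaced by a component
      of the variable of product type.\<close>
    have slot: "tup (Z \<otimes> C) (osl Z C 0 zs) ** pair2 ?p (h ** ?q) = tup ?Y ((wk Z (?A \<otimes> ?B) zs)[0 := h ** ?q])"
      if "els Z (Y[0 := T0 C]) zs" "C \<in> Ob K" "h \<in> Ce K" "src h = ?A \<otimes> ?B" "tgt h = C" for C zs h Y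
    proof -
      have "els (Z \<otimes> C) (Y[0 := C]) (osl Z C 0 zs)" using els_osl'[OF that(1,2)] .
      from ntuple2_hcomp[OF this, of "pair2 ?p (h ** ?q)"]
      have "tup (Z \<otimes> C) (osl Z C 0 zs) ** pair2 ?p (h ** ?q) = tup ?Y (map (\<lambda>x. x ** pair2 ?p (h ** ?q)) (osl Z C 0 zs))"
        using that A Z by simp
      also have "map (\<lambda>x. x ** pair2 ?p (h ** ?q)) (osl Z C 0 zs) = (wk Z (?A \<otimes> ?B) zs)[0 := h ** ?q]"
      proof (rule nth_equalityI)
        fix k assume "k < length (map (\<lambda>x. x ** pair2 ?p (h ** ?q)) (osl Z C 0 zs))"
        then have k: "k < length zs" by (simp add: osl_def)
        then have "zs ! k \<in> Ce K" "src (zs ! k) = Z" using elsD[OF that(1)] by simp_all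
        then show "map (\<lambda>x. x ** pair2 ?p (h ** ?q)) (osl Z C 0 zs) ! k = (wk Z (?A \<otimes> ?B) zs)[0 := h ** ?q] ! k"
          using k that A Z by (cases "k = 0") (simp_all add: osl_def)
      qed (simp add: osl_def)
      finally show ?thesis .
    qed
    have f'': "?f' = tup ?Y ((wk Z (?A \<otimes> ?B) ?y2)[0 := p1 ?A ?B ** ?q])"
      by (rule slot[OF e2]) (use A in simp_all)
    have g'': "?g' = tup ?Y ((wk Z (?A \<otimes> ?B) ?y3)[0 := p2 ?A ?B ** ?q])"
      by (rule slot[OF e3]) (use A in simp_all)
    let ?zs = "[wk Z (?A \<otimes> ?B) ?y1, (wk Z (?A \<otimes> ?B) ?y2)[0 := p1 ?A ?B ** ?q], (wk Z (?A \<otimes> ?B) ?y3)[0 := p2 ?A ?B ** ?q]]"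
    have AB: "?A \<otimes> ?B \<in> Ob K" using A by simp
    have z: "elss ?Y [?U, ?V, ?W] ?zs"
    proof -
      have "els ?Y (?V[0 := ?A]) (?zs ! 1)" 
        using els_update_same[OF els_wk[OF e2 AB] refl, of "p1 ?A ?B ** ?q" ?A] A Z by simp
      moreover have "els ?Y (?W[0 := ?B]) (?zs ! 2)" 
        using els_update_same[OF els_wk[OF e3 AB] refl, of "p2 ?A ?B ** ?q" ?B] A Z by simp
      ultimately show ?thesis using els_wk[OF e1 AB] Z AB unfolding Vs elss_def by (auto simp: less_Suc_eq)
    qed
    have cz: "concat ?zs = osl2 Z ?A ?B i j ys"
    proof -
      have "concat ?zs = (wk Z (?A \<otimes> ?B) (concat [?y1, ?y2, ?y3]))[i := p1 ?A ?B ** ?q, j := p2 ?A ?B ** ?q]"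
        using ij l(1) by (simp add: list_update_append)
      then show ?thesis unfolding y osl2_def .
    qed
    have zz: "pair2 (pair2 (?a ** ?p) ?f') ?g' = tup ?Y (map (tup ?Y) ?zs)"
      unfolding w1 f'' g'' by simp
    have ap: "?a ** ?p \<in> Ce K" "src (?a ** ?p) = ?Y" "tgt (?a ** ?p) = ?P" using a A Z by simp_all
    have r: "pair2 (?a ** ?p) (pair2 ?f' ?g') \<in> Ce K" "src (pair2 (?a ** ?p) (pair2 ?f' ?g')) = ?Y" "tgt (pair2 (?a ** ?p) (pair2 ?f' ?g')) = ?P \<otimes> (?Q \<otimes> ?R)"
      using ap fg' by (simp_all only: pair2_typing)
    have uT: "id2 (ungroup [?U, ?V, ?W]) \<in> Ce K" "src (id2 (ungroup [?U, ?V, ?W])) = ?P \<otimes> ?Q \<otimes> ?R" "tgt (id2 (ungroup [?U, ?V, ?W])) = nprod X"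
      using ugt np by (simp_all only: id2_typing)
    have aT: "id2 (assoc_inv ?P ?Q ?R) \<in> Ce K" "src (id2 (assoc_inv ?P ?Q ?R)) = ?P \<otimes> (?Q \<otimes> ?R)" "tgt (id2 (assoc_inv ?P ?Q ?R)) = ?P \<otimes> ?Q \<otimes> ?R"
      using O by (simp_all only: id2_typing assoc_inv_typing(1-3))
    have "id2 (assoc_inv ?P ?Q ?R) ** pair2 (?a ** ?p) (pair2 ?f' ?g') = pair2 (pair2 (?a ** ?p) ?f') ?g'"
      by (rule assoc_inv_pair[where Z = ?Y]) (use ap fg' in \<open>simp_all only:\<close>)
    moreover have "(id2 (ungroup [?U, ?V, ?W]) ** id2 (assoc_inv ?P ?Q ?R)) ** pair2 (?a ** ?p) (pair2 ?f' ?g')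
      = id2 (ungroup [?U, ?V, ?W]) ** (id2 (assoc_inv ?P ?Q ?R) ** pair2 (?a ** ?p) (pair2 ?f' ?g'))"
      by (rule hcomp_assoc') (use r uT aT in \<open>simp_all only:\<close>)
    ultimately have 3: "(id2 (ungroup [?U, ?V, ?W]) ** id2 (assoc_inv ?P ?Q ?R)) ** pair2 (?a ** ?p) (pair2 ?f' ?g') = tup ?Y (osl2 Z ?A ?B i j ys)"
      using ungroup_typing[OF ug, THEN conjunct2, THEN conjunct2, THEN conjunct2, THEN mp, OF z] unfolding zz cz by (simp only:)
    have \<tau>\<gamma>: "\<tau> (?A \<otimes> ?B) ?\<gamma> \<in> Ce K" "src (\<tau> (?A \<otimes> ?B) ?\<gamma>) = Z" "tgt (\<tau> (?A \<otimes> ?B) ?\<gamma>) = T0 ?Y" using \<gamma> AB by simp_all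
    have md: "(id2 (id1 ?P) \<otimes>\<^sub>2 \<Gamma> ?Q ?R) ** ?d \<in> Ce K" "src ((id2 (id1 ?P) \<otimes>\<^sub>2 \<Gamma> ?Q ?R) ** ?d) = nprod ?X"
       "tgt ((id2 (id1 ?P) \<otimes>\<^sub>2 \<Gamma> ?Q ?R) ** ?d) = ?P \<otimes> T0 (?Q \<otimes> ?R)"
      using m dT by (simp_all only: hcomp_typing)
    have "\<Gamma>n X i j ** tup Z ys = ?e ** (((id2 (id1 ?P) \<otimes>\<^sub>2 \<Gamma> ?Q ?R) ** ?d) ** tup Z ys)"
      unfolding G by (rule hcomp_assoc') (use eT md ys(1) in \<open>simp_all only: ntuple2_typing'\<close>)
    also have "\<dots> = T2 (id2 (ungroup [?U, ?V, ?W]) ** id2 (assoc_inv ?P ?Q ?R)) ** (T2 (pair2 (?a ** ?p) (pair2 ?f' ?g')) ** \<tau> (?A \<otimes> ?B) ?\<gamma>)"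
      unfolding 1 e 2[symmetric]
      by (rule hcomp_assoc')
        (use a r fg' \<tau>\<gamma> O uT aT in \<open>simp_all only: hcomp_typing T2_typing id2_typing t_typing ob_typing pair2_typing T0_Ob\<close>)
    also have "\<dots> = T2 ((id2 (ungroup [?U, ?V, ?W]) ** id2 (assoc_inv ?P ?Q ?R)) ** pair2 (?a ** ?p) (pair2 ?f' ?g')) ** \<tau> (?A \<otimes> ?B) ?\<gamma>"
      by (rule T2_comp_assoc) (use r uT aT \<tau>\<gamma> in \<open>simp_all only: hcomp_typing\<close>)
    finally show ?thesis unfolding 3 .
  qed
  moreover have "\<Gamma>n X i j \<in> Ce K" "src (\<Gamma>n X i j) = nprod ?X" "tgt (\<Gamma>n X i j) = T0 (nprod X)"
    unfolding G using eT m dT by (simp_all only: hcomp_typing)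
  ultimately show ?thesis by blast
qed

lemmas \<Gamma>n_typing = \<Gamma>n_facts[THEN conjunct1] \<Gamma>n_facts[THEN conjunct2, THEN conjunct1]
  \<Gamma>n_facts[THEN conjunct2, THEN conjunct2, THEN conjunct1]
lemmas \<Gamma>n_ntuple2 = \<Gamma>n_facts[THEN conjunct2, THEN conjunct2, THEN conjunct2, THEN mp, OF _ _ _ conjI]

end

context fp_two_category
begin

lemma slot_projs:
  assumes "set X \<subseteq> Ob K" "f \<in> Ar K" "i < length X" "Y = X[i := dom1 K f]"
  shows "id2 (slot X i f) = tup (nprod Y) ((projs Y)[i := id2 f ** projs Y ! i])"
proof -
  have Y: "set Y \<subseteq> Ob K" using assms set_update_subset_insert[of X i "dom1 K f"] by auto
  show ?thesis
    using slot_ntuple2[OF assms(1-3), of "nprod Y" "projs Y"] slot_typing[OF assms(1-3)] Y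
    by (simp add: assms(4)[symmetric])
qed

end

context strong_two_monad
begin

lemma tn_projs:
  assumes "set X \<subseteq> Ob K" "i < length X" "Y = X[i := T0 (X ! i)]"
  shows "id2 (tn X i) = T2 (tup (nprod Y \<otimes> X ! i) (osl (nprod Y) (X ! i) i (projs Y))) ** \<tau> (X ! i) (projs Y ! i)"
proof -
  have Y: "set Y \<subseteq> Ob K" using assms set_update_subset_insert[of X i "T0 (X ! i)"] by auto
  show ?thesis
    using tn_ntuple2[OF assms(1,2), of "nprod Y" "projs Y"] tn_typing[OF assms(1,2)] Y
    by (simp add: assms(3)[symmetric])
qed

end

context pseudo_commutative_strong_two_monad
begin

lemma \<Gamma>n_projs:
  assumes "set X \<subseteq> Ob K" "i < j" "j < length X" "Y = X[i := T0 (X ! i), j := T0 (X ! j)]"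
  shows "\<Gamma>n X i j = T2 (tup (nprod Y \<otimes> (X ! i \<otimes> X ! j)) (osl2 (nprod Y) (X ! i) (X ! j) i j (projs Y))) **
         \<tau> (X ! i \<otimes> X ! j) (\<Gamma> (X ! i) (X ! j) ** pair2 (projs Y ! i) (projs Y ! j))"
proof -
  have "set (X[i := T0 (X ! i)]) \<subseteq> Ob K" using assms set_update_subset_insert[of X i "T0 (X ! i)"] by auto
  then have Y: "set Y \<subseteq> Ob K" using assms set_update_subset_insert[of "X[i := T0 (X ! i)]" j "T0 (X ! j)"] by auto
  then show ?thesis
    using \<Gamma>n_ntuple2[OF assms(1-3), of "nprod Y" "projs Y"] \<Gamma>n_typing[OF assms(1-3)]
    by (simp add: assms(4)[symmetric] idcs_def)
qed

text \<open>\<open>fel As B h w\<close> expresses, on generalized elements, that the 1-cell \<open>h\<close> with the structure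
  2-cells \<open>w i\<close> is a multimorphism from the free algebras on \<open>As\<close> to the free algebra on \<open>B\<close>.\<close>

definition fel_typ :: "'o list \<Rightarrow> 'o \<Rightarrow> 't \<Rightarrow> (nat \<Rightarrow> 't) \<Rightarrow> bool" where
  "fel_typ As B h w \<longleftrightarrow> set As \<subseteq> Ob K \<and> B \<in> Ob K \<and> idc h \<and> src h = nprod (map T0 As) \<and> tgt h = T0 B \<and>
    (\<forall>i<length As. w i \<in> Ce K \<and> src (w i) = nprod ((map T0 As)[i := T0 (T0 (As ! i))]) \<and> tgt (w i) = T0 B \<and>
       (\<exists>v. vinv (w i) v)) \<and>
    (\<forall>i<length As. \<forall>Z ys. els Z ((map T0 As)[i := T0 (T0 (As ! i))]) ys \<longrightarrow> idcs ys \<longrightarrow>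
       dm (w i ** tup Z ys) = bnd (T0 (As ! i)) B (ys ! i) (h ** tup (Z \<otimes> T0 (As ! i)) (osl Z (T0 (As ! i)) i ys)) \<and>
       cm (w i ** tup Z ys) = h ** tup Z (ys[i := \<mu>2 (As ! i) ** ys ! i]))"

definition fel_eta :: "'o list \<Rightarrow> 't \<Rightarrow> (nat \<Rightarrow> 't) \<Rightarrow> bool" where
  "fel_eta As h w \<longleftrightarrow> (\<forall>i<length As. \<forall>Z ys. els Z (map T0 As) ys \<longrightarrow> idcs ys \<longrightarrow>
     w i ** tup Z (ys[i := \<eta>2 (T0 (As ! i)) ** ys ! i]) = h ** tup Z ys)"

definition fel_mu :: "'o list \<Rightarrow> 'o \<Rightarrow> (nat \<Rightarrow> 't) \<Rightarrow> bool" where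
  "fel_mu As B w \<longleftrightarrow> (\<forall>i<length As. \<forall>Z ys. els Z ((map T0 As)[i := T0 (T0 (T0 (As ! i)))]) ys \<longrightarrow> idcs ys \<longrightarrow>
     w i ** tup Z (ys[i := \<mu>2 (T0 (As ! i)) ** ys ! i])
     = (w i ** tup Z (ys[i := T2 (\<mu>2 (As ! i)) ** ys ! i]))
       \<cdot> bnd (T0 (T0 (As ! i))) B (ys ! i) (w i ** tup (Z \<otimes> T0 (T0 (As ! i))) (osl Z (T0 (T0 (As ! i))) i ys)))"

definition fel_coh :: "'o list \<Rightarrow> 'o \<Rightarrow> 't \<Rightarrow> (nat \<Rightarrow> 't) \<Rightarrow> bool" where
  "fel_coh As B h w \<longleftrightarrow> (\<forall>j<length As. \<forall>i<j. \<forall>Z ys.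
     els Z ((map T0 As)[i := T0 (T0 (As ! i)), j := T0 (T0 (As ! j))]) ys \<longrightarrow> idcs ys \<longrightarrow>
     (w i ** tup Z (ys[j := \<mu>2 (As ! j) ** ys ! j]))
       \<cdot> bnd (T0 (As ! i)) B (ys ! i) (w j ** tup (Z \<otimes> T0 (As ! i)) (osl Z (T0 (As ! i)) i ys))
     = (w j ** tup Z (ys[i := \<mu>2 (As ! i) ** ys ! i]))
       \<cdot> bnd (T0 (As ! j)) B (ys ! j) (w i ** tup (Z \<otimes> T0 (As ! j)) (osl Z (T0 (As ! j)) j ys))
       \<cdot> bnd (T0 (As ! i) \<otimes> T0 (As ! j)) B (\<Gamma> (T0 (As ! i)) (T0 (As ! j)) ** pair2 (ys ! i) (ys ! j))
           (h ** tup (Z \<otimes> (T0 (As ! i) \<otimes> T0 (As ! j))) (osl2 Z (T0 (As ! i)) (T0 (As ! j)) i j ys)))"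

definition fel :: "'o list \<Rightarrow> 'o \<Rightarrow> 't \<Rightarrow> (nat \<Rightarrow> 't) \<Rightarrow> bool" where
  "fel As B h w \<longleftrightarrow> fel_typ As B h w \<and> fel_eta As h w \<and> fel_mu As B w \<and> fel_coh As B h w"

lemma fel_typD:
  assumes "fel_typ As B h w"
  shows "set As \<subseteq> Ob K" "B \<in> Ob K" "idc h" "src h = nprod (map T0 As)" "tgt h = T0 B" "h \<in> Ce K"
    "i < length As \<Longrightarrow> w i \<in> Ce K" "i < length As \<Longrightarrow> src (w i) = nprod ((map T0 As)[i := T0 (T0 (As ! i))])"
    "i < length As \<Longrightarrow> tgt (w i) = T0 B" "i < length As \<Longrightarrow> \<exists>v. vinv (w i) v"
    "\<lbrakk>i < length As; els Z ((map T0 As)[i := T0 (T0 (As ! i))]) ys; idcs ys\<rbrakk> \<Longrightarrow>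
       dm (w i ** tup Z ys) = bnd (T0 (As ! i)) B (ys ! i) (h ** tup (Z \<otimes> T0 (As ! i)) (osl Z (T0 (As ! i)) i ys))"
    "\<lbrakk>i < length As; els Z ((map T0 As)[i := T0 (T0 (As ! i))]) ys; idcs ys\<rbrakk> \<Longrightarrow>
       cm (w i ** tup Z ys) = h ** tup Z (ys[i := \<mu>2 (As ! i) ** ys ! i])"
  using assms unfolding fel_typ_def by (blast dest: idcD)+

lemma map_T0_update [simp]: "i < length As \<Longrightarrow> (map T0 As)[i := T0 (As ! i)] = map T0 As"
  by (metis list_update_id map_update)

lemma map_T0_Ob: "set As \<subseteq> Ob K \<Longrightarrow> set (map T0 As) \<subseteq> Ob K"
  by auto

lemma update_Ob: "set X \<subseteq> Ob K \<Longrightarrow> A \<in> Ob K \<Longrightarrow> set (X[i := A]) \<subseteq> Ob K"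
  using set_update_subset_insert[of X i A] by auto

lemma idcs_projs: "set X \<subseteq> Ob K \<Longrightarrow> idcs (projs X)"
  by (simp add: idcs_def)

lemma hcomp_T2_\<tau>:
  assumes "\<alpha> \<in> Ce K" "src \<alpha> = P" "tgt \<alpha> = T0 B" "B \<in> Ob K" "els (src u \<otimes> A) Y ys" "nprod Y = P"
    "u \<in> Ce K" "tgt u = T0 A" "A \<in> Ob K"
  shows "\<mu>2 B ** (T2 \<alpha> ** (T2 (tup (src u \<otimes> A) ys) ** \<tau> A u)) = bnd A B u (\<alpha> ** tup (src u \<otimes> A) ys)"
  using assms by (simp add: bnd_def)

text \<open>Each clause of \<open>alg_cells1\<close> is the corresponding clause of
  \<open>fel\<close> at the generic tuple of its own input list, since \<open>slot\<close>,
  \<open>tn\<close> and \<open>\<Gamma>n\<close> have been described on elements.\<close>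

theorem fel_alg_cells1:
  assumes f: "fel As B (id2 f) (\<lambda>i. ws ! i)" and fA: "f \<in> Ar K" and l: "length ws = length As"
  shows "(f, ws) \<in> alg_cells1 (map Free As) (Free B)"
proof -
  have ft: "fel_typ As B (id2 f) (\<lambda>i. ws ! i)" and fe: "fel_eta As (id2 f) (\<lambda>i. ws ! i)"
    and fm: "fel_mu As B (\<lambda>i. ws ! i)" and fc: "fel_coh As B (id2 f) (\<lambda>i. ws ! i)"
    using f by (auto simp: fel_def)
  note d = fel_typD[OF ft]
  let ?X = "map T0 As"
  have X: "set ?X \<subseteq> Ob K" and lX: "length ?X = length As" using map_T0_Ob[OF d(1)] by simp_all
  have A: "As ! i \<in> Ob K" if "i < length As" for i using d(1) that by auto
  have fX: "map fst (map Free As) = ?X" by (simp add: Free_def)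
  have sA: "snd (map Free As ! i) = \<mu> (As ! i)" if "i < length As" for i using that by (simp add: Free_def)
  have fB: "fst (Free B) = T0 B" "snd (Free B) = \<mu> B" by (simp_all add: Free_def)
  have Xi: "?X ! i = T0 (As ! i)" if "i < length As" for i using that by simp
  define n where "n = length As"
  let ?Y = "\<lambda>i. ?X[i := T0 (T0 (As ! i))]"
  have Y: "set (?Y i) \<subseteq> Ob K" if "i < n" for i using update_Ob[OF X] A that unfolding n_def by simp
  have b: "\<mu> B \<in> Ar K" "dom1 K (\<mu> B) = T0 (T0 B)" using d(2) by simp_all
  have f1: "dom1 K f = nprod ?X" "cod1 K f = T0 B" using d(4,5) fA by simp_all
  have tnT: "tn ?X i \<in> Ar K" "dom1 K (tn ?X i) = nprod (?Y i)" "cod1 K (tn ?X i) = T0 (nprod ?X)" if "i < n" for i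
    using tn_typing[OF X, of i] that unfolding n_def by (simp_all add: Xi)
  have mu: "\<mu> (As ! i) \<in> Ar K" "dom1 K (\<mu> (As ! i)) = T0 (T0 (As ! i))" "cod1 K (\<mu> (As ! i)) = T0 (As ! i)" if "i < n" for i
    using that A unfolding n_def by simp_all
  have slT: "slot ?X i (\<mu> (As ! i)) \<in> Ar K" "dom1 K (slot ?X i (\<mu> (As ! i))) = nprod (?Y i)" "cod1 K (slot ?X i (\<mu> (As ! i))) = nprod ?X" if "i < n" for i
    using slot_typing[OF X mu(1)[OF that], of i] that mu[OF that] unfolding n_def by simp_all
  have ff: "f \<in> hom1 K (nprod ?X) (T0 B)"
    using fA f1 by (simp add: hom1_def)
  have p: "els (nprod Z) Z (projs Z)" "idcs (projs Z)" "length (projs Z) = length Z" if "set Z \<subseteq> Ob K" for Z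
    using that by (simp_all add: idcs_projs) (simp add: projs_def)
  have pj: "projs Z ! i \<in> Ce K" "src (projs Z ! i) = nprod Z" "tgt (projs Z ! i) = Z ! i" "idc (projs Z ! i)" if "set Z \<subseteq> Ob K" "i < length Z" for Z i
    using elsD(4-6)[OF p(1)[OF that(1)], of i] that idcs_nth[OF p(2)] p(3) by simp_all
  have wt: "ws ! i \<in> hom2 K (\<mu> B \<odot> T1 f \<odot> tn ?X i) (f \<odot> slot ?X i (\<mu> (As ! i)))" if i: "i < n" for i
  proof -
    have i': "i < length As" using i unfolding n_def .
    have Yi: "?Y i = ?X[i := T0 (?X ! i)]" using i' by simp
    \<comment> \<open>The generic tuple is an identity, so the value there is the structure 2-cell
      itself.\<close>
    have w: "ws ! i ** tup (nprod (?Y i)) (projs (?Y i)) = ws ! i"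
      using Y[OF i] d(7)[OF i'] d(8)[OF i'] by simp
    note pp = pj[OF Y[OF i], of i]
    have eo: "els (nprod (?Y i) \<otimes> T0 (As ! i)) ?X (osl (nprod (?Y i)) (T0 (As ! i)) i (projs (?Y i)))"
      using els_osl'[OF p(1)[OF Y[OF i]], of "T0 (As ! i)"] A[OF i'] i' by simp
    have "dm (ws ! i) = \<mu>2 B ** (T2 (id2 f) ** id2 (tn ?X i))"
      unfolding tn_projs[OF X i'[folded lX] Yi, unfolded Xi[OF i']]
      using d(11)[OF i' p(1)[OF Y[OF i]] p(2)[OF Y[OF i]]] hcomp_T2_\<tau>[OF d(6) d(4) d(5) d(2), of "projs (?Y i) ! i" "T0 (As ! i)" ?X] pp eo A[OF i'] i'
      unfolding w by simp
    \<comment> \<open>From here \<open>id2_inject\<close> leads back to the source 1-cell that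
      \<open>hom2\<close> asks for.\<close>
    then have "id2 (dom2 K (ws ! i)) = id2 (\<mu> B \<odot> T1 f \<odot> tn ?X i)"
      using b fA f1 tnT[OF i] d(2) by (simp add: dm_def)
    then have 1: "dom2 K (ws ! i) = \<mu> B \<odot> T1 f \<odot> tn ?X i"
      by (subst (asm) id2_inject) (use b fA f1 tnT[OF i] d(2) d(7)[OF i'] in simp_all)
    have "cm (ws ! i) = id2 f ** id2 (slot ?X i (\<mu> (As ! i)))"
      using d(12)[OF i' p(1)[OF Y[OF i]] p(2)[OF Y[OF i]]] slot_projs[OF X mu(1)[OF i] i'[folded lX], of "?Y i"] mu[OF i]
      unfolding w by simp
    then have "id2 (cod2 K (ws ! i)) = id2 (f \<odot> slot ?X i (\<mu> (As ! i)))"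
      using fA f1 slT[OF i] by (simp add: cm_def)
    then have 2: "cod2 K (ws ! i) = f \<odot> slot ?X i (\<mu> (As ! i))"
      by (subst (asm) id2_inject) (use fA f1 slT[OF i] d(7)[OF i'] in simp_all)
    show ?thesis using hom2I[OF d(7)[OF i']] unfolding 1 2 .
  qed
  have eta: "ws ! i ** id2 (slot ?X i (\<eta> (?X ! i))) = id2 f" if i: "i < n" for i
  proof -
    have i': "i < length As" using i unfolding n_def .
    have e: "\<eta> (?X ! i) \<in> Ar K" "dom1 K (\<eta> (?X ! i)) = ?X ! i" using A[OF i'] i' by simp_all
    have "ws ! i ** id2 (slot ?X i (\<eta> (?X ! i))) = id2 f ** tup (nprod ?X) (projs ?X)"
      using fe[unfolded fel_eta_def, rule_format, OF i' p(1)[OF X] p(2)[OF X]] slot_projs[OF X e(1) i'[folded lX], of ?X] e i' by simp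
    then show ?thesis using X d(4,6) by simp
  qed
  have mul: "ws ! i ** id2 (slot ?X i (\<mu> (?X ! i))) = (ws ! i ** id2 (slot ?X i (T1 (\<mu> (As ! i))))) \<cdot> (\<mu>2 B ** (T2 (ws ! i) ** id2 (tn (?Y i) i)))"
    if i: "i < n" for i
  proof -
    have i': "i < length As" using i unfolding n_def .
    let ?W = "?X[i := T0 (T0 (T0 (As ! i)))]"
    have W: "set ?W \<subseteq> Ob K" using update_Ob[OF X] A[OF i'] by simp
    have m: "\<mu> (?X ! i) \<in> Ar K" "dom1 K (\<mu> (?X ! i)) = T0 (T0 (T0 (As ! i)))" using A[OF i'] i' by simp_all
    have m': "T1 (\<mu> (As ! i)) \<in> Ar K" "dom1 K (T1 (\<mu> (As ! i))) = T0 (T0 (T0 (As ! i)))" using A[OF i'] by simp_all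
    have Wi: "?W = (?Y i)[i := T0 (?Y i ! i)]" using i' by simp
    have Yii: "?Y i ! i = T0 (T0 (As ! i))" using i' by simp
    note pp = pj[OF W, of i]
    have eo: "els (nprod ?W \<otimes> T0 (T0 (As ! i))) (?Y i) (osl (nprod ?W) (T0 (T0 (As ! i))) i (projs ?W))"
      using els_osl'[OF p(1)[OF W], of "T0 (T0 (As ! i))"] A[OF i'] by simp
    have iY: "i < length (?Y i)" using i' by simp
    have 1: "\<mu>2 B ** (T2 (ws ! i) ** id2 (tn (?Y i) i)) = bnd (T0 (T0 (As ! i))) B (projs ?W ! i) (ws ! i ** tup (nprod ?W \<otimes> T0 (T0 (As ! i))) (osl (nprod ?W) (T0 (T0 (As ! i))) i (projs ?W)))"
      unfolding tn_projs[OF Y[OF i] iY Wi, unfolded Yii]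
      using hcomp_T2_\<tau>[OF d(7)[OF i'] d(8)[OF i'] d(9)[OF i'] d(2), of "projs ?W ! i" "T0 (T0 (As ! i))" "?Y i"] pp eo A[OF i'] i' by simp
    show ?thesis
      unfolding 1 slot_projs[OF X m(1) i'[folded lX] arg_cong[OF m(2)[symmetric], of "\<lambda>x. ?X[i := x]"]]
        slot_projs[OF X m'(1) i'[folded lX] arg_cong[OF m'(2)[symmetric], of "\<lambda>x. ?X[i := x]"]]
      using fm[unfolded fel_mu_def, rule_format, OF i' p(1)[OF W] p(2)[OF W]] A[OF i'] i' by simp
  qed
  have coh: "(ws ! i ** id2 (slot (?Y i) j (\<mu> (As ! j)))) \<cdot> (\<mu>2 B ** (T2 (ws ! j) ** id2 (tn (?Y j) i)))
     = (ws ! j ** id2 (slot (?Y j) i (\<mu> (As ! i)))) \<cdot> (\<mu>2 B ** (T2 (ws ! i) ** id2 (tn (?Y i) j)))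
       \<cdot> (id2 (\<mu> B \<odot> T1 f) ** \<Gamma>n ?X i j)" if j: "j < n" and ij: "i < j" for i j
  proof -
    have j': "j < length As" and i: "i < n" and i': "i < length As" using j ij unfolding n_def by simp_all
    let ?W = "?X[i := T0 (T0 (As ! i)), j := T0 (T0 (As ! j))]"
    let ?P = "projs ?W" and ?Z = "nprod ?W"
    have W: "set ?W \<subseteq> Ob K" using update_Ob[OF Y[OF i]] A[OF j'] by simp
    have Wj: "?W = (?Y i)[j := dom1 K (\<mu> (As ! j))]" "?W = (?Y j)[i := dom1 K (\<mu> (As ! i))]"
      using mu[OF j] mu[OF i] ij by (simp_all add: list_update_swap)
    have Wt: "?W = (?Y j)[i := T0 (?Y j ! i)]" "?W = (?Y i)[j := T0 (?Y i ! j)]" "?W = ?X[i := T0 (?X ! i), j := T0 (?X ! j)]"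
      using ij i' j' by (simp_all add: list_update_swap)
    have Yij: "?Y j ! i = T0 (As ! i)" "?Y i ! j = T0 (As ! j)" using ij i' j' by simp_all
    have iY: "i < length (?Y j)" "j < length (?Y i)" using i' j' by simp_all
    note ppi = pj[OF W, of i] and ppj = pj[OF W, of j]
    have W2: "?W = (?Y j)[i := T0 (T0 (As ! i))]" using ij by (simp add: list_update_swap)
    have r1: "(?Y j)[i := T0 (As ! i)] = ?Y j" using ij i' by (simp add: list_update_swap[of j i])
    have r2: "(?Y i)[j := T0 (As ! j)] = ?Y i" using ij j' by (simp add: list_update_swap[of i j])
    have eo1: "els (?Z \<otimes> T0 (As ! i)) (?Y j) (osl ?Z (T0 (As ! i)) i ?P)"
      using els_osl'[OF p(1)[OF W, unfolded W2], of "T0 (As ! i)"] A[OF i'] unfolding r1 W2 by simp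
    have eo2: "els (?Z \<otimes> T0 (As ! j)) (?Y i) (osl ?Z (T0 (As ! j)) j ?P)"
      using els_osl'[OF p(1)[OF W], of "T0 (As ! j)"] A[OF j'] unfolding r2 by simp
    have 1: "\<mu>2 B ** (T2 (ws ! j) ** id2 (tn (?Y j) i)) = bnd (T0 (As ! i)) B (?P ! i) (ws ! j ** tup (?Z \<otimes> T0 (As ! i)) (osl ?Z (T0 (As ! i)) i ?P))"
      unfolding tn_projs[OF Y[OF j] iY(1) Wt(1), unfolded Yij]
      using hcomp_T2_\<tau>[OF d(7)[OF j'] d(8)[OF j'] d(9)[OF j'] d(2), of "?P ! i" "T0 (As ! i)" "?Y j"] ppi eo1 A[OF i'] i' ij by simp
    have 2: "\<mu>2 B ** (T2 (ws ! i) ** id2 (tn (?Y i) j)) = bnd (T0 (As ! j)) B (?P ! j) (ws ! i ** tup (?Z \<otimes> T0 (As ! j)) (osl ?Z (T0 (As ! j)) j ?P))"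
      unfolding tn_projs[OF Y[OF i] iY(2) Wt(2), unfolded Yij]
      using hcomp_T2_\<tau>[OF d(7)[OF i'] d(8)[OF i'] d(9)[OF i'] d(2), of "?P ! j" "T0 (As ! j)" "?Y i"] ppj eo2 A[OF j'] j' ij by simp
    let ?AB = "T0 (As ! i) \<otimes> T0 (As ! j)" and ?G = "\<Gamma> (T0 (As ! i)) (T0 (As ! j)) ** pair2 (?P ! i) (?P ! j)"
    have G: "?G \<in> Ce K" "src ?G = ?Z" "tgt ?G = T0 ?AB" "?AB \<in> Ob K" using ppi ppj A[OF i'] A[OF j'] i' j' ij by simp_all
    have eo3: "els (?Z \<otimes> ?AB) ?X (osl2 ?Z (T0 (As ! i)) (T0 (As ! j)) i j ?P)"
    proof -
      have "els (?Z \<otimes> ?AB) (?X[i := T0 (As ! i), j := T0 (As ! j)]) (osl2 ?Z (T0 (As ! i)) (T0 (As ! j)) i j ?P)"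
      proof -
        have e: "els (?Z \<otimes> ?AB) ?W (wk ?Z ?AB ?P)" by (rule els_wk[OF p(1)[OF W] G(4)])
        have q: "nprod ?W \<in> Ob K" "T0 (As ! i) \<in> Ob K" "T0 (As ! j) \<in> Ob K" using W A[OF i'] A[OF j'] by simp_all
        have "els (?Z \<otimes> ?AB) (?W[i := T0 (As ! i)]) ((wk ?Z ?AB ?P)[i := p1 (T0 (As ! i)) (T0 (As ! j)) ** p2 ?Z ?AB])"
          by (rule els_update[OF e]) (use q in simp_all)
        then have "els (?Z \<otimes> ?AB) (?W[i := T0 (As ! i), j := T0 (As ! j)]) (osl2 ?Z (T0 (As ! i)) (T0 (As ! j)) i j ?P)"
          unfolding osl2_def by (rule els_update) (use q in simp_all)
        moreover have "?W[i := T0 (As ! i), j := T0 (As ! j)] = ?X[i := T0 (As ! i), j := T0 (As ! j)]"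
          using ij by (simp add: list_update_swap)
        ultimately show ?thesis by simp
      qed
      moreover have "?X[i := T0 (As ! i), j := T0 (As ! j)] = ?X" using i' j' by simp
      ultimately show ?thesis by simp
    qed
    have 3: "id2 (\<mu> B \<odot> T1 f) ** \<Gamma>n ?X i j = bnd ?AB B ?G (id2 f ** tup (?Z \<otimes> ?AB) (osl2 ?Z (T0 (As ! i)) (T0 (As ! j)) i j ?P))"
    proof -
      have "id2 (\<mu> B \<odot> T1 f) = \<mu>2 B ** T2 (id2 f)" using b fA f1 d(2) by simp
      moreover have "\<Gamma>n ?X i j = T2 (tup (?Z \<otimes> ?AB) (osl2 ?Z (T0 (As ! i)) (T0 (As ! j)) i j ?P)) ** \<tau> ?AB ?G"
        using \<Gamma>n_projs[OF X ij j'[folded lX] Wt(3)] unfolding Xi[OF i'] Xi[OF j'] .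
      moreover have "T2 (tup (?Z \<otimes> ?AB) (osl2 ?Z (T0 (As ! i)) (T0 (As ! j)) i j ?P)) ** \<tau> ?AB ?G \<in> Ce K"
        "tgt (T2 (tup (?Z \<otimes> ?AB) (osl2 ?Z (T0 (As ! i)) (T0 (As ! j)) i j ?P)) ** \<tau> ?AB ?G) = T0 (nprod ?X)"
        using eo3 G by simp_all
      ultimately show ?thesis
        using hcomp_T2_\<tau>[OF d(6) d(4) d(5) d(2), of ?G ?AB ?X "osl2 ?Z (T0 (As ! i)) (T0 (As ! j)) i j ?P"] eo3 G d(2,5,6) f1 fA
        by simp
    qed
    show ?thesis
      unfolding 1 2 3 slot_projs[OF Y[OF i] mu(1)[OF j] iY(2) Wj(1)] slot_projs[OF Y[OF j] mu(1)[OF i] iY(1) Wj(2)]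
      using fc[unfolded fel_coh_def, rule_format, OF j' ij p(1)[OF W] p(2)[OF W]] .
  qed
  have inv: "invertible2 (ws ! i)" if "i < n" for i using d(10)[OF that[unfolded n_def]] invertible2_iff_vinv by blast
  show ?thesis
    unfolding alg_cells1_def Let_def mem_Collect_eq case_prod_conv fX fB length_map
    using wt eta mul coh inv ff l unfolding n_def by (auto simp: Free_def)
qed

end

section \<open>Composition of multimorphisms of free algebras\<close>

context pseudo_commutative_strong_two_monad
begin

text \<open>\<open>fel_typ\<close> prescribes the source of \<open>w i\<close> on elements only; the
  generic tuple turns this into an equation of 2-cells.\<close>

lemma fel_dm:
  assumes "fel_typ As B h w" "i < length As"
  shows "dm (w i) = \<mu>2 B ** (T2 h ** id2 (tn (map T0 As) i))"
proof -
  note d = fel_typD[OF assms(1)]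
  let ?X = "map T0 As" and ?Y = "(map T0 As)[i := T0 (T0 (As ! i))]"
  have A: "As ! i \<in> Ob K" using d(1) assms(2) by auto
  have X: "set ?X \<subseteq> Ob K" by (rule map_T0_Ob[OF d(1)])
  have Y: "set ?Y \<subseteq> Ob K" using update_Ob[OF X] A by simp
  have Yi: "?Y = ?X[i := T0 (?X ! i)]" and Xi: "?X ! i = T0 (As ! i)" and iX: "i < length ?X" using assms(2) by simp_all
  have p: "els (nprod ?Y) ?Y (projs ?Y)" "idcs (projs ?Y)" using Y by (simp_all add: idcs_projs)
  have pp: "projs ?Y ! i \<in> Ce K" "src (projs ?Y ! i) = nprod ?Y" "tgt (projs ?Y ! i) = T0 (T0 (As ! i))"
    using elsD(4-6)[OF p(1), of i] assms(2) by simp_all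
  have eo: "els (nprod ?Y \<otimes> T0 (As ! i)) ?X (osl (nprod ?Y) (T0 (As ! i)) i (projs ?Y))"
    using els_osl'[OF p(1), of "T0 (As ! i)"] A assms(2) by simp
  have "w i ** tup (nprod ?Y) (projs ?Y) = w i" using Y d(7,8)[OF assms(2)] by simp
  then show ?thesis
    unfolding tn_projs[OF X iX Yi, unfolded Xi]
    using d(11)[OF assms(2) p] hcomp_T2_\<tau>[OF d(6) d(4) d(5) d(2), of "projs ?Y ! i" "T0 (As ! i)" ?X] pp eo A assms(2)
    by simp
qed

text \<open>The entry at \<open>j\<close> may be a proper 2-cell, since it is overwritten. This
  occurs when one entry of a list of images is a structure 2-cell.\<close>

lemma idcs_update':
  assumes "\<And>k. k < length xs \<Longrightarrow> k \<noteq> j \<Longrightarrow> idc (xs ! k)" "idc v"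
  shows "idcs (xs[j := v])"
proof (rule idcsI)
  fix i assume "i < length (xs[j := v])"
  then show "idc (xs[j := v] ! i)" using assms by (cases "i = j") simp_all
qed

lemma map_dm_update:
  assumes "\<And>k. k < length xs \<Longrightarrow> k \<noteq> j \<Longrightarrow> idc (xs ! k)"
  shows "map dm (xs[j := v]) = xs[j := dm v]"
proof (rule nth_equalityI)
  fix i assume "i < length (map dm (xs[j := v]))"
  then show "map dm (xs[j := v]) ! i = xs[j := dm v] ! i" using assms by (cases "i = j") simp_all
qed simp

section \<open>Composites of multimorphisms of free algebras, evaluated on elements\<close>

context
  fixes Ass :: "'o list list" and Bs :: "'o list" and C :: 'o and f :: 'f and fs :: "'t list" and Gs :: "('f \<times> 't list) list"
  assumes F: "fel_typ Bs C (id2 f) (\<lambda>i. fs ! i)" and fA: "f \<in> Ar K"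
    and l: "length Ass = length Bs" "length Gs = length Bs"
    and GG: "\<forall>j<length Bs. fst (Gs ! j) \<in> Ar K \<and> fel_typ (Ass ! j) (Bs ! j) (id2 (fst (Gs ! j))) (\<lambda>i. snd (Gs ! j) ! i)"
begin

lemma args_typ: "j < length Bs \<Longrightarrow> fst (Gs ! j) \<in> Ar K"
  "j < length Bs \<Longrightarrow> fel_typ (Ass ! j) (Bs ! j) (id2 (fst (Gs ! j))) (\<lambda>i. snd (Gs ! j) ! i)"
  using GG by auto

abbreviation (input) "cmpc \<equiv> alg_comp1 (map (map Free) Ass) (f, fs) Gs"
abbreviation (input) "Txs \<equiv> map (map T0) Ass"
abbreviation (input) "imgs Z xss \<equiv> map (\<lambda>j. id2 (fst (Gs ! j)) ** tup Z (xss ! j)) [0..<length Bs]"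
abbreviation (input) "Tys j d \<equiv> Txs[j := (Txs ! j)[d := T0 (Txs ! j ! d)]]"
text \<open>\<open>scA\<close> and \<open>scB\<close> are the two vertical factors of a structure
  2-cell of the composite: \<open>scB\<close> contains the structure 2-cell of the outer cell and
  comes first, \<open>scA\<close> that of an inner cell.\<close>

abbreviation (input) "scA j d \<equiv> f \<lhd> nmap2 ((map id2 (map fst Gs))[j := snd (Gs ! j) ! d]) \<rhd> regroup (Tys j d)"
abbreviation (input) "scB j d \<equiv> fs ! j \<rhd> (nmap1 ((map fst Gs)[j := T1 (map fst Gs ! j) \<odot> tn (Txs ! j) d]) \<odot> regroup (Tys j d))"

lemma Txs_eq: "map (map fst) (map (map Free) Ass) = Txs"
  by (simp add: Free_def)

lemma comp_eq: "cmpc = (f \<odot> nmap1 (map fst Gs) \<odot> regroup Txs,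
   concat (map (\<lambda>j. map (\<lambda>d. scA j d \<cdot> scB j d) [0..<length (Ass ! j)]) [0..<length Ass]))"
  unfolding alg_comp1_def Let_def Txs_eq by (auto simp: o_def intro!: arg_cong[where f = concat])

lemma comp_Ob: "j < length Bs \<Longrightarrow> set (Ass ! j) \<subseteq> Ob K" "j < length Bs \<Longrightarrow> Bs ! j \<in> Ob K" "\<forall>X \<in> set Txs. set X \<subseteq> Ob K"
proof -
  show 1: "j < length Bs \<Longrightarrow> set (Ass ! j) \<subseteq> Ob K" "j < length Bs \<Longrightarrow> Bs ! j \<in> Ob K" for j using fel_typD(1,2)[OF args_typ(2)] by auto
  show "\<forall>X \<in> set Txs. set X \<subseteq> Ob K"
  proof
    fix X assume "X \<in> set Txs"
    then obtain j where "j < length Bs" "X = map T0 (Ass ! j)" using l by (auto simp: in_set_conv_nth)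
    then show "set X \<subseteq> Ob K" using map_T0_Ob[OF 1(1)] by simp
  qed
qed

lemma g_typing: "j < length Bs \<Longrightarrow> dom1 K (fst (Gs ! j)) = nprod (map T0 (Ass ! j))" "j < length Bs \<Longrightarrow> cod1 K (fst (Gs ! j)) = T0 (Bs ! j)"
  using fel_typD(4,5)[OF args_typ(2)] args_typ(1) by simp_all

lemma gs_Ar: "\<forall>g \<in> set (map fst Gs). g \<in> Ar K" "map (dom1 K) (map fst Gs) = map nprod Txs" "map (cod1 K) (map fst Gs) = map T0 Bs"
proof -
  show "\<forall>g \<in> set (map fst Gs). g \<in> Ar K" using args_typ(1) l by (simp add: all_set_conv_all_nth)
  show "map (dom1 K) (map fst Gs) = map nprod Txs" "map (cod1 K) (map fst Gs) = map T0 Bs"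
    using g_typing l by (auto intro!: nth_equalityI)
qed

lemma comp_fst_typing: "fst cmpc \<in> Ar K" "dom1 K (fst cmpc) = nprod (map T0 (concat Ass))" "cod1 K (fst cmpc) = T0 C"
  "id2 (fst cmpc) = id2 f ** (nmap2 (map id2 (map fst Gs)) ** id2 (regroup Txs))"
proof -
  note n = id2_nmap1[OF gs_Ar(1), unfolded gs_Ar(2,3)] and r = regroup_typing(1-3)[OF comp_Ob(3)]
  have f: "dom1 K f = nprod (map T0 Bs)" "cod1 K f = T0 C" using fel_typD(4,5)[OF F] fA by simp_all
  show "fst cmpc \<in> Ar K" "dom1 K (fst cmpc) = nprod (map T0 (concat Ass))" "cod1 K (fst cmpc) = T0 C"
    "id2 (fst cmpc) = id2 f ** (nmap2 (map id2 (map fst Gs)) ** id2 (regroup Txs))"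
    unfolding comp_eq fst_conv using n r f fA by (simp_all add: map_concat)
qed

lemma comp_fst_ntuple2:
  assumes e: "elss Z Txs xss"
  shows "id2 (fst cmpc) ** tup Z (concat xss) = id2 f ** tup Z (imgs Z xss)"
proof -
  have gc: "\<forall>\<alpha> \<in> set (map id2 (map fst Gs)). \<alpha> \<in> Ce K" using gs_Ar(1) by auto
  have gsrc: "map src (map id2 (map fst Gs)) = map nprod Txs" unfolding gs_Ar(2)[symmetric] using gs_Ar(1) by auto
  have gtgt: "map tgt (map id2 (map fst Gs)) = map T0 Bs" unfolding gs_Ar(3)[symmetric] using gs_Ar(1) by auto
  note n = nmap2_typing[OF gc, unfolded gsrc gtgt] and r = regroup_typing(1-3)[OF comp_Ob(3)]
  have f: "id2 f \<in> Ce K" "src (id2 f) = nprod (map T0 Bs)" using fel_typD(4,6)[OF F] by simp_all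
  have c: "tup Z (concat xss) \<in> Ce K" "tgt (tup Z (concat xss)) = nprod (concat Txs)" using elss_concat[OF e] by simp_all
  have "id2 (fst cmpc) ** tup Z (concat xss) = id2 f ** (nmap2 (map id2 (map fst Gs)) ** (id2 (regroup Txs) ** tup Z (concat xss)))"
    unfolding comp_fst_typing(4) using n r f c by (simp only: hcomp_assoc' hcomp_typing id2_typing)
  also have "\<dots> = id2 f ** tup Z (map2 (\<star>) (map id2 (map fst Gs)) (map (tup Z) xss))"
    unfolding regroup_ntuple2[OF e]
    using nmap2_ntuple2[OF gc, unfolded gsrc, OF els_map_ntuple2[OF e]] by (simp only:)
  also have "map2 (\<star>) (map id2 (map fst Gs)) (map (tup Z) xss) = imgs Z xss"
    using l elssD(1)[OF e] by (auto intro!: nth_equalityI)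
  finally show ?thesis .
qed

lemma comp_length: "length (snd cmpc) = length (concat Ass)"
proof -
  have "map length (map (\<lambda>j. map (\<lambda>d. scA j d \<cdot> scB j d) [0..<length (Ass ! j)]) [0..<length Ass]) = map length Ass"
    by (auto intro!: nth_equalityI)
  then show ?thesis unfolding comp_eq snd_conv by (simp only: length_concat)
qed

lemma comp_snd_nth:
  assumes "j < length Bs" "d < length (Ass ! j)"
  shows "snd cmpc ! (length (concat (take j Ass)) + d) = scA j d \<cdot> scB j d"
proof -
  let ?L = "map (\<lambda>j. map (\<lambda>d. scA j d \<cdot> scB j d) [0..<length (Ass ! j)]) [0..<length Ass]"
  have "map length ?L = map length Ass"
    by (auto intro!: nth_equalityI)
  from length_concat_take[OF this, of j] nth_concat_offset(2)[of j ?L d] show ?thesis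
    unfolding comp_eq snd_conv using assms l by simp
qed

lemma comp_Tys: 
  assumes "j < length Bs" "d < length (Ass ! j)"
  shows "\<forall>X \<in> set (Tys j d). set X \<subseteq> Ob K" "Tys j d ! j = (map T0 (Ass ! j))[d := T0 (T0 (Ass ! j ! d))]"
    "k < length Bs \<Longrightarrow> k \<noteq> j \<Longrightarrow> Tys j d ! k = map T0 (Ass ! k)"
    "concat (Tys j d) = (map T0 (concat Ass))[length (concat (take j Ass)) + d := T0 (T0 (Ass ! j ! d))]"
proof -
  show a: "Tys j d ! j = (map T0 (Ass ! j))[d := T0 (T0 (Ass ! j ! d))]" and b: "k < length Bs \<Longrightarrow> k \<noteq> j \<Longrightarrow> Tys j d ! k = map T0 (Ass ! k)" for k
    using assms l by simp_all
  show "\<forall>X \<in> set (Tys j d). set X \<subseteq> Ob K"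
  proof
    fix X assume "X \<in> set (Tys j d)"
    then obtain k where k: "k < length Bs" "X = Tys j d ! k" using l by (metis in_set_conv_nth length_list_update length_map)
    show "set X \<subseteq> Ob K"
    proof (cases "k = j")
      case True
      have "Ass ! j ! d \<in> Ob K" using comp_Ob(1)[OF assms(1)] assms(2) by auto
      then show ?thesis using update_Ob[OF map_T0_Ob[OF comp_Ob(1)[OF assms(1)]]] k(2) a True by simp
    next
      case False then show ?thesis using b[OF k(1) False] k(2) map_T0_Ob[OF comp_Ob(1)[OF k(1)]] by simp
    qed
  qed
  have "length (concat (take j Txs)) = length (concat (take j Ass))"
    by (rule length_concat_take) simp
  then show "concat (Tys j d) = (map T0 (concat Ass))[length (concat (take j Ass)) + d := T0 (T0 (Ass ! j ! d))]"
    using concat_update_offset[of j Txs d "T0 (Txs ! j ! d)"] assms l by (simp add: map_concat)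
qed

text \<open>The element to which the outer structure 2-cell is applied in place \<open>j\<close>. It
  has one layer of \<open>T\<close> more than the image of \<open>yss ! j\<close>, and
  \<open>\<mu>\<close> of it is the source of the inner structure 2-cell.\<close>

abbreviation (input) "vjc j d Z yss \<equiv> T2 (id2 (fst (Gs ! j))) ** (id2 (tn (map T0 (Ass ! j)) d) ** tup Z (yss ! j))"

lemma vj_typing:
  assumes "j < length Bs" "d < length (Ass ! j)" "els Z ((map T0 (Ass ! j))[d := T0 (T0 (Ass ! j ! d))]) ys"
  shows "T2 (id2 (fst (Gs ! j))) ** (id2 (tn (map T0 (Ass ! j)) d) ** tup Z ys) \<in> Ce K"
    "src (T2 (id2 (fst (Gs ! j))) ** (id2 (tn (map T0 (Ass ! j)) d) ** tup Z ys)) = Z"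
    "tgt (T2 (id2 (fst (Gs ! j))) ** (id2 (tn (map T0 (Ass ! j)) d) ** tup Z ys)) = T0 (T0 (Bs ! j))"
    "dm (snd (Gs ! j) ! d ** tup Z ys) = \<mu>2 (Bs ! j) ** (T2 (id2 (fst (Gs ! j))) ** (id2 (tn (map T0 (Ass ! j)) d) ** dm (tup Z ys)))"
    "idcs ys \<Longrightarrow> idc (T2 (id2 (fst (Gs ! j))) ** (id2 (tn (map T0 (Ass ! j)) d) ** tup Z ys))"
proof -
  let ?X = "map T0 (Ass ! j)"
  have d: "d < length ?X" "?X ! d = T0 (Ass ! j ! d)" using assms(2) by simp_all
  note t = tn_typing[OF map_T0_Ob[OF comp_Ob(1)[OF assms(1)]] d(1), unfolded d(2)]
  note g = g_typing[OF assms(1)] args_typ(1)[OF assms(1)] and w = fel_typD(7,8)[OF args_typ(2)[OF assms(1)] assms(2)]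
  define tt where "tt = tn ?X d"
  have tt: "tt \<in> Ar K" "dom1 K tt = nprod ((map T0 (Ass ! j))[d := T0 (T0 (Ass ! j ! d))])" "cod1 K tt = T0 (nprod ?X)" using t unfolding tt_def by blast+
  show "T2 (id2 (fst (Gs ! j))) ** (id2 (tn ?X d) ** tup Z ys) \<in> Ce K"
    "src (T2 (id2 (fst (Gs ! j))) ** (id2 (tn ?X d) ** tup Z ys)) = Z"
    "tgt (T2 (id2 (fst (Gs ! j))) ** (id2 (tn ?X d) ** tup Z ys)) = T0 (T0 (Bs ! j))"
    "idcs ys \<Longrightarrow> idc (T2 (id2 (fst (Gs ! j))) ** (id2 (tn (map T0 (Ass ! j)) d) ** tup Z ys))"
    unfolding tt_def[symmetric] using tt g assms(3) by simp_all
  have B: "Bs ! j \<in> Ob K" using comp_Ob(2)[OF assms(1)] .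
  have "dm (snd (Gs ! j) ! d ** tup Z ys) = dm (snd (Gs ! j) ! d) ** dm (tup Z ys)"
    using w assms(3) by (simp only: dm_hcomp ntuple2_typing')
  also have "\<dots> = \<mu>2 (Bs ! j) ** (T2 (id2 (fst (Gs ! j))) ** (id2 (tn (map T0 (Ass ! j)) d) ** dm (tup Z ys)))"
    unfolding fel_dm[OF args_typ(2)[OF assms(1)] assms(2)] tt_def[symmetric] using tt g assms(3) B by simp
  finally show "dm (snd (Gs ! j) ! d ** tup Z ys) = \<dots>" .
qed

text \<open>Both factors are described through one list of images, updated at \<open>j\<close> in
  two ways; their comparison thereby becomes a matter of the entry \<open>j\<close>.\<close>

lemma sc_facts:
  assumes j: "j < length Bs" and d: "d < length (Ass ! j)"
  shows "scA j d \<in> Ce K \<and> src (scA j d) = nprod (concat (Tys j d)) \<and> tgt (scA j d) = T0 C"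
    "scB j d \<in> Ce K \<and> src (scB j d) = nprod (concat (Tys j d)) \<and> tgt (scB j d) = T0 C"
    "elss Z (Tys j d) yss \<Longrightarrow> els Z (map T0 Bs) ((imgs Z yss)[j := snd (Gs ! j) ! d ** tup Z (yss ! j)])"
    "elss Z (Tys j d) yss \<Longrightarrow> els Z ((map T0 Bs)[j := T0 (T0 (Bs ! j))]) ((imgs Z yss)[j := vjc j d Z yss])"
    "elss Z (Tys j d) yss \<Longrightarrow> scA j d ** tup Z (concat yss) = id2 f ** tup Z ((imgs Z yss)[j := snd (Gs ! j) ! d ** tup Z (yss ! j)])"
    "elss Z (Tys j d) yss \<Longrightarrow> scB j d ** tup Z (concat yss) = fs ! j ** tup Z ((imgs Z yss)[j := vjc j d Z yss])"
proof -
  let ?X = "map T0 (Ass ! j)" and ?v = "snd (Gs ! j) ! d"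
  have d': "d < length ?X" "?X ! d = T0 (Ass ! j ! d)" using d by simp_all
  note t = tn_typing[OF map_T0_Ob[OF comp_Ob(1)[OF j]] d'(1), unfolded d'(2)]
  note Y = comp_Tys[OF j d] and r = regroup_typing(1-3)[OF comp_Tys(1)[OF j d]]
  note v = fel_typD(7-9)[OF args_typ(2)[OF j] d] and w = fel_typD(7-9)[OF F j]
  have f: "id2 f \<in> Ce K" "src (id2 f) = nprod (map T0 Bs)" "tgt (id2 f) = T0 C" using fel_typD(4-6)[OF F] by simp_all
  let ?as = "(map id2 (map fst Gs))[j := ?v]"
  have jl: "j < length ?as" "length ?as = length Bs" using j l by simp_all
  have ak: "?as ! k = (if k = j then ?v else id2 (fst (Gs ! k)))" if "k < length Bs" for k using that l by (simp add: nth_list_update)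
  have ac: "\<forall>\<alpha> \<in> set ?as. \<alpha> \<in> Ce K"
    unfolding all_set_conv_all_nth jl(2) using ak v(1) args_typ(1) by auto
  have asrc: "map src ?as = map nprod (Tys j d)"
    by (rule nth_equalityI) (use ak v args_typ(1) g_typing Y(2,3) l jl j in \<open>auto simp: nth_list_update\<close>)
  have atgt: "map tgt ?as = map T0 Bs"
    by (rule nth_equalityI) (use ak v args_typ(1) g_typing Y(2,3) l jl j in \<open>auto simp: nth_list_update\<close>)
  note n = nmap2_typing[OF ac, unfolded asrc atgt]
  show "scA j d \<in> Ce K \<and> src (scA j d) = nprod (concat (Tys j d)) \<and> tgt (scA j d) = T0 C"
    using f n r by (simp only: hcomp_typing id2_typing)
  let ?gs = "(map fst Gs)[j := T1 (map fst Gs ! j) \<odot> tn (Txs ! j) d]"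
  define tt where "tt = T1 (map fst Gs ! j) \<odot> tn (Txs ! j) d"
  have Xj: "Txs ! j = ?X" and Gj: "map fst Gs ! j = fst (Gs ! j)" using j l by simp_all
  have tt: "tt \<in> Ar K" "dom1 K tt = nprod (?X[d := T0 (T0 (Ass ! j ! d))])" "cod1 K tt = T0 (T0 (Bs ! j))"
      "id2 tt = T2 (id2 (fst (Gs ! j))) ** id2 (tn ?X d)"
    unfolding tt_def Xj Gj using t g_typing[OF j] args_typ(1)[OF j] by (simp_all only: comp1_typing T1_typing id2_comp1)
  have gk: "((map fst Gs)[j := tt]) ! k = (if k = j then tt else fst (Gs ! k))" if "k < length Bs" for k using that l by (simp add: nth_list_update)
  have gl: "length ((map fst Gs)[j := tt]) = length Bs" using l by simp
  have gA: "\<forall>g \<in> set ((map fst Gs)[j := tt]). g \<in> Ar K"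
    unfolding all_set_conv_all_nth gl using gk tt(1) args_typ(1) by auto
  have gd: "map (dom1 K) ((map fst Gs)[j := tt]) = map nprod (Tys j d)"
    by (rule nth_equalityI) (use gk tt args_typ(1) g_typing Y(2,3) l gl j in \<open>auto simp: nth_list_update\<close>)
  have gc: "map (cod1 K) ((map fst Gs)[j := tt]) = (map T0 Bs)[j := T0 (T0 (Bs ! j))]"
    by (rule nth_equalityI) (use gk tt args_typ(1) g_typing Y(2,3) l gl j in \<open>auto simp: nth_list_update\<close>)
  note m = id2_nmap1[OF gA, unfolded gd gc]
  have s2: "scB j d = fs ! j ** (nmap2 (map id2 ((map fst Gs)[j := tt])) ** id2 (regroup (Tys j d)))"
    unfolding tt_def[symmetric] m(4)[symmetric] using m r by (simp only: id2_comp1)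
  have mC: "\<forall>\<alpha> \<in> set (map id2 ((map fst Gs)[j := tt])). \<alpha> \<in> Ce K" using gA unfolding set_map by (blast intro: id2_typing(1))
  have msrc: "map src (map id2 ((map fst Gs)[j := tt])) = map nprod (Tys j d)"
    unfolding gd[symmetric] map_map using gA by (intro map_cong[OF refl]) (simp only: o_apply id2_typing)
  have mtgt: "map tgt (map id2 ((map fst Gs)[j := tt])) = (map T0 Bs)[j := T0 (T0 (Bs ! j))]"
    unfolding gc[symmetric] map_map using gA by (intro map_cong[OF refl]) (simp only: o_apply id2_typing)
  note m2 = nmap2_typing[OF mC, unfolded msrc mtgt]
  show "scB j d \<in> Ce K \<and> src (scB j d) = nprod (concat (Tys j d)) \<and> tgt (scB j d) = T0 C"
    unfolding s2 using w m2 r by (simp only: hcomp_typing id2_typing)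
  assume e: "elss Z (Tys j d) yss"
  have yl: "length yss = length Bs" using elssD(1)[OF e] l by simp
  note ey = els_map_ntuple2[OF e]
  have c: "tup Z (concat yss) \<in> Ce K" "tgt (tup Z (concat yss)) = nprod (concat (Tys j d))" using elss_concat[OF e] by simp_all
  have i1: "map2 (\<star>) ?as (map (tup Z) yss) = (imgs Z yss)[j := ?v ** tup Z (yss ! j)]"
    by (rule nth_equalityI) (use ak yl jl j in \<open>auto simp: nth_list_update\<close>)
  have ej: "els Z (?X[d := T0 (T0 (Ass ! j ! d))]) (yss ! j)" using elssD(3)[OF e, of j] Y(2) j l by simp
  have "id2 tt ** tup Z (yss ! j) = vjc j d Z yss"
    unfolding tt(4) by (rule hcomp_assoc') (use t g_typing[OF j] args_typ(1)[OF j] ej in \<open>simp_all only: id2_typing ntuple2_typing' T2_typing\<close>)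
  then have i2: "map2 (\<star>) (map id2 ((map fst Gs)[j := tt])) (map (tup Z) yss) = (imgs Z yss)[j := vjc j d Z yss]"
    by (intro nth_equalityI) (use gk yl gl j in \<open>auto simp: nth_list_update\<close>)
  show "els Z (map T0 Bs) ((imgs Z yss)[j := ?v ** tup Z (yss ! j)])"
    using els_map2[OF ac, unfolded asrc atgt, OF ey] unfolding i1 .
  show "els Z ((map T0 Bs)[j := T0 (T0 (Bs ! j))]) ((imgs Z yss)[j := vjc j d Z yss])"
    using els_map2[OF mC, unfolded msrc mtgt, OF ey] unfolding i2 .
  have "scA j d ** tup Z (concat yss) = id2 f ** (nmap2 ?as ** (id2 (regroup (Tys j d)) ** tup Z (concat yss)))"
    using f n r c by (simp only: hcomp_assoc' hcomp_typing id2_typing)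
  then show "scA j d ** tup Z (concat yss) = id2 f ** tup Z ((imgs Z yss)[j := ?v ** tup Z (yss ! j)])"
    unfolding regroup_ntuple2[OF e] nmap2_ntuple2[OF ac, unfolded asrc, OF ey] i1 .
  have "scB j d ** tup Z (concat yss) = fs ! j ** (nmap2 (map id2 ((map fst Gs)[j := tt])) ** (id2 (regroup (Tys j d)) ** tup Z (concat yss)))"
    unfolding s2 using w m2 r c by (simp only: hcomp_assoc' hcomp_typing id2_typing)
  then show "scB j d ** tup Z (concat yss) = fs ! j ** tup Z ((imgs Z yss)[j := vjc j d Z yss])"
    unfolding regroup_ntuple2[OF e] nmap2_ntuple2[OF mC, unfolded msrc, OF ey] i2 .
qed

text \<open>At the generic tuple the target of \<open>scB\<close> has \<open>\<mu>\<close> of the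
  deeper element in place \<open>j\<close>, which is the source of the inner structure 2-cell used
  by \<open>scA\<close>; the other entries are identities.\<close>

lemma sc_composable:
  assumes j: "j < length Bs" and d: "d < length (Ass ! j)"
  shows "cm (scB j d) = dm (scA j d)"
proof -
  let ?Y = "Tys j d" and ?v = "snd (Gs ! j) ! d"
  obtain yss where y: "elss (nprod (concat ?Y)) ?Y yss" "concat yss = projs (concat ?Y)" "\<forall>ys \<in> set yss. \<forall>y \<in> set ys. idc y"
    using elss_projs[OF comp_Tys(1)[OF j d]] by blast
  let ?Z = "nprod (concat ?Y)"
  note s = sc_facts[OF j d] and v = vj_typing[OF j d]
  have cOb: "set (concat ?Y) \<subseteq> Ob K" using comp_Tys(1)[OF j d] by auto
  have tp: "tup ?Z (concat yss) = id2 (id1 ?Z)" unfolding y(2) using ntuple2_projs[OF cOb] .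
  have 1: "scA j d = id2 f ** tup ?Z ((imgs ?Z yss)[j := ?v ** tup ?Z (yss ! j)])"
    using s(5)[OF y(1)] s(1)[THEN conjunct1] s(1)[THEN conjunct2, THEN conjunct1] unfolding tp by (simp only: hcomp_id)
  have 2: "scB j d = fs ! j ** tup ?Z ((imgs ?Z yss)[j := vjc j d ?Z yss])"
    using s(6)[OF y(1)] s(2)[THEN conjunct1] s(2)[THEN conjunct2, THEN conjunct1] unfolding tp by (simp only: hcomp_id)
  have ej: "els ?Z ((map T0 (Ass ! j))[d := T0 (T0 (Ass ! j ! d))]) (yss ! j)" using elssD(3)[OF y(1), of j] comp_Tys(2)[OF j d] j l by simp
  have jy: "j < length yss" using elssD(1)[OF y(1)] j l by simp
  have iy: "idcs (yss ! k)" if "k < length Bs" for k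
    using y(3) nth_mem[of k yss] elssD(1)[OF y(1)] l that unfolding idcs_def by auto
  have ii: "idc (imgs ?Z yss ! k)" if k: "k < length Bs" "k \<noteq> j" for k
  proof -
    have "els ?Z (map T0 (Ass ! k)) (yss ! k)" using elssD(3)[OF y(1), of k] comp_Tys(3)[OF j d k] k l by simp
    then show ?thesis using iy[OF k(1)] g_typing[OF k(1)] args_typ(1)[OF k(1)] k by simp
  qed
  have i2: "idcs ((imgs ?Z yss)[j := vjc j d ?Z yss])"
    by (rule idcs_update') (use ii v(5)[OF ej iy[OF j]] in simp_all)
  have "cm (scB j d) = id2 f ** tup ?Z ((imgs ?Z yss)[j := \<mu>2 (Bs ! j) ** vjc j d ?Z yss])"
    unfolding 2 using fel_typD(12)[OF F j s(4)[OF y(1)] i2] j by simp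
  also have "\<mu>2 (Bs ! j) ** vjc j d ?Z yss = dm (?v ** tup ?Z (yss ! j))"
    unfolding v(4)[OF ej] using ej iy[OF j] by simp
  also have "(imgs ?Z yss)[j := dm (?v ** tup ?Z (yss ! j))] = map dm ((imgs ?Z yss)[j := ?v ** tup ?Z (yss ! j)])"
    by (rule map_dm_update[symmetric]) (use ii in simp_all)
  also have "id2 f ** tup ?Z (map dm ((imgs ?Z yss)[j := ?v ** tup ?Z (yss ! j)])) = dm (scA j d)"
    unfolding 1 using dm_ntuple2[OF s(3)[OF y(1)]] dm_hcomp(1)[of "tup ?Z ((imgs ?Z yss)[j := ?v ** tup ?Z (yss ! j)])" "id2 f"] s(3)[OF y(1)] fel_typD(4-6)[OF F]
    by (simp only: ntuple2_typing' dm_idc id2_typing fA)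
  finally show ?thesis .
qed

lemma comp_snd_typing:
  assumes j: "j < length Bs" and d: "d < length (Ass ! j)"
  shows "snd cmpc ! (length (concat (take j Ass)) + d) \<in> Ce K"
    "src (snd cmpc ! (length (concat (take j Ass)) + d)) = nprod ((map T0 (concat Ass))[length (concat (take j Ass)) + d := T0 (T0 (Ass ! j ! d))])"
    "tgt (snd cmpc ! (length (concat (take j Ass)) + d)) = T0 C"
  unfolding comp_snd_nth[OF assms] comp_Tys(4)[OF assms, symmetric]
  using sc_composable[OF assms] sc_facts(1,2)[OF assms] by (simp_all only: vcomp_typing)

lemma comp_snd_ntuple2:
  assumes j: "j < length Bs" and d: "d < length (Ass ! j)"
    and e: "elss Z (Txs[j := (map T0 (Ass ! j))[d := T0 (T0 (Ass ! j ! d))]]) yss" and i: "\<forall>ys \<in> set yss. idcs ys"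
  shows "snd cmpc ! (length (concat (take j Ass)) + d) ** tup Z (concat yss)
    = (id2 f ** tup Z ((imgs Z yss)[j := snd (Gs ! j) ! d ** tup Z (yss ! j)]))
      \<cdot> (fs ! j ** tup Z ((imgs Z yss)[j := vjc j d Z yss]))"
proof -
  have Y: "Tys j d = Txs[j := (map T0 (Ass ! j))[d := T0 (T0 (Ass ! j ! d))]]" using j d l by simp
  have e: "elss Z (Tys j d) yss" unfolding Y by (rule e)
  have ic: "idcs (concat yss)" using i by (auto simp: idcs_def)
  have "(scA j d \<cdot> scB j d) ** tup Z (concat yss) = (scA j d ** tup Z (concat yss)) \<cdot> (scB j d ** tup Z (concat yss))"
    by (rule whisker_vcomp_right)
      (use sc_facts(1,2)[OF j d] sc_composable[OF j d] elss_concat[OF e] idc_ntuple2'[OF elss_concat[OF e] ic] in \<open>simp_all only: ntuple2_typing'\<close>)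
  then show ?thesis
    unfolding comp_snd_nth[OF j d] sc_facts(5)[OF j d e] sc_facts(6)[OF j d e] .
qed

end

end

section \<open>The iterated multiplication as a multimorphism\<close>

context fp_two_category
begin

text \<open>The substitution lemma for the variable that \<open>osl\<close> introduces.\<close>

lemma osl_sub:
  assumes "els Z X xs" "A \<in> Ob K" "C \<in> Ob K" "k \<in> Ce K" "src k = Z \<otimes> C" "tgt k = A"
  shows "tup (Z \<otimes> A) (osl Z A i xs) ** pair2 (p1 Z C) k = tup (Z \<otimes> C) ((wk Z C xs)[i := k])"
proof -
  note l = elsD[OF assms(1)]
  have "map (\<lambda>x. x ** pair2 (p1 Z C) k) (osl Z A i xs) = (wk Z C xs)[i := k]"
  proof (rule nth_equalityI)
    fix m assume "m < length (map (\<lambda>x. x ** pair2 (p1 Z C) k) (osl Z A i xs))"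
    then have m: "m < length xs" by (simp add: osl_def)
    then show "map (\<lambda>x. x ** pair2 (p1 Z C) k) (osl Z A i xs) ! m = (wk Z C xs)[i := k] ! m"
      using assms l by (cases "m = i") (simp_all add: osl_def)
  qed (simp add: osl_def)
  then show ?thesis
    using ntuple2_hcomp[OF els_osl[OF assms(1,2)], of "pair2 (p1 Z C) k"] assms l(2) by simp
qed

lemma osl_update: "i \<noteq> j \<Longrightarrow> osl Z A i (xs[j := x]) = (osl Z A i xs)[j := x ** p1 Z A]"
  by (simp add: osl_def list_update_swap)

lemma osl_nth: "i \<noteq> j \<Longrightarrow> j < length xs \<Longrightarrow> osl Z A i xs ! j = xs ! j ** p1 Z A"
  "i < length xs \<Longrightarrow> osl Z A i xs ! i = p2 Z A" "length (osl Z A i xs) = length xs"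
  by (simp_all add: osl_def)

lemma osl_cancel: "osl Z A i (xs[i := x]) = osl Z A i xs"
  by (simp add: osl_def)

end

context pseudo_commutative_strong_two_monad
begin

text \<open>Splits the variable of product type into two variables, in the order in which
  \<open>\<omega>'\<close> binds them: \<open>B\<close> first, then \<open>A\<close>. This
  identifies the target of the \<open>\<Gamma>\<close> factor in the coherence condition.\<close>

lemma osl2_sub:
  assumes "els Z X xs" "A \<in> Ob K" "B \<in> Ob K" "i \<noteq> j"
  shows "tup (Z \<otimes> (A \<otimes> B)) (osl2 Z A B i j xs)
      ** pair2 (p1 Z B ** p1 (Z \<otimes> B) A) (pair2 (p2 (Z \<otimes> B) A) (p2 Z B ** p1 (Z \<otimes> B) A))
    = tup (Z \<otimes> B \<otimes> A) (osl (Z \<otimes> B) A i (osl Z B j xs))"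
    (is "_ ** ?s = _")
    and els_osl2: "els (Z \<otimes> (A \<otimes> B)) (X[i := A, j := B]) (osl2 Z A B i j xs)"
proof -
  note l = elsD[OF assms(1)]
  have e: "els (Z \<otimes> (A \<otimes> B)) X (wk Z (A \<otimes> B) xs)" using els_wk[OF assms(1)] assms by simp
  show e2: "els (Z \<otimes> (A \<otimes> B)) (X[i := A, j := B]) (osl2 Z A B i j xs)"
    unfolding osl2_def by (rule els_update[OF els_update[OF e]]) (use assms l(2) in simp_all)
  have "map (\<lambda>x. x ** ?s) (osl2 Z A B i j xs) = osl (Z \<otimes> B) A i (osl Z B j xs)"
  proof (rule nth_equalityI)
    fix m assume "m < length (map (\<lambda>x. x ** ?s) (osl2 Z A B i j xs))"
    then have m: "m < length xs" by (simp add: osl2_def)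
    consider "m = i" "m \<noteq> j" | "m = j" "m \<noteq> i" | "m \<noteq> i" "m \<noteq> j" using assms(4) by blast
    then show "map (\<lambda>x. x ** ?s) (osl2 Z A B i j xs) ! m = osl (Z \<otimes> B) A i (osl Z B j xs) ! m"
      using assms l m by cases (simp_all add: osl2_def osl_def)
  qed (simp add: osl2_def osl_def)
  then show "tup (Z \<otimes> (A \<otimes> B)) (osl2 Z A B i j xs) ** ?s = tup (Z \<otimes> B \<otimes> A) (osl (Z \<otimes> B) A i (osl Z B j xs))"
    using ntuple2_hcomp[OF e2, of ?s] assms l(2) by simp
qed

lemma idcs_osl2: "els Z X xs \<Longrightarrow> idcs xs \<Longrightarrow> A \<in> Ob K \<Longrightarrow> B \<in> Ob K \<Longrightarrow> idcs (osl2 Z A B i j xs)"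
  unfolding osl2_def by (intro idcs_update idcs_wk) (auto dest: elsD(2))

lemma bnd_\<omega>':
  assumes "u \<in> Ce K" "v \<in> Ce K" "src u = Z" "src v = Z" "tgt u = T0 A" "tgt v = T0 B" "A \<in> Ob K" "B \<in> Ob K"
    "k \<in> Ce K" "src k = Z \<otimes> (A \<otimes> B)" "tgt k = T0 C" "C \<in> Ob K"
  shows "bnd (A \<otimes> B) C (id2 (\<omega>' A B) ** pair2 u v) k = bnd B C v (bnd A C (u ** p1 Z B)
    (k ** pair2 (p1 Z B ** p1 (Z \<otimes> B) A) (pair2 (p2 (Z \<otimes> B) A) (p2 Z B ** p1 (Z \<otimes> B) A))))"
proof -
  have [simp]: "Z \<in> Ob K" using assms by auto
  show ?thesis using assms by (simp add: \<omega>_bnd[of _ _ Z] bnd_assoc bnd_\<eta>)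
qed

text \<open>By the source and target clauses of \<open>fel_typ\<close> both sides become the same
  expression in \<open>bnd\<close> and \<open>h\<close>. In the second claim the target of
  \<open>\<Gamma>\<close> is \<open>\<omega>'\<close>, which runs entry \<open>j\<close> first, as
  the following factor does.\<close>

lemma fel_composable:
  assumes F: "fel_typ As B h w" and i: "i < length As" and j: "j < length As" and ij: "i \<noteq> j"
    and e: "els Z ((map T0 As)[i := T0 (T0 (As ! i)), j := T0 (T0 (As ! j))]) ys" and ic: "idcs ys"
  shows "cm (bnd (T0 (As ! i)) B (ys ! i) (w j ** tup (Z \<otimes> T0 (As ! i)) (osl Z (T0 (As ! i)) i ys)))
     = dm (w i ** tup Z (ys[j := \<mu>2 (As ! j) ** ys ! j]))" (is ?t1)
    "cm (bnd (T0 (As ! i) \<otimes> T0 (As ! j)) B (\<Gamma> (T0 (As ! i)) (T0 (As ! j)) ** pair2 (ys ! i) (ys ! j))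
           (h ** tup (Z \<otimes> (T0 (As ! i) \<otimes> T0 (As ! j))) (osl2 Z (T0 (As ! i)) (T0 (As ! j)) i j ys)))
     = dm (bnd (T0 (As ! j)) B (ys ! j) (w i ** tup (Z \<otimes> T0 (As ! j)) (osl Z (T0 (As ! j)) j ys)))" (is ?t2)
proof -
  note d = fel_typD[OF F] and l = elsD[OF e]
  let ?X = "map T0 As" and ?A = "T0 (As ! i)" and ?B = "T0 (As ! j)"
  have A: "As ! i \<in> Ob K" "As ! j \<in> Ob K" using d(1) i j by auto
  have Z: "Z \<in> Ob K" by (rule l(2))
  have yi: "ys ! i \<in> Ce K" "src (ys ! i) = Z" "tgt (ys ! i) = T0 ?A" "idc (ys ! i)" using l(1) l(4-6)[of i] i ij idcs_nth[OF ic, of i] by simp_all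
  have yj: "ys ! j \<in> Ce K" "src (ys ! j) = Z" "tgt (ys ! j) = T0 ?B" "idc (ys ! j)" using l(1) l(4-6)[of j] j ij idcs_nth[OF ic, of j] by simp_all
  have s1: "?X[i := T0 ?A, j := T0 ?B, i := ?A] = ?X[j := T0 ?B]" using i ij by (simp add: list_update_swap[of j i])
  have s2: "?X[i := T0 ?A, j := T0 ?B, j := ?B] = ?X[i := T0 ?A]" using j ij by (simp add: list_update_swap[of i j])
  have o1: "els (Z \<otimes> ?A) (?X[j := T0 ?B]) (osl Z ?A i ys)" using els_osl[OF e, of ?A i] A unfolding s1 by simp
  have o2: "els (Z \<otimes> ?B) (?X[i := T0 ?A]) (osl Z ?B j ys)" using els_osl[OF e, of ?B j] A unfolding s2 by simp
  have io: "idcs (osl Z ?A i ys)" "idcs (osl Z ?B j ys)" using idcs_osl[OF e ic] A by simp_all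
  have u: "els Z (?X[i := T0 ?A]) (ys[j := \<mu>2 (As ! j) ** ys ! j])"
    using els_update[OF e, of "\<mu>2 (As ! j) ** ys ! j" ?B j] yj A s2 by simp
  have iu: "idcs (ys[j := \<mu>2 (As ! j) ** ys ! j])" using idcs_update[OF ic] yj A by simp
  show ?t1
    using d(11)[OF i u iu] d(12)[OF j o1 io(1)] o1 yi yj A Z d(2) d(7-9)[OF j] i j ij l(1)
    by (simp add: osl_update osl_nth)
  have e1: "els (Z \<otimes> ?B) (?X[i := T0 ?A]) (osl Z ?B j ys)" by (rule o2)
  have e2: "els (Z \<otimes> (?A \<otimes> ?B)) ?X (osl2 Z ?A ?B i j ys)"
    using els_osl2[OF e, of ?A ?B i j] A i j ij by (simp add: list_update_swap[of j i])
  have i2: "idcs (osl2 Z ?A ?B i j ys)" using idcs_osl2[OF e ic] A by simp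
  have e3: "els (Z \<otimes> ?B \<otimes> ?A) ?X (osl (Z \<otimes> ?B) ?A i (osl Z ?B j ys))"
    using els_osl[OF e1, of ?A i] A i by simp
  have "cm (bnd (?A \<otimes> ?B) B (\<Gamma> ?A ?B ** pair2 (ys ! i) (ys ! j)) (h ** tup (Z \<otimes> (?A \<otimes> ?B)) (osl2 Z ?A ?B i j ys)))
    = bnd (?A \<otimes> ?B) B (id2 (\<omega>' ?A ?B) ** pair2 (ys ! i) (ys ! j)) (h ** tup (Z \<otimes> (?A \<otimes> ?B)) (osl2 Z ?A ?B i j ys))"
    using e2 i2 yi yj A d(2-6) by simp
  also have "\<dots> = bnd ?B B (ys ! j) (bnd ?A B (ys ! i ** p1 Z ?B) (h ** tup (Z \<otimes> ?B \<otimes> ?A) (osl (Z \<otimes> ?B) ?A i (osl Z ?B j ys))))"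
    using bnd_\<omega>'[of "ys ! i" "ys ! j" Z ?A ?B "h ** tup (Z \<otimes> (?A \<otimes> ?B)) (osl2 Z ?A ?B i j ys)" B] osl2_sub[OF e, of ?A ?B i j]
      e2 yi yj A d(2-6) ij Z by simp
  also have "\<dots> = dm (bnd ?B B (ys ! j) (w i ** tup (Z \<otimes> ?B) (osl Z ?B j ys)))"
    using d(11)[OF i o2 io(2)] o2 yi yj A d(2) d(7-9)[OF i] i j ij l(1) by (simp add: osl_nth)
  finally show ?t2 .
qed

text \<open>Both sides bind entry \<open>i\<close> and evaluate \<open>h\<close> at
  \<open>\<mu>\<close> of the bound variable; \<open>bnd_T2\<close> moves
  \<open>T2 (\<mu>2 (As ! i))\<close> from the entry to that variable.\<close>

lemma fel_mu_composable:
  assumes F: "fel_typ As B h w" and i: "i < length As"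
    and e: "els Z ((map T0 As)[i := T0 (T0 (T0 (As ! i)))]) ys" and ic: "idcs ys"
  shows "cm (bnd (T0 (T0 (As ! i))) B (ys ! i) (w i ** tup (Z \<otimes> T0 (T0 (As ! i))) (osl Z (T0 (T0 (As ! i))) i ys)))
     = dm (w i ** tup Z (ys[i := T2 (\<mu>2 (As ! i)) ** ys ! i]))"
proof -
  note d = fel_typD[OF F] and l = elsD[OF e]
  let ?X = "map T0 As" and ?A = "T0 (As ! i)"
  have A: "As ! i \<in> Ob K" using d(1) i by auto
  have Z: "Z \<in> Ob K" by (rule l(2))
  have yi: "ys ! i \<in> Ce K" "src (ys ! i) = Z" "tgt (ys ! i) = T0 (T0 ?A)" "idc (ys ! i)" using l(1) l(4-6)[of i] i idcs_nth[OF ic, of i] by simp_all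
  have o1: "els (Z \<otimes> T0 ?A) (?X[i := T0 ?A]) (osl Z (T0 ?A) i ys)" using els_osl'[OF e, of "T0 ?A"] A by simp
  have io: "idcs (osl Z (T0 ?A) i ys)" using idcs_osl[OF e ic] A by simp
  have u: "els Z (?X[i := T0 ?A]) (ys[i := T2 (\<mu>2 (As ! i)) ** ys ! i])"
    using els_update[OF e, of "T2 (\<mu>2 (As ! i)) ** ys ! i" "T0 ?A" i] yi A by simp
  have iu: "idcs (ys[i := T2 (\<mu>2 (As ! i)) ** ys ! i])" using idcs_update[OF ic] yi A by simp
  have o2: "els (Z \<otimes> ?A) ?X (osl Z ?A i ys)" using els_osl'[OF e, of ?A] A i by simp
  have s: "h ** (tup (Z \<otimes> ?A) (osl Z ?A i ys) ** pair2 (p1 Z (T0 ?A)) (\<mu>2 (As ! i) ** p2 Z (T0 ?A)))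
    = h ** tup (Z \<otimes> T0 ?A) ((wk Z (T0 ?A) ys)[i := \<mu>2 (As ! i) ** p2 Z (T0 ?A)])"
    using osl_sub[OF e, of ?A "T0 ?A" "\<mu>2 (As ! i) ** p2 Z (T0 ?A)" i] A Z by simp
  have "dm (w i ** tup Z (ys[i := T2 (\<mu>2 (As ! i)) ** ys ! i]))
    = bnd (T0 ?A) B (ys ! i) ((h ** tup (Z \<otimes> ?A) (osl Z ?A i ys)) ** pair2 (p1 Z (T0 ?A)) (\<mu>2 (As ! i) ** p2 Z (T0 ?A)))"
    using d(11)[OF i u iu] bnd_T2[of "ys ! i" "\<mu>2 (As ! i)" ?A "h ** tup (Z \<otimes> ?A) (osl Z ?A i ys)" B] i l(1) yi A d(2-6) o2
    by (simp add: osl_cancel)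
  also have "\<dots> = cm (bnd (T0 ?A) B (ys ! i) (w i ** tup (Z \<otimes> T0 ?A) (osl Z (T0 ?A) i ys)))"
  proof -
    have "(h ** tup (Z \<otimes> ?A) (osl Z ?A i ys)) ** pair2 (p1 Z (T0 ?A)) (\<mu>2 (As ! i) ** p2 Z (T0 ?A))
      = h ** tup (Z \<otimes> T0 ?A) ((wk Z (T0 ?A) ys)[i := \<mu>2 (As ! i) ** p2 Z (T0 ?A)])"
      using s o2 d(4-6) A Z by simp
    moreover have "cm (w i ** tup (Z \<otimes> T0 ?A) (osl Z (T0 ?A) i ys)) = h ** tup (Z \<otimes> T0 ?A) ((wk Z (T0 ?A) ys)[i := \<mu>2 (As ! i) ** p2 Z (T0 ?A)])"
      using d(12)[OF i o1 io] i l(1) by (simp add: osl_def)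
    ultimately show ?thesis
      using bnd_typing(5)[of "ys ! i" "T0 ?A" "w i ** tup (Z \<otimes> T0 ?A) (osl Z (T0 ?A) i ys)" B] yi A d(2) d(7-9)[OF i] o1 by simp
  qed
  finally show ?thesis by simp
qed

end

context two_category
begin

lemma interchange_composable:
  assumes "\<alpha> \<in> Ce K" "\<beta> \<in> Ce K" "tgt \<alpha> = src \<beta>"
  shows "cm (\<beta> ** dm \<alpha>) = dm (cm \<beta> ** \<alpha>)" "cm (dm \<beta> ** \<alpha>) = dm (\<beta> ** cm \<alpha>)"
  using assms by simp_all

end

section \<open>Adding one factor to a multimorphism\<close>

context symmetric_pseudo_commutative_strong_two_monad
begin

text \<open>\<open>step As P h w B h' w'\<close>: the pair \<open>(h', w')\<close> is the composite of \<open>\<omega>\<close> with \<open>(h, w)\<close> and the identity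
  of the free algebra on \<open>B\<close>.\<close>

definition step :: "'o list \<Rightarrow> 'o \<Rightarrow> 't \<Rightarrow> (nat \<Rightarrow> 't) \<Rightarrow> 'o \<Rightarrow> 't \<Rightarrow> (nat \<Rightarrow> 't) \<Rightarrow> bool" where
  "step As P h w B h' w' \<longleftrightarrow> B \<in> Ob K \<and> idc h' \<and> src h' = nprod (map T0 (As @ [B])) \<and> tgt h' = T0 (P \<otimes> B) \<and>
    (\<forall>i<length (As @ [B]). w' i \<in> Ce K \<and> src (w' i) = nprod ((map T0 (As @ [B]))[i := T0 (T0 ((As @ [B]) ! i))]) \<and> tgt (w' i) = T0 (P \<otimes> B)) \<and>
    (\<forall>Z xs y. els Z (map T0 As) xs \<longrightarrow> y \<in> Ce K \<longrightarrow> src y = Z \<longrightarrow> tgt y = T0 B \<longrightarrow>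
       h' ** tup Z (xs @ [y]) = \<omega>2 P B ** pair2 (h ** tup Z xs) y) \<and>
    (\<forall>i<length As. \<forall>Z xs y. els Z ((map T0 As)[i := T0 (T0 (As ! i))]) xs \<longrightarrow> idcs xs \<longrightarrow> idc y \<longrightarrow> src y = Z \<longrightarrow> tgt y = T0 B \<longrightarrow>
       w' i ** tup Z (xs @ [y]) = \<omega>2 P B ** pair2 (w i ** tup Z xs) y) \<and>
    (\<forall>Z xs y. els Z (map T0 As) xs \<longrightarrow> idcs xs \<longrightarrow> idc y \<longrightarrow> src y = Z \<longrightarrow> tgt y = T0 (T0 B) \<longrightarrow>
       w' (length As) ** tup Z (xs @ [y]) = c1 P B ** pair2 (h ** tup Z xs) y)"

lemma stepD:
  assumes "step As P h w B h' w'"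
  shows "B \<in> Ob K" "idc h'" "src h' = nprod (map T0 (As @ [B]))" "tgt h' = T0 (P \<otimes> B)"
    "i < length (As @ [B]) \<Longrightarrow> w' i \<in> Ce K"
    "i < length (As @ [B]) \<Longrightarrow> src (w' i) = nprod ((map T0 (As @ [B]))[i := T0 (T0 ((As @ [B]) ! i))])"
    "i < length (As @ [B]) \<Longrightarrow> tgt (w' i) = T0 (P \<otimes> B)"
    "\<lbrakk>els Z (map T0 As) xs; y \<in> Ce K; src y = Z; tgt y = T0 B\<rbrakk> \<Longrightarrow>
       h' ** tup Z (xs @ [y]) = \<omega>2 P B ** pair2 (h ** tup Z xs) y"
    "\<lbrakk>i < length As; els Z ((map T0 As)[i := T0 (T0 (As ! i))]) xs; idcs xs; idc y; src y = Z; tgt y = T0 B\<rbrakk> \<Longrightarrow>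
       w' i ** tup Z (xs @ [y]) = \<omega>2 P B ** pair2 (w i ** tup Z xs) y"
    "\<lbrakk>els Z (map T0 As) xs; idcs xs; idc y; src y = Z; tgt y = T0 (T0 B)\<rbrakk> \<Longrightarrow>
       w' (length As) ** tup Z (xs @ [y]) = c1 P B ** pair2 (h ** tup Z xs) y"
  using assms unfolding step_def by blast+

text \<open>With a fixed identity in the second argument, \<open>\<omega>\<close> preserves vertical
  composites; this carries equations between the old structure 2-cells over to the new ones.\<close>

lemma \<omega>_vcomp:
  assumes O: "P \<in> Ob K" "B \<in> Ob K" and "a \<in> Ce K" "b \<in> Ce K" "cm a = dm b" "idc y" "src a = src y" "tgt a = T0 P" "tgt y = T0 B"
  shows "\<omega>2 P B ** pair2 (b \<cdot> a) y = (\<omega>2 P B ** pair2 b y) \<cdot> (\<omega>2 P B ** pair2 a y)"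
    "cm (\<omega>2 P B ** pair2 a y) = dm (\<omega>2 P B ** pair2 b y)"
proof -
  have b: "src b = src y" "tgt b = T0 P" using cm_dm_src_tgt[OF assms(3-5)] assms by simp_all
  have y: "y \<in> Ce K" using assms by (simp add: idcD)
  have p: "pair2 (b \<cdot> a) y = pair2 b y \<cdot> pair2 a y"
    by (rule pair2_vcomp_left[OF assms(3,4,6,5,7)])
  have c: "cm (pair2 a y) = dm (pair2 b y)" using assms b y by (simp only: dm_pair2 dm_idc)
  show "\<omega>2 P B ** pair2 (b \<cdot> a) y = (\<omega>2 P B ** pair2 b y) \<cdot> (\<omega>2 P B ** pair2 a y)"
    unfolding p by (rule whisker_vcomp_left) (use assms b y O c in \<open>simp_all only: pair2_typing id2_typing \<omega>_typing\<close>)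
  show "cm (\<omega>2 P B ** pair2 a y) = dm (\<omega>2 P B ** pair2 b y)"
    using assms b y O c by (simp only: dm_hcomp pair2_typing id2_typing \<omega>_typing dm_idc)
qed

context
  fixes As :: "'o list" and P :: 'o and h :: 't and w :: "nat \<Rightarrow> 't" and B :: 'o and h' :: 't and w' :: "nat \<Rightarrow> 't"
  assumes S: "step As P h w B h' w'" and F: "fel As P h w"
begin

lemmas typF = fel_typD[OF F[unfolded fel_def, THEN conjunct1]]
lemmas stepS = stepD[OF S]

lemma felF: "fel_typ As P h w" "fel_eta As h w" "fel_mu As P w" "fel_coh As P h w"
  using F by (auto simp: fel_def)

lemma snoc_update:
  "i < length As \<Longrightarrow> (map T0 (As @ [B]))[i := C] = (map T0 As)[i := C] @ [T0 B]"
  "(map T0 (As @ [B]))[length As := C] = map T0 As @ [C]"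
  by (simp_all add: list_update_append)

lemma h_ty: "els Z (map T0 As) xs \<Longrightarrow> h ** tup Z xs \<in> Ce K" "els Z (map T0 As) xs \<Longrightarrow> src (h ** tup Z xs) = Z"
  "els Z (map T0 As) xs \<Longrightarrow> tgt (h ** tup Z xs) = T0 P" "els Z (map T0 As) xs \<Longrightarrow> idcs xs \<Longrightarrow> idc (h ** tup Z xs)"
  using typF(3-6) by simp_all

lemma w_ty: "i < length As \<Longrightarrow> els Z ((map T0 As)[i := T0 (T0 (As ! i))]) xs \<Longrightarrow> w i ** tup Z xs \<in> Ce K"
  "i < length As \<Longrightarrow> els Z ((map T0 As)[i := T0 (T0 (As ! i))]) xs \<Longrightarrow> src (w i ** tup Z xs) = Z"
  "i < length As \<Longrightarrow> els Z ((map T0 As)[i := T0 (T0 (As ! i))]) xs \<Longrightarrow> tgt (w i ** tup Z xs) = T0 P"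
  using typF(7-9) by simp_all

lemma h_wk: "els Z (map T0 As) xs \<Longrightarrow> C \<in> Ob K \<Longrightarrow> (h ** tup Z xs) ** p1 Z C = h ** tup (Z \<otimes> C) (wk Z C xs)"
  using ntuple2_wk[of Z "map T0 As" xs C] typF(4,6) elsD(2)[of Z "map T0 As" xs] by simp

lemma w_wk: "i < length As \<Longrightarrow> els Z ((map T0 As)[i := T0 (T0 (As ! i))]) xs \<Longrightarrow> C \<in> Ob K \<Longrightarrow>
  (w i ** tup Z xs) ** p1 Z C = w i ** tup (Z \<otimes> C) (wk Z C xs)"
  using ntuple2_wk[of Z "(map T0 As)[i := T0 (T0 (As ! i))]" xs C] typF(7,8) elsD(2)[of Z _ xs] by simp

lemma w'_n_forms:
  assumes x: "els Z (map T0 As) xs" "idcs xs" and y: "idc y" "src y = Z" "tgt y = T0 (T0 B)"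
  shows "dm (w' (length As) ** tup Z (xs @ [y])) = bnd (T0 B) (P \<otimes> B) y (h' ** tup (Z \<otimes> T0 B) (osl Z (T0 B) (length As) (xs @ [y])))"
    "cm (w' (length As) ** tup Z (xs @ [y])) = h' ** tup Z (xs @ [\<mu>2 B ** y])"
proof -
  let ?u = "h ** tup Z xs"
  have u: "?u \<in> Ce K" "src ?u = Z" "tgt ?u = T0 P" "idc ?u" using h_ty x by auto
  have y': "y \<in> Ce K" "Z \<in> Ob K" using y elsD(2)[OF x(1)] by (auto simp: idcD)
  have O: "B \<in> Ob K" "P \<in> Ob K" using typF(2) stepS(1) by auto
  have xl: "length xs = length As" using elsD(1)[OF x(1)] by simp
  have wx: "els (Z \<otimes> T0 B) (map T0 As) (wk Z (T0 B) xs)" using els_wk[OF x(1)] O by simp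
  have o: "h' ** tup (Z \<otimes> T0 B) (osl Z (T0 B) (length As) (xs @ [y])) = \<omega>2 P B ** pair2 (h ** tup (Z \<otimes> T0 B) (wk Z (T0 B) xs)) (p2 Z (T0 B))"
    unfolding xl[symmetric] osl_snoc(2) using stepS(8)[OF wx, of "p2 Z (T0 B)"] O y' by simp
  have R: "w' (length As) ** tup Z (xs @ [y]) = c1 P B ** pair2 ?u y" using stepS(10)[OF x y] .
  have "dm (c1 P B ** pair2 ?u y) = \<mu>2 (P \<otimes> B) ** (T2 (\<omega>2 P B) ** (id2 (t (T0 P) (T0 B)) ** pair2 ?u y))"
    using u y y' O by simp
  also have "\<dots> = bnd (T0 B) (P \<otimes> B) y (\<omega>2 P B ** pair2 (?u ** p1 Z (T0 B)) (p2 Z (T0 B)))"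
    using u y y' O by (simp add: t_pair_\<tau> bnd_def)
  finally show "dm (w' (length As) ** tup Z (xs @ [y])) = bnd (T0 B) (P \<otimes> B) y (h' ** tup (Z \<otimes> T0 B) (osl Z (T0 B) (length As) (xs @ [y])))"
    unfolding R o using h_wk[OF x(1), of "T0 B"] O by simp
  have "cm (c1 P B ** pair2 ?u y) = \<omega>2 P B ** pair2 ?u (\<mu>2 B ** y)"
    using u y y' O by simp
  then show "cm (w' (length As) ** tup Z (xs @ [y])) = h' ** tup Z (xs @ [\<mu>2 B ** y])"
    unfolding R using stepS(8)[OF x(1), of "\<mu>2 B ** y"] O y y' by simp
qed

lemma w'_forms:
  assumes i: "i < length As" and x: "els Z ((map T0 As)[i := T0 (T0 (As ! i))]) xs" "idcs xs" and y: "idc y" "src y = Z" "tgt y = T0 B"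
  shows "dm (w' i ** tup Z (xs @ [y])) = bnd (T0 (As ! i)) (P \<otimes> B) (xs ! i) (h' ** tup (Z \<otimes> T0 (As ! i)) (osl Z (T0 (As ! i)) i (xs @ [y])))"
    "cm (w' i ** tup Z (xs @ [y])) = h' ** tup Z ((xs @ [y])[i := \<mu>2 (As ! i) ** xs ! i])"
proof -
  let ?A = "T0 (As ! i)"
  have y': "y \<in> Ce K" "Z \<in> Ob K" using y elsD(2)[OF x(1)] by (auto simp: idcD)
  have A: "As ! i \<in> Ob K" using typF(1) i by auto
  have O: "B \<in> Ob K" "P \<in> Ob K" using typF(2) stepS(1) by auto
  note l = elsD[OF x(1)]
  have xi: "xs ! i \<in> Ce K" "src (xs ! i) = Z" "tgt (xs ! i) = T0 ?A" "idc (xs ! i)" using l(4-6)[of i] l(1) i idcs_nth[OF x(2), of i] by simp_all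
  have ox: "els (Z \<otimes> ?A) (map T0 As) (osl Z ?A i xs)" using els_osl'[OF x(1), of ?A] A i by simp
  have yA: "y ** p1 Z ?A \<in> Ce K" "src (y ** p1 Z ?A) = Z \<otimes> ?A" "tgt (y ** p1 Z ?A) = T0 B" using y y' A by simp_all
  have R: "w' i ** tup Z (xs @ [y]) = \<omega>2 P B ** pair2 (w i ** tup Z xs) y" using stepS(9)[OF i x y] .
  have xl: "i < length xs" using i l(1) by simp
  note wt = w_ty[OF i x(1)] and ho = h_ty(1-3)[OF ox]
  have dw: "dm (w i ** tup Z xs) = bnd ?A P (xs ! i) (h ** tup (Z \<otimes> ?A) (osl Z ?A i xs))" by (rule typF(11)[OF i x])
  have cw: "cm (w i ** tup Z xs) = h ** tup Z (xs[i := \<mu>2 (As ! i) ** xs ! i])" by (rule typF(12)[OF i x])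
  have "dm (\<omega>2 P B ** pair2 (w i ** tup Z xs) y) = \<omega>2 P B ** pair2 (dm (w i ** tup Z xs)) y"
    using wt y y' O by (simp del: dm_hcomp add: dm_hcomp[of "pair2 (w i ** tup Z xs) y"])
  also have "\<dots> = bnd ?A (P \<otimes> B) (xs ! i) (\<omega>2 P B ** pair2 (h ** tup (Z \<otimes> ?A) (osl Z ?A i xs)) (y ** p1 Z ?A))"
    unfolding dw by (rule \<omega>_bnd_left[where Z = Z]) (use xi ho y y' O A in simp_all)
  finally show "dm (w' i ** tup Z (xs @ [y])) = bnd ?A (P \<otimes> B) (xs ! i) (h' ** tup (Z \<otimes> ?A) (osl Z ?A i (xs @ [y])))"
    unfolding R osl_snoc(1)[OF xl] stepS(8)[OF ox yA] .
  have u: "els Z (map T0 As) (xs[i := \<mu>2 (As ! i) ** xs ! i])" using els_update_same[OF x(1) refl, of "\<mu>2 (As ! i) ** xs ! i" "T0 (As ! i)"] xi A i by simp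
  have "cm (\<omega>2 P B ** pair2 (w i ** tup Z xs) y) = \<omega>2 P B ** pair2 (cm (w i ** tup Z xs)) y"
    using wt y y' O by (simp del: dm_hcomp add: dm_hcomp[of "pair2 (w i ** tup Z xs) y"])
  then show "cm (w' i ** tup Z (xs @ [y])) = h' ** tup Z ((xs @ [y])[i := \<mu>2 (As ! i) ** xs ! i])"
    unfolding R cw using stepS(8)[OF u y'(1) y(2,3)] xl by (simp add: list_update_append)
qed

text \<open>At the generic tuple \<open>w' i\<close> is either the invertible \<open>w i\<close>
  whiskered by \<open>\<omega>\<close> or an instance of \<open>c1\<close>, whose inverse is
  \<open>D\<close>.\<close>

lemma vinv_w':
  assumes "i < length (As @ [B])"
  shows "\<exists>v. vinv (w' i) v"
proof -
  let ?Y = "(map T0 (As @ [B]))[i := T0 (T0 ((As @ [B]) ! i))]"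
  have Ob: "set (As @ [B]) \<subseteq> Ob K" using typF(1) stepS(1) by simp
  have O: "B \<in> Ob K" "P \<in> Ob K" using typF(2) stepS(1) by auto
  have Ai: "(As @ [B]) ! i \<in> Ob K" using Ob assms by (metis nth_mem subsetD)
  have Y: "set ?Y \<subseteq> Ob K" by (rule update_Ob[OF map_T0_Ob[OF Ob]]) (use Ai in simp)
  let ?Z = "nprod ?Y"
  have e: "els ?Z ?Y (projs ?Y)" "idcs (projs ?Y)" using Y by (simp_all add: idcs_projs)
  have p: "w' i = w' i ** tup ?Z (projs ?Y)" using Y stepS(5,6)[OF assms] by simp
  show ?thesis
  proof (cases "i < length As")
    case True
    then have Yi: "?Y = (map T0 As)[i := T0 (T0 (As ! i))] @ [T0 B]" by (simp add: list_update_append nth_append)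
    obtain xs y where xy: "projs ?Y = xs @ [y]" "els ?Z ((map T0 As)[i := T0 (T0 (As ! i))]) xs" "y \<in> Ce K" "src y = ?Z" "tgt y = T0 B"
      using els_snocE[OF e(1)[unfolded Yi]] unfolding Yi by metis
    have ic: "idcs xs" "idc y" using e(2) unfolding xy(1) by simp_all
    obtain v where v: "vinv (w i) v" using typF(10)[OF True] by blast
    have r: "w' i = \<omega>2 P B ** pair2 (w i ** tup ?Z xs) y"
      using p stepS(9)[OF True xy(2) ic xy(4,5)] unfolding xy(1) by simp
    have "vinv (\<omega>2 P B ** pair2 (w i ** tup ?Z xs) y) (\<omega>2 P B ** pair2 (v ** tup ?Z xs) y)"
      by (intro vinv_whisker vinv_pair2 vinv_idc v) (use xy ic O w_ty[OF True xy(2)] typF(8)[OF True] in simp_all)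
    then show ?thesis unfolding r[symmetric] by blast
  next
    case False
    then have i: "i = length As" using assms by simp
    have Yi: "?Y = map T0 As @ [T0 (T0 B)]" unfolding i snoc_update(2) by simp
    obtain xs y where xy: "projs ?Y = xs @ [y]" "els ?Z (map T0 As) xs" "y \<in> Ce K" "src y = ?Z" "tgt y = T0 (T0 B)"
      using els_snocE[OF e(1)[unfolded Yi]] unfolding Yi by metis
    have ic: "idcs xs" "idc y" using e(2) unfolding xy(1) by simp_all
    have r: "w' i = c1 P B ** pair2 (h ** tup ?Z xs) y"
      using p stepS(10)[OF xy(2) ic xy(4,5)] unfolding xy(1) i[symmetric] by simp
    have "vinv (c1 P B ** pair2 (h ** tup ?Z xs) y) (D P B ** pair2 (h ** tup ?Z xs) y)"
      by (intro vinv_sym[OF vinv_c1_pair]) (use xy ic O h_ty[OF xy(2)] in simp_all)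
    then show ?thesis unfolding r[symmetric] by blast
  qed
qed

lemmas step_vcomp = \<omega>_vcomp[OF typF(2) stepS(1)]

lemma step_typ: "fel_typ (As @ [B]) (P \<otimes> B) h' w'"
proof -
  have Ob: "set (As @ [B]) \<subseteq> Ob K" using typF(1) stepS(1) by simp
  have "dm (w' i ** tup Z ys) = bnd (T0 ((As @ [B]) ! i)) (P \<otimes> B) (ys ! i) (h' ** tup (Z \<otimes> T0 ((As @ [B]) ! i)) (osl Z (T0 ((As @ [B]) ! i)) i ys)) \<and>
       cm (w' i ** tup Z ys) = h' ** tup Z (ys[i := \<mu>2 ((As @ [B]) ! i) ** ys ! i])"
    if i: "i < length (As @ [B])" and e: "els Z ((map T0 (As @ [B]))[i := T0 (T0 ((As @ [B]) ! i))]) ys" and ic: "idcs ys" for i Z ys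
  proof (cases "i < length As")
    case True
    then have n: "(As @ [B]) ! i = As ! i" by (simp add: nth_append)
    obtain xs y where xy: "ys = xs @ [y]" "els Z ((map T0 As)[i := T0 (T0 (As ! i))]) xs" "y \<in> Ce K" "src y = Z" "tgt y = T0 B"
      using e unfolding n snoc_update(1)[OF True] by (rule els_snocE)
    have "idcs xs" "idc y" using ic unfolding xy(1) by simp_all
    note r = w'_forms[OF True xy(2) this xy(4,5)]
    have "ys ! i = xs ! i" using True elsD(1)[OF xy(2)] unfolding xy(1) by (simp add: nth_append)
    with r show ?thesis unfolding n xy(1) by simp
  next
    case False
    then have i: "i = length As" using i by simp
    have n: "(As @ [B]) ! i = B" unfolding i by simp
    obtain xs y where xy: "ys = xs @ [y]" "els Z (map T0 As) xs" "y \<in> Ce K" "src y = Z" "tgt y = T0 (T0 B)"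
      using e unfolding n unfolding i snoc_update(2) by (rule els_snocE)
    have "idcs xs" "idc y" using ic unfolding xy(1) by simp_all
    note r = w'_n_forms[OF xy(2) this xy(4,5)]
    have "length xs = length As" using elsD(1)[OF xy(2)] by simp
    with r show ?thesis unfolding n xy(1) unfolding i by (simp add: list_update_append nth_append)
  qed
  moreover have "P \<otimes> B \<in> Ob K" using typF(2) stepS(1) by simp
  ultimately show ?thesis
    unfolding fel_typ_def using Ob stepS(2-7) vinv_w' by blast
qed

lemma step_eta: "fel_eta (As @ [B]) h' w'"
  unfolding fel_eta_def
proof (intro allI impI)
  fix i Z ys assume i: "i < length (As @ [B])" and e: "els Z (map T0 (As @ [B])) ys" and ic: "idcs ys"
  have O: "B \<in> Ob K" "P \<in> Ob K" using typF(2) stepS(1) by auto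
  obtain xs y where xy: "ys = xs @ [y]" "els Z (map T0 As) xs" "y \<in> Ce K" "src y = Z" "tgt y = T0 B"
    using e unfolding map_append list.map by (rule els_snocE)
  have c: "idcs xs" "idc y" using ic unfolding xy(1) by simp_all
  note l = elsD[OF xy(2)]
  show "w' i ** tup Z (ys[i := \<eta>2 (T0 ((As @ [B]) ! i)) ** ys ! i]) = h' ** tup Z ys"
  proof (cases "i < length As")
    case True
    have A: "As ! i \<in> Ob K" using typF(1) True by auto
    have n: "(As @ [B]) ! i = As ! i" "ys ! i = xs ! i" "i < length xs" using True l(1) unfolding xy(1) by (simp_all add: nth_append)
    have xi: "xs ! i \<in> Ce K" "src (xs ! i) = Z" "tgt (xs ! i) = T0 (As ! i)" "idc (xs ! i)" using l(4-6)[of i] l(1) True idcs_nth[OF c(1), of i] by simp_all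
    have u: "els Z ((map T0 As)[i := T0 (T0 (As ! i))]) (xs[i := \<eta>2 (T0 (As ! i)) ** xs ! i])"
      by (rule els_update[OF xy(2)]) (use xi A in simp_all)
    have iu: "idcs (xs[i := \<eta>2 (T0 (As ! i)) ** xs ! i])" using idcs_update[OF c(1)] xi A by simp
    have "w' i ** tup Z (xs[i := \<eta>2 (T0 (As ! i)) ** xs ! i] @ [y]) = \<omega>2 P B ** pair2 (h ** tup Z xs) y"
      using stepS(9)[OF True u iu c(2) xy(4,5)] felF(2)[unfolded fel_eta_def, rule_format, OF True xy(2) c(1)] by simp
    then show ?thesis unfolding n xy(1) using stepS(8)[OF xy(2-5)] n by (simp add: list_update_append nth_append)
  next
    case False
    then have i: "i = length As" using i by simp
    have n: "(As @ [B]) ! i = B" "ys ! i = y" using l(1) unfolding i xy(1) by (simp_all add: nth_append)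
    have "w' (length As) ** tup Z (xs @ [\<eta>2 (T0 B) ** y]) = c1 P B ** pair2 (h ** tup Z xs) (\<eta>2 (T0 B) ** y)"
      by (rule stepS(10)[OF xy(2) c(1)]) (use xy c O in simp_all)
    also have "\<dots> = \<omega>2 P B ** pair2 (h ** tup Z xs) y"
      by (rule c1_\<eta>(1)[where Z = Z]) (use h_ty[OF xy(2)] c xy O in simp_all)
    finally show ?thesis unfolding n xy(1) stepS(8)[OF xy(2-5)] using l(1) unfolding i by (simp add: list_update_append nth_append)
  qed
qed

text \<open>In an old place the law is the old one whiskered by \<open>\<omega>\<close>, with the
  bound computation taken out by \<open>\<omega>_bnd_left\<close>; in the new last place it is
  \<open>c1_\<mu>2\<close>.\<close>

lemma step_mu: "fel_mu (As @ [B]) (P \<otimes> B) w'"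
  unfolding fel_mu_def
proof (intro allI impI)
  fix i Z ys assume i: "i < length (As @ [B])" and e: "els Z ((map T0 (As @ [B]))[i := T0 (T0 (T0 ((As @ [B]) ! i)))]) ys" and ic: "idcs ys"
  have O: "B \<in> Ob K" "P \<in> Ob K" using typF(2) stepS(1) by auto
  show "w' i ** tup Z (ys[i := \<mu>2 (T0 ((As @ [B]) ! i)) ** ys ! i])
     = (w' i ** tup Z (ys[i := T2 (\<mu>2 ((As @ [B]) ! i)) ** ys ! i]))
       \<cdot> bnd (T0 (T0 ((As @ [B]) ! i))) (P \<otimes> B) (ys ! i) (w' i ** tup (Z \<otimes> T0 (T0 ((As @ [B]) ! i))) (osl Z (T0 (T0 ((As @ [B]) ! i))) i ys))"
  proof (cases "i < length As")
    case True
    then have n: "(As @ [B]) ! i = As ! i" by (simp add: nth_append)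
    obtain xs y where xy: "ys = xs @ [y]" "els Z ((map T0 As)[i := T0 (T0 (T0 (As ! i)))]) xs" "y \<in> Ce K" "src y = Z" "tgt y = T0 B"
      using e unfolding n snoc_update(1)[OF True] by (rule els_snocE)
    have c: "idcs xs" "idc y" using ic unfolding xy(1) by simp_all
    note l = elsD[OF xy(2)]
    have A: "As ! i \<in> Ob K" using typF(1) True by auto
    have n2: "ys ! i = xs ! i" "i < length xs" using True l(1) unfolding xy(1) by (simp_all add: nth_append)
    let ?A = "T0 (As ! i)"
    have xi: "xs ! i \<in> Ce K" "src (xs ! i) = Z" "tgt (xs ! i) = T0 (T0 ?A)" "idc (xs ! i)" using l(4-6)[of i] l(1) True idcs_nth[OF c(1), of i] by simp_all
    let ?u1 = "xs[i := \<mu>2 ?A ** xs ! i]" and ?u2 = "xs[i := T2 (\<mu>2 (As ! i)) ** xs ! i]" and ?o = "osl Z (T0 ?A) i xs"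
    have u1: "els Z ((map T0 As)[i := T0 ?A]) ?u1" "idcs ?u1"
      using els_update[OF xy(2), of "\<mu>2 ?A ** xs ! i" "T0 ?A" i] idcs_update[OF c(1)] xi A by simp_all
    have u2: "els Z ((map T0 As)[i := T0 ?A]) ?u2" "idcs ?u2"
      using els_update[OF xy(2), of "T2 (\<mu>2 (As ! i)) ** xs ! i" "T0 ?A" i] idcs_update[OF c(1)] xi A by simp_all
    have o: "els (Z \<otimes> T0 ?A) ((map T0 As)[i := T0 ?A]) ?o" "idcs ?o"
      using els_osl'[OF xy(2), of "T0 ?A"] idcs_osl[OF xy(2) c(1)] A by simp_all
    let ?k = "w i ** tup (Z \<otimes> T0 ?A) ?o" and ?y = "y ** p1 Z (T0 ?A)"
    have yy: "idc ?y" "src ?y = Z \<otimes> T0 ?A" "tgt ?y = T0 B" using xy c A l(2) by simp_all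
    note k = w_ty[OF True o(1)] and w2 = w_ty[OF True u2(1)]
    have "w' i ** tup Z (?u1 @ [y]) = \<omega>2 P B ** pair2 (w i ** tup Z ?u1) y"
      by (rule stepS(9)[OF True u1 c(2) xy(4,5)])
    also have "w i ** tup Z ?u1 = (w i ** tup Z ?u2) \<cdot> bnd (T0 ?A) P (xs ! i) ?k"
      by (rule felF(3)[unfolded fel_mu_def, rule_format, OF True xy(2) c(1)])
    also have "\<omega>2 P B ** pair2 ((w i ** tup Z ?u2) \<cdot> bnd (T0 ?A) P (xs ! i) ?k) y
      = (\<omega>2 P B ** pair2 (w i ** tup Z ?u2) y) \<cdot> (\<omega>2 P B ** pair2 (bnd (T0 ?A) P (xs ! i) ?k) y)"
    proof -
      have b: "bnd (T0 ?A) P (xs ! i) ?k \<in> Ce K" "src (bnd (T0 ?A) P (xs ! i) ?k) = Z" "tgt (bnd (T0 ?A) P (xs ! i) ?k) = T0 P" using k xi O A by simp_all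
      show ?thesis
        by (rule step_vcomp(1)[OF b(1) w2(1) fel_mu_composable[OF felF(1) True xy(2) c(1)] c(2)]) (use b xy in simp_all)
    qed
    also have "\<omega>2 P B ** pair2 (w i ** tup Z ?u2) y = w' i ** tup Z (?u2 @ [y])"
      by (rule stepS(9)[OF True u2 c(2) xy(4,5), symmetric])
    also have "\<omega>2 P B ** pair2 (bnd (T0 ?A) P (xs ! i) ?k) y = bnd (T0 ?A) (P \<otimes> B) (xs ! i) (\<omega>2 P B ** pair2 ?k ?y)"
      by (rule \<omega>_bnd_left[where Z = Z]) (use k xi O A xy in simp_all)
    also have "\<omega>2 P B ** pair2 ?k ?y = w' i ** tup (Z \<otimes> T0 ?A) (?o @ [?y])"
      by (rule stepS(9)[OF True o yy, symmetric])
    finally show ?thesis unfolding n n2 unfolding xy(1) osl_snoc(1)[OF n2(2)] using n2 by (simp add: list_update_append)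
  next
    case False
    then have i: "i = length As" using i by simp
    have n: "(As @ [B]) ! i = B" unfolding i by simp
    obtain xs y where xy: "ys = xs @ [y]" "els Z (map T0 As) xs" "y \<in> Ce K" "src y = Z" "tgt y = T0 (T0 (T0 B))"
      using e unfolding n unfolding i snoc_update(2) by (rule els_snocE)
    have c: "idcs xs" "idc y" using ic unfolding xy(1) by simp_all
    note l = elsD[OF xy(2)]
    have n2: "ys ! i = y" "length xs = length As" using l(1) unfolding i xy(1) by (simp_all add: nth_append)
    let ?u = "h ** tup Z xs"
    note u = h_ty[OF xy(2)]
    have w: "els (Z \<otimes> T0 (T0 B)) (map T0 As) (wk Z (T0 (T0 B)) xs)" "idcs (wk Z (T0 (T0 B)) xs)"
      using els_wk[OF xy(2)] idcs_wk[OF xy(2) c(1)] O by simp_all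
    have 1: "w' (length As) ** tup Z (xs @ [\<mu>2 (T0 B) ** y]) = c1 P B ** pair2 ?u (\<mu>2 (T0 B) ** y)"
      by (rule stepS(10)[OF xy(2) c(1)]) (use xy c O in simp_all)
    have 2: "w' (length As) ** tup Z (xs @ [T2 (\<mu>2 B) ** y]) = c1 P B ** pair2 ?u (T2 (\<mu>2 B) ** y)"
      by (rule stepS(10)[OF xy(2) c(1)]) (use xy c O in simp_all)
    have 3: "w' (length As) ** tup (Z \<otimes> T0 (T0 B)) (wk Z (T0 (T0 B)) xs @ [p2 Z (T0 (T0 B))])
      = c1 P B ** pair2 (?u ** p1 Z (T0 (T0 B))) (p2 Z (T0 (T0 B)))"
      using stepS(10)[OF w, of "p2 Z (T0 (T0 B))"] O l(2) h_wk[OF xy(2), of "T0 (T0 B)"] by simp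
    have 4: "c1 P B ** pair2 ?u (\<mu>2 (T0 B) ** y) = (c1 P B ** pair2 ?u (T2 (\<mu>2 B) ** y))
       \<cdot> (\<mu>2 (P \<otimes> B) ** (T2 (c1 P B ** pair2 (?u ** p1 Z (T0 (T0 B))) (p2 Z (T0 (T0 B)))) ** \<tau> (T0 (T0 B)) y))"
      by (rule c1_\<mu>2) (use u c xy O in simp_all)
    have 5: "osl Z (T0 (T0 B)) (length As) (xs @ [y]) = wk Z (T0 (T0 B)) xs @ [p2 Z (T0 (T0 B))]"
      unfolding n2(2)[symmetric] by (rule osl_snoc(2))
    show ?thesis
      unfolding n n2(1) unfolding xy(1) i unfolding 5
      using 1 2 3 4 n2(2) by (simp add: list_update_append bnd_def)
  qed
qed

text \<open>For two old places the old coherence is whiskered by \<open>\<omega>\<close>. For an old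
  place and the new one, interchange moves \<open>w i\<close> and \<open>c1\<close> past each other,
  and \<open>c1_\<mu>1\<close> contributes the \<open>\<Gamma>\<close>.\<close>

lemma step_coh: "fel_coh (As @ [B]) (P \<otimes> B) h' w'"
  unfolding fel_coh_def
proof (intro allI impI)
  fix j i Z ys assume j: "j < length (As @ [B])" and ij: "i < j"
    and e: "els Z ((map T0 (As @ [B]))[i := T0 (T0 ((As @ [B]) ! i)), j := T0 (T0 ((As @ [B]) ! j))]) ys" and ic: "idcs ys"
  have O: "B \<in> Ob K" "P \<in> Ob K" using typF(2) stepS(1) by auto
  have i: "i < length As" using j ij by simp
  have ni: "(As @ [B]) ! i = As ! i" using i by (simp add: nth_append)
  have A: "As ! i \<in> Ob K" using typF(1) i by auto
  let ?A = "T0 (As ! i)"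
  show "(w' i ** tup Z (ys[j := \<mu>2 ((As @ [B]) ! j) ** ys ! j]))
       \<cdot> bnd (T0 ((As @ [B]) ! i)) (P \<otimes> B) (ys ! i) (w' j ** tup (Z \<otimes> T0 ((As @ [B]) ! i)) (osl Z (T0 ((As @ [B]) ! i)) i ys))
     = (w' j ** tup Z (ys[i := \<mu>2 ((As @ [B]) ! i) ** ys ! i]))
       \<cdot> bnd (T0 ((As @ [B]) ! j)) (P \<otimes> B) (ys ! j) (w' i ** tup (Z \<otimes> T0 ((As @ [B]) ! j)) (osl Z (T0 ((As @ [B]) ! j)) j ys))
       \<cdot> bnd (T0 ((As @ [B]) ! i) \<otimes> T0 ((As @ [B]) ! j)) (P \<otimes> B) (\<Gamma> (T0 ((As @ [B]) ! i)) (T0 ((As @ [B]) ! j)) ** pair2 (ys ! i) (ys ! j))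
           (h' ** tup (Z \<otimes> (T0 ((As @ [B]) ! i) \<otimes> T0 ((As @ [B]) ! j))) (osl2 Z (T0 ((As @ [B]) ! i)) (T0 ((As @ [B]) ! j)) i j ys))"
  proof (cases "j < length As")
    case True
    have nj: "(As @ [B]) ! j = As ! j" using True by (simp add: nth_append)
    let ?B = "T0 (As ! j)"
    let ?X = "(map T0 As)[i := T0 ?A, j := T0 ?B]"
    have Xe: "(map T0 (As @ [B]))[i := T0 ?A, j := T0 ?B] = ?X @ [T0 B]" using i True by (simp add: list_update_append)
    obtain xs y where xy: "ys = xs @ [y]" "els Z ?X xs" "y \<in> Ce K" "src y = Z" "tgt y = T0 B"
      using e unfolding ni nj Xe by (rule els_snocE)
    have c: "idcs xs" "idc y" using ic unfolding xy(1) by simp_all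
    note l = elsD[OF xy(2)]
    have Aj: "As ! j \<in> Ob K" using typF(1) True by auto
    have n2: "ys ! i = xs ! i" "i < length xs" "ys ! j = xs ! j" "j < length xs" using True i l(1) unfolding xy(1) by (simp_all add: nth_append)
    have xi: "xs ! i \<in> Ce K" "src (xs ! i) = Z" "tgt (xs ! i) = T0 ?A" "idc (xs ! i)" using l(4-6)[of i] l(1) i ij idcs_nth[OF c(1), of i] by simp_all
    have xj: "xs ! j \<in> Ce K" "src (xs ! j) = Z" "tgt (xs ! j) = T0 ?B" "idc (xs ! j)" using l(4-6)[of j] l(1) True idcs_nth[OF c(1), of j] by simp_all
    let ?ui = "xs[i := \<mu>2 (As ! i) ** xs ! i]" and ?uj = "xs[j := \<mu>2 (As ! j) ** xs ! j]"
    let ?oi = "osl Z ?A i xs" and ?oj = "osl Z ?B j xs" and ?o2 = "osl2 Z ?A ?B i j xs"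
    have sw: "?X = (map T0 As)[j := T0 ?B, i := T0 ?A]" using ij by (simp add: list_update_swap)
    have ui: "els Z ((map T0 As)[j := T0 ?B]) ?ui" "idcs ?ui"
      using els_update[OF xy(2), of "\<mu>2 (As ! i) ** xs ! i" ?A i] idcs_update[OF c(1)] xi A i ij unfolding sw
      by (simp_all add: list_update_swap[of j i])
    have uj: "els Z ((map T0 As)[i := T0 ?A]) ?uj" "idcs ?uj"
      using els_update[OF xy(2), of "\<mu>2 (As ! j) ** xs ! j" ?B j] idcs_update[OF c(1)] xj Aj True ij
      by (simp_all add: list_update_swap[of i j])
    have oi: "els (Z \<otimes> ?A) ((map T0 As)[j := T0 ?B]) ?oi" "idcs ?oi"
      using els_osl[OF xy(2), of ?A i] idcs_osl[OF xy(2) c(1)] A i ij by (simp_all add: list_update_swap[of j i])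
    have oj: "els (Z \<otimes> ?B) ((map T0 As)[i := T0 ?A]) ?oj" "idcs ?oj"
      using els_osl[OF xy(2), of ?B j] idcs_osl[OF xy(2) c(1)] Aj True ij by (simp_all add: list_update_swap[of i j])
    have o2: "els (Z \<otimes> (?A \<otimes> ?B)) (map T0 As) ?o2" "idcs ?o2"
      using els_osl2[OF xy(2), of ?A ?B i j] idcs_osl2[OF xy(2) c(1), of ?A ?B] A Aj i True ij by (simp_all add: list_update_swap[of j i])
    let ?a1 = "w i ** tup Z ?uj" and ?b1 = "bnd ?A P (xs ! i) (w j ** tup (Z \<otimes> ?A) ?oi)"
    let ?a2 = "w j ** tup Z ?ui" and ?b2 = "bnd ?B P (xs ! j) (w i ** tup (Z \<otimes> ?B) ?oj)"
    let ?G = "\<Gamma> ?A ?B ** pair2 (xs ! i) (xs ! j)"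
    let ?g = "bnd (?A \<otimes> ?B) P ?G (h ** tup (Z \<otimes> (?A \<otimes> ?B)) ?o2)"
    let ?W = "\<lambda>x. \<omega>2 P B ** pair2 x y"
    have IH: "?a1 \<cdot> ?b1 = ?a2 \<cdot> ?b2 \<cdot> ?g"
      by (rule felF(4)[unfolded fel_coh_def, rule_format, OF True ij xy(2) c(1)])
    have k1: "cm ?b1 = dm ?a1" and k3: "cm ?g = dm ?b2" using fel_composable[OF felF(1) i True _ xy(2) c(1)] ij by simp_all
    have k2: "cm ?b2 = dm ?a2" using fel_composable(1)[OF felF(1) True i _ xy(2)[unfolded sw] c(1)] ij by simp
    note a1 = w_ty[OF i uj(1)] and a2 = w_ty[OF True ui(1)] and kj = w_ty[OF True oi(1)] and ki = w_ty[OF i oj(1)]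
    have G: "?G \<in> Ce K" "src ?G = Z" "tgt ?G = T0 (?A \<otimes> ?B)" using xi xj A Aj by simp_all
    have b1: "?b1 \<in> Ce K" "src ?b1 = Z" "tgt ?b1 = T0 P" using kj xi A O by simp_all
    have b2: "?b2 \<in> Ce K" "src ?b2 = Z" "tgt ?b2 = T0 P" using ki xj Aj O by simp_all
    have g: "?g \<in> Ce K" "src ?g = Z" "tgt ?g = T0 P" using h_ty[OF o2(1)] G A Aj O by simp_all
    have b2g: "?b2 \<cdot> ?g \<in> Ce K" "src (?b2 \<cdot> ?g) = Z" "tgt (?b2 \<cdot> ?g) = T0 P" "cm (?b2 \<cdot> ?g) = cm ?b2"
      using b2 g k3 by simp_all
    have "?W (?a1 \<cdot> ?b1) = ?W ?a1 \<cdot> ?W ?b1"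
      by (rule step_vcomp(1)[OF b1(1) a1(1) k1 c(2)]) (use b1 xy in simp_all)
    moreover have "?W (?a2 \<cdot> ?b2 \<cdot> ?g) = ?W ?a2 \<cdot> ?W (?b2 \<cdot> ?g)"
      by (rule step_vcomp(1)[OF b2g(1) a2(1) _ c(2)]) (use b2g k2 xy in simp_all)
    moreover have "?W (?b2 \<cdot> ?g) = ?W ?b2 \<cdot> ?W ?g"
      by (rule step_vcomp(1)[OF g(1) b2(1) k3 c(2)]) (use g xy in simp_all)
    ultimately have W: "?W ?a1 \<cdot> ?W ?b1 = ?W ?a2 \<cdot> ?W ?b2 \<cdot> ?W ?g"
      using arg_cong[OF IH, of ?W] by simp
    have yA: "idc (y ** p1 Z C)" "src (y ** p1 Z C) = Z \<otimes> C" "tgt (y ** p1 Z C) = T0 B" "y ** p1 Z C \<in> Ce K" if "C \<in> Ob K" for C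
      using that xy c l(2) by simp_all
    have 1: "?W ?a1 = w' i ** tup Z (?uj @ [y])" by (rule stepS(9)[OF i uj c(2) xy(4,5), symmetric])
    have 2: "?W ?a2 = w' j ** tup Z (?ui @ [y])" by (rule stepS(9)[OF True ui c(2) xy(4,5), symmetric])
    have 3: "?W ?b1 = bnd ?A (P \<otimes> B) (xs ! i) (w' j ** tup (Z \<otimes> ?A) (?oi @ [y ** p1 Z ?A]))"
    proof -
      have "?W ?b1 = bnd ?A (P \<otimes> B) (xs ! i) (\<omega>2 P B ** pair2 (w j ** tup (Z \<otimes> ?A) ?oi) (y ** p1 Z ?A))"
        by (rule \<omega>_bnd_left[where Z = Z]) (use kj xi O A xy in simp_all)
      then show ?thesis using stepS(9)[OF True oi, of "y ** p1 Z ?A"] yA[of ?A] A by simp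
    qed
    have 4: "?W ?b2 = bnd ?B (P \<otimes> B) (xs ! j) (w' i ** tup (Z \<otimes> ?B) (?oj @ [y ** p1 Z ?B]))"
    proof -
      have "?W ?b2 = bnd ?B (P \<otimes> B) (xs ! j) (\<omega>2 P B ** pair2 (w i ** tup (Z \<otimes> ?B) ?oj) (y ** p1 Z ?B))"
        by (rule \<omega>_bnd_left[where Z = Z]) (use ki xj O Aj xy in simp_all)
      then show ?thesis using stepS(9)[OF i oj, of "y ** p1 Z ?B"] yA[of ?B] Aj by simp
    qed
    have 5: "?W ?g = bnd (?A \<otimes> ?B) (P \<otimes> B) ?G (h' ** tup (Z \<otimes> (?A \<otimes> ?B)) (?o2 @ [y ** p1 Z (?A \<otimes> ?B)]))"
    proof -
      have "?W ?g = bnd (?A \<otimes> ?B) (P \<otimes> B) ?G (\<omega>2 P B ** pair2 (h ** tup (Z \<otimes> (?A \<otimes> ?B)) ?o2) (y ** p1 Z (?A \<otimes> ?B)))"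
        by (rule \<omega>_bnd_left[where Z = Z]) (use h_ty[OF o2(1)] G O A Aj xy in simp_all)
      then show ?thesis using stepS(8)[OF o2(1), of "y ** p1 Z (?A \<otimes> ?B)"] yA[of "?A \<otimes> ?B"] A Aj by simp
    qed
    have 6: "osl2 Z ?A ?B i j (xs @ [y]) = ?o2 @ [y ** p1 Z (?A \<otimes> ?B)]" using n2 by (simp add: osl2_def list_update_append)
    show ?thesis
      unfolding ni nj n2 unfolding xy(1) osl_snoc(1)[OF n2(2)] osl_snoc(1)[OF n2(4)] 6
      using W unfolding 1 2 3 4 5 using n2 by (simp add: list_update_append)
  next
    case False
    then have jn: "j = length As" using j by simp
    have nj: "(As @ [B]) ! j = B" unfolding jn by simp
    have Xe: "(map T0 (As @ [B]))[i := T0 ?A, j := T0 (T0 B)] = (map T0 As)[i := T0 ?A] @ [T0 (T0 B)]"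
      unfolding jn using i by (simp add: list_update_append)
    obtain xs y where xy: "ys = xs @ [y]" "els Z ((map T0 As)[i := T0 ?A]) xs" "y \<in> Ce K" "src y = Z" "tgt y = T0 (T0 B)"
      using e unfolding ni nj Xe by (rule els_snocE)
    have c: "idcs xs" "idc y" using ic unfolding xy(1) by simp_all
    note l = elsD[OF xy(2)]
    have Z: "Z \<in> Ob K" by (rule l(2))
    have xl: "length xs = length As" using l(1) by simp
    have n2: "ys ! i = xs ! i" "i < length xs" "ys ! j = y" using i xl unfolding xy(1) jn by (simp_all add: nth_append)
    have xi: "xs ! i \<in> Ce K" "src (xs ! i) = Z" "tgt (xs ! i) = T0 ?A" "idc (xs ! i)" using l(4-6)[of i] l(1) i idcs_nth[OF c(1), of i] by simp_all
    let ?ui = "xs[i := \<mu>2 (As ! i) ** xs ! i]" and ?oi = "osl Z ?A i xs" and ?wx = "wk Z (T0 B) xs"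
    have ui: "els Z (map T0 As) ?ui" "idcs ?ui"
      using els_update_same[OF xy(2) refl, of "\<mu>2 (As ! i) ** xs ! i" ?A] idcs_update[OF c(1)] xi A i by simp_all
    have oi: "els (Z \<otimes> ?A) (map T0 As) ?oi" "idcs ?oi"
      using els_osl'[OF xy(2), of ?A] idcs_osl[OF xy(2) c(1)] A i by simp_all
    have wx: "els (Z \<otimes> T0 B) ((map T0 As)[i := T0 ?A]) ?wx" "idcs ?wx" using els_wk[OF xy(2)] idcs_wk[OF xy(2) c(1)] O by simp_all
    let ?\<theta> = "w i ** tup Z xs" and ?k = "h ** tup (Z \<otimes> ?A) ?oi"
    note \<theta> = w_ty[OF i xy(2)] and k = h_ty[OF oi(1)]
    have ki: "idc ?k" using k(4) oi(2) .
    \<comment> \<open>Runs entry \<open>i\<close> and returns the value of \<open>h\<close> as a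
      computation not yet run; \<open>\<mu>\<close> of it is the source of
      \<open>?\<theta>\<close>.\<close>
    let ?U = "T2 ?k ** \<tau> ?A (xs ! i)"
    have U: "idc ?U" "?U \<in> Ce K" "src ?U = Z" "tgt ?U = T0 (T0 P)" using k ki xi A by simp_all
    have dt: "dm ?\<theta> = \<mu>2 P ** ?U" using typF(11)[OF i xy(2) c(1)] by (simp add: bnd_def)
    have ct: "cm ?\<theta> = h ** tup Z ?ui" using typF(12)[OF i xy(2) c(1)] .
    let ?c = "c1 P B"
    let ?p1 = "\<omega>2 P B ** pair2 ?\<theta> (\<mu>2 B ** y)" and ?p2 = "?c ** pair2 (\<mu>2 P ** ?U) y"
    let ?q1 = "?c ** pair2 (h ** tup Z ?ui) y" and ?q2 = "bnd (T0 B) (P \<otimes> B) y (\<omega>2 P B ** pair2 (?\<theta> ** p1 Z (T0 B)) (p2 Z (T0 B)))"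
    have pr: "pair2 ?\<theta> y \<in> Ce K" "tgt (pair2 ?\<theta> y) = src ?c" "dm (pair2 ?\<theta> y) = pair2 (\<mu>2 P ** ?U) y" "cm (pair2 ?\<theta> y) = pair2 (h ** tup Z ?ui) y"
      using \<theta> xy c O dm_pair2[of ?\<theta> y] unfolding dt ct by simp_all
    have cc: "?c \<in> Ce K" using O by simp
    have e1: "cm ?c ** pair2 ?\<theta> y = ?p1" using O \<theta> xy by simp
    have e2: "dm ?c ** pair2 ?\<theta> y = ?q2"
    proof -
      have "dm ?c ** pair2 ?\<theta> y = \<mu>2 (P \<otimes> B) ** (T2 (\<omega>2 P B) ** (id2 (t (T0 P) (T0 B)) ** pair2 ?\<theta> y))"
        using O \<theta> xy by (simp add: t_bnd)
      also have "\<dots> = ?q2" using O \<theta> xy Z by (simp add: t_pair_\<tau> bnd_def)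
      finally show ?thesis .
    qed
    \<comment> \<open>The two factorizations of \<open>?c ** pair2 ?\<theta> y\<close>: on the left
      \<open>?c\<close> comes first, on the right \<open>?\<theta>\<close>.\<close>
    have E: "?p1 \<cdot> ?p2 = ?q1 \<cdot> ?q2"
      using hcomp_vcomp1[OF pr(1) cc pr(2)] hcomp_vcomp2[OF pr(1) cc pr(2)] unfolding e1 e2 pr(3,4) by simp
    have k1: "cm ?p2 = dm ?p1"
      using interchange_composable(1)[OF pr(1) cc pr(2)] unfolding e1 pr(3) .
    have k2: "cm ?q2 = dm ?q1"
      using interchange_composable(2)[OF pr(1) cc pr(2)] unfolding e2 pr(4) .
    have ty: "?p1 \<in> Ce K" "?p2 \<in> Ce K" "?q1 \<in> Ce K" "?q2 \<in> Ce K" using \<theta> U h_ty[OF ui(1)] xy O Z by simp_all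
    let ?AB = "?A \<otimes> T0 B"
    let ?G = "\<Gamma> ?A (T0 B) ** pair2 (xs ! i) y"
    have G: "?G \<in> Ce K" "src ?G = Z" "tgt ?G = T0 ?AB" using xi xy A O by simp_all
    let ?g = "\<mu>2 (P \<otimes> B) ** (T2 (\<omega>2 P B) ** (\<Gamma> (T0 P) (T0 B) ** pair2 ?U y))"
    have g: "?g \<in> Ce K" using U xy O by simp
    have k3: "cm ?g = dm ?p2" by (rule c1_\<mu>1_composable[where Z = Z]) (use U xy c O in simp_all)
    \<comment> \<open>Here \<open>\<Gamma>\<close> enters, still applied to the composite element
      \<open>?U\<close>.\<close>
    have M: "\<mu>2 (P \<otimes> B) ** (T2 (?c ** pair2 (p2 Z (T0 P)) (y ** p1 Z (T0 P))) ** \<tau> (T0 P) ?U) = ?p2 \<cdot> ?g"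
      by (rule c1_\<mu>1) (use U xy c O in simp_all)
    have L: "bnd ?A (P \<otimes> B) (xs ! i) (?c ** pair2 ?k (y ** p1 Z ?A)) = ?p2 \<cdot> ?g"
      unfolding M[symmetric] using k xi xy A O Z \<tau>_T2[of "\<tau> ?A (xs ! i)" ?k "T0 P"] \<tau>_\<tau>[of "xs ! i" ?A] by (simp add: bnd_def)
    \<comment> \<open>That \<open>?q2\<close> can follow \<open>?g\<close> is inferred from
      \<open>E\<close>: equal composites have equal sources.\<close>
    have dq: "dm ?q2 = dm ?p2"
      using vcomp_typing(4)[OF ty(2,1) k1] vcomp_typing(4)[OF ty(4,3) k2] unfolding E by simp
    \<comment> \<open>The factor \<open>?p2\<close>, common to interchange and to
      \<open>c1_\<mu>1\<close>, links the two sides of the coherence condition.\<close>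
    have main: "?p1 \<cdot> (?p2 \<cdot> ?g) = ?q1 \<cdot> (?q2 \<cdot> ?g)"
    proof -
      have "?p1 \<cdot> (?p2 \<cdot> ?g) = (?p1 \<cdot> ?p2) \<cdot> ?g" by (rule vcomp_assoc'[OF g ty(2,1) k3 k1, symmetric])
      also have "\<dots> = ?q1 \<cdot> (?q2 \<cdot> ?g)" unfolding E
        by (rule vcomp_assoc'[OF g ty(4,3) _ k2]) (use k3 dq in simp)
      finally show ?thesis .
    qed
    \<comment> \<open>Context extraction reduces \<open>\<Gamma>\<close> on \<open>?U\<close> and
      \<open>y\<close> to \<open>\<Gamma>\<close> on entry \<open>i\<close> and \<open>y\<close>, as
      the coherence condition demands.\<close>
    have gg: "?g = bnd ?AB (P \<otimes> B) ?G (h' ** tup (Z \<otimes> ?AB) (osl2 Z ?A (T0 B) i (length As) (xs @ [y])))"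
    proof -
      let ?p = "p1 Z ?AB" and ?q = "p2 Z ?AB"
      let ?s = "p1 ?A (T0 B) ** ?q"
      have "\<Gamma> (T0 P) (T0 B) ** pair2 ?U y = T2 (pair2 (?k ** pair2 ?p ?s) (p2 ?A (T0 B) ** ?q)) ** \<tau> ?AB ?G"
        by (rule \<Gamma>_\<tau>_left) (use k ki xi xy A O in simp_all)
      moreover have ks: "?k ** pair2 ?p ?s \<in> Ce K" "src (?k ** pair2 ?p ?s) = Z \<otimes> ?AB" "tgt (?k ** pair2 ?p ?s) = T0 P" using k A O Z by simp_all
      ultimately have 1: "?g = bnd ?AB (P \<otimes> B) ?G (\<omega>2 P B ** pair2 (?k ** pair2 ?p ?s) (p2 ?A (T0 B) ** ?q))"
        using G O A Z by (simp add: bnd_def)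
      have w2: "els (Z \<otimes> ?AB) (map T0 As) ((wk Z ?AB xs)[i := ?s])"
        using els_update_same[OF els_wk[OF xy(2), of ?AB] refl, of ?s ?A] A O Z i by simp
      have "?k ** pair2 ?p ?s = h ** (tup (Z \<otimes> ?A) ?oi ** pair2 ?p ?s)"
        using typF(4,6) oi A O Z by (intro hcomp_assoc') simp_all
      also have "\<dots> = h ** tup (Z \<otimes> ?AB) ((wk Z ?AB xs)[i := ?s])"
        using osl_sub[OF xy(2), of ?A ?AB ?s i] A O Z by simp
      finally have 2: "?k ** pair2 ?p ?s = h ** tup (Z \<otimes> ?AB) ((wk Z ?AB xs)[i := ?s])" .
      have 3: "osl2 Z ?A (T0 B) i (length As) (xs @ [y]) = (wk Z ?AB xs)[i := ?s] @ [p2 ?A (T0 B) ** ?q]"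
        using xl i by (simp add: osl2_def list_update_append)
      show ?thesis unfolding 1 2 3 using stepS(8)[OF w2, of "p2 ?A (T0 B) ** ?q"] A O Z by simp
    qed
    have r1: "w' i ** tup Z (xs @ [\<mu>2 B ** y]) = ?p1"
      by (rule stepS(9)[OF i xy(2) c(1)]) (use xy c O in simp_all)
    have r2: "w' (length As) ** tup (Z \<otimes> ?A) (?oi @ [y ** p1 Z ?A]) = ?c ** pair2 ?k (y ** p1 Z ?A)"
      by (rule stepS(10)[OF oi]) (use xy c A Z in simp_all)
    have r3: "w' (length As) ** tup Z (?ui @ [y]) = ?q1"
      by (rule stepS(10)[OF ui c(2) xy(4,5)])
    have r4: "w' i ** tup (Z \<otimes> T0 B) (?wx @ [p2 Z (T0 B)]) = \<omega>2 P B ** pair2 (?\<theta> ** p1 Z (T0 B)) (p2 Z (T0 B))"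
      using stepS(9)[OF i wx, of "p2 Z (T0 B)"] w_wk[OF i xy(2), of "T0 B"] O Z by simp
    have o1: "osl Z (T0 B) (length As) (xs @ [y]) = ?wx @ [p2 Z (T0 B)]" unfolding xl[symmetric] by (rule osl_snoc(2))
    show ?thesis
      unfolding ni nj n2 unfolding xy(1) jn osl_snoc(1)[OF n2(2)] o1
      using main n2 xl L[unfolded gg r2[symmetric]] unfolding gg r1[symmetric] r3[symmetric] r4[symmetric]
      by (simp add: list_update_append)
  qed
qed

theorem step_fel: "fel (As @ [B]) (P \<otimes> B) h' w'"
  unfolding fel_def using step_typ step_eta step_mu step_coh by blast

end

end

section \<open>The iterated \<open>\<omega>\<close> is a multimorphism\<close>

context pseudo_commutative_strong_two_monad
begin

abbreviation om :: "'o list \<Rightarrow> 't" where "om As \<equiv> id2 (fst (\<omega>n_cell As))"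
abbreviation w\<omega> :: "'o list \<Rightarrow> nat \<Rightarrow> 't" where "w\<omega> As \<equiv> (\<lambda>i. snd (\<omega>n_cell As) ! i)"

lemma \<omega>n_cell_Nil: "\<omega>n_cell [] = (\<eta> \<one>, [])"
  by (simp add: \<omega>n_cell.simps)

lemma alg_unit_Free: "alg_unit (Free A) = (id1 (T0 A), [\<mu>2 A])"
  by (simp add: alg_unit_def Free_def)

lemma \<omega>n_cell_single: "\<omega>n_cell [A] = (id1 (T0 A), [\<mu>2 A])"
  by (simp add: \<omega>n_cell.simps alg_unit_Free)

lemma \<omega>n_cell_two: "\<omega>n_cell [A, B] = \<omega>_cell A B"
  by (simp add: \<omega>n_cell.simps)

lemma \<omega>n_cell_snoc:
  "2 \<le> length As \<Longrightarrow> \<omega>n_cell (As @ [B]) = alg_comp1 (map (map Free) [As, [B]]) (\<omega> (nprod As) B, snd (\<omega>_cell (nprod As) B))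
    [\<omega>n_cell As, (id1 (T0 B), [\<mu>2 B])]"
  by (subst \<omega>n_cell.simps) (auto simp: alg_unit_def \<omega>_cell_def Free_def)

lemma els_single: "els Z [A] ys \<longleftrightarrow> (\<exists>y. ys = [y] \<and> y \<in> Ce K \<and> src y = Z \<and> tgt y = A)"
proof
  assume e: "els Z [A] ys"
  from elsD(1)[OF e] obtain y where "ys = [y]" by (metis length_Suc_conv length_0_conv One_nat_def list.size(3,4) plus_1_eq_Suc)
  with e show "\<exists>y. ys = [y] \<and> y \<in> Ce K \<and> src y = Z \<and> tgt y = A" by auto
qed auto

text \<open>The start of the induction over factors. The structure 2-cell is the identity on
  \<open>\<mu>\<close>, so the conditions are monad laws, and coherence is void for one
  input.\<close>

lemma fel_single:
  assumes [simp]: "A \<in> Ob K"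
  shows "fel [A] A (id2 (id1 (T0 A))) (\<lambda>i. [\<mu>2 A] ! i)"
proof -
  have v: "\<exists>v. vinv (\<mu>2 A) v" using vinv_idc[of "\<mu>2 A"] by auto
  have 1: "fel_typ [A] A (id2 (id1 (T0 A))) (\<lambda>i. [\<mu>2 A] ! i)"
    unfolding fel_typ_def using v by (auto simp: els_single osl_def wk_def \<mu>_bnd idcD)
  have 2: "fel_eta [A] (id2 (id1 (T0 A))) (\<lambda>i. [\<mu>2 A] ! i)"
    unfolding fel_eta_def by (auto simp: els_single \<mu>_unit)
  have 3: "fel_mu [A] A (\<lambda>i. [\<mu>2 A] ! i)"
    unfolding fel_mu_def
  proof (intro allI impI)
    fix i Z ys assume i: "i < length [A]" and e: "els Z ((map T0 [A])[i := T0 (T0 (T0 ([A] ! i)))]) ys" and ic: "idcs ys"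
    obtain y where y: "ys = [y]" "y \<in> Ce K" "src y = Z" "tgt y = T0 (T0 (T0 A))" "idc y"
      using e ic i by (auto simp: els_single)
    have Z: "Z \<in> Ob K" using y(2,3) by auto
    have "bnd (T0 (T0 A)) A y (\<mu>2 A ** p2 Z (T0 (T0 A))) = \<mu>2 A ** (T2 (\<mu>2 A) ** y)"
      using y Z T2_pr2_\<tau>[of y "T0 (T0 A)"] by (simp add: bnd_def flip: T2_comp_assoc)
    then show "[\<mu>2 A] ! i ** tup Z (ys[i := \<mu>2 (T0 ([A] ! i)) ** ys ! i]) =
       ([\<mu>2 A] ! i ** tup Z (ys[i := T2 (\<mu>2 ([A] ! i)) ** ys ! i]))
       \<cdot> bnd (T0 (T0 ([A] ! i))) A (ys ! i) ([\<mu>2 A] ! i ** tup (Z \<otimes> T0 (T0 ([A] ! i))) (osl Z (T0 (T0 ([A] ! i))) i ys))"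
      using i y by (simp add: osl_def wk_def \<mu>_assoc)
  qed
  have 4: "fel_coh [A] A (id2 (id1 (T0 A))) (\<lambda>i. [\<mu>2 A] ! i)"
    unfolding fel_coh_def by simp
  show ?thesis unfolding fel_def using 1 2 3 4 by blast
qed

lemma fel_Nil: "fel [] \<one> (om []) (w\<omega> [])"
  unfolding fel_def fel_typ_def fel_eta_def fel_mu_def fel_coh_def by (simp add: \<omega>n_cell_Nil)

lemma tn_single:
  assumes "A \<in> Ob K" "y \<in> Ce K" "tgt y = T0 A"
  shows "id2 (tn [A] 0) ** y = y"
proof -
  have "src y \<in> Ob K" using assms by auto
  then show ?thesis
    using tn_ntuple2[of "[A]" 0 "src y" "[y]"] assms T2_pr2_\<tau>[of y A] by (simp add: osl_def wk_def)
qed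

end

context symmetric_pseudo_commutative_strong_two_monad
begin

text \<open>Views the binary \<open>\<omega>\<close> as a factor added to the identity of a free
  algebra, so that its being a multimorphism is an instance of \<open>step_fel\<close>.\<close>

lemma \<omega>_cell_step:
  assumes [simp]: "A \<in> Ob K" "B \<in> Ob K"
  shows "step [A] A (id2 (id1 (T0 A))) (\<lambda>i. [\<mu>2 A] ! i) B (\<omega>2 A B) (\<lambda>i. snd (\<omega>_cell A B) ! i)"
proof -
  have w0: "snd (\<omega>_cell A B) ! 0 = id2 (\<omega> A B \<odot> (\<mu> A \<otimes>\<^sub>1 id1 (T0 B)))" by (simp add: \<omega>_cell_def)
  have w1: "snd (\<omega>_cell A B) ! Suc 0 = c1 A B" by (simp add: c1_def)
  show ?thesis
    unfolding step_def
    by (auto simp: els_single less_Suc_eq w0 w1 idcD)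
qed

lemma \<omega>_cell_fel:
  assumes "A \<in> Ob K" "B \<in> Ob K"
  shows "fel [A, B] (A \<otimes> B) (\<omega>2 A B) (\<lambda>i. snd (\<omega>_cell A B) ! i)"
  using step_fel[OF \<omega>_cell_step[OF assms] fel_single[OF assms(1)]] by simp

text \<open>A single factor is a case of its own because \<open>\<omega>n_cell\<close> has the
  binary cell as a separate clause. The empty list is excluded: the product of \<open>[B]\<close> is
  \<open>B\<close> and not \<open>\<one> \<otimes> B\<close>.\<close>

lemma \<omega>n_step_aux:
  assumes F: "fel As (nprod As) (om As) (w\<omega> As)" and fA: "fst (\<omega>n_cell As) \<in> Ar K" and lA: "length (snd (\<omega>n_cell As)) = length As"
    and B: "B \<in> Ob K" and ne: "As \<noteq> []"
  shows "step As (nprod As) (om As) (w\<omega> As) B (om (As @ [B])) (w\<omega> (As @ [B])) \<and>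
    fst (\<omega>n_cell (As @ [B])) \<in> Ar K \<and> length (snd (\<omega>n_cell (As @ [B]))) = length (As @ [B])"
proof (cases "length As = 1")
  case True
  then obtain A where A: "As = [A]" by (metis One_nat_def length_0_conv length_Suc_conv)
  have "A \<in> Ob K" using fel_typD(1)[OF F[unfolded fel_def, THEN conjunct1]] A by simp
  then show ?thesis
    using \<omega>_cell_step[of A B] B unfolding A
    by (simp add: \<omega>n_cell_single \<omega>n_cell_two \<omega>_cell_def)
next
  case False
  then have l2: "2 \<le> length As" using ne by (cases As) (auto simp: Suc_le_eq)
  let ?P = "nprod As"
  let ?Gs = "[\<omega>n_cell As, (id1 (T0 B), [\<mu>2 B])]"
  have FT: "fel_typ As ?P (om As) (w\<omega> As)" using F by (simp add: fel_def)
  note d = fel_typD[OF FT]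
  have O: "?P \<in> Ob K" using d(2) .
  have F1: "fel_typ [?P, B] (?P \<otimes> B) (\<omega>2 ?P B) (\<lambda>i. snd (\<omega>_cell ?P B) ! i)" using \<omega>_cell_fel[OF O B] by (simp add: fel_def)
  have F2: "\<omega> ?P B \<in> Ar K" using O B by simp
  have G: "\<forall>j<length [?P, B]. fst (?Gs ! j) \<in> Ar K \<and> fel_typ ([As, [B]] ! j) ([?P, B] ! j) (id2 (fst (?Gs ! j))) (\<lambda>i. snd (?Gs ! j) ! i)"
    using FT fel_single[OF B] fA B by (auto simp: less_Suc_eq fel_def)
  define cc where "cc = alg_comp1 (map (map Free) [As, [B]]) (\<omega> ?P B, snd (\<omega>_cell ?P B)) ?Gs"
  have cell: "\<omega>n_cell (As @ [B]) = cc" unfolding cc_def by (rule \<omega>n_cell_snoc[OF l2])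
  have ll: "length [As, [B]] = length [?P, B]" "length ?Gs = length [?P, B]" by simp_all
  note CT = comp_fst_typing[OF F1 F2 ll G, folded cc_def] and CN = comp_fst_ntuple2[OF F1 F2 ll G, folded cc_def]
    and CL = comp_length[OF F1 F2 ll G, folded cc_def] and ST = comp_snd_typing[OF F1 F2 ll G, folded cc_def]
    and SN = comp_snd_ntuple2[OF F1 F2 ll G, folded cc_def] and VT = vj_typing[OF F1 F2 ll G]
  have w0: "snd (\<omega>_cell ?P B) ! 0 = id2 (\<omega> ?P B \<odot> (\<mu> ?P \<otimes>\<^sub>1 id1 (T0 B)))" by (simp add: \<omega>_cell_def)
  have w1: "snd (\<omega>_cell ?P B) ! Suc 0 = c1 ?P B" by (simp add: c1_def)
  have cw: "snd cc ! i \<in> Ce K" "src (snd cc ! i) = nprod ((map T0 (As @ [B]))[i := T0 (T0 ((As @ [B]) ! i))])" "tgt (snd cc ! i) = T0 (?P \<otimes> B)"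
    if i: "i < length (As @ [B])" for i
  proof (atomize (full), cases "i < length As")
    case True
    then show "snd cc ! i \<in> Ce K \<and> src (snd cc ! i) = nprod ((map T0 (As @ [B]))[i := T0 (T0 ((As @ [B]) ! i))]) \<and> tgt (snd cc ! i) = T0 (?P \<otimes> B)"
      using ST[of 0 i] by (simp add: nth_append)
  next
    case False
    then have "i = length As" using i by simp
    then show "snd cc ! i \<in> Ce K \<and> src (snd cc ! i) = nprod ((map T0 (As @ [B]))[i := T0 (T0 ((As @ [B]) ! i))]) \<and> tgt (snd cc ! i) = T0 (?P \<otimes> B)"
      using ST[of 1 0] by simp
  qed
  have R1: "id2 (fst cc) ** tup Z (xs @ [y]) = \<omega>2 ?P B ** pair2 (om As ** tup Z xs) y"
    if "els Z (map T0 As) xs" "y \<in> Ce K" "src y = Z" "tgt y = T0 B" for Z xs y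
  proof -
    have "elss Z (map (map T0) [As, [B]]) [xs, [y]]" using that elsD(2)[OF that(1)] by (auto simp: elss_def less_Suc_eq)
    from CN[OF this] show ?thesis using that by simp
  qed
  have R2: "snd cc ! i ** tup Z (xs @ [y]) = \<omega>2 ?P B ** pair2 (w\<omega> As i ** tup Z xs) y"
    if i: "i < length As" and x: "els Z ((map T0 As)[i := T0 (T0 (As ! i))]) xs" "idcs xs" and y: "idc y" "src y = Z" "tgt y = T0 B" for i Z xs y
  proof -
    have yc: "y \<in> Ce K" using y by (simp add: idcD)
    have "elss Z ((map (map T0) [As, [B]])[0 := (map T0 ([As, [B]] ! 0))[i := T0 (T0 ([As, [B]] ! 0 ! i))]]) [xs, [y]]"
      using x y yc elsD(2)[OF x(1)] by (auto simp: elss_def less_Suc_eq)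
    from SN[of 0 i, OF _ _ this] have a: "snd cc ! i ** tup Z (xs @ [y]) = (\<omega>2 ?P B ** pair2 (w\<omega> As i ** tup Z xs) y)
      \<cdot> (snd (\<omega>_cell ?P B) ! 0 ** pair2 (T2 (om As) ** (id2 (tn (map T0 As) i) ** tup Z xs)) y)"
      using i x y yc by simp
    have x': "els Z ((map T0 ([As, [B]] ! 0))[i := T0 (T0 ([As, [B]] ! 0 ! i))]) xs" using x by simp
    note v = VT[of 0 i, OF _ _ x'] 
    let ?v = "T2 (om As) ** (id2 (tn (map T0 As) i) ** tup Z xs)"
    have v1: "?v \<in> Ce K" "src ?v = Z" "tgt ?v = T0 (T0 ?P)" "dm (w\<omega> As i ** tup Z xs) = \<mu>2 ?P ** ?v" "idc ?v"
      using v i x by simp_all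
    have wt: "w\<omega> As i ** tup Z xs \<in> Ce K" "src (w\<omega> As i ** tup Z xs) = Z" "tgt (w\<omega> As i ** tup Z xs) = T0 ?P"
      using d(7-9)[OF i] x by simp_all
    define W where "W = w\<omega> As i ** tup Z xs"
    note Wt = wt[folded W_def] v1(4)[folded W_def]
    define V where "V = ?v"
    note Vt = v1(1-3,5)[folded V_def] Wt(4)[folded V_def]
    have b: "snd (\<omega>_cell ?P B) ! 0 ** pair2 V y = \<omega>2 ?P B ** pair2 (\<mu>2 ?P ** V) y"
      unfolding w0 using Vt y yc O B by simp
    \<comment> \<open>The first structure 2-cell of the binary \<open>\<omega>\<close> is an
      identity, so only the inner structure 2-cell is left of the composite.\<close>
    have "(\<omega>2 ?P B ** pair2 W y) \<cdot> (\<omega>2 ?P B ** pair2 (\<mu>2 ?P ** V) y) = \<omega>2 ?P B ** pair2 W y"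
      by (rule vcomp_idc(2)) (use Vt Wt y yc O B in simp_all)
    then show ?thesis using a b unfolding W_def[symmetric] V_def[symmetric] by simp
  qed
  have R3: "snd cc ! length As ** tup Z (xs @ [y]) = c1 ?P B ** pair2 (om As ** tup Z xs) y"
    if x: "els Z (map T0 As) xs" "idcs xs" and y: "idc y" "src y = Z" "tgt y = T0 (T0 B)" for Z xs y
  proof -
    have yc: "y \<in> Ce K" using y by (simp add: idcD)
    have "elss Z ((map (map T0) [As, [B]])[1 := (map T0 ([As, [B]] ! 1))[0 := T0 (T0 ([As, [B]] ! 1 ! 0))]]) [xs, [y]]"
      using x y yc elsD(2)[OF x(1)] by (auto simp: elss_def less_Suc_eq)
    from SN[of 1 0, OF _ _ this] have a: "snd cc ! length As ** tup Z (xs @ [y]) = (\<omega>2 ?P B ** pair2 (om As ** tup Z xs) (\<mu>2 B ** y))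
      \<cdot> (c1 ?P B ** pair2 (om As ** tup Z xs) y)"
      using x y yc B by (simp add: w1 tn_single)
    define U where "U = om As ** tup Z xs"
    have U: "U \<in> Ce K" "src U = Z" "tgt U = T0 ?P" "idc U" unfolding U_def using d(3-6) x by simp_all
    \<comment> \<open>The inner cell in the last place is a unit with an identity structure 2-cell,
      so only \<open>c1\<close> is left of the composite.\<close>
    have "(\<omega>2 ?P B ** pair2 U (\<mu>2 B ** y)) \<cdot> (c1 ?P B ** pair2 U y) = c1 ?P B ** pair2 U y"
      by (rule vcomp_idc(1)) (use U y yc O B in simp_all)
    then show ?thesis using a unfolding U_def[symmetric] by simp
  qed
  have "idc (id2 (fst cc))" "src (id2 (fst cc)) = nprod (map T0 (As @ [B]))" "tgt (id2 (fst cc)) = T0 (?P \<otimes> B)"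
    using CT(1-3) by simp_all
  then have "step As ?P (om As) (w\<omega> As) B (id2 (fst cc)) (\<lambda>i. snd cc ! i)"
    unfolding step_def using B cw R1 R2 R3 by blast
  then show ?thesis unfolding cell using CT(1) CL by simp
qed

theorem \<omega>n_fel:
  "set As \<subseteq> Ob K \<Longrightarrow> fel As (nprod As) (om As) (w\<omega> As) \<and> fst (\<omega>n_cell As) \<in> Ar K \<and> length (snd (\<omega>n_cell As)) = length As"
proof (induction As rule: rev_induct)
  case Nil then show ?case using fel_Nil by (simp add: \<omega>n_cell_Nil)
next
  case (snoc B As)
  then have B: "B \<in> Ob K" and IH: "fel As (nprod As) (om As) (w\<omega> As)" "fst (\<omega>n_cell As) \<in> Ar K" "length (snd (\<omega>n_cell As)) = length As"
    by simp_all
  show ?case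
  proof (cases "As = []")
    case True
    then show ?thesis using fel_single[OF B] B by (simp add: \<omega>n_cell_single)
  next
    case False
    note s = \<omega>n_step_aux[OF IH B False]
    show ?thesis using step_fel[OF s[THEN conjunct1] IH(1)] s False by simp
  qed
qed

lemma \<omega>n_step:
  "set As \<subseteq> Ob K \<Longrightarrow> B \<in> Ob K \<Longrightarrow> As \<noteq> [] \<Longrightarrow> step As (nprod As) (om As) (w\<omega> As) B (om (As @ [B])) (w\<omega> (As @ [B]))"
  using \<omega>n_step_aux[of As B] \<omega>n_fel[of As] by blast

end

section \<open>Naturality and associativity of the iterated multiplication\<close>

context fp_two_category
begin

lemma nmap2_Nil: "nmap2 [] = id2 (id1 \<one>)"
  using terminal_unique[of "id2 (id1 \<one>)"] by (simp add: nmap2_eq)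

lemma nmap2_single: "g \<in> Ce K \<Longrightarrow> nmap2 [g] = g"
  by (simp add: nmap2_eq)

lemma nmap2_snoc:
  assumes "\<forall>g \<in> set gs. g \<in> Ce K" "g \<in> Ce K" "gs \<noteq> []"
  shows "nmap2 (gs @ [g]) = pair2 (nmap2 gs ** p1 (nprod (map src gs)) (src g)) (g ** p2 (nprod (map src gs)) (src g))"
proof -
  let ?X = "map src gs" and ?P = "nprod (map src gs)"
  have X: "set ?X \<subseteq> Ob K" "src g \<in> Ob K" using assms by auto
  have l: "map (\<lambda>i. (gs @ [g]) ! i \<rhd> nproj (?X @ [src g]) i) [0..<length (gs @ [g])]
    = map (\<lambda>x. x ** p1 ?P (src g)) (map (\<lambda>i. gs ! i \<rhd> nproj ?X i) [0..<length gs]) @ [g ** p2 ?P (src g)]"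
    using X assms by (auto simp: nproj_Suc nth_append)
  show ?thesis
    unfolding nmap2_eq map_append list.map l
    using ntuple2_hcomp[OF els_nmap2[OF assms(1)], of "p1 ?P (src g)"] X assms(3) by simp
qed

lemma idc_nmap2:
  assumes "idcs gs"
  shows "idc (nmap2 gs)"
proof -
  have c: "\<forall>g \<in> set gs. g \<in> Ce K" using assms by (auto simp: idcs_def idcD)
  then have X: "set (map src gs) \<subseteq> Ob K" by auto
  have "idcs (map (\<lambda>i. (gs ! i) \<rhd> nproj (map src gs) i) [0..<length gs])"
    using assms X by (auto simp: idcs_def)
  then show ?thesis using idc_ntuple2'[OF els_nmap2[OF c]] unfolding nmap2_eq by blast
qed

end

context symmetric_pseudo_commutative_strong_two_monad
begin

lemma om_d:
  assumes "set As \<subseteq> Ob K"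
  shows "fel_typ As (nprod As) (om As) (w\<omega> As)" "fst (\<omega>n_cell As) \<in> Ar K"
  using \<omega>n_fel[OF assms] by (auto simp: fel_def)

lemmas om_dt = fel_typD[OF om_d(1)]

lemma om_ty:
  assumes "set As \<subseteq> Ob K" "els Z (map T0 As) xs"
  shows "om As ** tup Z xs \<in> Ce K" "src (om As ** tup Z xs) = Z" "tgt (om As ** tup Z xs) = T0 (nprod As)"
    "idcs xs \<Longrightarrow> idc (om As ** tup Z xs)"
  using om_dt(3-6)[OF assms(1)] assms(2) by simp_all

lemma w\<omega>_ty:
  assumes "set As \<subseteq> Ob K" "i < length As" "els Z ((map T0 As)[i := T0 (T0 (As ! i))]) xs"
  shows "w\<omega> As i ** tup Z xs \<in> Ce K" "src (w\<omega> As i ** tup Z xs) = Z" "tgt (w\<omega> As i ** tup Z xs) = T0 (nprod As)"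
  using om_dt(7-9)[OF assms(1,2)] assms(3) by simp_all

lemma om_Nil: "Z \<in> Ob K \<Longrightarrow> om [] ** tup Z [] = \<eta>2 \<one> ** id2 (bang Z)"
  by (simp add: \<omega>n_cell_Nil)

lemma om_snoc:
  assumes "set As \<subseteq> Ob K" "B \<in> Ob K" "As \<noteq> []" "els Z (map T0 As) xs" "y \<in> Ce K" "src y = Z" "tgt y = T0 B"
  shows "om (As @ [B]) ** tup Z (xs @ [y]) = \<omega>2 (nprod As) B ** pair2 (om As ** tup Z xs) y"
  using stepD(8)[OF \<omega>n_step[OF assms(1-3)] assms(4-7)] .

lemma w\<omega>_snoc:
  assumes "set As \<subseteq> Ob K" "B \<in> Ob K" "As \<noteq> []" "idcs xs" "idc y" "src y = Z"
  shows "i < length As \<Longrightarrow> els Z ((map T0 As)[i := T0 (T0 (As ! i))]) xs \<Longrightarrow> tgt y = T0 B \<Longrightarrow>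
      w\<omega> (As @ [B]) i ** tup Z (xs @ [y]) = \<omega>2 (nprod As) B ** pair2 (w\<omega> As i ** tup Z xs) y"
    "els Z (map T0 As) xs \<Longrightarrow> tgt y = T0 (T0 B) \<Longrightarrow>
      w\<omega> (As @ [B]) (length As) ** tup Z (xs @ [y]) = c1 (nprod As) B ** pair2 (om As ** tup Z xs) y"
  using stepD(9)[OF \<omega>n_step[OF assms(1-3)]] stepD(10)[OF \<omega>n_step[OF assms(1-3)]] assms(4-6) by blast+

lemma els_T2_map2:
  assumes "\<forall>g \<in> set gs. g \<in> Ce K"
  shows "els Z (map T0 (map src gs)) xs \<Longrightarrow> els Z (map T0 (map tgt gs)) (map2 (\<lambda>g x. T2 g ** x) gs xs)"
    "j < length gs \<Longrightarrow> els Z ((map T0 (map src gs))[j := T0 (T0 (src (gs ! j)))]) xs \<Longrightarrow>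
      els Z ((map T0 (map tgt gs))[j := T0 (T0 (tgt (gs ! j)))]) ((map2 (\<lambda>g x. T2 g ** x) gs xs)[j := T2 (T2 (gs ! j)) ** xs ! j])"
proof -
  assume e: "els Z (map T0 (map src gs)) xs"
  show "els Z (map T0 (map tgt gs)) (map2 (\<lambda>g x. T2 g ** x) gs xs)"
    by (rule elsI) (use elsD[OF e] assms in simp_all)
next
  assume j: "j < length gs" and e: "els Z ((map T0 (map src gs))[j := T0 (T0 (src (gs ! j)))]) xs"
  show "els Z ((map T0 (map tgt gs))[j := T0 (T0 (tgt (gs ! j)))]) ((map2 (\<lambda>g x. T2 g ** x) gs xs)[j := T2 (T2 (gs ! j)) ** xs ! j])"
  proof (rule elsI)
    fix i assume "i < length ((map T0 (map tgt gs))[j := T0 (T0 (tgt (gs ! j)))])"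
    then show "(map2 (\<lambda>g x. T2 g ** x) gs xs)[j := T2 (T2 (gs ! j)) ** xs ! j] ! i \<in> Ce K \<and> src ((map2 (\<lambda>g x. T2 g ** x) gs xs)[j := T2 (T2 (gs ! j)) ** xs ! j] ! i) = Z
      \<and> tgt ((map2 (\<lambda>g x. T2 g ** x) gs xs)[j := T2 (T2 (gs ! j)) ** xs ! j] ! i) = (map T0 (map tgt gs))[j := T0 (T0 (tgt (gs ! j)))] ! i"
      using elsD(1)[OF e] elsD(4-6)[OF e, of i] assms j by (cases "i = j") simp_all
  qed (use elsD(1,2)[OF e] in simp_all)
qed

text \<open>No \<open>\<Gamma>\<close> enters the underlying 1-cell, so naturality holds for
  arbitrary 2-cells \<open>gs\<close>. Preservation of composition on 2-cells relies on this
  generality.\<close>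

lemma om_nat:
  assumes "\<forall>g \<in> set gs. g \<in> Ce K" "els Z (map T0 (map src gs)) xs"
  shows "om (map tgt gs) ** tup Z (map2 (\<lambda>g x. T2 g ** x) gs xs) = T2 (nmap2 gs) ** (om (map src gs) ** tup Z xs)"
  using assms
proof (induction gs arbitrary: xs rule: rev_induct)
  case Nil
  then show ?case by (simp add: \<omega>n_cell_Nil nmap2_Nil)
next
  case (snoc g gs)
  have g: "\<forall>g \<in> set gs. g \<in> Ce K" "g \<in> Ce K" using snoc.prems by auto
  have X: "set (map src gs) \<subseteq> Ob K" "set (map tgt gs) \<subseteq> Ob K" using g by auto
  obtain ys y where y: "xs = ys @ [y]" "els Z (map T0 (map src gs)) ys" "y \<in> Ce K" "src y = Z" "tgt y = T0 (src g)"
    using snoc.prems(2) unfolding map_append list.map by (rule els_snocE)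
  have l: "length ys = length gs" using elsD(1)[OF y(2)] by simp
  have Z: "Z \<in> Ob K" using elsD(2)[OF y(2)] .
  show ?case
  proof (cases "gs = []")
    case True
    then have "ys = []" using l by simp
    then show ?thesis using y g True by (simp add: \<omega>n_cell_single nmap2_single)
  next
    case False
    let ?us = "map2 (\<lambda>g x. T2 g ** x) gs ys"
    have u: "els Z (map T0 (map tgt gs)) ?us" by (rule els_T2_map2(1)[OF g(1) y(2)])
    let ?o = "om (map src gs) ** tup Z ys"
    note o = om_ty[OF X(1) y(2)]
    note nm = nmap2_typing[OF g(1)]
    have "om (map tgt gs @ [tgt g]) ** tup Z (?us @ [T2 g ** y]) = \<omega>2 (nprod (map tgt gs)) (tgt g) ** pair2 (om (map tgt gs) ** tup Z ?us) (T2 g ** y)"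
      by (rule om_snoc[OF X(2) _ _ u]) (use y g False in simp_all)
    also have "om (map tgt gs) ** tup Z ?us = T2 (nmap2 gs) ** ?o"
      by (rule snoc.IH[OF g(1) y(2)])
    also have "\<omega>2 (nprod (map tgt gs)) (tgt g) ** pair2 (T2 (nmap2 gs) ** ?o) (T2 g ** y)
       = T2 (nmap2 (gs @ [g])) ** (\<omega>2 (nprod (map src gs)) (src g) ** pair2 ?o y)"
      using \<omega>_nat[of ?o y "nmap2 gs" g] nm o y g False by (simp add: nmap2_snoc)
    also have "\<omega>2 (nprod (map src gs)) (src g) ** pair2 ?o y = om (map src gs @ [src g]) ** tup Z (ys @ [y])"
      by (rule om_snoc[OF X(1) _ _ y(2), symmetric]) (use y g False in simp_all)
    finally show ?thesis unfolding y(1) using l by simp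
  qed
qed

text \<open>The last place uses \<open>c1_nat\<close>, which restricts \<open>gs\<close> to identity
  2-cells. Place \<open>j\<close> carries an additional layer of \<open>T\<close>, hence the double
  \<open>T2\<close>.\<close>

lemma w\<omega>_nat:
  assumes "idcs gs" "j < length gs" "els Z ((map T0 (map src gs))[j := T0 (T0 (src (gs ! j)))]) xs" "idcs xs"
  shows "w\<omega> (map tgt gs) j ** tup Z ((map2 (\<lambda>g x. T2 g ** x) gs xs)[j := T2 (T2 (gs ! j)) ** xs ! j])
    = T2 (nmap2 gs) ** (w\<omega> (map src gs) j ** tup Z xs)"
  using assms
proof (induction gs arbitrary: xs rule: rev_induct)
  case (snoc g gs)
  have ic: "idcs gs" "idc g" using snoc.prems by simp_all
  then have g: "\<forall>g \<in> set gs. g \<in> Ce K" "g \<in> Ce K" by (auto simp: idcs_def idcD)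
  have X: "set (map src gs) \<subseteq> Ob K" "set (map tgt gs) \<subseteq> Ob K" using g by auto
  note nm = nmap2_typing[OF g(1)] idc_nmap2[OF ic(1)]
  let ?m = "\<lambda>ys. map2 (\<lambda>g x. T2 g ** x) gs ys"
  show ?case
  proof (cases "j < length gs")
    case True
    then have gj: "(gs @ [g]) ! j = gs ! j" by (simp add: nth_append)
    have ne: "gs \<noteq> []" using True by auto
    have "els Z ((map T0 (map src gs))[j := T0 (T0 (src (gs ! j)))] @ [T0 (src g)]) xs"
      using snoc.prems(3) True unfolding gj by (simp add: list_update_append)
    then obtain ys y where y: "xs = ys @ [y]" "els Z ((map T0 (map src gs))[j := T0 (T0 (src (gs ! j)))]) ys" "y \<in> Ce K" "src y = Z" "tgt y = T0 (src g)"
      by (rule els_snocE)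
    have c: "idcs ys" "idc y" using snoc.prems(4) unfolding y(1) by simp_all
    have l: "length ys = length gs" using elsD(1)[OF y(2)] by simp
    have Z: "Z \<in> Ob K" using elsD(2)[OF y(2)] .
    let ?us = "(?m ys)[j := T2 (T2 (gs ! j)) ** ys ! j]"
    have gi: "i < length gs \<Longrightarrow> gs ! i \<in> Ce K \<and> idc (gs ! i)" for i using g idcs_nth[OF ic(1)] by simp
    have ui: "idc (?us ! i)"
      if "i < length gs" for i
      using that gi[OF that] l elsD(4-6)[OF y(2), of i] idcs_nth[OF c(1), of i] by (cases "i = j") simp_all
    have u: "els Z ((map T0 (map tgt gs))[j := T0 (T0 (tgt (gs ! j)))]) ?us" by (rule els_T2_map2(2)[OF g(1) True y(2)])
    have uc: "idcs ?us" by (rule idcsI) (use ui l in simp)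
    let ?o = "w\<omega> (map src gs) j ** tup Z ys"
    have jl: "j < length (map src gs)" "j < length (map tgt gs)" using True by simp_all
    have y2: "els Z ((map T0 (map src gs))[j := T0 (T0 (map src gs ! j))]) ys" using y(2) True by simp
    have u2: "els Z ((map T0 (map tgt gs))[j := T0 (T0 (map tgt gs ! j))]) ?us" using u True by simp
    note o = w\<omega>_ty[OF X(1) jl(1) y2]
    have "w\<omega> (map tgt gs @ [tgt g]) j ** tup Z (?us @ [T2 g ** y]) = \<omega>2 (nprod (map tgt gs)) (tgt g) ** pair2 (w\<omega> (map tgt gs) j ** tup Z ?us) (T2 g ** y)"
      by (rule w\<omega>_snoc(1)[OF X(2) _ _ uc _ _ jl(2) u2]) (use y c ic g ne in simp_all)
    also have "w\<omega> (map tgt gs) j ** tup Z ?us = T2 (nmap2 gs) ** ?o"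
      by (rule snoc.IH[OF ic(1) True y(2) c(1)])
    also have "\<omega>2 (nprod (map tgt gs)) (tgt g) ** pair2 (T2 (nmap2 gs) ** ?o) (T2 g ** y)
       = T2 (nmap2 (gs @ [g])) ** (\<omega>2 (nprod (map src gs)) (src g) ** pair2 ?o y)"
      using \<omega>_nat[of ?o y "nmap2 gs" g] nm o y g ne by (simp add: nmap2_snoc)
    also have "\<omega>2 (nprod (map src gs)) (src g) ** pair2 ?o y = w\<omega> (map src gs @ [src g]) j ** tup Z (ys @ [y])"
      by (rule w\<omega>_snoc(1)[OF X(1) _ _ c(1) c(2) _ jl(1) y2, symmetric]) (use y g ne in simp_all)
    finally show ?thesis unfolding y(1) gj using l True by (simp add: list_update_append nth_append)
  next
    case False
    then have j: "j = length gs" using snoc.prems(2) by simp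
    have gj: "(gs @ [g]) ! j = g" unfolding j by simp
    have "els Z (map T0 (map src gs) @ [T0 (T0 (src g))]) xs"
      using snoc.prems(3) unfolding gj unfolding j by (simp add: list_update_append)
    then obtain ys y where y: "xs = ys @ [y]" "els Z (map T0 (map src gs)) ys" "y \<in> Ce K" "src y = Z" "tgt y = T0 (T0 (src g))"
      by (rule els_snocE)
    have c: "idcs ys" "idc y" using snoc.prems(4) unfolding y(1) by simp_all
    have l: "length ys = length gs" using elsD(1)[OF y(2)] by simp
    have Z: "Z \<in> Ob K" using elsD(2)[OF y(2)] .
    show ?thesis
    proof (cases "gs = []")
      case True
      then have "ys = []" using l by simp
      then show ?thesis using y g True j \<mu>_nat_assoc[of g y] by (simp add: \<omega>n_cell_single nmap2_single)
    next
      case ne: False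
      have gi: "i < length gs \<Longrightarrow> gs ! i \<in> Ce K \<and> idc (gs ! i)" for i using g idcs_nth[OF ic(1)] by simp
      have ui: "idc (?m ys ! i)"
        if "i < length gs" for i
        using that gi[OF that] l elsD(4-6)[OF y(2), of i] idcs_nth[OF c(1), of i] by simp
      have u: "els Z (map T0 (map tgt gs)) (?m ys)" by (rule els_T2_map2(1)[OF g(1) y(2)])
      have uc: "idcs (?m ys)" by (rule idcsI) (use ui l in simp)
      let ?o = "om (map src gs) ** tup Z ys"
      note o = om_ty[OF X(1) y(2)]
      have "w\<omega> (map tgt gs @ [tgt g]) (length (map tgt gs)) ** tup Z (?m ys @ [T2 (T2 g) ** y])
        = c1 (nprod (map tgt gs)) (tgt g) ** pair2 (om (map tgt gs) ** tup Z (?m ys)) (T2 (T2 g) ** y)"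
        by (rule w\<omega>_snoc(2)[OF X(2) _ _ uc _ _ u]) (use y c ic g ne in simp_all)
      also have "om (map tgt gs) ** tup Z (?m ys) = T2 (nmap2 gs) ** ?o"
        by (rule om_nat[OF g(1) y(2)])
      also have "c1 (nprod (map tgt gs)) (tgt g) ** pair2 (T2 (nmap2 gs) ** ?o) (T2 (T2 g) ** y)
         = T2 (nmap2 (gs @ [g])) ** (c1 (nprod (map src gs)) (src g) ** pair2 ?o y)"
        using c1_nat[of "nmap2 gs" g ?o y "nprod (map tgt gs)" "tgt g"] nm o y c ic g ne by (simp add: nmap2_snoc)
      also have "c1 (nprod (map src gs)) (src g) ** pair2 ?o y = w\<omega> (map src gs @ [src g]) (length (map src gs)) ** tup Z (ys @ [y])"
        by (rule w\<omega>_snoc(2)[OF X(1) _ _ c(1) c(2) _ y(2), symmetric]) (use y g ne in simp_all)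
      finally show ?thesis unfolding y(1) gj unfolding j using l by (simp add: list_update_append nth_append)
    qed
  qed
qed simp

text \<open>The source of \<open>w\<omega> As d\<close> at \<open>ys\<close> is \<open>\<mu>\<close>
  of this element, and in a composite the outer structure 2-cell is applied to it.\<close>

abbreviation V\<omega> :: "'o list \<Rightarrow> nat \<Rightarrow> 'o \<Rightarrow> 't list \<Rightarrow> 't" where
  "V\<omega> As d Z ys \<equiv> T2 (om As) ** (id2 (tn (map T0 As) d) ** tup Z ys)"

lemma V\<omega>_eq:
  assumes "set As \<subseteq> Ob K" "d < length As" "els Z ((map T0 As)[d := T0 (T0 (As ! d))]) ys"
  shows "V\<omega> As d Z ys = T2 (om As ** tup (Z \<otimes> T0 (As ! d)) (osl Z (T0 (As ! d)) d ys)) ** \<tau> (T0 (As ! d)) (ys ! d)"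
    "V\<omega> As d Z ys \<in> Ce K" "src (V\<omega> As d Z ys) = Z" "tgt (V\<omega> As d Z ys) = T0 (T0 (nprod As))" "idcs ys \<Longrightarrow> idc (V\<omega> As d Z ys)"
    "idcs ys \<Longrightarrow> dm (w\<omega> As d ** tup Z ys) = \<mu>2 (nprod As) ** V\<omega> As d Z ys"
proof -
  let ?X = "map T0 As" and ?A = "T0 (As ! d)"
  have d: "d < length ?X" "?X ! d = ?A" using assms(2) by simp_all
  have X: "set ?X \<subseteq> Ob K" by (rule map_T0_Ob[OF assms(1)])
  have A: "As ! d \<in> Ob K" using assms by simp
  note l = elsD[OF assms(3)]
  have y: "ys ! d \<in> Ce K" "src (ys ! d) = Z" "tgt (ys ! d) = T0 ?A" using l(1) l(4-6)[of d] assms(2) by simp_all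
  have o: "els (Z \<otimes> ?A) ?X (osl Z ?A d ys)" using els_osl'[OF assms(3), of ?A] A assms(2) by simp
  note omt = om_ty[OF assms(1) o] and omd = om_dt(3-6)[OF assms(1)]
  have t: "id2 (tn ?X d) ** tup Z ys = T2 (tup (Z \<otimes> ?A) (osl Z ?A d ys)) ** \<tau> ?A (ys ! d)"
    using tn_ntuple2[OF X d(1), of Z ys] assms(3) unfolding d(2) by simp
  show e: "V\<omega> As d Z ys = T2 (om As ** tup (Z \<otimes> ?A) (osl Z ?A d ys)) ** \<tau> ?A (ys ! d)"
    unfolding t using omd o y A by simp
  show "V\<omega> As d Z ys \<in> Ce K" "src (V\<omega> As d Z ys) = Z" "tgt (V\<omega> As d Z ys) = T0 (T0 (nprod As))"
    unfolding e using omt y A by simp_all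
  show "idc (V\<omega> As d Z ys)" if "idcs ys"
    unfolding e using omt y A idcs_osl[OF assms(3) that, of ?A d] idcs_nth[OF that, of d] l(1) assms(2) by simp
  show "dm (w\<omega> As d ** tup Z ys) = \<mu>2 (nprod As) ** V\<omega> As d Z ys" if "idcs ys"
    unfolding e om_dt(11)[OF assms that] by (simp add: bnd_def)
qed

text \<open>Brings the element into the two shapes that \<open>c1_\<omega>_middle\<close> and
  \<open>c1_\<omega>_right\<close> expect, according to whether \<open>d\<close> is an old place or
  the new last one.\<close>

lemma V\<omega>_snoc:
  assumes "set Bs \<subseteq> Ob K" "B \<in> Ob K" "Bs \<noteq> []"
  shows "\<lbrakk>d < length Bs; els Z ((map T0 Bs)[d := T0 (T0 (Bs ! d))]) ys; y \<in> Ce K; src y = Z; tgt y = T0 B\<rbrakk> \<Longrightarrow>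
      V\<omega> (Bs @ [B]) d Z (ys @ [y]) = T2 (\<omega>2 (nprod Bs) B ** pair2 (p2 Z (T0 (nprod Bs))) (y ** p1 Z (T0 (nprod Bs)))) ** \<tau> (T0 (nprod Bs)) (V\<omega> Bs d Z ys)"
    "\<lbrakk>els Z (map T0 Bs) ys; y \<in> Ce K; src y = Z; tgt y = T0 (T0 B)\<rbrakk> \<Longrightarrow>
      V\<omega> (Bs @ [B]) (length Bs) Z (ys @ [y]) = T2 (\<omega>2 (nprod Bs) B ** pair2 ((om Bs ** tup Z ys) ** p1 Z (T0 B)) (p2 Z (T0 B))) ** \<tau> (T0 B) y"
proof -
  have O: "set (Bs @ [B]) \<subseteq> Ob K" using assms by simp
  let ?Q = "nprod Bs"
  have Q: "?Q \<in> Ob K" using assms by simp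
  {
    assume d: "d < length Bs" and e: "els Z ((map T0 Bs)[d := T0 (T0 (Bs ! d))]) ys" and y: "y \<in> Ce K" "src y = Z" "tgt y = T0 B"
    let ?A = "T0 (Bs ! d)"
    have A: "Bs ! d \<in> Ob K" using assms(1) d by simp
    note l = elsD[OF e]
    have n: "(Bs @ [B]) ! d = Bs ! d" "(ys @ [y]) ! d = ys ! d" "d < length ys" using d l(1) by (simp_all add: nth_append)
    have yd: "ys ! d \<in> Ce K" "src (ys ! d) = Z" "tgt (ys ! d) = T0 ?A" using l(1) l(4-6)[of d] d by simp_all
    have e2: "els Z ((map T0 (Bs @ [B]))[d := T0 (T0 ((Bs @ [B]) ! d))]) (ys @ [y])"
      unfolding n using d e y by (simp add: list_update_append)
    have o: "els (Z \<otimes> ?A) (map T0 Bs) (osl Z ?A d ys)" using els_osl'[OF e, of ?A] A d by simp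
    let ?k = "om Bs ** tup (Z \<otimes> ?A) (osl Z ?A d ys)"
    note k = om_ty[OF assms(1) o]
    have "V\<omega> (Bs @ [B]) d Z (ys @ [y]) = T2 (om (Bs @ [B]) ** tup (Z \<otimes> ?A) (osl Z ?A d ys @ [y ** p1 Z ?A])) ** \<tau> ?A (ys ! d)"
      using V\<omega>_eq(1)[OF O _ e2] d unfolding n osl_snoc(1)[OF n(3)] by simp
    also have "om (Bs @ [B]) ** tup (Z \<otimes> ?A) (osl Z ?A d ys @ [y ** p1 Z ?A]) = \<omega>2 ?Q B ** pair2 ?k (y ** p1 Z ?A)"
      by (rule om_snoc[OF assms o]) (use y A l(2) in simp_all)
    also have "T2 (\<omega>2 ?Q B ** pair2 ?k (y ** p1 Z ?A)) ** \<tau> ?A (ys ! d)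
      = T2 (\<omega>2 ?Q B ** pair2 (p2 Z (T0 ?Q)) (y ** p1 Z (T0 ?Q))) ** \<tau> (T0 ?Q) (T2 ?k ** \<tau> ?A (ys ! d))"
      using \<tau>_T2[of "\<tau> ?A (ys ! d)" ?k "T0 ?Q"] \<tau>_\<tau>[of "ys ! d" ?A] k yd y A Q l(2) assms(2) by simp
    finally show "V\<omega> (Bs @ [B]) d Z (ys @ [y]) = T2 (\<omega>2 ?Q B ** pair2 (p2 Z (T0 ?Q)) (y ** p1 Z (T0 ?Q))) ** \<tau> (T0 ?Q) (V\<omega> Bs d Z ys)"
      unfolding V\<omega>_eq(1)[OF assms(1) d e] .
  }
  {
    assume e: "els Z (map T0 Bs) ys" and y: "y \<in> Ce K" "src y = Z" "tgt y = T0 (T0 B)"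
    note l = elsD[OF e]
    have lB: "length Bs = length ys" using l(1) by simp
    have lt: "length Bs < length (Bs @ [B])" by simp
    have n: "(Bs @ [B]) ! length Bs = B" "(ys @ [y]) ! length Bs = y" using lB by (simp_all add: nth_append)
    have e2: "els Z ((map T0 (Bs @ [B]))[length Bs := T0 (T0 ((Bs @ [B]) ! length Bs))]) (ys @ [y])"
      unfolding n using e y by (simp add: list_update_append)
    have wB: "els (Z \<otimes> T0 B) (map T0 Bs) (wk Z (T0 B) ys)" using els_wk[OF e] assms by simp
    have "V\<omega> (Bs @ [B]) (length Bs) Z (ys @ [y]) = T2 (om (Bs @ [B]) ** tup (Z \<otimes> T0 B) (wk Z (T0 B) ys @ [p2 Z (T0 B)])) ** \<tau> (T0 B) y"
      using V\<omega>_eq(1)[OF O lt e2] osl_snoc(2)[of Z "T0 B" ys y] unfolding n unfolding lB by simp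
    also have "om (Bs @ [B]) ** tup (Z \<otimes> T0 B) (wk Z (T0 B) ys @ [p2 Z (T0 B)]) = \<omega>2 ?Q B ** pair2 (om Bs ** tup (Z \<otimes> T0 B) (wk Z (T0 B) ys)) (p2 Z (T0 B))"
      by (rule om_snoc[OF assms wB]) (use assms l(2) in simp_all)
    also have "om Bs ** tup (Z \<otimes> T0 B) (wk Z (T0 B) ys) = (om Bs ** tup Z ys) ** p1 Z (T0 B)"
      using ntuple2_wk[OF e, of "T0 B"] om_dt(4,6)[OF assms(1)] e assms(2) l(2) by simp
    finally show "V\<omega> (Bs @ [B]) (length Bs) Z (ys @ [y]) = T2 (\<omega>2 ?Q B ** pair2 ((om Bs ** tup Z ys) ** p1 Z (T0 B)) (p2 Z (T0 B))) ** \<tau> (T0 B) y" .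
  }
qed

end

section \<open>Concatenation of two products, and associativity of \<open>\<omega>\<close> for
  it\<close>

context fp_two_category
begin

abbreviation grp :: "'o list \<Rightarrow> 'o list \<Rightarrow> 't" where "grp As Bs \<equiv> id2 (ungroup [As, Bs])"

lemma ntuple2_ex:
  assumes "set X \<subseteq> Ob K" "\<alpha> \<in> Ce K" "tgt \<alpha> = nprod X"
  obtains xs where "els (src \<alpha>) X xs" "\<alpha> = tup (src \<alpha>) xs"
proof -
  have "els (src \<alpha>) X (map (\<lambda>i. id2 (nproj X i) ** \<alpha>) [0..<length X])"
    using assms by (intro elsI) auto
  then show ?thesis using ntuple2_eta[OF assms] that by blast
qed

lemma grp_typing:
  assumes "set As \<subseteq> Ob K" "set Bs \<subseteq> Ob K"
  shows "ungroup [As, Bs] \<in> Ar K" "dom1 K (ungroup [As, Bs]) = nprod As \<otimes> nprod Bs" "cod1 K (ungroup [As, Bs]) = nprod (As @ Bs)"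
  using ungroup_typing[of "[As, Bs]"] assms by simp_all

lemma grp_ntuple2:
  assumes "els Z As xs" "els Z Bs ys"
  shows "grp As Bs ** pair2 (tup Z xs) (tup Z ys) = tup Z (xs @ ys)"
proof -
  have e: "elss Z [As, Bs] [xs, ys]" using assms elsD(2)[OF assms(1)] by (auto simp: elss_def less_Suc_eq)
  have "\<forall>X \<in> set [As, Bs]. set X \<subseteq> Ob K" using elsD(3)[OF assms(1)] elsD(3)[OF assms(2)] by simp
  from ungroup_typing[OF this] e show ?thesis by fastforce
qed

text \<open>Products are not strictly unital, so for an empty second list the canonical isomorphism
  is the projection that drops \<open>\<one>\<close>.\<close>

lemma grp_Nil:
  assumes "set As \<subseteq> Ob K"
  shows "grp As [] = p1 (nprod As) \<one>"
proof -
  let ?P = "nprod As"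
  let ?Z = "?P \<otimes> \<one>"
  obtain xs where x: "els ?Z As xs" "p1 ?P \<one> = tup ?Z xs"
    by (rule ntuple2_ex[OF assms, of "p1 ?P \<one>"]) (use assms in simp_all)
  have y: "p2 ?P \<one> = tup ?Z []" using terminal_unique[of "p2 ?P \<one>"] assms by simp
  have "grp As [] = grp As [] ** pair2 (p1 ?P \<one>) (p2 ?P \<one>)"
    using grp_typing[OF assms, of "[]"] assms by simp
  also have "\<dots> = tup ?Z (xs @ [])"
    unfolding y x(2) by (rule grp_ntuple2) (use x assms in simp_all)
  finally show ?thesis using x(2) by simp
qed

lemma grp_Nil_single:
  assumes "B \<in> Ob K"
  shows "grp [] [B] = p2 \<one> B"
proof -
  let ?Z = "\<one> \<otimes> B"
  have y: "p1 \<one> B = tup ?Z []" using terminal_unique[of "p1 \<one> B"] assms by simp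
  have "grp [] [B] = grp [] [B] ** pair2 (p1 \<one> B) (p2 \<one> B)"
    using grp_typing[of "[]" "[B]"] assms by simp
  also have "\<dots> = grp [] [B] ** pair2 (tup ?Z []) (tup ?Z [p2 \<one> B])"
    unfolding y by simp
  also have "\<dots> = tup ?Z ([] @ [p2 \<one> B])"
    by (rule grp_ntuple2) (use assms in simp_all)
  finally show ?thesis by simp
qed

text \<open>Products are bracketed to the left, so appending one factor to a nonempty list needs no
  rebracketing.\<close>

lemma grp_single:
  assumes "set As \<subseteq> Ob K" "B \<in> Ob K" "As \<noteq> []"
  shows "grp As [B] = id2 (id1 (nprod As \<otimes> B))"
proof -
  let ?P = "nprod As"
  let ?Z = "?P \<otimes> B"
  obtain xs where x: "els ?Z As xs" "p1 ?P B = tup ?Z xs"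
    by (rule ntuple2_ex[OF assms(1), of "p1 ?P B"]) (use assms in simp_all)
  have ne: "xs \<noteq> []" using elsD(1)[OF x(1)] assms(3) by auto
  have "grp As [B] = grp As [B] ** pair2 (p1 ?P B) (p2 ?P B)"
    using grp_typing[OF assms(1), of "[B]"] assms by simp
  also have "\<dots> = grp As [B] ** pair2 (tup ?Z xs) (tup ?Z [p2 ?P B])"
    unfolding x(2) by simp
  also have "\<dots> = tup ?Z (xs @ [p2 ?P B])"
    by (rule grp_ntuple2) (use x assms in simp_all)
  also have "\<dots> = pair2 (p1 ?P B) (p2 ?P B)" using ne x(2) by simp
  finally show ?thesis using assms by simp
qed

text \<open>The recursion along the second list: \<open>assoc\<close> accounts for its last factor
  being grouped with \<open>Bs\<close> before it is joined to \<open>As\<close>.\<close>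

lemma grp_snoc:
  assumes "set As \<subseteq> Ob K" "set Bs \<subseteq> Ob K" "B \<in> Ob K" "Bs \<noteq> []"
  shows "grp As (Bs @ [B]) ** id2 (assoc (nprod As) (nprod Bs) B)
    = pair2 (grp As Bs ** p1 (nprod As \<otimes> nprod Bs) B) (p2 (nprod As \<otimes> nprod Bs) B)"
proof -
  let ?P = "nprod As" and ?Q = "nprod Bs"
  let ?Z = "?P \<otimes> ?Q \<otimes> B"
  let ?x = "p1 ?P ?Q ** p1 (?P \<otimes> ?Q) B" and ?y = "p2 ?P ?Q ** p1 (?P \<otimes> ?Q) B" and ?z = "p2 (?P \<otimes> ?Q) B"
  obtain xs where x: "els ?Z As xs" "?x = tup ?Z xs"
    by (rule ntuple2_ex[OF assms(1), of ?x]) (use assms in simp_all)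
  obtain ys where y: "els ?Z Bs ys" "?y = tup ?Z ys"
    by (rule ntuple2_ex[OF assms(2), of ?y]) (use assms in simp_all)
  have ne: "ys \<noteq> []" using elsD(1)[OF y(1)] assms(4) by auto
  have "grp As (Bs @ [B]) ** id2 (assoc ?P ?Q B) = grp As (Bs @ [B]) ** pair2 ?x (pair2 ?y ?z)"
    using assms by simp
  also have "\<dots> = grp As (Bs @ [B]) ** pair2 (tup ?Z xs) (tup ?Z (ys @ [?z]))"
    unfolding x(2) y(2) using ne by simp
  also have "\<dots> = tup ?Z (xs @ ys @ [?z])"
    by (rule grp_ntuple2) (use x y assms in simp_all)
  also have "\<dots> = pair2 (tup ?Z (xs @ ys)) ?z"
    using ntuple2_snoc[of "xs @ ys" ?Z ?z] ne by simp
  also have "tup ?Z (xs @ ys) = grp As Bs ** pair2 ?x ?y"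
    unfolding x(2) y(2) by (rule grp_ntuple2[symmetric]) (use x y in simp_all)
  also have "pair2 ?x ?y = p1 (?P \<otimes> ?Q) B"
    using assms by simp
  finally show ?thesis .
qed

end

context symmetric_pseudo_commutative_strong_two_monad
begin

text \<open>The iterated \<open>\<omega>\<close> of no factors is a pure value of
  \<open>\<one>\<close>; combining with it adds a trivial component, which the projection
  removes.\<close>

lemma pr_\<omega>_unit:
  assumes "u \<in> Ce K" "tgt u = T0 A" "A \<in> Ob K" "src u = Z"
  shows "T2 (p1 A \<one>) ** (\<omega>2 A \<one> ** pair2 u (\<eta>2 \<one> ** id2 (bang Z))) = u"
    "T2 (p2 \<one> A) ** (\<omega>2 \<one> A ** pair2 (\<eta>2 \<one> ** id2 (bang Z)) u) = u"
proof -
  have Z: "Z \<in> Ob K" using assms by auto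
  note e = \<omega>_\<eta>[of u "id2 (bang Z)" Z A \<one>] and t = T2_pr2_\<tau>[of u A]
  show "T2 (p1 A \<one>) ** (\<omega>2 A \<one> ** pair2 u (\<eta>2 \<one> ** id2 (bang Z))) = u"
    using assms Z e(1) t by simp
  show "T2 (p2 \<one> A) ** (\<omega>2 \<one> A ** pair2 (\<eta>2 \<one> ** id2 (bang Z)) u) = u"
    using assms Z e(2) t by simp
qed

context
  fixes As Bs :: "'o list" and B :: 'o
  assumes A: "set As \<subseteq> Ob K" and B: "set Bs \<subseteq> Ob K" "B \<in> Ob K" "Bs \<noteq> []"
begin

lemma T2_grp_snoc:
  assumes "e \<in> Ce K" "tgt e = T0 (nprod As \<otimes> nprod Bs \<otimes> B)"
  shows "T2 (grp As (Bs @ [B])) ** (T2 (id2 (assoc (nprod As) (nprod Bs) B)) ** e)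
    = T2 (pair2 (grp As Bs ** p1 (nprod As \<otimes> nprod Bs) B) (p2 (nprod As \<otimes> nprod Bs) B)) ** e"
proof -
  have "set (Bs @ [B]) \<subseteq> Ob K" using B by simp
  note g = grp_typing[OF A this]
  show ?thesis
    unfolding grp_snoc[OF A B, symmetric] using g assms A B(1,2) \<open>Bs \<noteq> []\<close> by (simp del: assoc_typing(4))
qed

lemma T2_grp_\<omega>:
  assumes "u \<in> Ce K" "src u = Z" "tgt u = T0 (nprod As \<otimes> nprod Bs)" "y \<in> Ce K" "src y = Z" "tgt y = T0 B"
  shows "T2 (grp As (Bs @ [B])) ** (T2 (id2 (assoc (nprod As) (nprod Bs) B)) ** (\<omega>2 (nprod As \<otimes> nprod Bs) B ** pair2 u y))
    = \<omega>2 (nprod (As @ Bs)) B ** pair2 (T2 (grp As Bs) ** u) y"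
  using T2_grp_snoc[of "\<omega>2 (nprod As \<otimes> nprod Bs) B ** pair2 u y"]
    \<omega>_nat[of u y "grp As Bs" "id2 (id1 B)"] grp_typing[OF A B(1)] A B assms by simp

lemma T2_grp_c1:
  assumes "idc u" "src u = Z" "tgt u = T0 (nprod As \<otimes> nprod Bs)" "idc y" "src y = Z" "tgt y = T0 (T0 B)"
  shows "T2 (grp As (Bs @ [B])) ** (T2 (id2 (assoc (nprod As) (nprod Bs) B)) ** (c1 (nprod As \<otimes> nprod Bs) B ** pair2 u y))
    = c1 (nprod (As @ Bs)) B ** pair2 (T2 (grp As Bs) ** u) y"
  using T2_grp_snoc[of "c1 (nprod As \<otimes> nprod Bs) B ** pair2 u y"]
    c1_nat[of "grp As Bs" "id2 (id1 B)" u y "nprod (As @ Bs)" B] grp_typing[OF A B(1)] A B assms idcD(1)[OF assms(1)] idcD(1)[OF assms(4)] by simp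

lemma T2_grp_\<omega>_\<omega>:
  assumes "u \<in> Ce K" "src u = Z" "tgt u = T0 (nprod As)" "v \<in> Ce K" "src v = Z" "tgt v = T0 (nprod Bs)" "y \<in> Ce K" "src y = Z" "tgt y = T0 B"
  shows "T2 (grp As (Bs @ [B])) ** (\<omega>2 (nprod As) (nprod (Bs @ [B])) ** pair2 u (\<omega>2 (nprod Bs) B ** pair2 v y))
    = \<omega>2 (nprod (As @ Bs)) B ** pair2 (T2 (grp As Bs) ** (\<omega>2 (nprod As) (nprod Bs) ** pair2 u v)) y"
  using T2_grp_\<omega>[of "\<omega>2 (nprod As) (nprod Bs) ** pair2 u v" Z y]
    \<omega>_assoc[of u v y Z "nprod As" "nprod Bs" B] A B assms by simp

end

text \<open>Induction on \<open>Bs\<close>: the last factor is split off,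
  \<open>\<omega>_assoc\<close> rebrackets, and naturality of \<open>\<omega>\<close> moves
  \<open>grp\<close> inside. Where a list is empty the claim is a unit law.\<close>

lemma \<omega>_om_append:
  assumes "set As \<subseteq> Ob K" "els Z (map T0 As) xs" "set Bs \<subseteq> Ob K" "els Z (map T0 Bs) ys"
  shows "T2 (grp As Bs) ** (\<omega>2 (nprod As) (nprod Bs) ** pair2 (om As ** tup Z xs) (om Bs ** tup Z ys)) = om (As @ Bs) ** tup Z (xs @ ys)"
  using assms(3,4)
proof (induction Bs arbitrary: ys rule: rev_induct)
  case Nil
  note u = om_ty[OF assms(1,2)]
  show ?case using Nil pr_\<omega>_unit(1)[OF u(1,3) _ u(2)] assms(1) grp_Nil[OF assms(1)] by (simp add: \<omega>n_cell_Nil)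
next
  case (snoc B Bs)
  have B: "set Bs \<subseteq> Ob K" "B \<in> Ob K" using snoc.prems by auto
  obtain vs y where y: "ys = vs @ [y]" "els Z (map T0 Bs) vs" "y \<in> Ce K" "src y = Z" "tgt y = T0 B"
    using snoc.prems(2) unfolding map_append list.map by (rule els_snocE)
  have Z: "Z \<in> Ob K" using elsD(2)[OF y(2)] .
  note u = om_ty[OF assms(1,2)] and v = om_ty[OF B(1) y(2)]
  note IH = snoc.IH[OF B(1) y(2)]
  show ?case
  proof (cases "Bs = []")
    case True
    have vs: "vs = []" using y(2) True by simp
    show ?thesis
    proof (cases "As = []")
      case A: True
      then show ?thesis using assms(2) y B pr_\<omega>_unit(2)[OF y(3,5) B(2) y(4)] grp_Nil_single[OF B(2)] unfolding y(1) vs True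
        by (simp add: \<omega>n_cell_Nil \<omega>n_cell_single)
    next
      case False
      show ?thesis unfolding y(1) vs True append_Nil
        using om_snoc[OF assms(1) B(2) False assms(2) y(3-5)] grp_single[OF assms(1) B(2) False] u y B assms(1) by (simp add: \<omega>n_cell_single)
    qed
  next
    case False
    have O: "set (As @ Bs) \<subseteq> Ob K" "As @ Bs \<noteq> []" using assms(1) B False by auto
    have e: "els Z (map T0 (As @ Bs)) (xs @ vs)" using assms(2) y(2) elsD(1)[OF assms(2)] by (simp add: els_append)
    show ?thesis
      unfolding y(1) om_snoc[OF B False y(2-5)] T2_grp_\<omega>_\<omega>[OF assms(1) B False u(1-3) v(1-3) y(3-5)] IH
      using om_snoc[OF O(1) B(2) O(2) e y(3-5)] by simp
  qed
qed

text \<open>The structure 2-cell sits in the first argument and is merely whiskered by each further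
  \<open>\<omega>\<close>; \<open>\<omega>_assoc\<close> covers it because it holds for arbitrary
  2-cells.\<close>

lemma \<omega>_w\<omega>_append_left:
  assumes "set As \<subseteq> Ob K" "i < length As" "els Z ((map T0 As)[i := T0 (T0 (As ! i))]) xs" "idcs xs"
    "set Bs \<subseteq> Ob K" "els Z (map T0 Bs) ys" "idcs ys"
  shows "T2 (grp As Bs) ** (\<omega>2 (nprod As) (nprod Bs) ** pair2 (w\<omega> As i ** tup Z xs) (om Bs ** tup Z ys)) = w\<omega> (As @ Bs) i ** tup Z (xs @ ys)"
  using assms(5-7)
proof (induction Bs arbitrary: ys rule: rev_induct)
  case Nil
  note u = w\<omega>_ty[OF assms(1-3)]
  show ?case using Nil pr_\<omega>_unit(1)[OF u(1,3) _ u(2)] assms(1) grp_Nil[OF assms(1)] by (simp add: \<omega>n_cell_Nil)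
next
  case (snoc B Bs)
  have B: "set Bs \<subseteq> Ob K" "B \<in> Ob K" using snoc.prems by auto
  obtain vs y where y: "ys = vs @ [y]" "els Z (map T0 Bs) vs" "y \<in> Ce K" "src y = Z" "tgt y = T0 B"
    using snoc.prems(2) unfolding map_append list.map by (rule els_snocE)
  have c: "idcs vs" "idc y" using snoc.prems(3) unfolding y(1) by simp_all
  have Z: "Z \<in> Ob K" using elsD(2)[OF y(2)] .
  have A: "As \<noteq> []" using assms(2) by auto
  note u = w\<omega>_ty[OF assms(1-3)] and v = om_ty[OF B(1) y(2)]
  note IH = snoc.IH[OF B(1) y(2) c(1)]
  show ?case
  proof (cases "Bs = []")
    case True
    have vs: "vs = []" using y(2) True by simp
    show ?thesis unfolding y(1) vs True append_Nil
      using w\<omega>_snoc(1)[OF assms(1) B(2) A assms(4) c(2) y(4) assms(2,3) y(5)] grp_single[OF assms(1) B(2) A] u y B assms(1) by (simp add: \<omega>n_cell_single)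
  next
    case False
    have O: "set (As @ Bs) \<subseteq> Ob K" "As @ Bs \<noteq> []" "i < length (As @ Bs)" "idcs (xs @ vs)" using assms B A c by (auto simp: idcs_def)
    have l: "length xs = length As" using elsD(1)[OF assms(3)] by simp
    have e: "els Z ((map T0 (As @ Bs))[i := T0 (T0 ((As @ Bs) ! i))]) (xs @ vs)" using assms(2,3) y(2) l by (simp add: els_append list_update_append nth_append)
    show ?thesis
      unfolding y(1) om_snoc[OF B False y(2-5)] T2_grp_\<omega>_\<omega>[OF assms(1) B False u(1-3) v(1-3) y(3-5)] IH
      using w\<omega>_snoc(1)[OF O(1) B(2) O(2,4) c(2) y(4) O(3) e y(5)] by simp
  qed
qed

lemma \<omega>_w\<omega>_composable:
  assumes "idc u" "src u = Z" "tgt u = T0 P" "P \<in> Ob K" "set Bs \<subseteq> Ob K" "d < length Bs" "els Z ((map T0 Bs)[d := T0 (T0 (Bs ! d))]) ys" "idcs ys"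
  shows "cm (c1 P (nprod Bs) ** pair2 u (V\<omega> Bs d Z ys)) = dm (\<omega>2 P (nprod Bs) ** pair2 u (w\<omega> Bs d ** tup Z ys))"
  using V\<omega>_eq(2-4)[OF assms(5-7)] V\<omega>_eq(5,6)[OF assms(5-8)] w\<omega>_ty[OF assms(5-7)] assms(1-5) idcD(1)[OF assms(1)]
  by (simp del: dm_hcomp(1) add: dm_hcomp(1)[of "pair2 u (w\<omega> Bs d ** tup Z ys)"])

text \<open>A place of the second list involves the structure 2-cell of the inner iterated
  \<open>\<omega>\<close> and \<open>c1\<close> of the outer binary one. In the induction step an
  old place is treated by \<open>c1_\<omega>_middle\<close> and the induction hypothesis, the last
  place by \<open>c1_\<omega>_right\<close>.\<close>

lemma \<omega>_w\<omega>_append_right: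
  assumes "set As \<subseteq> Ob K" "els Z (map T0 As) xs" "idcs xs"
    "set Bs \<subseteq> Ob K" "d < length Bs" "els Z ((map T0 Bs)[d := T0 (T0 (Bs ! d))]) ys" "idcs ys"
  shows "T2 (grp As Bs) ** ((\<omega>2 (nprod As) (nprod Bs) ** pair2 (om As ** tup Z xs) (w\<omega> Bs d ** tup Z ys))
        \<cdot> (c1 (nprod As) (nprod Bs) ** pair2 (om As ** tup Z xs) (V\<omega> Bs d Z ys)))
    = w\<omega> (As @ Bs) (length As + d) ** tup Z (xs @ ys)"
  using assms(4-7)
proof (induction Bs arbitrary: ys rule: rev_induct)
  case (snoc B Bs)
  let ?P = "nprod As" and ?Q = "nprod Bs"
  have P: "?P \<in> Ob K" using assms(1) by simp
  have B: "set Bs \<subseteq> Ob K" "B \<in> Ob K" using snoc.prems by auto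
  have Q: "?Q \<in> Ob K" using B by simp
  have OB: "set (Bs @ [B]) \<subseteq> Ob K" by (rule snoc.prems(1))
  have Z: "Z \<in> Ob K" using elsD(2)[OF assms(2)] .
  let ?u = "om As ** tup Z xs"
  note u = om_ty(1-3)[OF assms(1,2)] om_ty(4)[OF assms(1,2,3)]
  note cmp = \<omega>_w\<omega>_composable[OF u(4,2,3) P snoc.prems]
  note V = V\<omega>_eq(2-4)[OF snoc.prems(1-3)] V\<omega>_eq(5)[OF snoc.prems] and W = w\<omega>_ty[OF snoc.prems(1-3)]
  show ?case
  proof (cases "d < length Bs")
    case True
    have dB: "(Bs @ [B]) ! d = Bs ! d" using True by (simp add: nth_append)
    have ne: "Bs \<noteq> []" using True by auto
    have "els Z ((map T0 Bs)[d := T0 (T0 (Bs ! d))] @ [T0 B]) ys"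
      using snoc.prems(3) True unfolding dB by (simp add: list_update_append)
    then obtain vs y where y: "ys = vs @ [y]" "els Z ((map T0 Bs)[d := T0 (T0 (Bs ! d))]) vs" "y \<in> Ce K" "src y = Z" "tgt y = T0 B"
      by (rule els_snocE)
    have c: "idcs vs" "idc y" using snoc.prems(4) unfolding y(1) by simp_all
    let ?V = "V\<omega> Bs d Z vs" and ?W = "w\<omega> Bs d ** tup Z vs" and ?V' = "V\<omega> (Bs @ [B]) d Z (vs @ [y])"
    note v = V\<omega>_eq(2-4)[OF B(1) True y(2)] V\<omega>_eq(5)[OF B(1) True y(2) c(1)] and w = w\<omega>_ty[OF B(1) True y(2)]
    \<comment> \<open>\<open>c1_\<omega>_middle\<close> solved for the outer \<open>c1\<close> by
      undoing the associativity isomorphism.\<close>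
    have c1m: "c1 ?P (nprod (Bs @ [B])) ** pair2 ?u ?V' = T2 (id2 (assoc ?P ?Q B)) ** (\<omega>2 (?P \<otimes> ?Q) B ** pair2 (c1 ?P ?Q ** pair2 ?u ?V) y)"
    proof -
      have e: "?V' = T2 (\<omega>2 ?Q B ** pair2 (p2 Z (T0 ?Q)) (y ** p1 Z (T0 ?Q))) ** \<tau> (T0 ?Q) ?V"
        by (rule V\<omega>_snoc(1)[OF B ne True y(2-5)])
      let ?e = "c1 ?P (?Q \<otimes> B) ** pair2 ?u ?V'"
      have V': "?V' \<in> Ce K" "src ?V' = Z" "tgt ?V' = T0 (T0 (nprod Bs \<otimes> B))" using V ne unfolding y(1) by simp_all
      have "T2 (id2 (assoc ?P ?Q B)) ** (T2 (id2 (assoc_inv ?P ?Q B)) ** ?e) = T2 (id2 (assoc ?P ?Q B) ** id2 (assoc_inv ?P ?Q B)) ** ?e"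
        by (rule T2_comp_assoc) (use P Q B(2) u V' in simp_all)
      also have "id2 (assoc ?P ?Q B) ** id2 (assoc_inv ?P ?Q B) = id2 (id1 (?P \<otimes> (?Q \<otimes> B)))"
        using P Q B(2) by simp
      also have "T2 (id2 (id1 (?P \<otimes> (?Q \<otimes> B)))) ** ?e = ?e" using P Q B(2) u V' by simp
      finally show ?thesis
        unfolding c1_\<omega>_middle[OF u(4) v(4) c(2) u(2) v(2) y(4) u(3) v(3) y(5) P Q B(2)] e[symmetric] using ne by simp
    qed
    have O: "set (As @ Bs) \<subseteq> Ob K" "As @ Bs \<noteq> []" "length As + d < length (As @ Bs)" "idcs (xs @ vs)" using assms B ne c True by (auto simp: idcs_def)
    have l: "length xs = length As" using elsD(1)[OF assms(2)] by simp
    have e: "els Z ((map T0 (As @ Bs))[length As + d := T0 (T0 ((As @ Bs) ! (length As + d)))]) (xs @ vs)"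
      using assms(2) y(2) l True by (simp add: els_append list_update_append nth_append)
    let ?a = "c1 ?P ?Q ** pair2 ?u ?V" and ?b = "\<omega>2 ?P ?Q ** pair2 ?u ?W"
    have ab: "cm ?a = dm ?b" by (rule \<omega>_w\<omega>_composable[OF u(4,2,3) P B(1) True y(2) c(1)])
    have at: "?a \<in> Ce K" "src ?a = Z" "tgt ?a = T0 (?P \<otimes> ?Q)" "?b \<in> Ce K" "src ?b = Z" "tgt ?b = T0 (?P \<otimes> ?Q)" using u v w P Q by simp_all
    note g = grp_typing[OF assms(1) B(1)] and g' = grp_typing[OF assms(1) OB]
    have ws: "w\<omega> (Bs @ [B]) d ** tup Z (vs @ [y]) = \<omega>2 ?Q B ** pair2 ?W y"
      by (rule w\<omega>_snoc(1)[OF B ne c y(4) True y(2) y(5)])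
    have t1: "T2 (grp As (Bs @ [B])) ** (\<omega>2 ?P (nprod (Bs @ [B])) ** pair2 ?u (w\<omega> (Bs @ [B]) d ** tup Z (vs @ [y])))
      = \<omega>2 (nprod (As @ Bs)) B ** pair2 (T2 (grp As Bs) ** ?b) y"
      unfolding ws by (rule T2_grp_\<omega>_\<omega>[OF assms(1) B ne u(1-3) w y(3-5)])
    have t2: "T2 (grp As (Bs @ [B])) ** (c1 ?P (nprod (Bs @ [B])) ** pair2 ?u ?V') = \<omega>2 (nprod (As @ Bs)) B ** pair2 (T2 (grp As Bs) ** ?a) y"
      unfolding c1m by (rule T2_grp_\<omega>[OF assms(1) B ne at(1-3) y(3-5)])
    have "T2 (grp As (Bs @ [B])) ** ((\<omega>2 ?P (nprod (Bs @ [B])) ** pair2 ?u (w\<omega> (Bs @ [B]) d ** tup Z (vs @ [y]))) \<cdot> (c1 ?P (nprod (Bs @ [B])) ** pair2 ?u ?V'))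
      = (\<omega>2 (nprod (As @ Bs)) B ** pair2 (T2 (grp As Bs) ** ?b) y) \<cdot> (\<omega>2 (nprod (As @ Bs)) B ** pair2 (T2 (grp As Bs) ** ?a) y)"
      unfolding t1[symmetric] t2[symmetric]
      by (rule whisker_vcomp_left) (use u V W P OB g' cmp y(1) in simp_all)
    also have "\<dots> = \<omega>2 (nprod (As @ Bs)) B ** pair2 ((T2 (grp As Bs) ** ?b) \<cdot> (T2 (grp As Bs) ** ?a)) y"
      by (rule \<omega>_vcomp(1)[symmetric]) (use at ab g y c B O(1) in simp_all)
    also have "(T2 (grp As Bs) ** ?b) \<cdot> (T2 (grp As Bs) ** ?a) = T2 (grp As Bs) ** (?b \<cdot> ?a)"
      by (rule whisker_vcomp_left[symmetric]) (use at ab g in simp_all)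
    also have "\<dots> = w\<omega> (As @ Bs) (length As + d) ** tup Z (xs @ vs)"
      by (rule snoc.IH[OF B(1) True y(2) c(1)])
    also have "\<omega>2 (nprod (As @ Bs)) B ** pair2 (w\<omega> (As @ Bs) (length As + d) ** tup Z (xs @ vs)) y = w\<omega> ((As @ Bs) @ [B]) (length As + d) ** tup Z ((xs @ vs) @ [y])"
      by (rule w\<omega>_snoc(1)[OF O(1) B(2) O(2,4) c(2) y(4) O(3) e y(5), symmetric])
    finally show ?thesis unfolding y(1) by simp
  next
    case False
    then have d: "d = length Bs" using snoc.prems(2) by simp
    have dB: "(Bs @ [B]) ! d = B" unfolding d by simp
    have "els Z (map T0 Bs @ [T0 (T0 B)]) ys"
      using snoc.prems(3) unfolding dB unfolding d by (simp add: list_update_append)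
    then obtain vs y where y: "ys = vs @ [y]" "els Z (map T0 Bs) vs" "y \<in> Ce K" "src y = Z" "tgt y = T0 (T0 B)"
      by (rule els_snocE)
    have c: "idcs vs" "idc y" using snoc.prems(4) unfolding y(1) by simp_all
    show ?thesis
    proof (cases "Bs = []")
      case True
      have vs: "vs = []" using y(2) True by simp
      have t: "V\<omega> [B] 0 Z [y] = y" using tn_single B(2) y by (simp add: \<omega>n_cell_single)
      have w: "w\<omega> [B] 0 ** tup Z [y] = \<mu>2 B ** y" by (simp add: \<omega>n_cell_single)
      have d0: "d = 0" using d True by simp
      have q: "nprod [B] = B" by simp
      show ?thesis
      proof (cases "As = []")
        case A: True
        have x: "xs = []" using assms(2) A by simp
        have P1: "nprod [] = \<one>" by simp
        let ?e = "\<eta>2 \<one> ** id2 (bang Z)" and ?m = "\<mu>2 B ** y"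
        let ?r = "\<omega>2 \<one> B ** pair2 ?e ?m"
        \<comment> \<open>The first argument is pure here, so \<open>c1\<close> is an identity, the
          same one as the other factor.\<close>
        have c1e: "c1 \<one> B ** pair2 ?e y = ?r"
          by (rule c1_\<eta>(2)) (use Z c y B in simp_all)
        have rc: "idc ?r" using Z c y B by simp
        have rr: "?r \<cdot> ?r = ?r" using rc by (simp add: idcD)
        have pu: "T2 (p2 \<one> B) ** ?r = ?m" by (rule pr_\<omega>_unit(2)) (use B y in simp_all)
        show ?thesis unfolding y(1) vs True A x d0 append_Nil t w q P1 om_Nil[OF Z] c1e rr grp_Nil_single[OF B(2)] pu list.size
          using w by simp
      next
        case A: False
        have ws: "w\<omega> (As @ [B]) (length As) ** tup Z (xs @ [y]) = c1 ?P B ** pair2 ?u y"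
          by (rule w\<omega>_snoc(2)[OF assms(1) B(2) A assms(3) c(2) y(4) assms(2) y(5)])
        have "(\<omega>2 ?P B ** pair2 ?u (\<mu>2 B ** y)) \<cdot> (c1 ?P B ** pair2 ?u y) = c1 ?P B ** pair2 ?u y"
          by (rule vcomp_idc(1)) (use P B(2) u y c in simp_all)
        then show ?thesis unfolding y(1) vs True d0 append_Nil t w q grp_single[OF assms(1) B(2) A] using ws P B(2) u y by simp
      qed
    next
      case ne: False
      let ?v = "om Bs ** tup Z vs"
      note v = om_ty(1-3)[OF B(1) y(2)] om_ty(4)[OF B(1) y(2) c(1)]
      have ws: "w\<omega> (Bs @ [B]) (length Bs) ** tup Z (vs @ [y]) = c1 ?Q B ** pair2 ?v y"
        by (rule w\<omega>_snoc(2)[OF B ne c y(4,2,5)])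
      have Vs: "V\<omega> (Bs @ [B]) (length Bs) Z (vs @ [y]) = T2 (\<omega>2 ?Q B ** pair2 (?v ** p1 Z (T0 B)) (p2 Z (T0 B))) ** \<tau> (T0 B) y"
        by (rule V\<omega>_snoc(2)[OF B ne y(2-5)])
      have np: "nprod (Bs @ [B]) = ?Q \<otimes> B" using ne by simp
      have O: "set (As @ Bs) \<subseteq> Ob K" "As @ Bs \<noteq> []" "idcs (xs @ vs)" using assms B ne c by (auto simp: idcs_def)
      have e: "els Z (map T0 (As @ Bs)) (xs @ vs)" using assms(2) y(2) elsD(1)[OF assms(2)] by (simp add: els_append)
      have "T2 (grp As (Bs @ [B])) ** ((\<omega>2 ?P (?Q \<otimes> B) ** pair2 ?u (c1 ?Q B ** pair2 ?v y)) \<cdot> (c1 ?P (?Q \<otimes> B) ** pair2 ?u (V\<omega> (Bs @ [B]) (length Bs) Z (vs @ [y]))))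
        = T2 (grp As (Bs @ [B])) ** (T2 (id2 (assoc ?P ?Q B)) ** (c1 (?P \<otimes> ?Q) B ** pair2 (\<omega>2 ?P ?Q ** pair2 ?u ?v) y))"
        unfolding Vs c1_\<omega>_right[OF u(4) v(4) c(2) u(2) v(2) y(4) u(3) v(3) y(5) P Q B(2)] ..
      also have "\<dots> = c1 (nprod (As @ Bs)) B ** pair2 (T2 (grp As Bs) ** (\<omega>2 ?P ?Q ** pair2 ?u ?v)) y"
        by (rule T2_grp_c1[OF assms(1) B ne]) (use u v y c P Q in simp_all)
      also have "T2 (grp As Bs) ** (\<omega>2 ?P ?Q ** pair2 ?u ?v) = om (As @ Bs) ** tup Z (xs @ vs)"
        by (rule \<omega>_om_append[OF assms(1,2) B(1) y(2)])
      also have "c1 (nprod (As @ Bs)) B ** pair2 (om (As @ Bs) ** tup Z (xs @ vs)) y = w\<omega> ((As @ Bs) @ [B]) (length (As @ Bs)) ** tup Z ((xs @ vs) @ [y])"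
        by (rule w\<omega>_snoc(2)[OF O(1) B(2) O(2,3) c(2) y(4) e y(5), symmetric])
      finally show ?thesis unfolding y(1) d ws np by simp
    qed
  qed
qed simp

end

section \<open>Concatenation of a list of products\<close>

context fp_two_category
begin

lemma regroup_Nil: "id2 (regroup []) = id2 (id1 \<one>)"
  using terminal_unique[of "id2 (id1 \<one>)"] by (simp add: regroup_def)

lemma regroup_single:
  assumes "set X \<subseteq> Ob K"
  shows "id2 (regroup [X]) = id2 (id1 (nprod X))"
proof -
  have e: "elss (nprod X) [X] [projs X]" using assms by (simp add: elss_def)
  have "id2 (regroup [X]) ** tup (nprod X) (projs X) = id2 (id1 (nprod X))"
    using regroup_ntuple2[OF e] assms by simp
  then show ?thesis using regroup_typing(1-3)[of "[X]"] assms by simp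
qed

text \<open>Splits the regrouping into that of all blocks but the last and one binary concatenation,
  in step with the induction over blocks.\<close>

lemma regroup_snoc:
  assumes "\<forall>X \<in> set Xss. set X \<subseteq> Ob K" "set X \<subseteq> Ob K" "Xss \<noteq> []"
  shows "id2 (regroup (Xss @ [X])) ** grp (concat Xss) X
    = pair2 (id2 (regroup Xss) ** p1 (nprod (concat Xss)) (nprod X)) (p2 (nprod (concat Xss)) (nprod X))"
proof -
  let ?P = "nprod (concat Xss)" and ?Q = "nprod X"
  let ?Z = "?P \<otimes> ?Q"
  have C: "set (concat Xss) \<subseteq> Ob K" using assms(1) by auto
  have PQ: "?P \<in> Ob K" "?Q \<in> Ob K" using C assms(2) by simp_all
  obtain ys where y: "els ?Z (concat Xss) ys" "p1 ?P ?Q = tup ?Z ys"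
    by (rule ntuple2_ex[OF C, of "p1 ?P ?Q"]) (use PQ in simp_all)
  obtain xss where x: "elss ?Z Xss xss" "concat xss = ys" using elss_ex[OF y(1)] by blast
  obtain zs where z: "els ?Z X zs" "p2 ?P ?Q = tup ?Z zs"
    by (rule ntuple2_ex[OF assms(2), of "p2 ?P ?Q"]) (use PQ in simp_all)
  have ne: "map (tup ?Z) xss \<noteq> []" using elssD(1)[OF x(1)] assms(3) by auto
  note g = grp_typing[OF C assms(2)]
  have r: "regroup (Xss @ [X]) \<in> Ar K" "dom1 K (regroup (Xss @ [X])) = nprod (concat Xss @ X)"
    using regroup_typing(1,2)[of "Xss @ [X]"] assms by auto
  have e: "elss ?Z (Xss @ [X]) (xss @ [zs])" using x z by simp
  have "id2 (regroup (Xss @ [X])) ** grp (concat Xss) X = id2 (regroup (Xss @ [X])) ** (grp (concat Xss) X ** pair2 (p1 ?P ?Q) (p2 ?P ?Q))"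
    using g PQ by simp
  also have "\<dots> = id2 (regroup (Xss @ [X])) ** tup ?Z (concat (xss @ [zs]))"
    unfolding y(2) z(2) grp_ntuple2[OF y(1) z(1)] using x(2) by simp
  also have "\<dots> = pair2 (tup ?Z (map (tup ?Z) xss)) (p2 ?P ?Q)"
    unfolding regroup_ntuple2[OF e] z(2) using ne by simp
  also have "tup ?Z (map (tup ?Z) xss) = id2 (regroup Xss) ** p1 ?P ?Q"
    unfolding y(2) x(2)[symmetric] regroup_ntuple2[OF x(1)] ..
  finally show ?thesis .
qed

end

context symmetric_pseudo_commutative_strong_two_monad
begin

abbreviation oms :: "'o \<Rightarrow> 'o list list \<Rightarrow> 't list list \<Rightarrow> 't list" where
  "oms Z Ass xss \<equiv> map2 (\<lambda>As xs. om As ** tup Z xs) Ass xss"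

lemma els_oms:
  assumes "\<forall>As \<in> set Ass. set As \<subseteq> Ob K" "elss Z (map (map T0) Ass) xss"
  shows "els Z (map T0 (map nprod Ass)) (oms Z Ass xss)"
    "\<forall>xs \<in> set xss. idcs xs \<Longrightarrow> idcs (oms Z Ass xss)"
proof -
  note l = elssD[OF assms(2)]
  have O: "set (Ass ! i) \<subseteq> Ob K" if "i < length Ass" for i using assms(1) that by simp
  have e: "els Z (map T0 (Ass ! i)) (xss ! i)" if "i < length Ass" for i using l(3)[of i] that by simp
  show "els Z (map T0 (map nprod Ass)) (oms Z Ass xss)"
    by (rule elsI) (use l(1,2) om_ty[OF O e] in simp_all)
  show "idcs (oms Z Ass xss)" if c: "\<forall>xs \<in> set xss. idcs xs"
    by (rule idcsI) (use l(1) om_ty(4)[OF O e] c in simp)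
qed

lemma T2_regroup_snoc:
  assumes "\<forall>X \<in> set Xss. set X \<subseteq> Ob K" "set X \<subseteq> Ob K" "Xss \<noteq> []" "e \<in> Ce K" "tgt e = T0 (nprod (concat Xss) \<otimes> nprod X)"
  shows "T2 (id2 (regroup (Xss @ [X]))) ** (T2 (grp (concat Xss) X) ** e)
    = T2 (pair2 (id2 (regroup Xss) ** p1 (nprod (concat Xss)) (nprod X)) (p2 (nprod (concat Xss)) (nprod X))) ** e"
proof -
  have C: "set (concat Xss) \<subseteq> Ob K" using assms(1) by auto
  have r: "regroup (Xss @ [X]) \<in> Ar K" "dom1 K (regroup (Xss @ [X])) = nprod (concat Xss @ X)"
    using regroup_typing(1,2)[of "Xss @ [X]"] assms by auto
  show ?thesis
    unfolding regroup_snoc[OF assms(1-3), symmetric] by (rule T2_comp_assoc) (use r grp_typing[OF C assms(2)] assms in simp_all)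
qed

text \<open>Induction over the blocks with \<open>\<omega>_om_append\<close> for the last one:
  general associativity of the iterated \<open>\<omega>\<close>.\<close>

lemma om_concat:
  assumes "\<forall>As \<in> set Ass. set As \<subseteq> Ob K" "elss Z (map (map T0) Ass) xss"
  shows "T2 (id2 (regroup Ass)) ** (om (concat Ass) ** tup Z (concat xss)) = om (map nprod Ass) ** tup Z (oms Z Ass xss)"
  using assms
proof (induction Ass arbitrary: xss rule: rev_induct)
  case Nil
  then show ?case by (simp add: regroup_Nil \<omega>n_cell_Nil)
next
  case (snoc As Ass)
  have A: "\<forall>As \<in> set Ass. set As \<subseteq> Ob K" "set As \<subseteq> Ob K" using snoc.prems(1) by auto
  have "elss Z (map (map T0) Ass @ [map T0 As]) xss" using snoc.prems(2) by simp
  then obtain yss ys where y: "xss = yss @ [ys]" "elss Z (map (map T0) Ass) yss" "els Z (map T0 As) ys"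
    by (rule elss_snocE)
  have ly: "length yss = length Ass" using elssD(1)[OF y(2)] by simp
  have Z: "Z \<in> Ob K" using elsD(2)[OF y(3)] .
  have C: "set (concat Ass) \<subseteq> Ob K" using A by auto
  have ec: "els Z (map T0 (concat Ass)) (concat yss)" using elss_concat[OF y(2)] by (simp add: map_concat)
  let ?u = "om (concat Ass) ** tup Z (concat yss)" and ?v = "om As ** tup Z ys"
  note u = om_ty(1-3)[OF C ec] and v = om_ty(1-3)[OF A(2) y(3)]
  note IH = snoc.IH[OF A(1) y(2)]
  have N: "set (map nprod Ass) \<subseteq> Ob K" using A(1) by auto
  note o = els_oms(1)[OF A(1) y(2)]
  show ?case
  proof (cases "Ass = []")
    case True
    then have "yss = []" using ly by simp
    then show ?thesis using True y(1) v A(2) by (simp add: regroup_single \<omega>n_cell_single)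
  next
    case False
    note r = regroup_typing(1-3)[OF A(1)]
    have "T2 (id2 (regroup (Ass @ [As]))) ** (om (concat Ass @ As) ** tup Z (concat yss @ ys))
      = \<omega>2 (nprod (map nprod Ass)) (nprod As) ** pair2 (T2 (id2 (regroup Ass)) ** ?u) ?v"
      unfolding \<omega>_om_append[OF C ec A(2) y(3), symmetric]
      using T2_regroup_snoc[OF A False, of "\<omega>2 (nprod (concat Ass)) (nprod As) ** pair2 ?u ?v"]
        \<omega>_nat[of ?u ?v "id2 (regroup Ass)" "id2 (id1 (nprod As))"] u v A C r by simp
    also have "T2 (id2 (regroup Ass)) ** ?u = om (map nprod Ass) ** tup Z (oms Z Ass yss)" by (rule IH)
    also have "\<omega>2 (nprod (map nprod Ass)) (nprod As) ** pair2 (om (map nprod Ass) ** tup Z (oms Z Ass yss)) ?v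
      = om (map nprod Ass @ [nprod As]) ** tup Z (oms Z Ass yss @ [?v])"
      by (rule om_snoc[symmetric, OF N _ _ o]) (use v A False in simp_all)
    finally show ?thesis unfolding y(1) using ly by simp
  qed
qed

lemma om_w\<omega>_composable:
  assumes "set Cs \<subseteq> Ob K" "j < length Cs" "els Z (map T0 Cs) (ls[j := w])" "els Z ((map T0 Cs)[j := T0 (T0 (Cs ! j))]) (ls[j := V])"
    "idc V" "\<forall>i < length ls. i \<noteq> j \<longrightarrow> idc (ls ! i)" "dm w = \<mu>2 (Cs ! j) ** V"
  shows "cm (w\<omega> Cs j ** tup Z (ls[j := V])) = dm (om Cs ** tup Z (ls[j := w]))"
proof -
  have l: "length ls = length Cs" using elsD(1)[OF assms(3)] by simp
  have i: "idcs (ls[j := V])" by (rule idcs_update') (use assms in auto)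
  have "cm (w\<omega> Cs j ** tup Z (ls[j := V])) = om Cs ** tup Z (ls[j := dm w])"
    using om_dt(12)[OF assms(1,2,4) i] assms(2,7) l by simp
  also have "ls[j := dm w] = map dm (ls[j := w])"
    by (rule map_dm_update[symmetric]) (use assms in auto)
  also have "om Cs ** tup Z (map dm (ls[j := w])) = dm (om Cs ** tup Z (ls[j := w]))"
    using om_dt(3,4,6)[OF assms(1)] assms(3) dm_ntuple2[OF assms(3)] by simp
  finally show ?thesis .
qed

text \<open>Each free algebra contributes one \<open>T0\<close>; the second one marks the place
  \<open>d\<close> of block \<open>j\<close> to which the structure 2-cell belongs.\<close>

definition slotted :: "'o list list \<Rightarrow> nat \<Rightarrow> nat \<Rightarrow> 'o list list" where
  "slotted Ass j d = (map (map T0) Ass)[j := (map T0 (Ass ! j))[d := T0 (T0 (Ass ! j ! d))]]"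

lemma slotted_simps:
  "j < length Ass \<Longrightarrow> slotted (Ass @ [As]) j d = slotted Ass j d @ [map T0 As]"
  "slotted (Ass @ [As]) (length Ass) d = map (map T0) Ass @ [(map T0 As)[d := T0 (T0 (As ! d))]]"
  "length (slotted Ass j d) = length Ass"
  by (simp_all add: slotted_def list_update_append nth_append)

lemma slotted_nth:
  "j < length Ass \<Longrightarrow> slotted Ass j d ! j = (map T0 (Ass ! j))[d := T0 (T0 (Ass ! j ! d))]"
  "i < length Ass \<Longrightarrow> i \<noteq> j \<Longrightarrow> slotted Ass j d ! i = map T0 (Ass ! i)"
  by (simp_all add: slotted_def)

lemma concat_slotted:
  assumes "j < length Ass" "d < length (Ass ! j)"
  shows "concat (slotted Ass j d) = (map T0 (concat Ass))[length (concat (take j Ass)) + d := T0 (T0 (concat Ass ! (length (concat (take j Ass)) + d)))]"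
proof -
  have "length (concat (take j (map (map T0) Ass))) = length (concat (take j Ass))"
    by (rule length_concat_take) simp
  then show ?thesis
    unfolding nth_concat_offset(2)[OF assms]
    using concat_update_offset[of j "map (map T0) Ass" d "T0 (T0 (Ass ! j ! d))"] assms by (simp add: map_concat slotted_def)
qed

text \<open>The two factors of the composition formula evaluate the outer \<open>\<omega>\<close>
  and its structure 2-cell at one list of images, changed in entry \<open>j\<close> only. Collected
  here is what both evaluations require.\<close>

lemma oms_slotted:
  assumes "\<forall>As \<in> set Ass. set As \<subseteq> Ob K" "j < length Ass" "d < length (Ass ! j)" "elss Z (slotted Ass j d) zss" "\<forall>zs \<in> set zss. idcs zs"
  shows "els Z (map T0 (map nprod Ass)) ((oms Z Ass zss)[j := w\<omega> (Ass ! j) d ** tup Z (zss ! j)])"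
    "els Z ((map T0 (map nprod Ass))[j := T0 (T0 (map nprod Ass ! j))]) ((oms Z Ass zss)[j := V\<omega> (Ass ! j) d Z (zss ! j)])"
    "idcs ((oms Z Ass zss)[j := V\<omega> (Ass ! j) d Z (zss ! j)])"
    "cm (w\<omega> (map nprod Ass) j ** tup Z ((oms Z Ass zss)[j := V\<omega> (Ass ! j) d Z (zss ! j)]))
     = dm (om (map nprod Ass) ** tup Z ((oms Z Ass zss)[j := w\<omega> (Ass ! j) d ** tup Z (zss ! j)]))"
proof -
  note l = elssD[OF assms(4)]
  have lz: "length zss = length Ass" using l(1) by (simp add: slotted_simps)
  have O: "set (Ass ! i) \<subseteq> Ob K" if "i < length Ass" for i using assms(1) that by simp
  have N: "set (map nprod Ass) \<subseteq> Ob K" using assms(1) by auto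
  have ej: "els Z ((map T0 (Ass ! j))[d := T0 (T0 (Ass ! j ! d))]) (zss ! j)" using l(3)[of j] assms(2) by (simp add: slotted_simps slotted_nth)
  have ic: "idcs (zss ! i)" if "i < length Ass" for i using assms(5) that lz by simp
  define W V where "W = w\<omega> (Ass ! j) d ** tup Z (zss ! j)" and "V = V\<omega> (Ass ! j) d Z (zss ! j)"
  note w = w\<omega>_ty[OF O[OF assms(2)] assms(3) ej, folded W_def] and v = V\<omega>_eq(2-4)[OF O[OF assms(2)] assms(3) ej, folded V_def] V\<omega>_eq(5,6)[OF O[OF assms(2)] assms(3) ej ic[OF assms(2)], folded V_def W_def]
  have o: "oms Z Ass zss ! i \<in> Ce K \<and> src (oms Z Ass zss ! i) = Z \<and> tgt (oms Z Ass zss ! i) = T0 (nprod (Ass ! i)) \<and> idc (oms Z Ass zss ! i)"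
    if i: "i < length Ass" "i \<noteq> j" for i
  proof -
    have "els Z (map T0 (Ass ! i)) (zss ! i)" using l(3)[of i] i by (simp add: slotted_simps slotted_nth)
    from om_ty[OF O[OF i(1)] this] show ?thesis using i lz ic[OF i(1)] by simp
  qed
  show e1: "els Z (map T0 (map nprod Ass)) ((oms Z Ass zss)[j := w\<omega> (Ass ! j) d ** tup Z (zss ! j)])"
    unfolding W_def[symmetric]
  proof (rule elsI)
    fix i assume i: "i < length (map T0 (map nprod Ass))"
    then show "(oms Z Ass zss)[j := W] ! i \<in> Ce K \<and> src ((oms Z Ass zss)[j := W] ! i) = Z \<and> tgt ((oms Z Ass zss)[j := W] ! i) = map T0 (map nprod Ass) ! i"
      using o[of i] w lz by (cases "i = j") simp_all
  qed (use l(2) lz in simp_all)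
  show e2: "els Z ((map T0 (map nprod Ass))[j := T0 (T0 (map nprod Ass ! j))]) ((oms Z Ass zss)[j := V\<omega> (Ass ! j) d Z (zss ! j)])"
    unfolding V_def[symmetric]
  proof (rule elsI)
    fix i assume i: "i < length ((map T0 (map nprod Ass))[j := T0 (T0 (map nprod Ass ! j))])"
    then show "(oms Z Ass zss)[j := V] ! i \<in> Ce K \<and> src ((oms Z Ass zss)[j := V] ! i) = Z \<and> tgt ((oms Z Ass zss)[j := V] ! i) = (map T0 (map nprod Ass))[j := T0 (T0 (map nprod Ass ! j))] ! i"
      using o[of i] v lz by (cases "i = j") simp_all
  qed (use l(2) lz in simp_all)
  show "idcs ((oms Z Ass zss)[j := V\<omega> (Ass ! j) d Z (zss ! j)])"
    unfolding V_def[symmetric] by (rule idcs_update') (use o v lz in simp_all)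
  show "cm (w\<omega> (map nprod Ass) j ** tup Z ((oms Z Ass zss)[j := V\<omega> (Ass ! j) d Z (zss ! j)]))
     = dm (om (map nprod Ass) ** tup Z ((oms Z Ass zss)[j := w\<omega> (Ass ! j) d ** tup Z (zss ! j)]))"
    by (rule om_w\<omega>_composable[OF N _ e1 e2], unfold V_def[symmetric] W_def[symmetric]) (use o v assms(2) lz in simp_all)
qed

text \<open>The right-hand side is the composition formula for structure 2-cells. In the induction
  over blocks, a last block other than \<open>j\<close> only whiskers the formula by
  \<open>\<omega>\<close>; if block \<open>j\<close> is the last,
  \<open>\<omega>_w\<omega>_append_right\<close> yields both factors at once.\<close>

lemma w\<omega>_concat:
  assumes "\<forall>As \<in> set Ass. set As \<subseteq> Ob K" "j < length Ass" "d < length (Ass ! j)" "elss Z (slotted Ass j d) zss" "\<forall>zs \<in> set zss. idcs zs"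
  shows "T2 (id2 (regroup Ass)) ** (w\<omega> (concat Ass) (length (concat (take j Ass)) + d) ** tup Z (concat zss))
    = (om (map nprod Ass) ** tup Z ((oms Z Ass zss)[j := w\<omega> (Ass ! j) d ** tup Z (zss ! j)]))
      \<cdot> (w\<omega> (map nprod Ass) j ** tup Z ((oms Z Ass zss)[j := V\<omega> (Ass ! j) d Z (zss ! j)]))"
  using assms
proof (induction Ass arbitrary: zss rule: rev_induct)
  case (snoc As Ass)
  have A: "\<forall>As \<in> set Ass. set As \<subseteq> Ob K" "set As \<subseteq> Ob K" using snoc.prems(1) by auto
  have C: "set (concat Ass) \<subseteq> Ob K" using A by auto
  have N: "set (map nprod Ass) \<subseteq> Ob K" using A(1) by auto
  have Q: "nprod As \<in> Ob K" using A(2) by simp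
  note r = regroup_typing(1-3)[OF A(1)]
  show ?case
  proof (cases "j < length Ass")
    case True
    have ne: "Ass \<noteq> []" "map nprod Ass \<noteq> []" using True by auto
    have n: "(Ass @ [As]) ! j = Ass ! j" "take j (Ass @ [As]) = take j Ass" using True by (simp_all add: nth_append)
    have d: "d < length (Ass ! j)" using snoc.prems(3) unfolding n .
    have "elss Z (slotted Ass j d @ [map T0 As]) zss" using snoc.prems(4) True by (simp add: slotted_simps)
    then obtain yss ys where y: "zss = yss @ [ys]" "elss Z (slotted Ass j d) yss" "els Z (map T0 As) ys"
      by (rule elss_snocE)
    have ly: "length yss = length Ass" using elssD(1)[OF y(2)] by (simp add: slotted_simps)
    have c: "\<forall>ys \<in> set yss. idcs ys" "idcs ys" using snoc.prems(5) unfolding y(1) by simp_all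
    have cc: "idcs (concat yss)" using c(1) by (auto simp: idcs_def)
    let ?s = "length (concat (take j Ass)) + d"
    have s: "?s < length (concat Ass)" by (rule nth_concat_offset(1)[OF True d])
    have ec: "els Z ((map T0 (concat Ass))[?s := T0 (T0 (concat Ass ! ?s))]) (concat yss)"
      using elss_concat[OF y(2)] unfolding concat_slotted[OF True d] .
    let ?u = "w\<omega> (concat Ass) ?s ** tup Z (concat yss)" and ?v = "om As ** tup Z ys"
    note u = w\<omega>_ty[OF C s ec] and v = om_ty(1-3)[OF A(2) y(3)] om_ty(4)[OF A(2) y(3) c(2)]
    note os = oms_slotted[OF A(1) True d y(2) c(1)]
    let ?b = "om (map nprod Ass) ** tup Z ((oms Z Ass yss)[j := w\<omega> (Ass ! j) d ** tup Z (yss ! j)])"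
    let ?a = "w\<omega> (map nprod Ass) j ** tup Z ((oms Z Ass yss)[j := V\<omega> (Ass ! j) d Z (yss ! j)])"
    have jl: "j < length (map nprod Ass)" using True by simp
    note b = om_ty(1-3)[OF N os(1)] and a = w\<omega>_ty[OF N jl os(2)]
    have "T2 (id2 (regroup (Ass @ [As]))) ** (w\<omega> (concat Ass @ As) ?s ** tup Z (concat yss @ ys))
      = \<omega>2 (nprod (map nprod Ass)) (nprod As) ** pair2 (T2 (id2 (regroup Ass)) ** ?u) ?v"
      unfolding \<omega>_w\<omega>_append_left[OF C s ec cc A(2) y(3) c(2), symmetric]
      using T2_regroup_snoc[OF A ne(1), of "\<omega>2 (nprod (concat Ass)) (nprod As) ** pair2 ?u ?v"]
        \<omega>_nat[of ?u ?v "id2 (regroup Ass)" "id2 (id1 (nprod As))"] u v A C r by simp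
    also have "T2 (id2 (regroup Ass)) ** ?u = ?b \<cdot> ?a" by (rule snoc.IH[OF A(1) True d y(2) c(1)])
    also have "\<omega>2 (nprod (map nprod Ass)) (nprod As) ** pair2 (?b \<cdot> ?a) ?v
       = (\<omega>2 (nprod (map nprod Ass)) (nprod As) ** pair2 ?b ?v) \<cdot> (\<omega>2 (nprod (map nprod Ass)) (nprod As) ** pair2 ?a ?v)"
      by (rule \<omega>_vcomp(1)[OF nprod_Ob[OF N] Q a(1) b(1) os(4) v(4)]) (use a v in simp_all)
    also have "\<omega>2 (nprod (map nprod Ass)) (nprod As) ** pair2 ?b ?v
       = om (map nprod Ass @ [nprod As]) ** tup Z ((oms Z Ass yss)[j := w\<omega> (Ass ! j) d ** tup Z (yss ! j)] @ [?v])"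
      by (rule om_snoc[OF N Q ne(2) os(1) v(1-3), symmetric])
    also have "\<omega>2 (nprod (map nprod Ass)) (nprod As) ** pair2 ?a ?v
       = w\<omega> (map nprod Ass @ [nprod As]) j ** tup Z ((oms Z Ass yss)[j := V\<omega> (Ass ! j) d Z (yss ! j)] @ [?v])"
      by (rule w\<omega>_snoc(1)[OF N Q ne(2) os(3) v(4,2) jl os(2) v(3), symmetric])
    finally show ?thesis unfolding y(1) using n True ly by (simp add: list_update_append nth_append)
  next
    case False
    then have j: "j = length Ass" using snoc.prems(2) by simp
    have n: "(Ass @ [As]) ! j = As" "take j (Ass @ [As]) = Ass" unfolding j by simp_all
    have d: "d < length As" using snoc.prems(3) unfolding n .
    have "elss Z (map (map T0) Ass @ [(map T0 As)[d := T0 (T0 (As ! d))]]) zss" using snoc.prems(4) unfolding j by (simp add: slotted_simps)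
    then obtain yss ys where y: "zss = yss @ [ys]" "elss Z (map (map T0) Ass) yss" "els Z ((map T0 As)[d := T0 (T0 (As ! d))]) ys"
      by (rule elss_snocE)
    have ly: "length yss = length Ass" using elssD(1)[OF y(2)] by simp
    have c: "\<forall>ys \<in> set yss. idcs ys" "idcs ys" using snoc.prems(5) unfolding y(1) by simp_all
    let ?W = "w\<omega> As d ** tup Z ys" and ?V = "V\<omega> As d Z ys"
    note w = w\<omega>_ty[OF A(2) d y(3)] and v = V\<omega>_eq(2-4)[OF A(2) d y(3)] V\<omega>_eq(5,6)[OF A(2) d y(3) c(2)]
    show ?thesis
    proof (cases "Ass = []")
      case True
      then have yss: "yss = []" using ly by simp
      \<comment> \<open>With a single block the outer cell is a unit, and its factor is the identity
        on the source of \<open>?W\<close>.\<close>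
      have m: "?W \<cdot> (\<mu>2 (nprod As) ** ?V) = ?W"
        by (rule vcomp_idc(2)) (use w v Q in simp_all)
      show ?thesis unfolding y(1) j True yss using w v m A(2) by (simp add: regroup_single \<omega>n_cell_single)
    next
      case ne: False
      then have ne': "map nprod Ass \<noteq> []" by simp
      have cc: "idcs (concat yss)" using c(1) by (auto simp: idcs_def)
      have ec: "els Z (map T0 (concat Ass)) (concat yss)" using elss_concat[OF y(2)] by (simp add: map_concat)
      let ?P = "nprod (concat Ass)" and ?Q = "nprod As" and ?N = "nprod (map nprod Ass)"
      have P: "?P \<in> Ob K" "?N \<in> Ob K" using C N by simp_all
      let ?u = "om (concat Ass) ** tup Z (concat yss)" and ?u' = "om (map nprod Ass) ** tup Z (oms Z Ass yss)"
      note u = om_ty(1-3)[OF C ec] om_ty(4)[OF C ec cc]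
      note o = els_oms(1)[OF A(1) y(2)] els_oms(2)[OF A(1) y(2) c(1)]
      note u' = om_ty(1-3)[OF N o(1)] om_ty(4)[OF N o]
      have uu: "T2 (id2 (regroup Ass)) ** ?u = ?u'" by (rule om_concat[OF A(1) y(2)])
      have cmp: "cm (c1 ?P ?Q ** pair2 ?u ?V) = dm (\<omega>2 ?P ?Q ** pair2 ?u ?W)"
        by (rule \<omega>_w\<omega>_composable[OF u(4,2,3) P(1) A(2) d y(3) c(2)])
      have t1: "T2 (pair2 (id2 (regroup Ass) ** p1 ?P ?Q) (p2 ?P ?Q)) ** (\<omega>2 ?P ?Q ** pair2 ?u ?W) = \<omega>2 ?N ?Q ** pair2 ?u' ?W"
        unfolding uu[symmetric] using \<omega>_nat[of ?u ?W "id2 (regroup Ass)" "id2 (id1 ?Q)"] u w r P Q by simp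
      have t2: "T2 (pair2 (id2 (regroup Ass) ** p1 ?P ?Q) (p2 ?P ?Q)) ** (c1 ?P ?Q ** pair2 ?u ?V) = c1 ?N ?Q ** pair2 ?u' ?V"
        unfolding uu[symmetric] using c1_nat[of "id2 (regroup Ass)" "id2 (id1 ?Q)" ?u ?V ?N ?Q] u v r P Q by simp
      have vt: "(\<omega>2 ?P ?Q ** pair2 ?u ?W) \<cdot> (c1 ?P ?Q ** pair2 ?u ?V) \<in> Ce K" "tgt ((\<omega>2 ?P ?Q ** pair2 ?u ?W) \<cdot> (c1 ?P ?Q ** pair2 ?u ?V)) = T0 (?P \<otimes> ?Q)"
        using vcomp_typing(1,3)[OF _ _ cmp] u w v P Q by simp_all
      have "T2 (id2 (regroup (Ass @ [As]))) ** (w\<omega> (concat Ass @ As) (length (concat Ass) + d) ** tup Z (concat yss @ ys))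
        = T2 (pair2 (id2 (regroup Ass) ** p1 ?P ?Q) (p2 ?P ?Q)) ** ((\<omega>2 ?P ?Q ** pair2 ?u ?W) \<cdot> (c1 ?P ?Q ** pair2 ?u ?V))"
        unfolding \<omega>_w\<omega>_append_right[OF C ec cc A(2) d y(3) c(2), symmetric] by (rule T2_regroup_snoc[OF A ne vt])
      also have "\<dots> = (\<omega>2 ?N ?Q ** pair2 ?u' ?W) \<cdot> (c1 ?N ?Q ** pair2 ?u' ?V)"
        unfolding t1[symmetric] t2[symmetric]
        by (rule whisker_vcomp_left) (use u w v P Q r cmp in simp_all)
      also have "\<omega>2 ?N ?Q ** pair2 ?u' ?W = om (map nprod Ass @ [?Q]) ** tup Z (oms Z Ass yss @ [?W])"
        by (rule om_snoc[OF N Q ne' o(1) w, symmetric])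
      also have "c1 ?N ?Q ** pair2 ?u' ?V = w\<omega> (map nprod Ass @ [?Q]) (length (map nprod Ass)) ** tup Z (oms Z Ass yss @ [?V])"
        by (rule w\<omega>_snoc(2)[OF N Q ne' o(2) v(4) v(2) o(1) v(3), symmetric])
      finally show ?thesis unfolding y(1) j using ly by (simp add: list_update_append nth_append)
    qed
  qed
qed simp

end

section \<open>The free algebra multifunctor\<close>

context pseudo_commutative_strong_two_monad
begin

lemma alg_cells1_FreeD:
  assumes "F \<in> alg_cells1 (map Free As) (Free B)" "set As \<subseteq> Ob K" "B \<in> Ob K"
  shows "fst F \<in> Ar K" "dom1 K (fst F) = nprod (map T0 As)" "cod1 K (fst F) = T0 B" "length (snd F) = length As"
    "i < length As \<Longrightarrow> snd F ! i \<in> Ce K" "i < length As \<Longrightarrow> src (snd F ! i) = nprod ((map T0 As)[i := T0 (T0 (As ! i))])"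
    "i < length As \<Longrightarrow> tgt (snd F ! i) = T0 B"
    "i < length As \<Longrightarrow> dm (snd F ! i) = \<mu>2 B ** (T2 (id2 (fst F)) ** id2 (tn (map T0 As) i))"
    "i < length As \<Longrightarrow> cm (snd F ! i) = id2 (fst F) ** id2 (slot (map T0 As) i (\<mu> (As ! i)))"
proof -
  let ?X = "map T0 As"
  have fX: "map fst (map Free As) = ?X" by (simp add: Free_def)
  have X: "set ?X \<subseteq> Ob K" by (rule map_T0_Ob[OF assms(2)])
  obtain f ws where F: "F = (f, ws)" by (cases F)
  have *: "f \<in> hom1 K (nprod ?X) (T0 B)" "length ws = length As"
    "i < length As \<Longrightarrow> ws ! i \<in> hom2 K (\<mu> B \<odot> T1 f \<odot> tn ?X i) (f \<odot> slot ?X i (\<mu> (As ! i)))" for i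
    using assms(1) unfolding F alg_cells1_def Let_def fX by (auto simp: Free_def)
  show f: "fst F \<in> Ar K" "dom1 K (fst F) = nprod (map T0 As)" "cod1 K (fst F) = T0 B" and "length (snd F) = length As"
    using *(1,2) by (auto simp: F hom1_def)
  assume i: "i < length As"
  have A: "As ! i \<in> Ob K" using assms(2) i by simp
  have iX: "i < length ?X" using i by simp
  note t = tn_typing[OF X iX] and s = slot_typing[OF X _ iX, of "\<mu> (As ! i)"]
  have w: "snd F ! i \<in> Ce K" "dom2 K (snd F ! i) = \<mu> B \<odot> T1 (fst F) \<odot> tn ?X i" "cod2 K (snd F ! i) = fst F \<odot> slot ?X i (\<mu> (As ! i))"
    using *(3)[OF i] unfolding F by (auto simp: hom2_def)
  have t2: "tn ?X i \<in> Ar K" "dom1 K (tn ?X i) = nprod (?X[i := T0 (T0 (As ! i))])" "cod1 K (tn ?X i) = T0 (nprod ?X)"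
    using t i by simp_all
  have s2: "slot ?X i (\<mu> (As ! i)) \<in> Ar K" "dom1 K (slot ?X i (\<mu> (As ! i))) = nprod (?X[i := T0 (T0 (As ! i))])" "cod1 K (slot ?X i (\<mu> (As ! i))) = nprod ?X"
    using s A i by simp_all
  show "snd F ! i \<in> Ce K" by (rule w)
  show "src (snd F ! i) = nprod (?X[i := T0 (T0 (As ! i))])" "tgt (snd F ! i) = T0 B"
    unfolding src_def tgt_def w using f t2 assms(3) by simp_all
  show "dm (snd F ! i) = \<mu>2 B ** (T2 (id2 (fst F)) ** id2 (tn ?X i))"
    unfolding dm_def w using f t2 assms(3) by simp
  show "cm (snd F ! i) = id2 (fst F) ** id2 (slot ?X i (\<mu> (As ! i)))"
    unfolding cm_def w using f s2 by simp
qed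

lemma alg_cells2_Free_iff:
  "(F, \<alpha>, G) \<in> alg_cells2 (map Free As) (Free B) \<longleftrightarrow>
     F \<in> alg_cells1 (map Free As) (Free B) \<and> G \<in> alg_cells1 (map Free As) (Free B) \<and> \<alpha> \<in> hom2 K (fst F) (fst G) \<and>
     (\<forall>i<length As. (\<alpha> ** id2 (slot (map T0 As) i (\<mu> (As ! i)))) \<cdot> (snd F ! i) = (snd G ! i) \<cdot> (\<mu>2 B ** (T2 \<alpha> ** id2 (tn (map T0 As) i))))"
proof -
  have 1: "map fst (map Free As) = map T0 As" by (simp add: Free_def)
  have 2: "snd (Free B) = \<mu> B" "i < length As \<Longrightarrow> snd (map Free As ! i) = \<mu> (As ! i)" for i by (simp_all add: Free_def)
  show ?thesis unfolding alg_cells2_def Let_def 1 mem_Collect_eq case_prod_conv using 2 by auto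
qed

lemma slot_tn_Free:
  assumes "set As \<subseteq> Ob K" "i < length As"
  shows "slot (map T0 As) i (\<mu> (As ! i)) \<in> Ar K" "dom1 K (slot (map T0 As) i (\<mu> (As ! i))) = nprod ((map T0 As)[i := T0 (T0 (As ! i))])"
    "cod1 K (slot (map T0 As) i (\<mu> (As ! i))) = nprod (map T0 As)"
    "tn (map T0 As) i \<in> Ar K" "dom1 K (tn (map T0 As) i) = nprod ((map T0 As)[i := T0 (T0 (As ! i))])" "cod1 K (tn (map T0 As) i) = T0 (nprod (map T0 As))"
proof -
  have A: "As ! i \<in> Ob K" "i < length (map T0 As)" using assms by simp_all
  show "slot (map T0 As) i (\<mu> (As ! i)) \<in> Ar K" "dom1 K (slot (map T0 As) i (\<mu> (As ! i))) = nprod ((map T0 As)[i := T0 (T0 (As ! i))])"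
    "cod1 K (slot (map T0 As) i (\<mu> (As ! i))) = nprod (map T0 As)"
    "tn (map T0 As) i \<in> Ar K" "dom1 K (tn (map T0 As) i) = nprod ((map T0 As)[i := T0 (T0 (As ! i))])" "cod1 K (tn (map T0 As) i) = T0 (nprod (map T0 As))"
    using slot_typing[OF map_T0_Ob[OF assms(1)] _ A(2), of "\<mu> (As ! i)"] tn_typing[OF map_T0_Ob[OF assms(1)] A(2)] A assms(2) by simp_all
qed

text \<open>Restricted to free algebras: these are the hom-categories into which the multifunctor
  maps.\<close>

lemma category_alg_hom_Free:
  assumes "set As \<subseteq> Ob K" "B \<in> Ob K"
  shows "category (alg_hom (map Free As) (Free B))"
proof -
  let ?C1 = "alg_cells1 (map Free As) (Free B)" and ?C2 = "alg_cells2 (map Free As) (Free B)"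
  note D = alg_cells1_FreeD[OF _ assms] and S = slot_tn_Free[OF assms(1)]
  have id: "(F, id2 (fst F), F) \<in> ?C2" if F: "F \<in> ?C1" for F
    unfolding alg_cells2_Free_iff
  proof (intro conjI allI impI F)
    show "id2 (fst F) \<in> hom2 K (fst F) (fst F)" using D(1)[OF F] by (simp add: id2_in)
    fix i assume i: "i < length As"
    show "(id2 (fst F) ** id2 (slot (map T0 As) i (\<mu> (As ! i)))) \<cdot> (snd F ! i) = (snd F ! i) \<cdot> (\<mu>2 B ** (T2 (id2 (fst F)) ** id2 (tn (map T0 As) i)))"
      unfolding D(8,9)[OF F i, symmetric] using D(5)[OF F i] by simp
  qed
  have comp: "(F, \<beta> \<cdot> \<alpha>, H) \<in> ?C2" if a: "(F, \<alpha>, G) \<in> ?C2" and b: "(G, \<beta>, H) \<in> ?C2" for F G H \<alpha> \<beta>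
  proof -
    have F: "F \<in> ?C1" "G \<in> ?C1" "H \<in> ?C1" and h: "\<alpha> \<in> hom2 K (fst F) (fst G)" "\<beta> \<in> hom2 K (fst G) (fst H)"
      using a b unfolding alg_cells2_Free_iff by blast+
    have c: "\<alpha> \<in> Ce K" "\<beta> \<in> Ce K" "dm \<alpha> = id2 (fst F)" "cm \<alpha> = id2 (fst G)" "dm \<beta> = id2 (fst G)" "cm \<beta> = id2 (fst H)"
      using h by (auto simp: hom2_def dm_def cm_def)
    have st: "src \<alpha> = nprod (map T0 As)" "tgt \<alpha> = T0 B" "src \<beta> = nprod (map T0 As)" "tgt \<beta> = T0 B"
      using h D(1-3)[OF F(1)] D(1-3)[OF F(2)] by (auto simp: hom2_def src_def tgt_def)
    have "((\<beta> \<cdot> \<alpha>) ** id2 (slot (map T0 As) i (\<mu> (As ! i)))) \<cdot> (snd F ! i) = (snd H ! i) \<cdot> (\<mu>2 B ** (T2 (\<beta> \<cdot> \<alpha>) ** id2 (tn (map T0 As) i)))"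
      if i: "i < length As" for i
    proof -
      define s where "s = id2 (slot (map T0 As) i (\<mu> (As ! i)))"
      define k where "k = id2 (tn (map T0 As) i)"
      have s: "idc s" "s \<in> Ce K" "tgt s = nprod (map T0 As)" and k: "idc k" "k \<in> Ce K" "tgt k = T0 (nprod (map T0 As))"
        unfolding s_def k_def using S[OF i] by simp_all
      note w = D(5,8,9)[OF F(1) i, folded s_def k_def] D(5,8,9)[OF F(2) i, folded s_def k_def] D(5,8,9)[OF F(3) i, folded s_def k_def]
      have e: "(\<alpha> ** s) \<cdot> (snd F ! i) = (snd G ! i) \<cdot> (\<mu>2 B ** (T2 \<alpha> ** k))" "(\<beta> ** s) \<cdot> (snd G ! i) = (snd H ! i) \<cdot> (\<mu>2 B ** (T2 \<beta> ** k))"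
        unfolding s_def k_def using a b i unfolding alg_cells2_Free_iff by blast+
      \<comment> \<open>Pasting of the compatibility squares of \<open>\<alpha>\<close> and
        \<open>\<beta>\<close> along the structure 2-cell of \<open>G\<close>.\<close>
      have "((\<beta> \<cdot> \<alpha>) ** s) \<cdot> (snd F ! i) = (\<beta> ** s) \<cdot> ((\<alpha> ** s) \<cdot> (snd F ! i))"
        using c st s w by simp
      also have "\<dots> = ((\<beta> ** s) \<cdot> (snd G ! i)) \<cdot> (\<mu>2 B ** (T2 \<alpha> ** k))"
        unfolding e(1) by (rule vcomp_assoc'[symmetric]) (use c st s k w assms(2) in simp_all)
      also have "\<dots> = (snd H ! i) \<cdot> ((\<mu>2 B ** (T2 \<beta> ** k)) \<cdot> (\<mu>2 B ** (T2 \<alpha> ** k)))"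
        unfolding e(2) by (rule vcomp_assoc') (use c st s k w assms(2) in simp_all)
      also have "(\<mu>2 B ** (T2 \<beta> ** k)) \<cdot> (\<mu>2 B ** (T2 \<alpha> ** k)) = \<mu>2 B ** (T2 (\<beta> \<cdot> \<alpha>) ** k)"
        using c st k assms(2) by simp
      finally show ?thesis unfolding s_def k_def .
    qed
    moreover have "\<beta> \<cdot> \<alpha> \<in> hom2 K (fst F) (fst H)" by (rule vcomp_in[OF h])
    ultimately show ?thesis unfolding alg_cells2_Free_iff using F by blast
  qed
  have cells: "F \<in> ?C1" "G \<in> ?C1" "\<alpha> \<in> hom2 K (fst F) (fst G)" if "(F, \<alpha>, G) \<in> ?C2" for F \<alpha> G
    using that unfolding alg_cells2_Free_iff by blast+
  have idl: "id2 g \<cdot> \<alpha> = \<alpha>" "\<alpha> \<cdot> id2 f = \<alpha>" if "((f, fs), \<alpha>, (g, gs)) \<in> ?C2" for f fs \<alpha> g gs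
    using vcomp_id_left vcomp_id_right cells(3)[OF that] by auto
  have ass: "(\<gamma> \<cdot> \<beta>) \<cdot> \<alpha> = \<gamma> \<cdot> (\<beta> \<cdot> \<alpha>)" if "(F, \<alpha>, G) \<in> ?C2" "(G, \<beta>, H) \<in> ?C2" "(H, \<gamma>, L) \<in> ?C2" for F \<alpha> G \<beta> H \<gamma> L
    using vcomp_assoc cells(3)[OF that(1)] cells(3)[OF that(2)] cells(3)[OF that(3)] by blast
  show ?thesis
    unfolding category_def alg_hom_def
    by (auto simp: idl ass intro: id comp dest: cells)
qed

lemma category_K_multi:
  assumes "set As \<subseteq> Ob K" "B \<in> Ob K"
  shows "category (MHom K_multi As B)"
proof -
  have ar: "f \<in> hom1 K (nprod As) B \<Longrightarrow> f \<in> Ar K" for f by (simp add: hom1_def)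
  have v: "\<beta> \<cdot> \<alpha> \<in> Ce K" "dom2 K (\<beta> \<cdot> \<alpha>) = dom2 K \<alpha>" "cod2 K (\<beta> \<cdot> \<alpha>) = cod2 K \<beta>"
    if "\<alpha> \<in> Ce K" "\<beta> \<in> Ce K" "cod2 K \<alpha> = dom2 K \<beta>" for \<alpha> \<beta>
    using vcomp_in[of \<alpha> _ _ \<beta>] that by (auto simp: hom2_def)
  have ass: "(\<gamma> \<cdot> \<beta>) \<cdot> \<alpha> = \<gamma> \<cdot> (\<beta> \<cdot> \<alpha>)" if "\<alpha> \<in> Ce K" "\<beta> \<in> Ce K" "\<gamma> \<in> Ce K" "cod2 K \<alpha> = dom2 K \<beta>" "cod2 K \<beta> = dom2 K \<gamma>" for \<alpha> \<beta> \<gamma>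
    using that by (intro vcomp_assoc') (simp_all add: dm_eq_iff)
  have i: "id2 (cod2 K \<alpha>) \<cdot> \<alpha> = \<alpha>" "\<alpha> \<cdot> id2 (dom2 K \<alpha>) = \<alpha>" if "\<alpha> \<in> Ce K" for \<alpha>
    using that vcomp_id_left[OF hom2I] vcomp_id_right[OF hom2I] by simp_all
  show ?thesis
    unfolding category_def K_multi_def
    by (simp only: cat.simps cat_multi.simps, intro conjI ballI impI; simp add: ar v ass i)
qed

lemma algebra_Free: "A \<in> Ob K \<Longrightarrow> algebra (Free A)"
  by (simp add: algebra_def Free_def \<mu>_in monad_unit_left monad_assoc)

text \<open>\<open>T2 f\<close> is a strict morphism of free algebras: it commutes with
  \<open>\<mu>\<close> and can therefore be pushed into every \<open>bnd\<close>. All conditions of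
  \<open>fel\<close> are then whiskered by it.\<close>

lemma fel_whisker:
  assumes F: "fel As P h w" and f: "idc f" "src f = P" "tgt f = B" and w': "\<forall>i<length As. w' i = T2 f ** w i"
  shows "fel As B (T2 f ** h) w'"
proof -
  have ft: "fel_typ As P h w" and fe: "fel_eta As h w" and fm: "fel_mu As P w" and fc: "fel_coh As P h w"
    using F by (auto simp: fel_def)
  note d = fel_typD[OF ft]
  have fC: "f \<in> Ce K" and B: "B \<in> Ob K" using f by (auto simp: idcD)
  have T: "T2 f \<in> Ce K" "src (T2 f) = T0 P" "tgt (T2 f) = T0 B" "idc (T2 f)" using f fC by simp_all
  have A: "i < length As \<Longrightarrow> As ! i \<in> Ob K" for i using d(1) by simp
  have push: "T2 f ** bnd C P u (x ** n) = bnd C B u ((T2 f ** x) ** n)"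
    if "u \<in> Ce K" "tgt u = T0 C" "C \<in> Ob K" "x \<in> Ce K" "tgt x = T0 P" "n \<in> Ce K" "tgt n = src x" "src n = src u \<otimes> C" for C u x n
    using T2_bnd_push[of u C "x ** n" P f] that f fC T by simp
  have sl: "ys ! i \<in> Ce K" "src (ys ! i) = Z" "tgt (ys ! i) = T0 C"
     if "els Z X ys" "i < length X" "X ! i = T0 C" for Z ys i C X
    using elsD(4-6)[OF that(1,2)] that(3) by simp_all
  have 1: "fel_typ As B (T2 f ** h) w'"
    unfolding fel_typ_def
  proof (intro conjI allI impI d(1) B)
    show "idc (T2 f ** h)" "src (T2 f ** h) = nprod (map T0 As)" "tgt (T2 f ** h) = T0 B" using d T by simp_all
    fix i assume i: "i < length As"
    note wi = d(7-9)[OF i]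
    show "w' i \<in> Ce K" "src (w' i) = nprod ((map T0 As)[i := T0 (T0 (As ! i))])" "tgt (w' i) = T0 B" using w' i wi T by simp_all
    show "\<exists>v. vinv (w' i) v" using d(10)[OF i] vinv_whisker(1)[OF _ T(4)] w' i wi T by fastforce
    fix Z ys assume e: "els Z ((map T0 As)[i := T0 (T0 (As ! i))]) ys" and c: "idcs ys"
    note y = sl[OF e, of i "T0 (As ! i)"]
    have o: "els (Z \<otimes> T0 (As ! i)) (map T0 As) (osl Z (T0 (As ! i)) i ys)" using els_osl'[OF e, of "T0 (As ! i)"] A[OF i] i by simp
    have s: "w' i ** tup Z ys = T2 f ** (w i ** tup Z ys)" using w' i wi T e by simp
    show "dm (w' i ** tup Z ys) = bnd (T0 (As ! i)) B (ys ! i) ((T2 f ** h) ** tup (Z \<otimes> T0 (As ! i)) (osl Z (T0 (As ! i)) i ys))"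
      using push[of "ys ! i" "T0 (As ! i)" h "tup (Z \<otimes> T0 (As ! i)) (osl Z (T0 (As ! i)) i ys)"] y o A[OF i] i d(3-6)
        d(11)[OF i e c] dm_hcomp(1)[of "w i ** tup Z ys" "T2 f"] wi T e unfolding s by simp
    have u: "els Z (map T0 As) (ys[i := \<mu>2 (As ! i) ** ys ! i])"
      using els_update[OF e, of "\<mu>2 (As ! i) ** ys ! i" "T0 (As ! i)" i] y A[OF i] i by simp
    show "cm (w' i ** tup Z ys) = (T2 f ** h) ** tup Z (ys[i := \<mu>2 (As ! i) ** ys ! i])"
      using d(12)[OF i e c] dm_hcomp(2)[of "w i ** tup Z ys" "T2 f"] wi T e u d(3-6) unfolding s by simp
  qed
  note d' = fel_typD[OF 1]
  have 2: "fel_eta As (T2 f ** h) w'"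
    unfolding fel_eta_def
  proof (intro allI impI)
    fix i Z ys assume i: "i < length As" and e: "els Z (map T0 As) ys" and c: "idcs ys"
    note y = sl[OF e, of i "As ! i"]
    have u: "els Z ((map T0 As)[i := T0 (T0 (As ! i))]) (ys[i := \<eta>2 (T0 (As ! i)) ** ys ! i])"
      by (rule els_update[OF e]) (use y A[OF i] i in simp_all)
    show "w' i ** tup Z (ys[i := \<eta>2 (T0 (As ! i)) ** ys ! i]) = (T2 f ** h) ** tup Z ys"
      using fe[unfolded fel_eta_def, rule_format, OF i e c] w' i d(7-9)[OF i] T u e d(3-6) by simp
  qed
  have 3: "fel_mu As B w'"
    unfolding fel_mu_def
  proof (intro allI impI)
    fix i Z ys assume i: "i < length As" and e: "els Z ((map T0 As)[i := T0 (T0 (T0 (As ! i)))]) ys" and c: "idcs ys"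
    note y = sl[OF e, of i "T0 (T0 (As ! i))"]
    let ?n = "tup (Z \<otimes> T0 (T0 (As ! i))) (osl Z (T0 (T0 (As ! i))) i ys)"
    let ?a = "bnd (T0 (T0 (As ! i))) P (ys ! i) (w i ** ?n)" and ?m = "tup Z (ys[i := T2 (\<mu>2 (As ! i)) ** ys ! i])"
    have u1: "els Z ((map T0 As)[i := T0 (T0 (As ! i))]) (ys[i := \<mu>2 (T0 (As ! i)) ** ys ! i])"
      and u2: "els Z ((map T0 As)[i := T0 (T0 (As ! i))]) (ys[i := T2 (\<mu>2 (As ! i)) ** ys ! i])"
      using els_update[OF e, of _ "T0 (T0 (As ! i))" i] y A[OF i] i by simp_all
    have o: "els (Z \<otimes> T0 (T0 (As ! i))) ((map T0 As)[i := T0 (T0 (As ! i))]) (osl Z (T0 (T0 (As ! i))) i ys)"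
      using els_osl'[OF e, of "T0 (T0 (As ! i))"] A[OF i] i by simp
    note wi = d(7-9)[OF i]
    have at: "?a \<in> Ce K" "tgt ?a = T0 P" using y o wi A[OF i] i d(2) by simp_all
    have "T2 f ** ((w i ** ?m) \<cdot> ?a) = (T2 f ** (w i ** ?m)) \<cdot> (T2 f ** ?a)"
      by (rule whisker_vcomp_left[OF at(1) _ T(4) fel_mu_composable[OF ft i e c]]) (use wi u2 T at in simp_all)
    also have "T2 f ** ?a = bnd (T0 (T0 (As ! i))) B (ys ! i) (w' i ** ?n)"
      using push[of "ys ! i" "T0 (T0 (As ! i))" "w i" ?n] y o wi A[OF i] i w' by simp
    finally show "w' i ** tup Z (ys[i := \<mu>2 (T0 (As ! i)) ** ys ! i])
     = (w' i ** ?m) \<cdot> bnd (T0 (T0 (As ! i))) B (ys ! i) (w' i ** ?n)"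
      using fm[unfolded fel_mu_def, rule_format, OF i e c, symmetric] w' i wi u1 u2 T by simp
  qed
  have 4: "fel_coh As B (T2 f ** h) w'"
    unfolding fel_coh_def
  proof (intro allI impI)
    fix j i Z ys assume j: "j < length As" and ij: "i < j" and c: "idcs ys"
      and e: "els Z ((map T0 As)[i := T0 (T0 (As ! i)), j := T0 (T0 (As ! j))]) ys"
    have i: "i < length As" and ne: "i \<noteq> j" using ij j by simp_all
    have e': "els Z ((map T0 As)[j := T0 (T0 (As ! j)), i := T0 (T0 (As ! i))]) ys" using e ne by (simp add: list_update_swap)
    note yi = sl[OF e, of i "T0 (As ! i)"] and yj = sl[OF e, of j "T0 (As ! j)"]
    note wi = d(7-9)[OF i] and wj = d(7-9)[OF j]
    let ?ni = "tup (Z \<otimes> T0 (As ! i)) (osl Z (T0 (As ! i)) i ys)" and ?nj = "tup (Z \<otimes> T0 (As ! j)) (osl Z (T0 (As ! j)) j ys)"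
    let ?G = "\<Gamma> (T0 (As ! i)) (T0 (As ! j)) ** pair2 (ys ! i) (ys ! j)"
    let ?C = "T0 (As ! i) \<otimes> T0 (As ! j)"
    let ?ng = "tup (Z \<otimes> ?C) (osl2 Z (T0 (As ! i)) (T0 (As ! j)) i j ys)"
    have oi: "els (Z \<otimes> T0 (As ! i)) ((map T0 As)[j := T0 (T0 (As ! j))]) (osl Z (T0 (As ! i)) i ys)"
      using els_osl'[OF e', of "T0 (As ! i)"] A[OF i] i ne by (simp add: list_update_swap)
    have oj: "els (Z \<otimes> T0 (As ! j)) ((map T0 As)[i := T0 (T0 (As ! i))]) (osl Z (T0 (As ! j)) j ys)"
      using els_osl'[OF e, of "T0 (As ! j)"] A[OF j] j ne by (simp add: list_update_swap)
    have ui: "els Z ((map T0 As)[i := T0 (T0 (As ! i))]) (ys[j := \<mu>2 (As ! j) ** ys ! j])"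
      using els_update[OF e, of "\<mu>2 (As ! j) ** ys ! j" "T0 (As ! j)" j] yj A[OF j] j ne by (simp add: list_update_swap)
    have uj: "els Z ((map T0 As)[j := T0 (T0 (As ! j))]) (ys[i := \<mu>2 (As ! i) ** ys ! i])"
      using els_update[OF e', of "\<mu>2 (As ! i) ** ys ! i" "T0 (As ! i)" i] yi A[OF i] i ne by (simp add: list_update_swap)
    show "(w' i ** tup Z (ys[j := \<mu>2 (As ! j) ** ys ! j])) \<cdot> bnd (T0 (As ! i)) B (ys ! i) (w' j ** ?ni)
     = (w' j ** tup Z (ys[i := \<mu>2 (As ! i) ** ys ! i])) \<cdot> bnd (T0 (As ! j)) B (ys ! j) (w' i ** ?nj)
       \<cdot> bnd ?C B ?G ((T2 f ** h) ** ?ng)"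
    proof -
      let ?L = "w i ** tup Z (ys[j := \<mu>2 (As ! j) ** ys ! j])" and ?a = "bnd (T0 (As ! i)) P (ys ! i) (w j ** ?ni)"
      let ?R = "w j ** tup Z (ys[i := \<mu>2 (As ! i) ** ys ! i])" and ?b = "bnd (T0 (As ! j)) P (ys ! j) (w i ** ?nj)"
      let ?g = "bnd ?C P ?G (h ** ?ng)"
      have og: "els (Z \<otimes> ?C) (map T0 As) (osl2 Z (T0 (As ! i)) (T0 (As ! j)) i j ys)"
        using els_osl2[OF e, of "T0 (As ! i)" "T0 (As ! j)" i j] A[OF i] A[OF j] i j ne by (simp add: list_update_swap[of j i])
      have Z: "Z \<in> Ob K" by (rule elsD(2)[OF e])
      have G: "?G \<in> Ce K" "src ?G = Z" "tgt ?G = T0 ?C" using yi yj A[OF i] A[OF j] i j ne by simp_all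
      note cmp = fel_composable(1)[OF ft i j ne e c] fel_composable(1)[OF ft j i ne[symmetric] e' c] fel_composable(2)[OF ft i j ne e c]
      have L: "?L \<in> Ce K" "tgt ?L = T0 P" "?R \<in> Ce K" "tgt ?R = T0 P" using wi wj ui uj by simp_all
      have a: "?a \<in> Ce K" "tgt ?a = T0 P" and b: "?b \<in> Ce K" "tgt ?b = T0 P" and g: "?g \<in> Ce K" "tgt ?g = T0 P"
        using yi yj wi wj oi oj A[OF i] A[OF j] i j ne d(2-6) og G by simp_all
      have pa: "T2 f ** ?a = bnd (T0 (As ! i)) B (ys ! i) (w' j ** ?ni)"
        using push[of "ys ! i" "T0 (As ! i)" "w j" ?ni] yi oi wj A[OF i] i j ne w' by simp
      have pb: "T2 f ** ?b = bnd (T0 (As ! j)) B (ys ! j) (w' i ** ?nj)"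
        using push[of "ys ! j" "T0 (As ! j)" "w i" ?nj] yj oj wi A[OF j] i j ne w' by simp
      have pg: "T2 f ** ?g = bnd ?C B ?G ((T2 f ** h) ** ?ng)"
        by (rule push) (use G og A[OF i] A[OF j] d(3-6) in simp_all)
      have pL: "T2 f ** ?L = w' i ** tup Z (ys[j := \<mu>2 (As ! j) ** ys ! j])" "T2 f ** ?R = w' j ** tup Z (ys[i := \<mu>2 (As ! i) ** ys ! i])"
        using wi wj ui uj T w' i j by simp_all
      have "T2 f ** (?L \<cdot> ?a) = (T2 f ** ?L) \<cdot> (T2 f ** ?a)"
        by (rule whisker_vcomp_left[OF a(1) L(1) T(4) cmp(1)]) (use a T in simp)
      moreover have "T2 f ** (?R \<cdot> (?b \<cdot> ?g)) = (T2 f ** ?R) \<cdot> (T2 f ** (?b \<cdot> ?g))"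
        by (rule whisker_vcomp_left[OF vcomp_typing(1)[OF g(1) b(1) cmp(3)] L(3) T(4)])
          (use vcomp_typing(3,5)[OF g(1) b(1) cmp(3)] cmp(2) g T in simp_all)
      moreover have "T2 f ** (?b \<cdot> ?g) = (T2 f ** ?b) \<cdot> (T2 f ** ?g)"
        by (rule whisker_vcomp_left[OF g(1) b(1) T(4) cmp(3)]) (use g T in simp)
      moreover have "?L \<cdot> ?a = ?R \<cdot> (?b \<cdot> ?g)" using fc[unfolded fel_coh_def, rule_format, OF j ij e c] .
      ultimately show ?thesis unfolding pa pb pg pL by simp
    qed
  qed
  show ?thesis using 1 2 3 4 by (simp add: fel_def)
qed


end

section \<open>The free construction on 1-cells and on 2-cells\<close>

context symmetric_pseudo_commutative_strong_two_monad
begin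

text \<open>The image of \<open>f\<close> as a unary 1-cell has an identity structure 2-cell, so
  composing with it only whiskers those of \<open>\<omega>\<close>. This gives one formula for the
  separate clauses with no, one and several inputs.\<close>

lemma free1_eq:
  assumes "set As \<subseteq> Ob K" "f \<in> hom1 K (nprod As) B"
  shows "free1 As B f = (T1 f \<odot> fst (\<omega>n_cell As), map (\<lambda>w. T2 (id2 f) ** w) (snd (\<omega>n_cell As)))"
proof -
  let ?P = "nprod As"
  have f: "f \<in> Ar K" "dom1 K f = ?P" "cod1 K f = B" using assms(2) by (simp_all add: hom1_def)
  have P: "?P \<in> Ob K" and B: "B \<in> Ob K" using assms(1) f by auto
  note o = \<omega>n_fel[OF assms(1)] and d = om_dt[OF assms(1)]
  show ?thesis
  proof (cases "length As \<le> 1")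
    case True
    show ?thesis
    proof (cases As)
      case Nil
      then show ?thesis by (simp add: free1_def \<omega>n_cell_Nil)
    next
      case (Cons A Cs)
      then have A: "As = [A]" using True by simp
      have "T1 f \<odot> id1 (T0 A) = T1 f" using comp1_id_right[of "T1 f" "T0 A" "T0 B"] f A by (simp add: hom1_def)
      then show ?thesis using f P A by (simp add: free1_def free1_unary_def \<omega>n_cell_single)
    qed
  next
    case False
    let ?fs = "[id2 (T1 f \<odot> \<mu> ?P)]"
    let ?c = "alg_comp1 (map (map Free) [As]) (T1 f, ?fs) [\<omega>n_cell As]"
    have e: "free1 As B f = ?c"
      using False f by (auto simp: free1_def free1_unary_def)
    have "fel [?P] B (T2 (id2 f) ** id2 (id1 (T0 ?P))) (\<lambda>i. ?fs ! i)"
      by (rule fel_whisker[OF fel_single[OF P]]) (use f P in simp_all)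
    then have F1: "fel_typ [?P] B (id2 (T1 f)) (\<lambda>i. ?fs ! i)" using f P by (simp add: fel_def)
    have F2: "T1 f \<in> Ar K" using f by simp
    have ll: "length [As] = length [?P]" "length [\<omega>n_cell As] = length [?P]" by simp_all
    have G: "\<forall>j<length [?P]. fst ([\<omega>n_cell As] ! j) \<in> Ar K \<and> fel_typ ([As] ! j) ([?P] ! j) (id2 (fst ([\<omega>n_cell As] ! j))) (\<lambda>i. snd ([\<omega>n_cell As] ! j) ! i)"
      using o by (simp add: fel_def)
    note ty = comp_fst_typing[OF F1 F2 ll G] and ln = comp_length[OF F1 F2 ll G]
      and st = comp_snd_typing[OF F1 F2 ll G, of 0] and se = comp_snd_ntuple2[OF F1 F2 ll G, of 0]
    have oc: "cod1 K (fst (\<omega>n_cell As)) = T0 ?P" "fst (\<omega>n_cell As) \<in> Ar K" using d(5) o by simp_all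
    have 1: "fst ?c = T1 f \<odot> fst (\<omega>n_cell As)"
    proof -
      have "id2 (fst ?c) = id2 (T1 f) ** (nmap2 (map id2 (map fst [\<omega>n_cell As])) ** id2 (regroup [map T0 As]))"
        using ty(4) by simp
      also have "\<dots> = id2 (T1 f \<odot> fst (\<omega>n_cell As))"
        using regroup_single[OF map_T0_Ob[OF assms(1)]] d(3-6) oc f by (simp add: nmap2_single)
      finally have e2: "id2 (fst ?c) = id2 (T1 f \<odot> fst (\<omega>n_cell As))" .
      show ?thesis by (rule id2_inject[THEN iffD1, OF ty(1) _ e2]) (use f oc in simp)
    qed
    have 2: "snd ?c = map (\<lambda>w. T2 (id2 f) ** w) (snd (\<omega>n_cell As))"
    proof (rule nth_equalityI)
      show "length (snd ?c) = length (map (\<lambda>w. T2 (id2 f) ** w) (snd (\<omega>n_cell As)))" using ln o by simp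
      fix i assume "i < length (snd ?c)"
      then have i: "i < length As" using ln by simp
      let ?Y = "(map T0 As)[i := T0 (T0 (As ! i))]"
      have Y: "set ?Y \<subseteq> Ob K" using update_Ob[OF map_T0_Ob[OF assms(1)]] assms(1) i by simp
      have p: "els (nprod ?Y) ?Y (projs ?Y)" "idcs (projs ?Y)" using Y by (simp_all add: idcs_projs)
      have ps: "elss (nprod ?Y) ((map (map T0) [As])[0 := (map T0 ([As] ! 0))[i := T0 (T0 ([As] ! 0 ! i))]]) [projs ?Y]"
        using p(1) Y by (simp add: elss_def)
      have t: "snd ?c ! i \<in> Ce K" "src (snd ?c ! i) = nprod ?Y" using st[of i] i by simp_all
      define V w where "V = V\<omega> As i (nprod ?Y) (projs ?Y)" and "w = w\<omega> As i"
      note v = V\<omega>_eq(2-4)[OF assms(1) i p(1), folded V_def] V\<omega>_eq(5,6)[OF assms(1) i p, folded V_def w_def] and w = d(7-9)[OF i, folded w_def]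
      have wi: "w ** tup (nprod ?Y) (projs ?Y) = w" using Y w by simp
      \<comment> \<open>The outer factor is the identity on the source of the inner one and drops
        out of the vertical composite.\<close>
      have wd: "id2 (T1 f \<odot> \<mu> ?P) ** V = T2 (id2 f) ** dm w" using v(5) v(1-4) f P unfolding wi by simp
      have "snd ?c ! i = snd ?c ! (length (concat (take 0 [As])) + i) ** tup (nprod ?Y) (concat [projs ?Y])"
        using t Y by simp
      also have "\<dots> = (id2 (T1 f) ** (w ** tup (nprod ?Y) (projs ?Y))) \<cdot> (id2 (T1 f \<odot> \<mu> ?P) ** V)"
        using se[OF _ _ ps] i p(2) unfolding V_def w_def by simp
      also have "\<dots> = T2 (id2 f) ** w"
        unfolding wd wi T1_typing(4)[OF f(1)] by (rule vcomp_idc(2)) (use w f in simp_all)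
      finally show "snd ?c ! i = map (\<lambda>w. T2 (id2 f) ** w) (snd (\<omega>n_cell As)) ! i" using i o unfolding w_def by simp
    qed
    show ?thesis unfolding e using 1 2 by (simp add: prod_eq_iff)
  qed
qed

lemma free1_fel:
  assumes "set As \<subseteq> Ob K" "f \<in> hom1 K (nprod As) B"
  shows "fel As B (id2 (fst (free1 As B f))) (\<lambda>i. snd (free1 As B f) ! i)" "free1 As B f \<in> alg_cells1 (map Free As) (Free B)"
    "fst (free1 As B f) \<in> Ar K" "id2 (fst (free1 As B f)) = T2 (id2 f) ** om As" "length (snd (free1 As B f)) = length As"
    "i < length As \<Longrightarrow> snd (free1 As B f) ! i = T2 (id2 f) ** w\<omega> As i"
proof -
  have f: "f \<in> Ar K" "dom1 K f = nprod As" "cod1 K f = B" using assms(2) by (simp_all add: hom1_def)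
  note o = \<omega>n_fel[OF assms(1)] and e = free1_eq[OF assms]
  note d = om_dt(3-6)[OF assms(1)]
  have c: "cod1 K (fst (\<omega>n_cell As)) = T0 (nprod As)" using d(3) o by simp
  show a: "fst (free1 As B f) \<in> Ar K" and i: "id2 (fst (free1 As B f)) = T2 (id2 f) ** om As"
    unfolding e using f o c by simp_all
  show l: "length (snd (free1 As B f)) = length As" and w: "i < length As \<Longrightarrow> snd (free1 As B f) ! i = T2 (id2 f) ** w\<omega> As i" for i
    unfolding e using o by simp_all
  show F: "fel As B (id2 (fst (free1 As B f))) (\<lambda>i. snd (free1 As B f) ! i)"
    unfolding i by (rule fel_whisker[OF o[THEN conjunct1]]) (use f w in simp_all)
  show "free1 As B f \<in> alg_cells1 (map Free As) (Free B)"
    using fel_alg_cells1[OF F a l] by simp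
qed

lemma free2_eq:
  assumes "set As \<subseteq> Ob K" "\<alpha> \<in> Ce K" "src \<alpha> = nprod As" "tgt \<alpha> = B"
  shows "free2 As B \<alpha> = (free1 As B (dom2 K \<alpha>), T2 \<alpha> ** om As, free1 As B (cod2 K \<alpha>))"
proof (cases "length As \<le> 1")
  case True
  show ?thesis
  proof (cases As)
    case Nil
    then show ?thesis by (simp add: free2_def \<omega>n_cell_Nil Let_def)
  next
    case (Cons A Cs)
    then have "As = [A]" using True by simp
    then show ?thesis using assms by (simp add: free2_def free1_def \<omega>n_cell_single Let_def)
  qed
next
  case False
  have fX: "map (map fst) [map Free As] = [map T0 As]" by (simp add: Free_def)
  note d = om_dt(3-6)[OF assms(1)]
  have "(T2 \<alpha> ** nmap2 (map (fst \<circ> snd) [(\<omega>n_cell As, om As, \<omega>n_cell As)])) \<rhd> regroup [map T0 As] = T2 \<alpha> ** om As"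
    using regroup_single[OF map_T0_Ob[OF assms(1)]] d assms by (simp add: nmap2_single)
  then show ?thesis using False unfolding free2_def alg_comp2_def Let_def case_prod_conv fX
    by (auto simp: free1_def)
qed

text \<open>The compatibility square is interchange of \<open>T2 \<alpha>\<close> with a structure
  2-cell of \<open>\<omega>\<close>, combined with 2-naturality of \<open>\<mu>\<close>.\<close>

lemma free2_cells2:
  assumes "set As \<subseteq> Ob K" "\<alpha> \<in> Ce K" "dom2 K \<alpha> \<in> hom1 K (nprod As) B" "cod2 K \<alpha> \<in> hom1 K (nprod As) B"
  shows "(free1 As B (dom2 K \<alpha>), T2 \<alpha> ** om As, free1 As B (cod2 K \<alpha>)) \<in> alg_cells2 (map Free As) (Free B)"
proof -
  have st: "src \<alpha> = nprod As" "tgt \<alpha> = B" using assms(3) by (simp_all add: src_def tgt_def hom1_def)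
  have B: "B \<in> Ob K" using st assms(2) by auto
  note o = \<omega>n_fel[OF assms(1)] and d = om_dt(3-6)[OF assms(1)] and F = free1_fel[OF assms(1,3)] and G = free1_fel[OF assms(1,4)]
  have W: "\<omega>n_cell As \<in> alg_cells1 (map Free As) (Free (nprod As))"
    using fel_alg_cells1[of As "nprod As" "fst (\<omega>n_cell As)" "snd (\<omega>n_cell As)"] o by simp
  note D = alg_cells1_FreeD[OF W assms(1) nprod_Ob[OF assms(1)]]
  show ?thesis
    unfolding alg_cells2_Free_iff
  proof (intro conjI allI impI F(2) G(2))
    show "T2 \<alpha> ** om As \<in> hom2 K (fst (free1 As B (dom2 K \<alpha>))) (fst (free1 As B (cod2 K \<alpha>)))"
      using d assms(2) st o unfolding hom2_def free1_eq[OF assms(1,3)] free1_eq[OF assms(1,4)] by simp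
    fix i assume i: "i < length As"
    note S = slot_tn_Free[OF assms(1) i]
    define s k w where "s = id2 (slot (map T0 As) i (\<mu> (As ! i)))" and "k = id2 (tn (map T0 As) i)" and "w = w\<omega> As i"
    have s: "s \<in> Ce K" "tgt s = nprod (map T0 As)" and k: "k \<in> Ce K" "tgt k = T0 (nprod (map T0 As))"
      unfolding s_def k_def using S by simp_all
    note w = D(5,7-9)[OF i, folded w_def s_def k_def]
    have "((T2 \<alpha> ** om As) ** s) \<cdot> (T2 (id2 (dom2 K \<alpha>)) ** w) = (T2 \<alpha> ** cm w) \<cdot> (dm (T2 \<alpha>) ** w)"
      using w s d assms(2) st by (simp add: dm_def[of \<alpha>])
    also have "\<dots> = (cm (T2 \<alpha>) ** w) \<cdot> (T2 \<alpha> ** dm w)"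
      using hcomp_vcomp1[of w "T2 \<alpha>"] hcomp_vcomp2[of w "T2 \<alpha>"] w assms(2) st by simp
    also have "T2 \<alpha> ** dm w = \<mu>2 B ** (T2 (T2 \<alpha> ** om As) ** k)"
      unfolding w(3) using \<mu>_nat_assoc[of \<alpha> "T2 (om As) ** k"] d k assms(2) st o by simp
    finally show "((T2 \<alpha> ** om As) ** id2 (slot (map T0 As) i (\<mu> (As ! i)))) \<cdot> snd (free1 As B (dom2 K \<alpha>)) ! i
       = snd (free1 As B (cod2 K \<alpha>)) ! i \<cdot> (\<mu>2 B ** (T2 (T2 \<alpha> ** om As) ** id2 (tn (map T0 As) i)))"
      unfolding F(6)[OF i] G(6)[OF i] w_def[symmetric] s_def[symmetric] k_def[symmetric] using assms(2) by (simp add: cm_def)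
  qed
qed

end

section \<open>Functoriality and preservation of composition\<close>

context symmetric_pseudo_commutative_strong_two_monad
begin

text \<open>With \<open>T2 \<alpha> ** om As\<close> as the uniform value on 2-cells, functoriality
  is that of \<open>T2\<close> and of precomposition with the 1-cell \<open>om As\<close>.\<close>

lemma free_functor:
  assumes "set As \<subseteq> Ob K" "B \<in> Ob K"
  shows "is_functor (MHom K_multi As B) (MHom T_Alg (map Free As) (Free B)) (free1 As B) (free2 As B)"
proof -
  note o = \<omega>n_fel[OF assms(1)] and d = om_dt(3-6)[OF assms(1)]
  have ar: "f \<in> Ar K" if "f \<in> hom1 K (nprod As) B" for f using that by (simp add: hom1_def)
  have e2: "free2 As B \<alpha> = (free1 As B (dom2 K \<alpha>), T2 \<alpha> ** om As, free1 As B (cod2 K \<alpha>))"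
    if "\<alpha> \<in> Ce K" "dom2 K \<alpha> \<in> hom1 K (nprod As) B" for \<alpha>
    by (rule free2_eq[OF assms(1)]) (use that in \<open>simp_all add: src_def tgt_def hom1_def\<close>)
  have idp: "free2 As B (id2 f) = (free1 As B f, id2 (fst (free1 As B f)), free1 As B f)" if f: "f \<in> hom1 K (nprod As) B" for f
    using e2[of "id2 f"] ar[OF f] f free1_fel(4)[OF assms(1) f] by simp
  have cp: "free2 As B (\<beta> \<cdot> \<alpha>) = (free1 As B (dom2 K \<alpha>), (T2 \<beta> ** om As) \<cdot> (T2 \<alpha> ** om As), free1 As B (cod2 K \<beta>))"
    if a: "\<alpha> \<in> Ce K" "\<beta> \<in> Ce K" "cod2 K \<alpha> = dom2 K \<beta>" "dom2 K \<alpha> \<in> hom1 K (nprod As) B" for \<alpha> \<beta>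
  proof -
    have c: "cm \<alpha> = dm \<beta>" using a by (simp add: dm_eq_iff)
    have v: "\<beta> \<cdot> \<alpha> \<in> Ce K" "dom2 K (\<beta> \<cdot> \<alpha>) = dom2 K \<alpha>" "cod2 K (\<beta> \<cdot> \<alpha>) = cod2 K \<beta>"
      using vcomp_in[of \<alpha> "dom2 K \<alpha>" "cod2 K \<alpha>" \<beta> "cod2 K \<beta>"] a by (auto simp: hom2_def)
    have s: "src \<alpha> = nprod As" "src \<beta> = nprod As" using a dom1_dom2_src[OF a(1)] dom1_dom2_src[OF a(2)] by (auto simp: hom1_def)
    show ?thesis using e2[OF v(1)] v a c s d by simp
  qed
  have "f \<in> hom1 K (nprod As) B \<Longrightarrow> free1 As B f \<in> alg_cells1 (map Free As) (Free B)" for f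
    by (rule free1_fel(2)[OF assms(1)])
  moreover have "free2 As B \<alpha> \<in> alg_cells2 (map Free As) (Free B)"
    if "\<alpha> \<in> Ce K" "dom2 K \<alpha> \<in> hom1 K (nprod As) B" "cod2 K \<alpha> \<in> hom1 K (nprod As) B" for \<alpha>
    unfolding e2[OF that(1,2)] by (rule free2_cells2[OF assms(1) that])
  ultimately show ?thesis
    using category_K_multi[OF assms] category_alg_hom_Free[OF assms] e2 idp cp
    unfolding is_functor_def T_Alg_def by (simp add: K_multi_def alg_hom_def)
qed

lemma concat_offset:
  "s < length (concat xss) \<Longrightarrow> \<exists>j d. j < length xss \<and> d < length (xss ! j) \<and> s = length (concat (take j xss)) + d"
proof (induction xss rule: rev_induct)
  case (snoc xs xss)
  show ?case
  proof (cases "s < length (concat xss)")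
    case True
    with snoc.IH obtain j d where "j < length xss" "d < length (xss ! j)" "s = length (concat (take j xss)) + d" by blast
    then show ?thesis by (intro exI[of _ j] exI[of _ d]) (simp add: nth_append)
  next
    case False
    then show ?thesis using snoc.prems by (intro exI[of _ "length xss"] exI[of _ "s - length (concat xss)"]) (simp add: nth_append)
  qed
qed simp

lemma free1_unit: "A \<in> Ob K \<Longrightarrow> free1 [A] A (id1 A) = alg_unit (Free A)"
  using T1_id[of A] comp1_id_left[OF \<mu>_in[of A]] by (simp add: free1_def free1_unary_def alg_unit_Free)

text \<open>Associativity \<open>om_concat\<close> absorbs the regrouping, and naturality
  \<open>om_nat\<close> then distributes the 2-cells \<open>\<beta>s\<close> over the
  entries.\<close>

lemma free_om:
  assumes "\<forall>As \<in> set Ass. set As \<subseteq> Ob K" "map src \<beta>s = map nprod Ass" "map tgt \<beta>s = Bs" "\<forall>\<beta> \<in> set \<beta>s. \<beta> \<in> Ce K"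
    "\<alpha> \<in> Ce K" "src \<alpha> = nprod Bs" "elss Z (map (map T0) Ass) xss"
  shows "T2 ((\<alpha> ** nmap2 \<beta>s) ** id2 (regroup Ass)) ** (om (concat Ass) ** tup Z (concat xss))
    = T2 \<alpha> ** (om Bs ** tup Z (map2 (\<lambda>\<beta> x. T2 \<beta> ** x) \<beta>s (oms Z Ass xss)))"
proof -
  have C: "set (concat Ass) \<subseteq> Ob K" using assms(1) by auto
  have ec: "els Z (map T0 (concat Ass)) (concat xss)" using elss_concat[OF assms(7)] by (simp add: map_concat)
  note r = regroup_typing(1-3)[OF assms(1)] and n = nmap2_typing[OF assms(4), unfolded assms(2,3)] and u = om_ty(1-3)[OF C ec]
  note o = els_oms(1)[OF assms(1,7)]
  have "T2 ((\<alpha> ** nmap2 \<beta>s) ** id2 (regroup Ass)) ** (om (concat Ass) ** tup Z (concat xss))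
     = T2 \<alpha> ** (T2 (nmap2 \<beta>s) ** (T2 (id2 (regroup Ass)) ** (om (concat Ass) ** tup Z (concat xss))))"
    using r n u assms(5,6) by simp
  then show ?thesis
    unfolding om_concat[OF assms(1,7)] using om_nat[OF assms(4), of Z "oms Z Ass xss"] o unfolding assms(2,3) by simp
qed

text \<open>Compared at the generic tuple, cut into blocks. Applied to identity 2-cells it also
  gives the equation of underlying 1-cells for composites of 1-cells.\<close>

lemma free2_cell_comp:
  assumes "\<forall>As \<in> set Ass. set As \<subseteq> Ob K" "set Bs \<subseteq> Ob K" "length Ass = length Bs"
    "map src \<beta>s = map nprod Ass" "map tgt \<beta>s = Bs" "\<forall>\<beta> \<in> set \<beta>s. \<beta> \<in> Ce K" "\<alpha> \<in> Ce K" "src \<alpha> = nprod Bs"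
  defines "\<gamma>s \<equiv> map (\<lambda>j. T2 (\<beta>s ! j) ** om (Ass ! j)) [0..<length Bs]"
  shows "T2 ((\<alpha> ** nmap2 \<beta>s) \<rhd> regroup Ass) ** om (concat Ass) = (T2 \<alpha> ** om Bs) ** (nmap2 \<gamma>s ** id2 (regroup (map (map T0) Ass)))"
    "(T2 \<alpha> ** om Bs) ** (nmap2 \<gamma>s ** id2 (regroup (map (map T0) Ass))) = ((T2 \<alpha> ** om Bs) ** nmap2 \<gamma>s) \<rhd> regroup (map (map T0) Ass)"
proof -
  have AO: "set (Ass ! j) \<subseteq> Ob K" if "j < length Bs" for j using assms(1,3) that by simp
  have C: "set (concat Ass) \<subseteq> Ob K" using assms(1) by auto
  have lb: "length \<beta>s = length Bs" using arg_cong[OF assms(5), of length] by simp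
  have bty: "\<beta>s ! j \<in> Ce K" "src (\<beta>s ! j) = nprod (Ass ! j)" "tgt (\<beta>s ! j) = Bs ! j" if j: "j < length Bs" for j
    using assms(3,6) arg_cong[OF assms(4), of "\<lambda>l. l ! j"] arg_cong[OF assms(5), of "\<lambda>l. l ! j"] j lb by simp_all
  have XO: "\<forall>X \<in> set (map (map T0) Ass). set X \<subseteq> Ob K" using assms(1) by (auto intro!: T0_in)
  note rT = regroup_typing(1-3)[OF XO] and oB = om_dt(3-6)[OF assms(2)] and oC = om_dt(3-6)[OF C]
  have gs: "\<forall>\<gamma> \<in> set \<gamma>s. \<gamma> \<in> Ce K" "map src \<gamma>s = map nprod (map (map T0) Ass)" "map tgt \<gamma>s = map T0 Bs"
    unfolding \<gamma>s_def using bty om_dt(3-6)[OF AO] assms(3) by (auto intro!: nth_equalityI)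
  note ng = nmap2_typing[OF gs(1), unfolded gs(2,3)]
  show "(T2 \<alpha> ** om Bs) ** (nmap2 \<gamma>s ** id2 (regroup (map (map T0) Ass))) = ((T2 \<alpha> ** om Bs) ** nmap2 \<gamma>s) \<rhd> regroup (map (map T0) Ass)"
    by (rule hcomp_assoc'[symmetric]) (use rT ng oB assms(7,8) in simp_all)
  obtain xss where x: "elss (nprod (concat (map (map T0) Ass))) (map (map T0) Ass) xss" "concat xss = projs (concat (map (map T0) Ass))"
    "\<forall>xs \<in> set xss. \<forall>x \<in> set xs. idc x"
    by (rule elss_projs[OF XO])
  let ?Z = "nprod (concat (map (map T0) Ass))"
  have cT: "concat (map (map T0) Ass) = map T0 (concat Ass)" by (simp add: map_concat)
  have id: "tup ?Z (concat xss) = id2 (id1 ?Z)"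
    unfolding x(2) by (rule ntuple2_projs) (use XO in auto)
  \<comment> \<open>The entries agree one by one: each is \<open>T2\<close> of some
    \<open>\<beta>\<close> after the iterated \<open>\<omega>\<close> of a block.\<close>
  have m: "map2 (\<star>) \<gamma>s (map (tup ?Z) xss) = map2 (\<lambda>\<beta> x. T2 \<beta> ** x) \<beta>s (oms ?Z Ass xss)"
  proof (rule nth_equalityI)
    fix j assume "j < length (map2 (\<star>) \<gamma>s (map (tup ?Z) xss))"
    then have j: "j < length Bs" by (simp add: \<gamma>s_def)
    have "els ?Z (map T0 (Ass ! j)) (xss ! j)" using elssD(3)[OF x(1), of j] j assms(3) by simp
    then show "map2 (\<star>) \<gamma>s (map (tup ?Z) xss) ! j = map2 (\<lambda>\<beta> x. T2 \<beta> ** x) \<beta>s (oms ?Z Ass xss) ! j"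
      unfolding \<gamma>s_def using bty[OF j] om_dt(3-6)[OF AO[OF j]] j assms(3) lb elssD(1)[OF x(1)] by simp
  qed (use assms(3) lb elssD(1)[OF x(1)] in \<open>simp add: \<gamma>s_def\<close>)
  note ex = els_map_ntuple2[OF x(1)]
  have el: "els ?Z (map T0 Bs) (map2 (\<star>) \<gamma>s (map (tup ?Z) xss))"
    using els_map2[OF gs(1), of ?Z "map (tup ?Z) xss"] ex unfolding gs(2,3) by blast
  have nn: "nmap2 \<gamma>s ** tup ?Z (map (tup ?Z) xss) = tup ?Z (map2 (\<star>) \<gamma>s (map (tup ?Z) xss))"
    using nmap2_ntuple2[OF gs(1), of ?Z "map (tup ?Z) xss"] ex unfolding gs(2) by blast
  have "id2 (regroup (map (map T0) Ass)) = tup ?Z (map (tup ?Z) xss)"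
    using regroup_ntuple2[OF x(1)] rT unfolding id by simp
  then have "(T2 \<alpha> ** om Bs) ** (nmap2 \<gamma>s ** id2 (regroup (map (map T0) Ass))) = (T2 \<alpha> ** om Bs) ** (nmap2 \<gamma>s ** tup ?Z (map (tup ?Z) xss))"
    by simp
  also have "\<dots> = T2 \<alpha> ** (om Bs ** tup ?Z (map2 (\<lambda>\<beta> x. T2 \<beta> ** x) \<beta>s (oms ?Z Ass xss)))"
    unfolding nn m[symmetric] by (rule hcomp_assoc') (use oB assms(7,8) el in simp_all)
  also have "\<dots> = T2 ((\<alpha> ** nmap2 \<beta>s) \<rhd> regroup Ass) ** (om (concat Ass) ** tup ?Z (concat xss))"
    by (rule free_om[OF assms(1,4-8) x(1), symmetric])
  also have "\<dots> = T2 ((\<alpha> ** nmap2 \<beta>s) \<rhd> regroup Ass) ** om (concat Ass)" unfolding id unfolding cT using oC by simp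
  finally show "T2 ((\<alpha> ** nmap2 \<beta>s) \<rhd> regroup Ass) ** om (concat Ass) = (T2 \<alpha> ** om Bs) ** (nmap2 \<gamma>s ** id2 (regroup (map (map T0) Ass)))" by simp
qed

text \<open>On underlying 1-cells this is \<open>free2_cell_comp\<close>. Structure 2-cells are
  compared at the generic tuple of each place: naturality of \<open>\<omega>\<close> and of its
  structure 2-cells turns the composition formula into the right-hand side of
  \<open>w\<omega>_concat\<close>.\<close>

lemma free1_comp:
  assumes "\<forall>As \<in> set Ass. set As \<subseteq> Ob K" "set Bs \<subseteq> Ob K" "length Ass = length Bs" "length gs = length Bs"
    and f: "f \<in> hom1 K (nprod Bs) C" and g: "\<forall>j<length Bs. gs ! j \<in> hom1 K (nprod (Ass ! j)) (Bs ! j)"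
  shows "free1 (concat Ass) C (f \<odot> nmap1 gs \<odot> regroup Ass)
    = alg_comp1 (map (map Free) Ass) (free1 Bs C f) (map (\<lambda>j. free1 (Ass ! j) (Bs ! j) (gs ! j)) [0..<length Bs])"
proof -
  let ?Gs = "map (\<lambda>j. free1 (Ass ! j) (Bs ! j) (gs ! j)) [0..<length Bs]"
  let ?h = "f \<odot> nmap1 gs \<odot> regroup Ass"
  let ?\<beta> = "map id2 gs"
  obtain F fs where Ff: "free1 Bs C f = (F, fs)" by (cases "free1 Bs C f")
  let ?c = "alg_comp1 (map (map Free) Ass) (F, fs) ?Gs"
  have fA: "f \<in> Ar K" "dom1 K f = nprod Bs" "cod1 K f = C" using f by (simp_all add: hom1_def)
  have gA: "gs ! j \<in> Ar K" "dom1 K (gs ! j) = nprod (Ass ! j)" "cod1 K (gs ! j) = Bs ! j" if "j < length Bs" for j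
    using g that by (auto simp: hom1_def)
  have gs: "\<forall>g \<in> set gs. g \<in> Ar K" "map (dom1 K) gs = map nprod Ass" "map (cod1 K) gs = Bs"
    using gA assms(3,4) by (auto simp: in_set_conv_nth intro!: nth_equalityI)
  have \<beta>: "\<forall>\<beta> \<in> set ?\<beta>. \<beta> \<in> Ce K" "map src ?\<beta> = map nprod Ass" "map tgt ?\<beta> = Bs" "idcs ?\<beta>"
    unfolding gs(2,3)[symmetric] using gs(1) by (auto simp: idcs_def)
  have AO: "set (Ass ! j) \<subseteq> Ob K" if "j < length Bs" for j using assms(1,3) that by simp
  have C: "set (concat Ass) \<subseteq> Ob K" using assms(1) by auto
  note n = id2_nmap1[OF gs(1), unfolded gs(2,3)] and r = regroup_typing(1-3)[OF assms(1)]
  have h: "?h \<in> hom1 K (nprod (concat Ass)) C" "id2 ?h = (id2 f ** nmap2 ?\<beta>) ** id2 (regroup Ass)"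
    using n r fA nmap2_typing[OF \<beta>(1), unfolded \<beta>(2,3)] by (simp_all add: hom1_def)
  note FF = free1_fel[OF assms(2) f, unfolded Ff fst_conv snd_conv] and H = free1_fel[OF C h(1)]
  have FG: "fel (Ass ! j) (Bs ! j) (id2 (fst (?Gs ! j))) (\<lambda>i. snd (?Gs ! j) ! i)" "fst (?Gs ! j) \<in> Ar K"
     "id2 (fst (?Gs ! j)) = T2 (id2 (gs ! j)) ** om (Ass ! j)" "length (snd (?Gs ! j)) = length (Ass ! j)"
     "i < length (Ass ! j) \<Longrightarrow> snd (?Gs ! j) ! i = T2 (id2 (gs ! j)) ** w\<omega> (Ass ! j) i"
     if j: "j < length Bs" for j i
  proof -
    have e: "?Gs ! j = free1 (Ass ! j) (Bs ! j) (gs ! j)" using j by simp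
    note q = free1_fel[OF AO[OF j] g[rule_format, OF j]]
    show "fel (Ass ! j) (Bs ! j) (id2 (fst (?Gs ! j))) (\<lambda>i. snd (?Gs ! j) ! i)" "fst (?Gs ! j) \<in> Ar K"
     "id2 (fst (?Gs ! j)) = T2 (id2 (gs ! j)) ** om (Ass ! j)" "length (snd (?Gs ! j)) = length (Ass ! j)"
     "i < length (Ass ! j) \<Longrightarrow> snd (?Gs ! j) ! i = T2 (id2 (gs ! j)) ** w\<omega> (Ass ! j) i" unfolding e using q by blast+
  qed
  have P1: "fel_typ Bs C (id2 F) (\<lambda>i. fs ! i)" using FF(1) by (simp add: fel_def)
  have P4: "\<forall>j<length Bs. fst (?Gs ! j) \<in> Ar K \<and> fel_typ (Ass ! j) (Bs ! j) (id2 (fst (?Gs ! j))) (\<lambda>i. snd (?Gs ! j) ! i)"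
    using FG(1,2) unfolding fel_def by blast
  have lG: "length ?Gs = length Bs" by simp
  note ty = comp_fst_typing[OF P1 FF(3) assms(3) lG P4]
    and ln = comp_length[OF P1 FF(3) assms(3) lG P4] and st = comp_snd_typing[OF P1 FF(3) assms(3) lG P4]
    and se = comp_snd_ntuple2[OF P1 FF(3) assms(3) lG P4]
  note om = om_dt[OF C]
  have f2: "id2 f \<in> Ce K" "src (id2 f) = nprod Bs" "tgt (id2 f) = C" "idc (id2 f)" using fA by simp_all
  note oB = om_dt[OF assms(2)]
  have 1: "fst (free1 (concat Ass) C ?h) = fst ?c"
  proof (rule id2_inject[THEN iffD1, OF H(3) ty(1)])
    have m: "map (\<lambda>j. T2 (?\<beta> ! j) ** om (Ass ! j)) [0..<length Bs] = map id2 (map fst ?Gs)"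
      using FG(3) assms(4) by (auto simp del: id2_typing)
    show "id2 (fst (free1 (concat Ass) C ?h)) = id2 (fst ?c)"
      unfolding H(4) h(2) ty(4) FF(4) by (rule free2_cell_comp(1)[OF assms(1-3) \<beta>(2,3,1) f2(1,2), unfolded m])
  qed
  have 2: "snd (free1 (concat Ass) C ?h) = snd ?c"
  proof (rule nth_equalityI)
    show "length (snd (free1 (concat Ass) C ?h)) = length (snd ?c)" using H(5) ln by simp
    fix s assume "s < length (snd (free1 (concat Ass) C ?h))"
    then have s: "s < length (concat Ass)" using H(5) by simp
    obtain j d where jd: "j < length Ass" "d < length (Ass ! j)" "s = length (concat (take j Ass)) + d"
      using s concat_offset by blast
    have j: "j < length Bs" using jd(1) assms(3) by simp
    let ?Y = "slotted Ass j d"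
    let ?Z = "nprod (concat ?Y)"
    have YO: "\<forall>X \<in> set ?Y. set X \<subseteq> Ob K"
      unfolding all_set_conv_all_nth
    proof (intro allI impI)
      fix k assume "k < length ?Y"
      then have k: "k < length Ass" by (simp add: slotted_simps)
      have "Ass ! j ! d \<in> Ob K" using AO[OF j] jd(2) by simp
      then show "set (?Y ! k) \<subseteq> Ob K"
        using map_T0_Ob[OF AO, of k] update_Ob[OF map_T0_Ob[OF AO[OF j]]] k jd(1) assms(3)
        by (cases "k = j") (simp_all add: slotted_nth)
    qed
    obtain zss where z: "elss ?Z ?Y zss" "concat zss = projs (concat ?Y)" "\<forall>zs \<in> set zss. \<forall>z \<in> set zs. idc z"
      by (rule elss_projs[OF YO])
    have zi: "\<forall>zs \<in> set zss. idcs zs" using z(3) by (simp add: idcs_def)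
    have lz: "length zss = length Bs" using elssD(1)[OF z(1)] assms(3) by (simp add: slotted_simps)
    have id: "tup ?Z (concat zss) = id2 (id1 ?Z)"
      unfolding z(2) by (rule ntuple2_projs) (use YO in auto)
    have cY: "concat ?Y = (map T0 (concat Ass))[s := T0 (T0 (concat Ass ! s))]"
      using concat_slotted[OF jd(1,2)] unfolding jd(3)[symmetric] .
    have ej: "els ?Z ((map T0 (Ass ! j))[d := T0 (T0 (Ass ! j ! d))]) (zss ! j)"
      using elssD(3)[OF z(1), of j] jd(1) by (simp add: slotted_simps slotted_nth)
    note om' = om_dt(3-6)[OF AO[OF j]] and wj = om_dt(7-9)[OF AO[OF j] jd(2)]
    define W V where "W = w\<omega> (Ass ! j) d ** tup ?Z (zss ! j)" and "V = V\<omega> (Ass ! j) d ?Z (zss ! j)"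
    note os = oms_slotted[OF assms(1) jd(1,2) z(1) zi, folded W_def V_def]
    let ?o = "oms ?Z Ass zss"
    have im: "map (\<lambda>j. id2 (fst (?Gs ! j)) ** tup ?Z (zss ! j)) [0..<length Bs] ! k = T2 (?\<beta> ! k) ** ?o ! k"
      if k: "k < length Bs" "k \<noteq> j" for k
    proof -
      have e: "els ?Z (map T0 (Ass ! k)) (zss ! k)" using elssD(3)[OF z(1), of k] k jd(1) assms(3) by (simp add: slotted_simps slotted_nth)
      show ?thesis using FG(3)[OF k(1)] om_dt(3-6)[OF AO[OF k(1)]] gA[OF k(1)] e k assms(3,4) lz by (simp del: id2_typing(4))
    qed
    have gj: "?\<beta> ! j = id2 (gs ! j)" "T2 (id2 (gs ! j)) \<in> Ce K" "src (T2 (id2 (gs ! j))) = T0 (nprod (Ass ! j))"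
      "T2 (T2 (id2 (gs ! j))) \<in> Ce K" "src (T2 (T2 (id2 (gs ! j)))) = T0 (T0 (nprod (Ass ! j)))"
      using gA[OF j] j assms(4) by simp_all
    \<comment> \<open>Each entry is \<open>T2\<close> of an entry of \<open>?\<beta>\<close> applied
      to the value of an inner \<open>\<omega>\<close>, the shape to which \<open>om_nat\<close>
      applies.\<close>
    have i1: "(map (\<lambda>j. id2 (fst (?Gs ! j)) ** tup ?Z (zss ! j)) [0..<length Bs])[j := snd (?Gs ! j) ! d ** tup ?Z (zss ! j)]
       = map2 (\<lambda>\<beta> x. T2 \<beta> ** x) ?\<beta> (?o[j := W])"
    proof (rule nth_equalityI)
      fix k assume "k < length ((map (\<lambda>j. id2 (fst (?Gs ! j)) ** tup ?Z (zss ! j)) [0..<length Bs])[j := snd (?Gs ! j) ! d ** tup ?Z (zss ! j)])"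
      then have k: "k < length Bs" by simp
      have "snd (?Gs ! j) ! d ** tup ?Z (zss ! j) = T2 (id2 (gs ! j)) ** W"
        unfolding FG(5)[OF j jd(2)] W_def by (rule hcomp_assoc') (use gj wj ej in simp_all)
      then show "((map (\<lambda>j. id2 (fst (?Gs ! j)) ** tup ?Z (zss ! j)) [0..<length Bs])[j := snd (?Gs ! j) ! d ** tup ?Z (zss ! j)]) ! k
        = map2 (\<lambda>\<beta> x. T2 \<beta> ** x) ?\<beta> (?o[j := W]) ! k"
        using im[of k] gj(1) j k assms(3,4) lz by (cases "k = j") simp_all
    qed (use assms(3,4) lz in simp)
    \<comment> \<open>The same with place \<open>j\<close> one layer of \<open>T\<close> deeper, the
      shape to which \<open>w\<omega>_nat\<close> applies.\<close>
    have i2: "(map (\<lambda>j. id2 (fst (?Gs ! j)) ** tup ?Z (zss ! j)) [0..<length Bs])[j := T2 (id2 (fst (?Gs ! j))) ** (id2 (tn (map T0 (Ass ! j)) d) ** tup ?Z (zss ! j))]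
       = (map2 (\<lambda>\<beta> x. T2 \<beta> ** x) ?\<beta> (?o[j := V]))[j := T2 (T2 (?\<beta> ! j)) ** (?o[j := V]) ! j]"
    proof (rule nth_equalityI)
      fix k assume "k < length ((map (\<lambda>j. id2 (fst (?Gs ! j)) ** tup ?Z (zss ! j)) [0..<length Bs])[j := T2 (id2 (fst (?Gs ! j))) ** (id2 (tn (map T0 (Ass ! j)) d) ** tup ?Z (zss ! j))])"
      then have k: "k < length Bs" by simp
      define q where "q = id2 (tn (map T0 (Ass ! j)) d) ** tup ?Z (zss ! j)"
      have q: "q \<in> Ce K" "tgt q = T0 (nprod (map T0 (Ass ! j)))" unfolding q_def using slot_tn_Free(4-6)[OF AO[OF j] jd(2)] ej by simp_all
      have "T2 (id2 (fst (?Gs ! j))) ** q = T2 (T2 (id2 (gs ! j))) ** V"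
        unfolding FG(3)[OF j] V_def q_def[symmetric] using q gj om' gA[OF j] by simp
      then show "((map (\<lambda>j. id2 (fst (?Gs ! j)) ** tup ?Z (zss ! j)) [0..<length Bs])[j := T2 (id2 (fst (?Gs ! j))) ** (id2 (tn (map T0 (Ass ! j)) d) ** tup ?Z (zss ! j))]) ! k
        = ((map2 (\<lambda>\<beta> x. T2 \<beta> ** x) ?\<beta> (?o[j := V]))[j := T2 (T2 (?\<beta> ! j)) ** (?o[j := V]) ! j]) ! k"
        unfolding q_def[symmetric] using im[of k] gj(1) j k assms(3,4) lz by (cases "k = j") simp_all
    qed (use assms(3,4) lz in simp)
    have jb: "j < length ?\<beta>" "j < length (map nprod Ass)" using j assms(3,4) by simp_all
    have N: "set (map nprod Ass) \<subseteq> Ob K" using assms(1) by auto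
    have sj: "src (?\<beta> ! j) = map nprod Ass ! j" using arg_cong[OF \<beta>(2), of "\<lambda>l. l ! j"] jb by simp
    have n1: "om Bs ** tup ?Z (map2 (\<lambda>\<beta> x. T2 \<beta> ** x) ?\<beta> (?o[j := W])) = T2 (nmap2 ?\<beta>) ** (om (map nprod Ass) ** tup ?Z (?o[j := W]))"
      using om_nat[OF \<beta>(1), of ?Z "?o[j := W]"] os(1) unfolding \<beta>(2,3) by blast
    have n2: "w\<omega> Bs j ** tup ?Z ((map2 (\<lambda>\<beta> x. T2 \<beta> ** x) ?\<beta> (?o[j := V]))[j := T2 (T2 (?\<beta> ! j)) ** (?o[j := V]) ! j])
       = T2 (nmap2 ?\<beta>) ** (w\<omega> (map nprod Ass) j ** tup ?Z (?o[j := V]))"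
      using w\<omega>_nat[OF \<beta>(4) jb(1), of ?Z "?o[j := V]"] os(2,3) unfolding \<beta>(2,3) sj by blast
    have e1: "els ?Z (map T0 Bs) (map2 (\<lambda>\<beta> x. T2 \<beta> ** x) ?\<beta> (?o[j := W]))"
      using els_T2_map2(1)[OF \<beta>(1), of ?Z "?o[j := W]"] os(1) unfolding \<beta>(2,3) by blast
    have tj: "tgt (?\<beta> ! j) = Bs ! j" using gA[OF j] gj(1) by simp
    have e2: "els ?Z ((map T0 Bs)[j := T0 (T0 (Bs ! j))]) ((map2 (\<lambda>\<beta> x. T2 \<beta> ** x) ?\<beta> (?o[j := V]))[j := T2 (T2 (?\<beta> ! j)) ** (?o[j := V]) ! j])"
      using els_T2_map2(2)[OF \<beta>(1) jb(1), of ?Z "?o[j := V]"] os(2) unfolding \<beta>(2,3) sj tj by blast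
    note nm = nmap2_typing[OF \<beta>(1), unfolded \<beta>(2,3)] idc_nmap2[OF \<beta>(4)]
    note tb = om_ty(1-3)[OF N os(1)] and ta = w\<omega>_ty[OF N jb(2) os(2)]
    have eY: "elss ?Z ((map (map T0) Ass)[j := (map T0 (Ass ! j))[d := T0 (T0 (Ass ! j ! d))]]) zss"
      using z(1) unfolding slotted_def .
    have "snd ?c ! s = snd ?c ! s ** tup ?Z (concat zss)"
      unfolding id using st(1,2)[OF j jd(2)] unfolding jd(3)[symmetric] cY nth_concat_offset(2)[OF jd(1,2), symmetric] jd(3)[symmetric]
      by simp
    also have "\<dots> = (id2 F ** tup ?Z (map2 (\<lambda>\<beta> x. T2 \<beta> ** x) ?\<beta> (?o[j := W])))
       \<cdot> (fs ! j ** tup ?Z ((map2 (\<lambda>\<beta> x. T2 \<beta> ** x) ?\<beta> (?o[j := V]))[j := T2 (T2 (?\<beta> ! j)) ** (?o[j := V]) ! j]))"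
      using se[OF j jd(2) eY zi] unfolding jd(3)[symmetric] i1 i2 .
    also have "id2 F ** tup ?Z (map2 (\<lambda>\<beta> x. T2 \<beta> ** x) ?\<beta> (?o[j := W])) = T2 (id2 f) ** (T2 (nmap2 ?\<beta>) ** (om (map nprod Ass) ** tup ?Z (?o[j := W])))"
      unfolding FF(4) n1[symmetric] by (rule hcomp_assoc') (use e1 oB(3-6) f2 in simp_all)
    also have "fs ! j ** tup ?Z ((map2 (\<lambda>\<beta> x. T2 \<beta> ** x) ?\<beta> (?o[j := V]))[j := T2 (T2 (?\<beta> ! j)) ** (?o[j := V]) ! j])
       = T2 (id2 f) ** (T2 (nmap2 ?\<beta>) ** (w\<omega> (map nprod Ass) j ** tup ?Z (?o[j := V])))"
      unfolding FF(6)[OF j] n2[symmetric] by (rule hcomp_assoc') (use e2 oB(7-9)[OF j] f2 in simp_all)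
    \<comment> \<open>The whiskerings common to both factors are taken out, so that the remaining
      vertical composite is the one in \<open>w\<omega>_concat\<close>.\<close>
    also have "(T2 (id2 f) ** (T2 (nmap2 ?\<beta>) ** (om (map nprod Ass) ** tup ?Z (?o[j := W])))) \<cdot> (T2 (id2 f) ** (T2 (nmap2 ?\<beta>) ** (w\<omega> (map nprod Ass) j ** tup ?Z (?o[j := V]))))
       = T2 (id2 f) ** (T2 (nmap2 ?\<beta>) ** ((om (map nprod Ass) ** tup ?Z (?o[j := W])) \<cdot> (w\<omega> (map nprod Ass) j ** tup ?Z (?o[j := V]))))"
      using ta tb os(4) nm f2 by (simp del: T2_comp_assoc)
    also have "(om (map nprod Ass) ** tup ?Z (?o[j := W])) \<cdot> (w\<omega> (map nprod Ass) j ** tup ?Z (?o[j := V])) = T2 (id2 (regroup Ass)) ** (w\<omega> (concat Ass) s ** tup ?Z (concat zss))"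
      using w\<omega>_concat[OF assms(1) jd(1,2) z(1) zi] unfolding jd(3) W_def V_def by simp
    also have "T2 (id2 f) ** (T2 (nmap2 ?\<beta>) ** (T2 (id2 (regroup Ass)) ** (w\<omega> (concat Ass) s ** tup ?Z (concat zss)))) = T2 (id2 ?h) ** w\<omega> (concat Ass) s"
    proof -
      have ws: "w\<omega> (concat Ass) s ** tup ?Z (concat zss) = w\<omega> (concat Ass) s" unfolding id unfolding cY using om(7,8)[OF s] by simp
      show ?thesis unfolding ws h(2) using om(7-9)[OF s] nm r f2 by simp
    qed
    finally show "snd (free1 (concat Ass) C ?h) ! s = snd ?c ! s" unfolding H(6)[OF s] by simp
  qed
  show ?thesis unfolding Ff using 1 2 by (simp add: prod_eq_iff)
qed


text \<open>A 2-cell of algebras is a triple. Its source and target are two instances of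
  \<open>free1_comp\<close>, and its middle component is \<open>free2_cell_comp\<close>.\<close>

lemma free2_comp:
  assumes "\<forall>As \<in> set Ass. set As \<subseteq> Ob K" "set Bs \<subseteq> Ob K" "length Ass = length Bs" "length \<beta>s = length Bs"
    and \<alpha>: "\<alpha> \<in> Ce K" "dom2 K \<alpha> \<in> hom1 K (nprod Bs) C" "cod2 K \<alpha> \<in> hom1 K (nprod Bs) C"
    and \<beta>: "\<forall>j<length Bs. \<beta>s ! j \<in> Ce K \<and> dom2 K (\<beta>s ! j) \<in> hom1 K (nprod (Ass ! j)) (Bs ! j) \<and> cod2 K (\<beta>s ! j) \<in> hom1 K (nprod (Ass ! j)) (Bs ! j)"
  shows "free2 (concat Ass) C ((\<alpha> ** nmap2 \<beta>s) \<rhd> regroup Ass)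
    = alg_comp2 (map (map Free) Ass) (free2 Bs C \<alpha>) (map (\<lambda>j. free2 (Ass ! j) (Bs ! j) (\<beta>s ! j)) [0..<length Bs])"
proof -
  let ?Gs = "map (\<lambda>j. free2 (Ass ! j) (Bs ! j) (\<beta>s ! j)) [0..<length Bs]"
  have aty: "src \<alpha> = nprod Bs" "tgt \<alpha> = C" using \<alpha> by (simp_all add: src_def tgt_def hom1_def)
  have bty: "\<beta>s ! j \<in> Ce K" "src (\<beta>s ! j) = nprod (Ass ! j)" "tgt (\<beta>s ! j) = Bs ! j" if "j < length Bs" for j
    using \<beta> that by (auto simp: src_def tgt_def hom1_def)
  have AO: "set (Ass ! j) \<subseteq> Ob K" if "j < length Bs" for j using assms(1,3) that by simp
  have C: "set (concat Ass) \<subseteq> Ob K" using assms(1) by auto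
  have bs: "\<forall>\<beta> \<in> set \<beta>s. \<beta> \<in> Ce K" "map src \<beta>s = map nprod Ass" "map tgt \<beta>s = Bs"
    using bty assms(3,4) by (auto simp: in_set_conv_nth intro!: nth_equalityI)
  note n = nmap2_typing[OF bs(1), unfolded bs(2,3)] and r = regroup_typing(1-3)[OF assms(1)]
  let ?h = "(\<alpha> ** nmap2 \<beta>s) \<rhd> regroup Ass"
  have h: "?h \<in> Ce K" "src ?h = nprod (concat Ass)" "tgt ?h = C" using n r \<alpha>(1) aty by simp_all
  have f1: "nmap1 (map (dom2 K) \<beta>s) \<in> hom1 K (nprod (map nprod Ass)) (nprod Bs)" "nmap1 (map (cod2 K) \<beta>s) \<in> hom1 K (nprod (map nprod Ass)) (nprod Bs)"
    using n dom1_dom2_src[OF n(1)] dom2_Ar[OF n(1)] unfolding dm_nmap2[OF bs(1)] by (simp_all add: hom1_def)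
  have rr: "regroup Ass \<in> hom1 K (nprod (concat Ass)) (nprod (map nprod Ass))" using r by (simp add: hom1_def)
  have hd: "dom2 K ?h = dom2 K \<alpha> \<odot> nmap1 (map (dom2 K) \<beta>s) \<odot> regroup Ass" "cod2 K ?h = cod2 K \<alpha> \<odot> nmap1 (map (cod2 K) \<beta>s) \<odot> regroup Ass"
    using n r \<alpha>(1) aty comp1_assoc[OF rr f1(1) \<alpha>(2)] comp1_assoc[OF rr f1(2) \<alpha>(3)] by (simp_all add: dm_nmap2[OF bs(1)])
  have G: "?Gs = map (\<lambda>j. (free1 (Ass ! j) (Bs ! j) (dom2 K (\<beta>s ! j)), T2 (\<beta>s ! j) ** om (Ass ! j), free1 (Ass ! j) (Bs ! j) (cod2 K (\<beta>s ! j)))) [0..<length Bs]"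
    by (rule map_cong[OF refl]) (use free2_eq[OF AO] bty in simp)
  let ?\<gamma> = "map (\<lambda>j. T2 (\<beta>s ! j) ** om (Ass ! j)) [0..<length Bs]"
  have m: "map (\<lambda>j. free1 (Ass ! j) (Bs ! j) (map p \<beta>s ! j)) [0..<length Bs] = map (\<lambda>j. free1 (Ass ! j) (Bs ! j) (p (\<beta>s ! j))) [0..<length Bs]" for p
    by (rule map_cong[OF refl]) (use assms(4) in simp)
  have c1: "free1 (concat Ass) C (dom2 K ?h) = alg_comp1 (map (map Free) Ass) (free1 Bs C (dom2 K \<alpha>)) (map fst ?Gs)"
    "free1 (concat Ass) C (cod2 K ?h) = alg_comp1 (map (map Free) Ass) (free1 Bs C (cod2 K \<alpha>)) (map (snd \<circ> snd) ?Gs)"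
    unfolding hd G
    using free1_comp[OF assms(1-3) _ \<alpha>(2), of "map (dom2 K) \<beta>s"] free1_comp[OF assms(1-3) _ \<alpha>(3), of "map (cod2 K) \<beta>s"] \<beta> assms(4)
    unfolding m by (simp_all add: o_def)
  have c2: "T2 ?h ** om (concat Ass) = ((T2 \<alpha> ** om Bs) ** nmap2 ?\<gamma>) \<rhd> regroup (map (map T0) Ass)"
    using free2_cell_comp[OF assms(1-3) bs(2,3,1) \<alpha>(1) aty(1)] by simp
  have fX: "map (map fst) (map (map Free) Ass) = map (map T0) Ass" by (simp add: Free_def)
  have g: "map (fst \<circ> snd) ?Gs = ?\<gamma>" unfolding G by (simp add: o_def)
  show ?thesis
    unfolding free2_eq[OF C h] free2_eq[OF assms(2) \<alpha>(1) aty] alg_comp2_def case_prod_conv c1 c2 fX g ..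
qed

lemma free_multifunctor: "cat_multifunctor K_multi T_Alg Free free1 free2"
  unfolding cat_multifunctor_def
proof (intro conjI allI impI ballI)
  fix A assume "A \<in> MOb K_multi"
  then have A: "A \<in> Ob K" by (simp add: K_multi_def)
  show "Free A \<in> MOb T_Alg" using algebra_Free[OF A] by (simp add: T_Alg_def)
  show "free1 [A] A (MUnit K_multi A) = MUnit T_Alg (Free A)"
    using free1_unit[OF A] by (simp add: K_multi_def T_Alg_def)
next
  fix As B assume "set As \<subseteq> MOb K_multi \<and> B \<in> MOb K_multi"
  then show "is_functor (MHom K_multi As B) (MHom T_Alg (map Free As) (Free B)) (free1 As B) (free2 As B)"
    using free_functor by (simp add: K_multi_def)
next
  fix Ass Bs C f gs
  assume "(\<forall>As \<in> set Ass. set As \<subseteq> MOb K_multi) \<and> set Bs \<subseteq> MOb K_multi \<and> C \<in> MOb K_multi \<and>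
    length Ass = length Bs \<and> length gs = length Bs \<and> f \<in> CO (MHom K_multi Bs C) \<and>
    (\<forall>j<length Bs. gs ! j \<in> CO (MHom K_multi (Ass ! j) (Bs ! j)))"
  then show "free1 (concat Ass) C (MComp1 K_multi Ass Bs C f gs) =
      MComp1 T_Alg (map (map Free) Ass) (map Free Bs) (Free C) (free1 Bs C f) (map (\<lambda>j. free1 (Ass ! j) (Bs ! j) (gs ! j)) [0..<length Bs])"
    using free1_comp[of Ass Bs gs f C] by (simp add: K_multi_def T_Alg_def)
next
  fix Ass Bs C \<alpha> \<beta>s
  assume "(\<forall>As \<in> set Ass. set As \<subseteq> MOb K_multi) \<and> set Bs \<subseteq> MOb K_multi \<and> C \<in> MOb K_multi \<and>
    length Ass = length Bs \<and> length \<beta>s = length Bs \<and> \<alpha> \<in> CA (MHom K_multi Bs C) \<and>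
    (\<forall>j<length Bs. \<beta>s ! j \<in> CA (MHom K_multi (Ass ! j) (Bs ! j)))"
  then show "free2 (concat Ass) C (MComp2 K_multi Ass Bs C \<alpha> \<beta>s) =
      MComp2 T_Alg (map (map Free) Ass) (map Free Bs) (Free C) (free2 Bs C \<alpha>) (map (\<lambda>j. free2 (Ass ! j) (Bs ! j) (\<beta>s ! j)) [0..<length Bs])"
    using free2_comp[of Ass Bs \<beta>s \<alpha> C] by (simp add: K_multi_def T_Alg_def)
qed

end

theorem theorem1p1:
  fixes K :: "('o, 'f, 't) fp_two_cat"
    and T0 :: "'o \<Rightarrow> 'o" and T1 :: "'f \<Rightarrow> 'f" and T2 :: "'t \<Rightarrow> 't"
    and \<eta> \<mu> :: "'o \<Rightarrow> 'f" and t :: "'o \<Rightarrow> 'o \<Rightarrow> 'f" and \<Gamma> :: "'o \<Rightarrow> 'o \<Rightarrow> 't"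
  assumes "symmetric_pseudo_commutative_strong_two_monad K T0 T1 T2 \<eta> \<mu> t \<Gamma>"
  shows "cat_multifunctor
           (fp_two_category.K_multi K)
           (pseudo_commutative_strong_two_monad.T_Alg K T0 T1 T2 \<eta> \<mu> t \<Gamma>)
           (strong_two_monad.Free T0 \<mu>)
           (pseudo_commutative_strong_two_monad.free1 K T0 T1 T2 \<eta> \<mu> t \<Gamma>)
           (pseudo_commutative_strong_two_monad.free2 K T0 T1 T2 \<eta> \<mu> t \<Gamma>)"
proof -
  interpret symmetric_pseudo_commutative_strong_two_monad K T0 T1 T2 \<eta> \<mu> t \<Gamma> by (rule assms)
  show ?thesis by (rule free_multifunctor)
qed

end
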